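(* Work either in the symplectic setting ($Cor=SCor$, $C=SC$, $H^M_\bullet=SH^M_\bullet$) or in the pseudoholomorphic setting ($Cor=JCor$, $C=JC$, $H^M_\bullet=JH^M_\bullet$), with $X,Y,Z,M$ objects of the corresponding type. Let $F\in C(Z,Y)$ and $G\in C(Y,X)$. Then the maps $F^*:C_n^M(Y,X)\to C_n^M(Z,X)$ and $G_*:C_n^M(Z,Y)\to C_n^M(Z,X)$ induce maps $$F^*:H_\bullet^M(Y,X)\to H_\bullet^M(Z,X),\qquad G_*:H_\bullet^M(Z,Y)\to H_\bullet^M(Z,X).$$ In particular, $F$ and $G$ may be ordinary morphisms $Z\to Y$ and $Y\to X$ (symplectic embeddings, respectively pseudoholomorphic maps).
   Context: All manifolds are smooth without boundary; products carry product structures; a point $pt$ is allowed. In the symplectic setting objects are symplectic manifolds, morphisms are symplectic embeddings ($f^*\omega_X=\omega_Y$), and $M=(M,\omega_M,p_0,p_1)$ is a connected symplectic manifold with two marked points. In the pseudoholomorphic setting objects are symplectic manifolds with compatible almost complex structure, morphisms are pseudoholomorphic maps, and $M=(M,\omega_M,J_M,p_0,p_1)$ is a connected object with two marked points. Symplectic correspondences: for $n\ge0$, $SCor_n(Y,X)$ is the set of global sections over $Y$ of the sheafification of the presheaf sending an open $U\subset Y$ to the set of unordered $n$-tuples $\{f_1,\dots,f_n\}$ of smooth maps $U\to X$ with $\sum_i f_i^*\omega_X=\omega_Y|_U$, two tuples being identified if $\{f_i(y)\}_i=\{g_i(y)\}_i$ as unordered tuples with multiplicity for every $y\in U$. $SCor^0_n(Y,X)$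 (isotropic correspondences) is defined likewise with $\sum_i f_i^*\omega_X=0$. $F+G$ denotes local concatenation. On $\coprod_{n\ge0}SCor_n(Y,X)$ let $\sim$ be the equivalence relation generated by $F\sim F+G$ with $G$ isotropic; $SCor(Y,X)$ is the set of global sections over $Y$ of the sheafification of $U\mapsto(\coprod_n SCor_n(U,X))/\!\sim$. $SC(Y,X)=\mathbb{Z}[SCor(Y,X)]$ is the free abelian group (zero if $SCor(Y,X)=\emptyset$). Pseudoholomorphic correspondences: $JCor_n(Y,X)$, $n\ge1$, is the same kind of sheafification using unordered $n$-tuples of pseudoholomorphic maps $U\to X$; $JCor_0(Y,X)=\{\emptyset\}$ has one element; $JCor(Y,X)$ is the set of global sections over $Y$ of the sheafification of $U\mapsto\coprod_{n\ge0}JCor_n(U,X)$, a commutative monoid under local concatenation with zero $\emptyset$; $JC(Y,X)$ is its Grothendieck group. A morphism $f:Y\to X$ is regarded as $\{f\}\in Cor(Y,X)\subset C(Y,X)$. Composition $Cor(Y,X)\times Cor(Z,Y)\to Cor(Z,X)$, $(G,F)\mapsto G\circ F$: if $F|_U=\{f_1,\dots,f_k\}$ and $G|_{V_i}=\{g_{i,1},\dots,g_{i,n_i}\}$ with $f_i(U)\subset V_i$, then $(G\circ F)|_U=\{g_{i,j}\circ f_i\}_{i,j}$ (all compositions; in the symplectic setting, modulo isotropic correspondences). It is extended bilinearly to $C$. Cohomology: $M^0=pt$, $C_n^M(Y,X)=C(Y\times M^n,X)$. For $0\le i\le n-1$, $\varepsilon\in\{0,1\}$ let $d_{i,\varepsilon}:M^{n-1}\to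 M^n$ insert $p_\varepsilon$ after the first $i$ factors; $d^{i,\varepsilon}\sigma=\sigma\circ(id_Y\times d_{i,\varepsilon})$ and $d=\sum_{\varepsilon=0}^1\sum_{i=0}^{n-1}(-1)^{\varepsilon+i}d^{i,\varepsilon}:C_n^M(Y,X)\to C_{n-1}^M(Y,X)$. Then $d^2=0$ and $H_\bullet^M(Y,X)$ is the homology of this complex. Induced maps: for $G\in C(Y,X)$, $G_*:C_n^M(Z,Y)\to C_n^M(Z,X)$ is $\sigma\mapsto G\circ\sigma$. For $F\in Cor(Z,Y)$, $F\times id_{M^n}$ denotes the correspondence from $Z\times M^n$ to $Y\times M^n$ locally given by the maps $\{f_1\times id_{M^n},\dots,f_k\times id_{M^n}\}$ when $F|_U=\{f_1,\dots,f_k\}$; it is regarded as an element of $Cor(Z\times M^n,Y\times M^n)$, and $F^*:C_n^M(Y,X)\to C_n^M(Z,X)$ is $\sigma\mapsto\sigma\circ(F\times id_{M^n})$, extended linearly in $F\in C(Z,Y)$.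
   Formalization: Symplectic setting: {f_1×id,…,f_k×id} pulls back to ω_Z+kω_{M^n}, so is not symplectic for k≠1 in general; F×id is taken as the unique element of SCor(Z×M^n,Y×M^n) given by {f_i×id} wherever that tuple is symplectic. Manifolds are assumed nonempty. *)

theory Defs
  imports
    "HOL-Analysis.Analysis"
    "HOL-Algebra.Free_Abelian_Groups"
    "HOL-Library.Multiset"
begin

section \<open>Smooth manifolds\<close>

subsection \<open>Smooth functions on open subsets of \<open>Euclidean_space d\<close>\<close>

definition partial_deriv :: "nat \<Rightarrow> ((nat \<Rightarrow> real) \<Rightarrow> real) \<Rightarrow> (nat \<Rightarrow> real) \<Rightarrow> real"
  where "partial_deriv i f x = deriv (\<lambda>t. f (x(i := t))) (x i)"

text \<open>Smoothness means: all iterated partial derivatives exist and are continuous.\<close>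

definition smooth_real_on :: "nat \<Rightarrow> (nat \<Rightarrow> real) set \<Rightarrow> ((nat \<Rightarrow> real) \<Rightarrow> real) \<Rightarrow> bool"
  where "smooth_real_on d S f \<longleftrightarrow>
    openin (Euclidean_space d) S \<and>
    (\<forall>js. set js \<subseteq> {..<d} \<longrightarrow>
      continuous_map (subtopology (Euclidean_space d) S) euclideanreal (foldr partial_deriv js f) \<and>
      (\<forall>x\<in>S. \<forall>i<d. (\<lambda>t. foldr partial_deriv js f (x(i := t))) field_differentiable (at (x i))))"

subsection \<open>Manifolds, smooth maps, tangent vectors\<close>

text \<open>A chart is a pair \<open>(V, \<phi>)\<close> of an open set and a map that matters only on \<open>V\<close>.  The atlas
  need not be maximal.  Manifolds are nonempty and have a fixed dimension.\<close>

record 'p manifold =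
  mtop :: "'p topology"
  mdim :: nat
  atlas :: "('p set \<times> ('p \<Rightarrow> nat \<Rightarrow> real)) set"

definition smooth_manifold :: "('p, 'b) manifold_scheme \<Rightarrow> bool"
  where "smooth_manifold M \<longleftrightarrow>
    topspace (mtop M) \<noteq> {} \<and> Hausdorff_space (mtop M) \<and> second_countable (mtop M) \<and>
    \<Union>(fst ` atlas M) = topspace (mtop M) \<and>
    (\<forall>(V, \<phi>)\<in>atlas M.
      openin (mtop M) V \<and> openin (Euclidean_space (mdim M)) (\<phi> ` V) \<and>
      homeomorphic_map (subtopology (mtop M) V)
        (subtopology (Euclidean_space (mdim M)) (\<phi> ` V)) \<phi>) \<and>
    (\<forall>(V, \<phi>)\<in>atlas M. \<forall>(W, \<psi>)\<in>atlas M. \<forall>i<mdim M.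
      smooth_real_on (mdim M) (\<phi> ` (V \<inter> W)) (\<lambda>x. \<psi> (inv_into V \<phi> x) i))"

definition smooth_fun_on :: "('p, 'b) manifold_scheme \<Rightarrow> 'p set \<Rightarrow> ('p \<Rightarrow> real) \<Rightarrow> bool"
  where "smooth_fun_on M U g \<longleftrightarrow>
    openin (mtop M) U \<and>
    (\<forall>(V, \<phi>)\<in>atlas M. smooth_real_on (mdim M) (\<phi> ` (U \<inter> V)) (\<lambda>x. g (inv_into V \<phi> x)))"

definition smooth_near :: "('p, 'b) manifold_scheme \<Rightarrow> 'p \<Rightarrow> ('p \<Rightarrow> real) \<Rightarrow> bool"
  where "smooth_near M p g \<longleftrightarrow> (\<exists>U. p \<in> U \<and> smooth_fun_on M U g)"

definition smooth_map_on ::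
    "('y, 'b) manifold_scheme \<Rightarrow> ('x, 'c) manifold_scheme \<Rightarrow> 'y set \<Rightarrow> ('y \<Rightarrow> 'x) \<Rightarrow> bool"
  where "smooth_map_on Y X U f \<longleftrightarrow>
    openin (mtop Y) U \<and> continuous_map (subtopology (mtop Y) U) (mtop X) f \<and>
    (\<forall>(V, \<psi>)\<in>atlas X. \<forall>i<mdim X. smooth_fun_on Y (U \<inter> f -` V) (\<lambda>y. \<psi> (f y) i))"

text \<open>Tangent vectors at \<open>p\<close> are derivations on the functions that are smooth near \<open>p\<close>, extended by
  zero to all other functions so that equality of vectors is equality of HOL functions.
  The Leibniz rule forces the value on \<open>g\<close> to depend only on the germ of \<open>g\<close> at \<open>p\<close>.\<close>

type_synonym 'p tvec = "('p \<Rightarrow> real) \<Rightarrow> real"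

definition tangent_space :: "('p, 'b) manifold_scheme \<Rightarrow> 'p \<Rightarrow> 'p tvec set"
  where "tangent_space M p = {v.
    (\<forall>g. \<not> smooth_near M p g \<longrightarrow> v g = 0) \<and>
    (\<forall>a b g h. smooth_near M p g \<and> smooth_near M p h \<longrightarrow>
      v (\<lambda>q. a * g q + b * h q) = a * v g + b * v h) \<and>
    (\<forall>g h. smooth_near M p g \<and> smooth_near M p h \<longrightarrow>
      v (\<lambda>q. g q * h q) = g p * v h + h p * v g)}"

definition vadd :: "'p tvec \<Rightarrow> 'p tvec \<Rightarrow> 'p tvec"
  where "vadd v w = (\<lambda>g. v g + w g)"

definition vscale :: "real \<Rightarrow> 'p tvec \<Rightarrow> 'p tvec"
  where "vscale a v = (\<lambda>g. a * v g)"

definition vzero :: "'p tvec"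
  where "vzero = (\<lambda>g. 0)"

definition coord_vec ::
    "('p, 'b) manifold_scheme \<Rightarrow> 'p set \<Rightarrow> ('p \<Rightarrow> nat \<Rightarrow> real) \<Rightarrow> nat \<Rightarrow> 'p \<Rightarrow> 'p tvec"
  where "coord_vec M V \<phi> i p = (\<lambda>g.
    if smooth_near M p g then partial_deriv i (\<lambda>x. g (inv_into V \<phi> x)) (\<phi> p) else 0)"

text \<open>\<open>tmap X f p\<close> is the differential of \<open>f\<close> at \<open>p\<close>, where \<open>X\<close> is the target of \<open>f\<close>.\<close>

definition tmap :: "('x, 'c) manifold_scheme \<Rightarrow> ('y \<Rightarrow> 'x) \<Rightarrow> 'y \<Rightarrow> 'y tvec \<Rightarrow> 'x tvec"
  where "tmap X f p v = (\<lambda>g. if smooth_near X (f p) g then v (\<lambda>q. g (f q)) else 0)"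

subsection \<open>Symplectic manifolds and compatible almost complex structures\<close>

text \<open>The form and the almost complex structure matter only on tangent vectors.\<close>

record 'p symp_manifold = "'p manifold" +
  form :: "'p \<Rightarrow> 'p tvec \<Rightarrow> 'p tvec \<Rightarrow> real"

record 'p acs_manifold = "'p symp_manifold" +
  acs :: "'p \<Rightarrow> 'p tvec \<Rightarrow> 'p tvec"

definition form_coeff ::
    "('p, 'b) symp_manifold_scheme \<Rightarrow> 'p set \<Rightarrow> ('p \<Rightarrow> nat \<Rightarrow> real) \<Rightarrow> nat \<Rightarrow> nat
      \<Rightarrow> (nat \<Rightarrow> real) \<Rightarrow> real"
  where "form_coeff M V \<phi> i j x =
    (let p = inv_into V \<phi> x in form M p (coord_vec M V \<phi> i p) (coord_vec M V \<phi> j p))"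

definition symplectic_manifold :: "('p, 'b) symp_manifold_scheme \<Rightarrow> bool"
  where "symplectic_manifold M \<longleftrightarrow>
    smooth_manifold M \<and>
    (\<forall>p\<in>topspace (mtop M). let T = tangent_space M p in
      (\<forall>u\<in>T. \<forall>v\<in>T. \<forall>w\<in>T. \<forall>a b.
        form M p (vadd (vscale a u) (vscale b v)) w = a * form M p u w + b * form M p v w) \<and>
      (\<forall>u\<in>T. \<forall>v\<in>T. form M p u v = - form M p v u) \<and>
      (\<forall>u\<in>T. (\<forall>v\<in>T. form M p u v = 0) \<longrightarrow> u = vzero)) \<and>
    (\<forall>(V, \<phi>)\<in>atlas M.
      (\<forall>i<mdim M. \<forall>j<mdim M. smooth_real_on (mdim M) (\<phi> ` V) (form_coeff M V \<phi> i j)) \<and>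
      (\<forall>i<mdim M. \<forall>j<mdim M. \<forall>k<mdim M. \<forall>x\<in>\<phi> ` V.
        partial_deriv i (form_coeff M V \<phi> j k) x + partial_deriv j (form_coeff M V \<phi> k i) x
          + partial_deriv k (form_coeff M V \<phi> i j) x = 0))"

definition compatible_acs :: "('p, 'b) acs_manifold_scheme \<Rightarrow> bool"
  where "compatible_acs M \<longleftrightarrow>
    (\<forall>p\<in>topspace (mtop M). let T = tangent_space M p; J = acs M p in
      (\<forall>v\<in>T. J v \<in> T \<and> J (J v) = vscale (-1) v) \<and>
      (\<forall>v\<in>T. \<forall>w\<in>T. \<forall>a b.
        J (vadd (vscale a v) (vscale b w)) = vadd (vscale a (J v)) (vscale b (J w))) \<and>
      (\<forall>v\<in>T. \<forall>w\<in>T. form M p (J v) (J w) = form M p v w) \<and>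
      (\<forall>v\<in>T. v \<noteq> vzero \<longrightarrow> form M p v (J v) > 0)) \<and>
    (\<forall>(V, \<phi>)\<in>atlas M. \<forall>i<mdim M. \<forall>j<mdim M.
      smooth_real_on (mdim M) (\<phi> ` V)
        (\<lambda>x. let p = inv_into V \<phi> x in acs M p (coord_vec M V \<phi> i p) (\<lambda>q. \<phi> q j)))"

definition pseudoholomorphic_manifold :: "('p, 'b) acs_manifold_scheme \<Rightarrow> bool"
  where "pseudoholomorphic_manifold M \<longleftrightarrow> symplectic_manifold M \<and> compatible_acs M"

definition symplectic_embedding ::
    "('y, 'b) symp_manifold_scheme \<Rightarrow> ('x, 'c) symp_manifold_scheme \<Rightarrow> ('y \<Rightarrow> 'x) \<Rightarrow> bool"
  where "symplectic_embedding Y X f \<longleftrightarrow>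
    smooth_map_on Y X (topspace (mtop Y)) f \<and>
    embedding_map (mtop Y) (mtop X) f \<and>
    (\<forall>y\<in>topspace (mtop Y).
      inj_on (tmap X f y) (tangent_space Y y) \<and>
      (\<forall>v\<in>tangent_space Y y. \<forall>w\<in>tangent_space Y y.
        form X (f y) (tmap X f y v) (tmap X f y w) = form Y y v w))"

definition pseudoholomorphic_on ::
    "('y, 'b) acs_manifold_scheme \<Rightarrow> ('x, 'c) acs_manifold_scheme \<Rightarrow> 'y set \<Rightarrow> ('y \<Rightarrow> 'x) \<Rightarrow> bool"
  where "pseudoholomorphic_on Y X U f \<longleftrightarrow>
    smooth_map_on Y X U f \<and>
    (\<forall>y\<in>U. \<forall>v\<in>tangent_space Y y. tmap X f y (acs Y y v) = acs X (f y) (tmap X f y v))"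

subsection \<open>Products and powers\<close>

text \<open>In products the coordinate blocks are concatenated.  A point of the \<open>n\<close>-th power is an
  extensional function on \<open>{..<n}\<close>; the \<open>0\<close>-th power is a point.\<close>

definition prod_chart ::
    "nat \<Rightarrow> ('a set \<times> ('a \<Rightarrow> nat \<Rightarrow> real)) \<Rightarrow> ('b set \<times> ('b \<Rightarrow> nat \<Rightarrow> real))
      \<Rightarrow> ('a \<times> 'b) set \<times> ('a \<times> 'b \<Rightarrow> nat \<Rightarrow> real)"
  where "prod_chart d c e =
    (fst c \<times> fst e, \<lambda>(a, b) i. if i < d then snd c a i else snd e b (i - d))"

definition power_chart ::
    "nat \<Rightarrow> nat \<Rightarrow> (nat \<Rightarrow> 'm set \<times> ('m \<Rightarrow> nat \<Rightarrow> real))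
      \<Rightarrow> (nat \<Rightarrow> 'm) set \<times> ((nat \<Rightarrow> 'm) \<Rightarrow> nat \<Rightarrow> real)"
  where "power_chart d n c =
    (\<Pi>\<^sub>E k\<in>{..<n}. fst (c k),
     \<lambda>m i. if i < n * d then snd (c (i div d)) (m (i div d)) (i mod d) else 0)"

definition prod_form ::
    "('a, 'd) symp_manifold_scheme \<Rightarrow> ('b, 'e) symp_manifold_scheme
      \<Rightarrow> 'a \<times> 'b \<Rightarrow> ('a \<times> 'b) tvec \<Rightarrow> ('a \<times> 'b) tvec \<Rightarrow> real"
  where "prod_form A B p v w =
    form A (fst p) (tmap A fst p v) (tmap A fst p w) +
    form B (snd p) (tmap B snd p v) (tmap B snd p w)"

definition power_form ::
    "('m, 'd) symp_manifold_scheme \<Rightarrow> nat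
      \<Rightarrow> (nat \<Rightarrow> 'm) \<Rightarrow> (nat \<Rightarrow> 'm) tvec \<Rightarrow> (nat \<Rightarrow> 'm) tvec \<Rightarrow> real"
  where "power_form M n m v w =
    (\<Sum>k<n. form M (m k) (tmap M (\<lambda>m. m k) m v) (tmap M (\<lambda>m. m k) m w))"

definition prod_symp :: "'a symp_manifold \<Rightarrow> 'b symp_manifold \<Rightarrow> ('a \<times> 'b) symp_manifold"
  where "prod_symp A B =
    \<lparr>mtop = prod_topology (mtop A) (mtop B), mdim = mdim A + mdim B,
     atlas = {prod_chart (mdim A) c e | c e. c \<in> atlas A \<and> e \<in> atlas B},
     form = prod_form A B\<rparr>"

definition power_symp :: "'m symp_manifold \<Rightarrow> nat \<Rightarrow> (nat \<Rightarrow> 'm) symp_manifold"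
  where "power_symp M n =
    \<lparr>mtop = product_topology (\<lambda>_. mtop M) {..<n}, mdim = n * mdim M,
     atlas = {power_chart (mdim M) n c | c. c \<in> {..<n} \<rightarrow> atlas M},
     form = power_form M n\<rparr>"

text \<open>The product almost complex structures are written through the inclusions of the factors:
  \<open>T(A \<times> B) = TA \<oplus> TB\<close>.\<close>

definition prod_acs :: "'a acs_manifold \<Rightarrow> 'b acs_manifold \<Rightarrow> ('a \<times> 'b) acs_manifold"
  where "prod_acs A B = (let P = prod_symp (symp_manifold.truncate A) (symp_manifold.truncate B) in
    \<lparr>mtop = mtop P, mdim = mdim P, atlas = atlas P, form = form P,
     acs = (\<lambda>p v. vadd
       (tmap P (\<lambda>a. (a, snd p)) (fst p) (acs A (fst p) (tmap A fst p v)))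
       (tmap P (\<lambda>b. (fst p, b)) (snd p) (acs B (snd p) (tmap B snd p v))))\<rparr>)"

definition power_acs :: "'m acs_manifold \<Rightarrow> nat \<Rightarrow> (nat \<Rightarrow> 'm) acs_manifold"
  where "power_acs M n = (let P = power_symp (symp_manifold.truncate M) n in
    \<lparr>mtop = mtop P, mdim = mdim P, atlas = atlas P, form = form P,
     acs = (\<lambda>m v g. \<Sum>k<n.
       tmap P (\<lambda>q. m(k := q)) (m k) (acs M (m k) (tmap M (\<lambda>m. m k) m v)) g)\<rparr>)"


section \<open>Sheafification\<close>

text \<open>A presheaf on a topological space \<open>T\<close> is given by its sections \<open>P U\<close> over each open set
  \<open>U\<close> and by a map \<open>r W\<close> restricting sections over larger open sets to \<open>W\<close>.  Sections of the
  sheafification are the families of germs that are locally the germs of a section.\<close>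

definition germ ::
    "'y topology \<Rightarrow> ('y set \<Rightarrow> 's set) \<Rightarrow> ('y set \<Rightarrow> 's \<Rightarrow> 's) \<Rightarrow> 'y set \<Rightarrow> 's \<Rightarrow> 'y
      \<Rightarrow> ('y set \<times> 's) set"
  where "germ T P r U s y =
    {(V, t). openin T V \<and> y \<in> V \<and> t \<in> P V \<and>
      (\<exists>W. openin T W \<and> y \<in> W \<and> W \<subseteq> U \<inter> V \<and> r W s = r W t)}"

definition sheafify ::
    "'y topology \<Rightarrow> ('y set \<Rightarrow> 's set) \<Rightarrow> ('y set \<Rightarrow> 's \<Rightarrow> 's) \<Rightarrow> 'y set
      \<Rightarrow> ('y \<Rightarrow> ('y set \<times> 's) set) set"
  where "sheafify T P r U = {\<sigma> \<in> extensional U.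
    \<forall>y\<in>U. \<exists>W s. openin T W \<and> y \<in> W \<and> W \<subseteq> U \<and> s \<in> P W \<and> (\<forall>z\<in>W. \<sigma> z = germ T P r W s z)}"

abbreviation restr :: "'y set \<Rightarrow> ('y \<Rightarrow> 's) \<Rightarrow> 'y \<Rightarrow> 's"
  where "restr W s \<equiv> restrict s W"


section \<open>Multivalued maps and \<open>n\<close>-correspondences\<close>

text \<open>An unordered tuple \<open>{f\<^sub>1, \<dots>, f\<^sub>n}\<close> of maps on \<open>U\<close>, up to the identification of tuples with the
  same values, is represented by the function \<open>y \<mapsto> {f\<^sub>1 y, \<dots>, f\<^sub>n y}\<close> into multisets.  The parameter
  \<open>adm U fs\<close> says which tuples on \<open>U\<close> are admitted.\<close>

type_synonym ('y, 'x) mval = "'y \<Rightarrow> 'x multiset"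
type_synonym ('y, 'x) ncor = "'y \<Rightarrow> ('y set \<times> ('y, 'x) mval) set"

definition mval :: "'y set \<Rightarrow> ('y \<Rightarrow> 'x) list \<Rightarrow> ('y, 'x) mval"
  where "mval U fs = (\<lambda>y\<in>U. mset (map (\<lambda>f. f y) fs))"

definition tuples ::
    "('y set \<Rightarrow> ('y \<Rightarrow> 'x) list \<Rightarrow> bool) \<Rightarrow> nat \<Rightarrow> 'y set \<Rightarrow> ('y, 'x) mval set"
  where "tuples adm n U = {mval U fs | fs. length fs = n \<and> adm U fs}"

definition ncors ::
    "'y topology \<Rightarrow> ('y set \<Rightarrow> ('y \<Rightarrow> 'x) list \<Rightarrow> bool) \<Rightarrow> nat \<Rightarrow> 'y set \<Rightarrow> ('y, 'x) ncor set"
  where "ncors T adm n U = sheafify T (tuples adm n) restr U"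

definition ncor_tuple ::
    "'y topology \<Rightarrow> ('y set \<Rightarrow> ('y \<Rightarrow> 'x) list \<Rightarrow> bool) \<Rightarrow> 'y set \<Rightarrow> ('y \<Rightarrow> 'x) list \<Rightarrow> ('y, 'x) ncor"
  where "ncor_tuple T adm U fs = (\<lambda>y\<in>U. germ T (tuples adm (length fs)) restr U (mval U fs) y)"

text \<open>Local concatenation over \<open>U\<close> of two sections whose result is an \<open>n\<close>-correspondence.\<close>

definition ncor_add ::
    "'y topology \<Rightarrow> ('y set \<Rightarrow> ('y \<Rightarrow> 'x) list \<Rightarrow> bool) \<Rightarrow> nat \<Rightarrow> 'y set
      \<Rightarrow> ('y, 'x) ncor \<Rightarrow> ('y, 'x) ncor \<Rightarrow> ('y, 'x) ncor"
  where "ncor_add T adm n U F G = (\<lambda>y\<in>U. \<Union>(V, s)\<in>F y. \<Union>(W, t)\<in>G y.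
    germ T (tuples adm n) restr (V \<inter> W) (\<lambda>z\<in>V \<inter> W. s z + t z) y)"

text \<open>Composition and product with an identity are characterised by local representations:
  \<open>rep F U fs\<close> means that \<open>F\<close> restricted to \<open>U\<close> is the correspondence given by the tuple \<open>fs\<close>.\<close>

definition comp_tuple :: "('z \<Rightarrow> 'y) list \<Rightarrow> ('y \<Rightarrow> 'x) list list \<Rightarrow> ('z \<Rightarrow> 'x) list"
  where "comp_tuple fs gss = concat (map2 (\<lambda>f gs. map (\<lambda>g. g \<circ> f) gs) fs gss)"

definition cor_comp ::
    "('f \<Rightarrow> 'z set \<Rightarrow> ('z \<Rightarrow> 'y) list \<Rightarrow> bool) \<Rightarrow> ('g \<Rightarrow> 'y set \<Rightarrow> ('y \<Rightarrow> 'x) list \<Rightarrow> bool)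
      \<Rightarrow> ('h \<Rightarrow> 'z set \<Rightarrow> ('z \<Rightarrow> 'x) list \<Rightarrow> bool) \<Rightarrow> 'h set \<Rightarrow> 'g \<Rightarrow> 'f \<Rightarrow> 'h"
  where "cor_comp repF repG repH Cor G F = (THE H. H \<in> Cor \<and>
    (\<forall>U fs Vs gss. repF F U fs \<and> length Vs = length fs \<and> length gss = length fs \<and>
      (\<forall>i<length fs. repG G (Vs ! i) (gss ! i) \<and> (fs ! i) ` U \<subseteq> Vs ! i) \<longrightarrow>
      repH H U (comp_tuple fs gss)))"


section \<open>Symplectic correspondences\<close>

subsection \<open>The set \<open>SCor(Y, X)\<close>\<close>

definition pullback_sum ::
    "'x symp_manifold \<Rightarrow> ('y \<Rightarrow> 'x) list \<Rightarrow> 'y \<Rightarrow> 'y tvec \<Rightarrow> 'y tvec \<Rightarrow> real"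
  where "pullback_sum X fs y v w = (\<Sum>f\<leftarrow>fs. form X (f y) (tmap X f y v) (tmap X f y w))"

definition symp_tuple ::
    "'y symp_manifold \<Rightarrow> 'x symp_manifold \<Rightarrow> 'y set \<Rightarrow> ('y \<Rightarrow> 'x) list \<Rightarrow> bool"
  where "symp_tuple Y X U fs \<longleftrightarrow> (\<forall>f\<in>set fs. smooth_map_on Y X U f) \<and>
    (\<forall>y\<in>U. \<forall>v\<in>tangent_space Y y. \<forall>w\<in>tangent_space Y y. pullback_sum X fs y v w = form Y y v w)"

definition iso_tuple ::
    "'y symp_manifold \<Rightarrow> 'x symp_manifold \<Rightarrow> 'y set \<Rightarrow> ('y \<Rightarrow> 'x) list \<Rightarrow> bool"
  where "iso_tuple Y X U fs \<longleftrightarrow> (\<forall>f\<in>set fs. smooth_map_on Y X U f) \<and>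
    (\<forall>y\<in>U. \<forall>v\<in>tangent_space Y y. \<forall>w\<in>tangent_space Y y. pullback_sum X fs y v w = 0)"

definition SCors :: "'y symp_manifold \<Rightarrow> 'x symp_manifold \<Rightarrow> nat \<Rightarrow> 'y set \<Rightarrow> ('y, 'x) ncor set"
  where "SCors Y X = ncors (mtop Y) (symp_tuple Y X)"

definition SCors0 :: "'y symp_manifold \<Rightarrow> 'x symp_manifold \<Rightarrow> nat \<Rightarrow> 'y set \<Rightarrow> ('y, 'x) ncor set"
  where "SCors0 Y X = ncors (mtop Y) (iso_tuple Y X)"

definition SCor_coprod ::
    "'y symp_manifold \<Rightarrow> 'x symp_manifold \<Rightarrow> 'y set \<Rightarrow> (nat \<times> ('y, 'x) ncor) set"
  where "SCor_coprod Y X U = Sigma UNIV (\<lambda>n. SCors Y X n U)"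

definition add_isotropic ::
    "'y symp_manifold \<Rightarrow> 'x symp_manifold \<Rightarrow> 'y set
      \<Rightarrow> nat \<times> ('y, 'x) ncor \<Rightarrow> nat \<times> ('y, 'x) ncor \<Rightarrow> bool"
  where "add_isotropic Y X U a b \<longleftrightarrow> (\<exists>n F m G.
    F \<in> SCors Y X n U \<and> G \<in> SCors0 Y X m U \<and> a = (n, F) \<and>
    b = (n + m, ncor_add (mtop Y) (symp_tuple Y X) (n + m) U F G))"

definition SCor_rel ::
    "'y symp_manifold \<Rightarrow> 'x symp_manifold \<Rightarrow> 'y set
      \<Rightarrow> ((nat \<times> ('y, 'x) ncor) \<times> (nat \<times> ('y, 'x) ncor)) set"
  where "SCor_rel Y X U = {(a, b). a \<in> SCor_coprod Y X U \<and> b \<in> SCor_coprod Y X U \<and>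
    equivclp (add_isotropic Y X U) a b}"

type_synonym ('y, 'x) scor = "'y \<Rightarrow> ('y set \<times> (nat \<times> ('y, 'x) ncor) set) set"

definition SCor_presheaf ::
    "'y symp_manifold \<Rightarrow> 'x symp_manifold \<Rightarrow> 'y set \<Rightarrow> (nat \<times> ('y, 'x) ncor) set set"
  where "SCor_presheaf Y X U = SCor_coprod Y X U // SCor_rel Y X U"

definition SCor_restr ::
    "'y symp_manifold \<Rightarrow> 'x symp_manifold \<Rightarrow> 'y set
      \<Rightarrow> (nat \<times> ('y, 'x) ncor) set \<Rightarrow> (nat \<times> ('y, 'x) ncor) set"
  where "SCor_restr Y X W c = (\<Union>(n, F)\<in>c. SCor_rel Y X W `` {(n, restrict F W)})"

definition SCor :: "'y symp_manifold \<Rightarrow> 'x symp_manifold \<Rightarrow> ('y, 'x) scor set"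
  where "SCor Y X = sheafify (mtop Y) (SCor_presheaf Y X) (SCor_restr Y X) (topspace (mtop Y))"

definition SCor_germ ::
    "'y symp_manifold \<Rightarrow> 'x symp_manifold \<Rightarrow> 'y set \<Rightarrow> ('y \<Rightarrow> 'x) list \<Rightarrow> 'y
      \<Rightarrow> ('y set \<times> (nat \<times> ('y, 'x) ncor) set) set"
  where "SCor_germ Y X U fs y =
    germ (mtop Y) (SCor_presheaf Y X) (SCor_restr Y X) U
      (SCor_rel Y X U `` {(length fs, ncor_tuple (mtop Y) (symp_tuple Y X) U fs)}) y"

definition SCor_rep ::
    "'y symp_manifold \<Rightarrow> 'x symp_manifold \<Rightarrow> ('y, 'x) scor \<Rightarrow> 'y set \<Rightarrow> ('y \<Rightarrow> 'x) list \<Rightarrow> bool"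
  where "SCor_rep Y X F U fs \<longleftrightarrow>
    openin (mtop Y) U \<and> symp_tuple Y X U fs \<and> (\<forall>y\<in>U. F y = SCor_germ Y X U fs y)"

subsection \<open>Operations on \<open>SCor\<close>\<close>

definition SCor_of :: "'y symp_manifold \<Rightarrow> 'x symp_manifold \<Rightarrow> ('y \<Rightarrow> 'x) \<Rightarrow> ('y, 'x) scor"
  where "SCor_of Y X f = (\<lambda>y\<in>topspace (mtop Y). SCor_germ Y X (topspace (mtop Y)) [f] y)"

definition SCor_comp ::
    "'z symp_manifold \<Rightarrow> 'y symp_manifold \<Rightarrow> 'x symp_manifold
      \<Rightarrow> ('y, 'x) scor \<Rightarrow> ('z, 'y) scor \<Rightarrow> ('z, 'x) scor"
  where "SCor_comp Z Y X = cor_comp (SCor_rep Z Y) (SCor_rep Y X) (SCor_rep Z X) (SCor Z X)"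

text \<open>\<open>SCor_times Z Y N F\<close> is \<open>F \<times> id\<^sub>N\<close>.  If \<open>F\<close> is \<open>{f\<^sub>1, \<dots>, f\<^sub>k}\<close> on \<open>U\<close>, the forms pulled back by the
  maps \<open>f\<^sub>i \<times> id\<^sub>N\<close> sum up to \<open>\<omega>\<^sub>Z + k \<omega>\<^sub>N\<close>, so the tuple \<open>{f\<^sub>i \<times> id\<^sub>N}\<close> is a symplectic tuple only if
  \<open>k = 1\<close> or \<open>\<omega>\<^sub>N = 0\<close>.  The requirement that \<open>F \<times> id\<^sub>N\<close> be locally given by \<open>{f\<^sub>i \<times> id\<^sub>N}\<close> is therefore
  imposed for all local representations of \<open>F\<close> for which it makes sense.  This determines
  \<open>F \<times> id\<^sub>N\<close>: any two symplectic tuples \<open>A, B\<close> defined near a point are equivalent there, because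
  some tuple \<open>H\<close> near that point pulls the form back to minus the given one, so that
  \<open>A \<sim> A + (B + H) = B + (A + H) \<sim> B\<close>.\<close>

definition SCor_times ::
    "'z symp_manifold \<Rightarrow> 'y symp_manifold \<Rightarrow> 'n symp_manifold \<Rightarrow> ('z, 'y) scor
      \<Rightarrow> ('z \<times> 'n, 'y \<times> 'n) scor"
  where "SCor_times Z Y N F = (let ZN = prod_symp Z N; YN = prod_symp Y N in
    THE H. H \<in> SCor ZN YN \<and>
      (\<forall>U fs. let U' = U \<times> topspace (mtop N); fs' = map (\<lambda>f. map_prod f id) fs in
        SCor_rep Z Y F U fs \<and> symp_tuple ZN YN U' fs' \<longrightarrow> SCor_rep ZN YN H U' fs'))"

subsection \<open>The groups \<open>SC(Y, X)\<close>\<close>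

definition SC :: "'y symp_manifold \<Rightarrow> 'x symp_manifold \<Rightarrow> (('y, 'x) scor \<Rightarrow>\<^sub>0 int) monoid"
  where "SC Y X = free_Abelian_group (SCor Y X)"

definition SC_of :: "'y symp_manifold \<Rightarrow> 'x symp_manifold \<Rightarrow> ('y \<Rightarrow> 'x) \<Rightarrow> ('y, 'x) scor \<Rightarrow>\<^sub>0 int"
  where "SC_of Y X f = frag_of (SCor_of Y X f)"

definition SC_comp ::
    "'z symp_manifold \<Rightarrow> 'y symp_manifold \<Rightarrow> 'x symp_manifold
      \<Rightarrow> (('y, 'x) scor \<Rightarrow>\<^sub>0 int) \<Rightarrow> (('z, 'y) scor \<Rightarrow>\<^sub>0 int) \<Rightarrow> (('z, 'x) scor \<Rightarrow>\<^sub>0 int)"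
  where "SC_comp Z Y X G F =
    frag_extend (\<lambda>g. frag_extend (\<lambda>f. frag_of (SCor_comp Z Y X g f)) F) G"


section \<open>Pseudoholomorphic correspondences\<close>

subsection \<open>The monoid \<open>JCor(Y, X)\<close>\<close>

definition hol_tuple ::
    "'y acs_manifold \<Rightarrow> 'x acs_manifold \<Rightarrow> 'y set \<Rightarrow> ('y \<Rightarrow> 'x) list \<Rightarrow> bool"
  where "hol_tuple Y X U fs \<longleftrightarrow> (\<forall>f\<in>set fs. pseudoholomorphic_on Y X U f)"

text \<open>For \<open>n = 0\<close> there is only the empty tuple, so \<open>JCors Y X 0 U\<close> has exactly one element.\<close>

definition JCors :: "'y acs_manifold \<Rightarrow> 'x acs_manifold \<Rightarrow> nat \<Rightarrow> 'y set \<Rightarrow> ('y, 'x) ncor set"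
  where "JCors Y X = ncors (mtop Y) (hol_tuple Y X)"

type_synonym ('y, 'x) jcor = "'y \<Rightarrow> ('y set \<times> nat \<times> ('y, 'x) ncor) set"

definition JCor_presheaf ::
    "'y acs_manifold \<Rightarrow> 'x acs_manifold \<Rightarrow> 'y set \<Rightarrow> (nat \<times> ('y, 'x) ncor) set"
  where "JCor_presheaf Y X U = Sigma UNIV (\<lambda>n. JCors Y X n U)"

definition JCor_restr :: "'y set \<Rightarrow> nat \<times> ('y, 'x) ncor \<Rightarrow> nat \<times> ('y, 'x) ncor"
  where "JCor_restr W a = (fst a, restrict (snd a) W)"

definition JCor :: "'y acs_manifold \<Rightarrow> 'x acs_manifold \<Rightarrow> ('y, 'x) jcor set"
  where "JCor Y X = sheafify (mtop Y) (JCor_presheaf Y X) JCor_restr (topspace (mtop Y))"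

definition JCor_germ ::
    "'y acs_manifold \<Rightarrow> 'x acs_manifold \<Rightarrow> 'y set \<Rightarrow> ('y \<Rightarrow> 'x) list \<Rightarrow> 'y
      \<Rightarrow> ('y set \<times> nat \<times> ('y, 'x) ncor) set"
  where "JCor_germ Y X U fs y =
    germ (mtop Y) (JCor_presheaf Y X) JCor_restr U
      (length fs, ncor_tuple (mtop Y) (hol_tuple Y X) U fs) y"

definition JCor_rep ::
    "'y acs_manifold \<Rightarrow> 'x acs_manifold \<Rightarrow> ('y, 'x) jcor \<Rightarrow> 'y set \<Rightarrow> ('y \<Rightarrow> 'x) list \<Rightarrow> bool"
  where "JCor_rep Y X F U fs \<longleftrightarrow>
    openin (mtop Y) U \<and> hol_tuple Y X U fs \<and> (\<forall>y\<in>U. F y = JCor_germ Y X U fs y)"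

definition JCor_add ::
    "'y acs_manifold \<Rightarrow> 'x acs_manifold \<Rightarrow> ('y, 'x) jcor \<Rightarrow> ('y, 'x) jcor \<Rightarrow> ('y, 'x) jcor"
  where "JCor_add Y X F G = (\<lambda>y\<in>topspace (mtop Y). \<Union>(V, n, s)\<in>F y. \<Union>(W, m, t)\<in>G y.
    germ (mtop Y) (JCor_presheaf Y X) JCor_restr (V \<inter> W)
      (n + m, ncor_add (mtop Y) (hol_tuple Y X) (n + m) (V \<inter> W) s t) y)"

definition JCor_tuple ::
    "'y acs_manifold \<Rightarrow> 'x acs_manifold \<Rightarrow> ('y \<Rightarrow> 'x) list \<Rightarrow> ('y, 'x) jcor"
  where "JCor_tuple Y X fs = (\<lambda>y\<in>topspace (mtop Y). JCor_germ Y X (topspace (mtop Y)) fs y)"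

definition JCor_monoid :: "'y acs_manifold \<Rightarrow> 'x acs_manifold \<Rightarrow> ('y, 'x) jcor monoid"
  where "JCor_monoid Y X =
    \<lparr>carrier = JCor Y X, monoid.mult = JCor_add Y X, one = JCor_tuple Y X []\<rparr>"

subsection \<open>Operations on \<open>JCor\<close>\<close>

definition JCor_comp ::
    "'z acs_manifold \<Rightarrow> 'y acs_manifold \<Rightarrow> 'x acs_manifold
      \<Rightarrow> ('y, 'x) jcor \<Rightarrow> ('z, 'y) jcor \<Rightarrow> ('z, 'x) jcor"
  where "JCor_comp Z Y X = cor_comp (JCor_rep Z Y) (JCor_rep Y X) (JCor_rep Z X) (JCor Z X)"

definition JCor_times ::
    "'z acs_manifold \<Rightarrow> 'y acs_manifold \<Rightarrow> 'n acs_manifold \<Rightarrow> ('z, 'y) jcor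
      \<Rightarrow> ('z \<times> 'n, 'y \<times> 'n) jcor"
  where "JCor_times Z Y N F = (let ZN = prod_acs Z N; YN = prod_acs Y N in
    THE H. H \<in> JCor ZN YN \<and>
      (\<forall>U fs. JCor_rep Z Y F U fs \<longrightarrow>
        JCor_rep ZN YN H (U \<times> topspace (mtop N)) (map (\<lambda>f. map_prod f id) fs)))"

subsection \<open>The groups \<open>JC(Y, X)\<close>\<close>

text \<open>The Grothendieck group of a commutative monoid \<open>A\<close>: the class of \<open>(a, b)\<close> stands for the
  formal difference \<open>a - b\<close>.\<close>

definition groth_rel :: "('a, 'b) monoid_scheme \<Rightarrow> (('a \<times> 'a) \<times> ('a \<times> 'a)) set"
  where "groth_rel A = {((a, b), (c, d)).
    a \<in> carrier A \<and> b \<in> carrier A \<and> c \<in> carrier A \<and> d \<in> carrier A \<and>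
    (\<exists>k\<in>carrier A. a \<otimes>\<^bsub>A\<^esub> d \<otimes>\<^bsub>A\<^esub> k = c \<otimes>\<^bsub>A\<^esub> b \<otimes>\<^bsub>A\<^esub> k)}"

definition groth_class :: "('a, 'b) monoid_scheme \<Rightarrow> 'a \<Rightarrow> 'a \<Rightarrow> ('a \<times> 'a) set"
  where "groth_class A a b = groth_rel A `` {(a, b)}"

definition groth_group :: "('a, 'b) monoid_scheme \<Rightarrow> ('a \<times> 'a) set monoid"
  where "groth_group A =
    \<lparr>carrier = (carrier A \<times> carrier A) // groth_rel A,
     monoid.mult = (\<lambda>P Q. \<Union>(a, b)\<in>P. \<Union>(c, d)\<in>Q. groth_class A (a \<otimes>\<^bsub>A\<^esub> c) (b \<otimes>\<^bsub>A\<^esub> d)),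
     one = groth_class A \<one>\<^bsub>A\<^esub> \<one>\<^bsub>A\<^esub>\<rparr>"

definition JC :: "'y acs_manifold \<Rightarrow> 'x acs_manifold \<Rightarrow> (('y, 'x) jcor \<times> ('y, 'x) jcor) set monoid"
  where "JC Y X = groth_group (JCor_monoid Y X)"

definition JC_of ::
    "'y acs_manifold \<Rightarrow> 'x acs_manifold \<Rightarrow> ('y \<Rightarrow> 'x) \<Rightarrow> (('y, 'x) jcor \<times> ('y, 'x) jcor) set"
  where "JC_of Y X f = groth_class (JCor_monoid Y X) (JCor_tuple Y X [f]) (JCor_tuple Y X [])"

text \<open>The bilinear extension: \<open>(a - b) \<circ> (c - d) = (a \<circ> c + b \<circ> d) - (a \<circ> d + b \<circ> c)\<close>.\<close>

definition JC_comp ::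
    "'z acs_manifold \<Rightarrow> 'y acs_manifold \<Rightarrow> 'x acs_manifold
      \<Rightarrow> (('y, 'x) jcor \<times> ('y, 'x) jcor) set \<Rightarrow> (('z, 'y) jcor \<times> ('z, 'y) jcor) set
      \<Rightarrow> (('z, 'x) jcor \<times> ('z, 'x) jcor) set"
  where "JC_comp Z Y X G F =
    (let cmp = JCor_comp Z Y X; add = JCor_add Z X in
      \<Union>(a, b)\<in>G. \<Union>(c, d)\<in>F. groth_class (JCor_monoid Z X)
        (add (cmp a c) (cmp b d)) (add (cmp a d) (cmp b c)))"

definition JC_times ::
    "'z acs_manifold \<Rightarrow> 'y acs_manifold \<Rightarrow> 'n acs_manifold
      \<Rightarrow> (('z, 'y) jcor \<times> ('z, 'y) jcor) set
      \<Rightarrow> (('z \<times> 'n, 'y \<times> 'n) jcor \<times> ('z \<times> 'n, 'y \<times> 'n) jcor) set"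
  where "JC_times Z Y N F = (\<Union>(a, b)\<in>F. groth_class (JCor_monoid (prod_acs Z N) (prod_acs Y N))
    (JCor_times Z Y N a) (JCor_times Z Y N b))"


section \<open>Homology\<close>

subsection \<open>Chain complexes of groups in multiplicative notation\<close>

definition homology :: "(nat \<Rightarrow> 'c monoid) \<Rightarrow> (nat \<Rightarrow> 'c \<Rightarrow> 'c) \<Rightarrow> nat \<Rightarrow> 'c set monoid"
  where "homology C d n =
    (C n)\<lparr>carrier := kernel (C n) (C (n - 1)) (d n)\<rparr> Mod (d (Suc n) ` carrier (C (Suc n)))"

definition homology_class :: "(nat \<Rightarrow> 'c monoid) \<Rightarrow> (nat \<Rightarrow> 'c \<Rightarrow> 'c) \<Rightarrow> nat \<Rightarrow> 'c \<Rightarrow> 'c set"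
  where "homology_class C d n \<sigma> = (d (Suc n) ` carrier (C (Suc n))) #>\<^bsub>C n\<^esub> \<sigma>"

text \<open>The family \<open>\<phi>\<close> consists of homomorphisms \<open>C\<^sub>n \<rightarrow> C'\<^sub>n\<close> that induce well-defined
  homomorphisms \<open>[\<sigma>] \<mapsto> [\<phi> \<sigma>]\<close> on homology.\<close>

definition induces_on_homology ::
    "(nat \<Rightarrow> 'c monoid) \<Rightarrow> (nat \<Rightarrow> 'c \<Rightarrow> 'c) \<Rightarrow> (nat \<Rightarrow> 'e monoid) \<Rightarrow> (nat \<Rightarrow> 'e \<Rightarrow> 'e)
      \<Rightarrow> (nat \<Rightarrow> 'c \<Rightarrow> 'e) \<Rightarrow> bool"
  where "induces_on_homology C d C' d' \<phi> \<longleftrightarrow> (\<forall>n.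
    \<phi> n \<in> hom (C n) (C' n) \<and>
    (\<forall>\<sigma>\<in>kernel (C n) (C (n - 1)) (d n). \<phi> n \<sigma> \<in> kernel (C' n) (C' (n - 1)) (d' n)) \<and>
    (\<exists>\<Phi>\<in>hom (homology C d n) (homology C' d' n).
      \<forall>\<sigma>\<in>kernel (C n) (C (n - 1)) (d n).
        \<Phi> (homology_class C d n \<sigma>) = homology_class C' d' n (\<phi> n \<sigma>)))"

text \<open>The differential \<open>\<Sum>\<^sub>\<epsilon> \<Sum>\<^sub>i (-1)\<^sup>\<epsilon>\<^sup>+\<^sup>i d\<^sup>i\<^sup>,\<^sup>\<epsilon>\<close>.  For \<open>n = 0\<close> the sum is empty, i.e. the differential
  vanishes (with the irrelevant target \<open>C 0\<close>).\<close>

definition cubical_diff ::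
    "(nat \<Rightarrow> 'c monoid) \<Rightarrow> (nat \<Rightarrow> nat \<Rightarrow> nat \<Rightarrow> 'c \<Rightarrow> 'c) \<Rightarrow> nat \<Rightarrow> 'c \<Rightarrow> 'c"
  where "cubical_diff C face n \<sigma> =
    finprod (C (n - 1))
      (\<lambda>(e, i). face n i e \<sigma> [^]\<^bsub>C (n - 1)\<^esub> ((-1) ^ (e + i) :: int)) ({0..1} \<times> {..<n})"

definition insert_point :: "nat \<Rightarrow> nat \<Rightarrow> 'm \<Rightarrow> (nat \<Rightarrow> 'm) \<Rightarrow> nat \<Rightarrow> 'm"
  where "insert_point n i p m = (\<lambda>k\<in>{..<n}. if k < i then m k else if k = i then p else m (k - 1))"

definition face_map :: "'m \<Rightarrow> 'm \<Rightarrow> nat \<Rightarrow> nat \<Rightarrow> nat \<Rightarrow> 'y \<times> (nat \<Rightarrow> 'm) \<Rightarrow> 'y \<times> (nat \<Rightarrow> 'm)"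
  where "face_map p0 p1 n i e = map_prod id (insert_point n i (if e = 0 then p0 else p1))"

subsection \<open>The symplectic complex\<close>

definition SC_chain ::
    "'m symp_manifold \<Rightarrow> 'y symp_manifold \<Rightarrow> 'x symp_manifold \<Rightarrow> nat
      \<Rightarrow> (('y \<times> (nat \<Rightarrow> 'm), 'x) scor \<Rightarrow>\<^sub>0 int) monoid"
  where "SC_chain M Y X n = SC (prod_symp Y (power_symp M n)) X"

definition SC_diff ::
    "'m symp_manifold \<Rightarrow> 'm \<Rightarrow> 'm \<Rightarrow> 'y symp_manifold \<Rightarrow> 'x symp_manifold \<Rightarrow> nat
      \<Rightarrow> (('y \<times> (nat \<Rightarrow> 'm), 'x) scor \<Rightarrow>\<^sub>0 int) \<Rightarrow> (('y \<times> (nat \<Rightarrow> 'm), 'x) scor \<Rightarrow>\<^sub>0 int)"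
  where "SC_diff M p0 p1 Y X = cubical_diff (SC_chain M Y X)
    (\<lambda>n i e \<sigma>. let A = prod_symp Y (power_symp M (n - 1)); B = prod_symp Y (power_symp M n) in
      SC_comp A B X \<sigma> (SC_of A B (face_map p0 p1 n i e)))"

definition SC_push ::
    "'m symp_manifold \<Rightarrow> 'z symp_manifold \<Rightarrow> 'y symp_manifold \<Rightarrow> 'x symp_manifold
      \<Rightarrow> (('y, 'x) scor \<Rightarrow>\<^sub>0 int) \<Rightarrow> nat
      \<Rightarrow> (('z \<times> (nat \<Rightarrow> 'm), 'y) scor \<Rightarrow>\<^sub>0 int) \<Rightarrow> (('z \<times> (nat \<Rightarrow> 'm), 'x) scor \<Rightarrow>\<^sub>0 int)"
  where "SC_push M Z Y X G n \<sigma> = SC_comp (prod_symp Z (power_symp M n)) Y X G \<sigma>"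

definition SC_pull ::
    "'m symp_manifold \<Rightarrow> 'z symp_manifold \<Rightarrow> 'y symp_manifold \<Rightarrow> 'x symp_manifold
      \<Rightarrow> (('z, 'y) scor \<Rightarrow>\<^sub>0 int) \<Rightarrow> nat
      \<Rightarrow> (('y \<times> (nat \<Rightarrow> 'm), 'x) scor \<Rightarrow>\<^sub>0 int) \<Rightarrow> (('z \<times> (nat \<Rightarrow> 'm), 'x) scor \<Rightarrow>\<^sub>0 int)"
  where "SC_pull M Z Y X F n \<sigma> = (let N = power_symp M n in
    frag_extend (\<lambda>f. SC_comp (prod_symp Z N) (prod_symp Y N) X \<sigma> (frag_of (SCor_times Z Y N f))) F)"

subsection \<open>The pseudoholomorphic complex\<close>

definition JC_chain ::
    "'m acs_manifold \<Rightarrow> 'y acs_manifold \<Rightarrow> 'x acs_manifold \<Rightarrow> nat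
      \<Rightarrow> (('y \<times> (nat \<Rightarrow> 'm), 'x) jcor \<times> ('y \<times> (nat \<Rightarrow> 'm), 'x) jcor) set monoid"
  where "JC_chain M Y X n = JC (prod_acs Y (power_acs M n)) X"

definition JC_diff ::
    "'m acs_manifold \<Rightarrow> 'm \<Rightarrow> 'm \<Rightarrow> 'y acs_manifold \<Rightarrow> 'x acs_manifold \<Rightarrow> nat
      \<Rightarrow> (('y \<times> (nat \<Rightarrow> 'm), 'x) jcor \<times> ('y \<times> (nat \<Rightarrow> 'm), 'x) jcor) set
      \<Rightarrow> (('y \<times> (nat \<Rightarrow> 'm), 'x) jcor \<times> ('y \<times> (nat \<Rightarrow> 'm), 'x) jcor) set"
  where "JC_diff M p0 p1 Y X = cubical_diff (JC_chain M Y X)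
    (\<lambda>n i e \<sigma>. let A = prod_acs Y (power_acs M (n - 1)); B = prod_acs Y (power_acs M n) in
      JC_comp A B X \<sigma> (JC_of A B (face_map p0 p1 n i e)))"

definition JC_push ::
    "'m acs_manifold \<Rightarrow> 'z acs_manifold \<Rightarrow> 'y acs_manifold \<Rightarrow> 'x acs_manifold
      \<Rightarrow> (('y, 'x) jcor \<times> ('y, 'x) jcor) set \<Rightarrow> nat
      \<Rightarrow> (('z \<times> (nat \<Rightarrow> 'm), 'y) jcor \<times> ('z \<times> (nat \<Rightarrow> 'm), 'y) jcor) set
      \<Rightarrow> (('z \<times> (nat \<Rightarrow> 'm), 'x) jcor \<times> ('z \<times> (nat \<Rightarrow> 'm), 'x) jcor) set"
  where "JC_push M Z Y X G n \<sigma> = JC_comp (prod_acs Z (power_acs M n)) Y X G \<sigma>"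

definition JC_pull ::
    "'m acs_manifold \<Rightarrow> 'z acs_manifold \<Rightarrow> 'y acs_manifold \<Rightarrow> 'x acs_manifold
      \<Rightarrow> (('z, 'y) jcor \<times> ('z, 'y) jcor) set \<Rightarrow> nat
      \<Rightarrow> (('y \<times> (nat \<Rightarrow> 'm), 'x) jcor \<times> ('y \<times> (nat \<Rightarrow> 'm), 'x) jcor) set
      \<Rightarrow> (('z \<times> (nat \<Rightarrow> 'm), 'x) jcor \<times> ('z \<times> (nat \<Rightarrow> 'm), 'x) jcor) set"
  where "JC_pull M Z Y X F n \<sigma> = (let N = power_acs M n in
    JC_comp (prod_acs Z N) (prod_acs Y N) X \<sigma> (JC_times Z Y N F))"

end

theory Submission
  imports Defs
begin

text \<open>Symplectic case.  By the Poincare lemma every symplectic form is locally a sum of terms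
  \<open>da \<and> db\<close>, and a symplectic manifold of positive dimension contains a plane with the standard area
  form.  Hence near each point some tuple \<open>H\<close> of maps into \<open>X\<close> pulls the form back to \<open>-\<omega>\<^sub>Y\<close>, and
  \<open>A \<sim> A + (B + H) = B + (A + H) \<sim> B\<close> shows that all symplectic tuples have the same germ.  So
  \<open>SCor(Y, X)\<close> has at most one element, an element of \<open>SC(Y, X)\<close> is an integer, and composition
  multiplies these integers.

  Pseudoholomorphic case.  A correspondence is determined by its values, which are multisets, and
  \<open>G \<circ> F\<close> sends \<open>z\<close> to the sum of the multisets \<open>G(y)\<close> over \<open>y \<in> F(z)\<close>.  So composition is biadditive and associative, and
  \<open>F \<times> id\<close> commutes with the face maps because both sides have the same values.

  In both cases \<open>F\<^sup>*\<close> and \<open>G\<^sub>*\<close> commute with the face operators and hence with the differentials.\<close>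

section \<open>Calculus on open subsets of \<open>Euclidean_space d\<close>\<close>

text \<open>Three points shape the symplectic half. The argument \<open>A \<sim> A + (B + H)\<close>
  needs a tuple \<open>H\<close> with a prescribed pull-back, so the plane in \<open>X\<close> must
  carry exactly \<open>dx \<and> dy\<close>: a coordinate plane is reparametrised by the inverse of
  a primitive, and exchanging \<open>a\<close> and \<open>b\<close> then supplies the minus sign. If
  \<open>X\<close> has no plane, its form is zero, and a symplectic tuple exists only where the form
  of \<open>Y\<close> is zero too. Second, the argument is applied to \<open>Y \<times> M^n\<close>,
  so it rests on properties that pass to products: \<open>local_exact\<close>, and a plane or the
  zero form. Third, at most one element does not mean exactly one: to land in the free group, local
  symplectic tuples must be exhibited, for \<open>F \<times> id\<close> by a tuple other than
  \<open>{f_i \<times> id}\<close>, which in general is not symplectic.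

  In the pseudoholomorphic half, definitions by \<open>THE\<close> and by unions over
  representatives are evaluated once and for all through \<open>jval\<close>; multisets are
  cancellative, so equality in the Grothendieck group becomes an identity of values.\<close>

abbreviation espace :: "nat \<Rightarrow> (nat \<Rightarrow> real) set"
  where "espace d \<equiv> topspace (Euclidean_space d)"

text \<open>\<open>deriv\<close> has a value even where no derivative exists, so the rules of
  calculus are stated with this relation; \<open>partial_deriv_eqI\<close> translates back.\<close>

definition has_partial :: "nat \<Rightarrow> ((nat \<Rightarrow> real) \<Rightarrow> real) \<Rightarrow> real \<Rightarrow> (nat \<Rightarrow> real) \<Rightarrow> bool"
  where "has_partial i f D x \<longleftrightarrow> ((\<lambda>t. f (x(i := t))) has_field_derivative D) (at (x i))"

text \<open>Sup-norm balls in \<open>espace d\<close>. Moving coordinates of a point towards those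
  of the centre does not leave the cube, which suits both radial contractions and paths that change
  one coordinate at a time.\<close>

definition cube :: "nat \<Rightarrow> (nat \<Rightarrow> real) \<Rightarrow> real \<Rightarrow> (nat \<Rightarrow> real) set"
  where "cube d x e = {y \<in> espace d. \<forall>i<d. \<bar>y i - x i\<bar> < e}"

section \<open>The topology of \<open>espace d\<close> in terms of cubes\<close>

lemma espace_iff: "x \<in> espace d \<longleftrightarrow> (\<forall>i\<ge>d. x i = 0)"
  by (simp add: topspace_Euclidean_space)

lemma espace_upd: "x \<in> espace d \<Longrightarrow> i < d \<Longrightarrow> x(i := t) \<in> espace d"
  by (auto simp: espace_iff)

lemma cube_mono: "e \<le> e' \<Longrightarrow> cube d x e \<subseteq> cube d x e'"
  by (force simp: cube_def)

lemma cube_center: "x \<in> espace d \<Longrightarrow> 0 < e \<Longrightarrow> x \<in> cube d x e"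
  by (simp add: cube_def)

lemma openin_cube: "openin (Euclidean_space d) (cube d x e)"
proof -
  have c: "continuous_map (Euclidean_space d) euclideanreal (\<lambda>y. y i)" for i
    unfolding Euclidean_space_def
    by (intro continuous_map_from_subtopology) (metis UNIV_I continuous_map_product_coordinates)
  have "openin (Euclidean_space d) {y \<in> espace d. \<forall>i\<in>{..<k}. \<bar>y i - x i\<bar> < e}" for k
  proof (induction k)
    case (Suc k)
    have "openin (Euclidean_space d) {y \<in> espace d. y k \<in> {x k - e<..<x k + e}}"
      by (rule openin_continuous_map_preimage[OF c]) auto
    moreover have "{y \<in> espace d. \<forall>i\<in>{..<Suc k}. \<bar>y i - x i\<bar> < e} =
      {y \<in> espace d. \<forall>i\<in>{..<k}. \<bar>y i - x i\<bar> < e} \<inter> {y \<in> espace d. y k \<in> {x k - e<..<x k + e}}"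
      by (auto simp: less_Suc_eq abs_diff_less_iff)
    ultimately show ?case
      using Suc openin_Int by auto
  qed auto
  from this[of d] show ?thesis
    by (simp add: cube_def Ball_def)
qed

text \<open>A basic open set of the product topology constrains the coordinates separately, and
  points of \<open>espace d\<close> vary in only \<open>d\<close> of them, so a minimum of finitely
  many radii gives a cube.\<close>

lemma openin_Euclidean_iff:
  "openin (Euclidean_space d) S \<longleftrightarrow> S \<subseteq> espace d \<and> (\<forall>x\<in>S. \<exists>e>0. cube d x e \<subseteq> S)"
proof
  assume S: "openin (Euclidean_space d) S"
  have "\<exists>e>0. cube d x e \<subseteq> S" if x: "x \<in> S" for x
  proof -
    obtain T where T: "openin (powertop_real UNIV) T" "S = T \<inter> {x. \<forall>i\<ge>d. x i = 0}"
      using S unfolding Euclidean_space_def openin_subtopology by auto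
    then have "x \<in> T"
      using x by blast
    then obtain U where U: "\<And>i. open (U i)" "x \<in> Pi\<^sub>E UNIV U" "Pi\<^sub>E UNIV U \<subseteq> T"
      using T(1) unfolding openin_product_topology_alt open_openin[symmetric] by (meson UNIV_I)
    have "\<exists>e>0. \<forall>t. \<bar>t - x i\<bar> < e \<longrightarrow> t \<in> U i" for i
      using U(1)[of i] U(2) unfolding open_dist dist_real_def by (meson PiE_mem UNIV_I)
    then obtain e where e: "\<And>i. e i > 0" "\<And>i t. \<bar>t - x i\<bar> < e i \<Longrightarrow> t \<in> U i"
      by metis
    \<comment> \<open>The entry \<open>1\<close> keeps the set nonempty, so that \<open>Min\<close>
      makes sense for \<open>d = 0\<close>.\<close>
    define m where "m = Min (insert 1 (e ` {..<d}))"
    have "m > 0"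
      unfolding m_def by (subst Min_gr_iff) (auto simp: e)
    have m: "m \<le> e i" if "i < d" for i
      unfolding m_def using that by (intro Min_le) auto
    have "y i \<in> U i" if y: "y \<in> cube d x m" for y i
    proof (cases "i < d")
      case True
      then show ?thesis
        using y m[of i] by (intro e(2)) (force simp: cube_def)
    next
      case False
      then have "y i = x i"
        using y x T(2) by (simp add: cube_def espace_iff)
      then show ?thesis
        using e by simp
    qed
    then have "cube d x m \<subseteq> S"
      using T(2) U(3) by (auto simp: cube_def espace_iff)
    then show ?thesis
      using \<open>m > 0\<close> by blast
  qed
  then show "S \<subseteq> espace d \<and> (\<forall>x\<in>S. \<exists>e>0. cube d x e \<subseteq> S)"
    using S openin_subset by blast
next
  assume *: "S \<subseteq> espace d \<and> (\<forall>x\<in>S. \<exists>e>0. cube d x e \<subseteq> S)"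
  show "openin (Euclidean_space d) S"
    by (subst openin_subopen) (metis * cube_center openin_cube subset_iff)
qed

lemma Euclidean_space_eq: "Euclidean_space d = top_of_set {x. \<forall>i\<ge>d. x i = 0}"
  unfolding Euclidean_space_def euclidean_product_topology by simp

lemma continuous_map_Euclidean_iff:
  assumes "S \<subseteq> espace d"
  shows "continuous_map (subtopology (Euclidean_space d) S) euclideanreal f \<longleftrightarrow> continuous_on S f"
proof -
  have "subtopology (Euclidean_space d) S = top_of_set S"
    using assms unfolding topspace_Euclidean_space
    by (simp add: Euclidean_space_eq subtopology_subtopology Int_absorb1)
  then show ?thesis
    by simp
qed

lemma continuous_on_cube_iff:
  fixes f :: "(nat \<Rightarrow> real) \<Rightarrow> real"
  assumes S: "S \<subseteq> espace d"
  shows "continuous_on S f \<longleftrightarrow>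
    (\<forall>x\<in>S. \<forall>h>0. \<exists>e>0. \<forall>y\<in>S \<inter> cube d x e. \<bar>f y - f x\<bar> < h)"
proof
  assume f: "continuous_on S f"
  show "\<forall>x\<in>S. \<forall>h>0. \<exists>e>0. \<forall>y\<in>S \<inter> cube d x e. \<bar>f y - f x\<bar> < h"
  proof (intro ballI allI impI)
    fix x and h :: real assume x: "x \<in> S" "h > 0"
    have "openin (top_of_set S) (S \<inter> f -` ball (f x) h)"
      using f by (intro continuous_openin_preimage_gen) auto
    then obtain T where T: "open T" "S \<inter> f -` ball (f x) h = S \<inter> T"
      by (auto simp: openin_open)
    have "openin (Euclidean_space d) (espace d \<inter> T)"
      using T(1) unfolding Euclidean_space_eq topspace_euclidean_subtopology by (rule openin_open_Int)
    moreover have "x \<in> T"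
    proof -
      have "x \<in> S \<inter> f -` ball (f x) h"
        using x by simp
      then show ?thesis
        unfolding T(2) by simp
    qed
    ultimately obtain e where "e > 0" "cube d x e \<subseteq> T"
      using S x unfolding openin_Euclidean_iff by blast
    then show "\<exists>e>0. \<forall>y\<in>S \<inter> cube d x e. \<bar>f y - f x\<bar> < h"
      using T(2) by (intro exI[of _ e]) (auto simp: set_eq_iff dist_real_def abs_minus_commute)
  qed
next
  assume *: "\<forall>x\<in>S. \<forall>h>0. \<exists>e>0. \<forall>y\<in>S \<inter> cube d x e. \<bar>f y - f x\<bar> < h"
  show "continuous_on S f"
    unfolding continuous_on_def
  proof (intro ballI tendstoI)
    fix x and h :: real assume x: "x \<in> S" "h > 0"
    with * obtain e where e: "e > 0" "\<forall>y\<in>S \<inter> cube d x e. \<bar>f y - f x\<bar> < h"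
      by blast
    obtain T where T: "open T" "cube d x e = espace d \<inter> T"
      using openin_cube[of d x e] unfolding Euclidean_space_eq topspace_euclidean_subtopology openin_open
      by blast
    have "x \<in> T"
      using T cube_center[of x d e] S x e by auto
    then show "\<forall>\<^sub>F y in at x within S. dist (f y) (f x) < h"
      unfolding eventually_at_topological using e T S
      by (intro exI[of _ T]) (auto simp: dist_real_def)
  qed
qed

lemma eventually_upd_in:
  assumes "openin (Euclidean_space d) S" "x \<in> S" "i < d"
  obtains e where "e > 0" "\<And>t. \<bar>t - x i\<bar> < e \<Longrightarrow> x(i := t) \<in> S"
proof -
  obtain e where e: "e > 0" "cube d x e \<subseteq> S" "x \<in> espace d"
    using assms unfolding openin_Euclidean_iff by blast
  show thesis
    by (rule that[OF e(1)]) (use e assms in \<open>auto simp: cube_def espace_upd intro!: subsetD[OF e(2)]\<close>)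
qed

section \<open>Rules for single partial derivatives\<close>

lemma has_partial_cong:
  assumes "openin (Euclidean_space d) S" "x \<in> S" "i < d" "\<And>y. y \<in> S \<Longrightarrow> f y = g y"
  shows "has_partial i f D x \<longleftrightarrow> has_partial i g D x"
proof -
  obtain e where e: "e > 0" "\<And>t. \<bar>t - x i\<bar> < e \<Longrightarrow> x(i := t) \<in> S"
    using eventually_upd_in[OF assms(1-3)] by metis
  show ?thesis
    unfolding has_partial_def
  proof (rule DERIV_cong_ev)
    show "\<forall>\<^sub>F t in nhds (x i). f (x(i := t)) = g (x(i := t))"
      unfolding eventually_nhds_metric using e assms(4) by (auto simp: dist_real_def)
  qed auto
qed

lemma partial_deriv_eqI: "has_partial i f D x \<Longrightarrow> partial_deriv i f x = D"
  unfolding partial_deriv_def has_partial_def by (rule DERIV_imp_deriv)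

lemma has_partial_const: "has_partial i (\<lambda>x. c) 0 x"
  by (simp add: has_partial_def)

lemma has_partial_coord: "has_partial i (\<lambda>x. x j) (if i = j then 1 else 0) x"
  by (simp add: has_partial_def)

lemma has_partial_add:
  "has_partial i f D x \<Longrightarrow> has_partial i g E x \<Longrightarrow> has_partial i (\<lambda>x. f x + g x) (D + E) x"
  unfolding has_partial_def by (rule DERIV_add)

lemma has_partial_mult:
  assumes "has_partial i f D x" "has_partial i g E x"
  shows "has_partial i (\<lambda>x. f x * g x) (D * g x + f x * E) x"
  using DERIV_mult'[OF assms[unfolded has_partial_def]]
  by (simp add: has_partial_def add.commute)

lemma has_partial_inverse:
  assumes "has_partial i f D x" "f x \<noteq> 0"
  shows "has_partial i (\<lambda>x. inverse (f x)) (- 1 * (inverse (f x) * D * inverse (f x))) x"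
  using DERIV_inverse'[OF assms(1)[unfolded has_partial_def]] assms(2)
  by (simp add: has_partial_def)

lemma has_partial_sum:
  "(\<And>l. l \<in> A \<Longrightarrow> has_partial i (f l) (D l) x) \<Longrightarrow>
    has_partial i (\<lambda>x. \<Sum>l\<in>A. f l x) (\<Sum>l\<in>A. D l) x"
  unfolding has_partial_def by (rule DERIV_sum)

lemma partial_deriv_cong:
  assumes "openin (Euclidean_space d) S" "x \<in> S" "i < d" "\<And>y. y \<in> S \<Longrightarrow> f y = g y"
  shows "partial_deriv i f x = partial_deriv i g x"
  using has_partial_cong[OF assms(1-3), of f g] assms(4)
  unfolding partial_deriv_def deriv_def has_partial_def by simp

subsection \<open>Functions of class \<open>C\<^sup>k\<close>\<close>

text \<open>Smoothness is defined through lists of directions. Recursion on the order instead turns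
  each closure property into an induction on \<open>k\<close>, in which the first partial
  derivatives satisfy the hypothesis one order lower.\<close>

primrec Ck :: "nat \<Rightarrow> nat \<Rightarrow> (nat \<Rightarrow> real) set \<Rightarrow> ((nat \<Rightarrow> real) \<Rightarrow> real) \<Rightarrow> bool" where
  "Ck d 0 S f \<longleftrightarrow> continuous_on S f"
| "Ck d (Suc k) S f \<longleftrightarrow> continuous_on S f \<and>
    (\<forall>i<d. (\<forall>x\<in>S. has_partial i f (partial_deriv i f x) x) \<and> Ck d k S (partial_deriv i f))"

lemma Ck_continuous: "Ck d k S f \<Longrightarrow> continuous_on S f"
  by (cases k) auto

lemma Ck_foldr:
  "Ck d k S f \<longleftrightarrow> (\<forall>js. set js \<subseteq> {..<d} \<and> length js \<le> k \<longrightarrow>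
    continuous_on S (foldr partial_deriv js f) \<and> (length js < k \<longrightarrow>
      (\<forall>x\<in>S. \<forall>i<d. (\<lambda>t. foldr partial_deriv js f (x(i := t))) field_differentiable (at (x i)))))"
  (is "_ \<longleftrightarrow> (\<forall>js. ?P k f js)")
proof (induction k arbitrary: f)
  case (Suc k)
  have diff: "has_partial i f (partial_deriv i f x) x \<longleftrightarrow>
      (\<lambda>t. f (x(i := t))) field_differentiable (at (x i))" for i x
    using DERIV_imp_deriv field_differentiable_def
    by (fastforce simp: partial_deriv_def has_partial_def intro: field_differentiable_derivI)
  \<comment> \<open>\<open>foldr partial_deriv (js @ [i]) f\<close> differentiates in direction
    \<open>i\<close> first, so peeling off the last entry matches the recursion of
    \<open>Ck\<close>.\<close>
  have snoc: "(\<forall>js. Q js) \<longleftrightarrow> Q [] \<and> (\<forall>js i. Q (js @ [i]))" for Q :: "nat list \<Rightarrow> bool"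
    by (metis rev_exhaust)
  have split: "(\<forall>i<d. (\<forall>x\<in>S. A i x) \<and> (\<forall>js. B i js)) \<longleftrightarrow> (\<forall>x\<in>S. \<forall>i<d. A i x) \<and> (\<forall>i<d. \<forall>js. B i js)"
    for A :: "nat \<Rightarrow> (nat \<Rightarrow> real) \<Rightarrow> bool" and B :: "nat \<Rightarrow> nat list \<Rightarrow> bool"
    by blast
  have "(\<forall>js. ?P (Suc k) f js) \<longleftrightarrow> ?P (Suc k) f [] \<and> (\<forall>js i. ?P (Suc k) f (js @ [i]))"
    by (rule snoc)
  also have "(\<forall>js i. ?P (Suc k) f (js @ [i])) \<longleftrightarrow> (\<forall>i<d. \<forall>js. ?P k (partial_deriv i f) js)"
    by auto
  finally have "(\<forall>js. ?P (Suc k) f js) \<longleftrightarrow>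
      ?P (Suc k) f [] \<and> (\<forall>i<d. \<forall>js. ?P k (partial_deriv i f) js)" .
  then show ?case
    unfolding Ck.simps Suc.IH diff split by (simp del: fun_upd_apply)
qed simp

lemma smooth_real_on_iff:
  "smooth_real_on d S f \<longleftrightarrow> openin (Euclidean_space d) S \<and> (\<forall>k. Ck d k S f)"
proof (cases "openin (Euclidean_space d) S")
  case True
  then have S: "S \<subseteq> espace d"
    by (simp add: openin_subset)
  show ?thesis
  proof
    assume "smooth_real_on d S f"
    then show "openin (Euclidean_space d) S \<and> (\<forall>k. Ck d k S f)"
      unfolding smooth_real_on_def Ck_foldr continuous_map_Euclidean_iff[OF S] by blast
  next
    assume *: "openin (Euclidean_space d) S \<and> (\<forall>k. Ck d k S f)"
    show "smooth_real_on d S f"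
      unfolding smooth_real_on_def continuous_map_Euclidean_iff[OF S]
    proof (intro conjI allI impI True)
      fix js assume js: "set js \<subseteq> {..<d}"
      \<comment> \<open>One order more than the length, because \<open>Ck_foldr\<close> yields
        differentiability only for lists strictly shorter than the order.\<close>
      have "Ck d (Suc (length js)) S f"
        using * by blast
      then show "continuous_on S (foldr partial_deriv js f)"
        and "\<forall>x\<in>S. \<forall>i<d. (\<lambda>t. foldr partial_deriv js f (x(i := t))) field_differentiable at (x i)"
        unfolding Ck_foldr using js by auto
    qed
  qed
qed (simp add: smooth_real_on_def)

lemma smooth_real_on_open: "smooth_real_on d S f \<Longrightarrow> openin (Euclidean_space d) S"
  by (simp add: smooth_real_on_iff)

lemma Ck_cong:
  assumes S: "openin (Euclidean_space d) S" and "\<And>y. y \<in> S \<Longrightarrow> f y = g y" "Ck d k S f"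
  shows "Ck d k S g"
  using assms(2,3)
proof (induction k arbitrary: f g)
  case 0
  then show ?case by (simp cong: continuous_on_cong)
next
  case (Suc k)
  have "continuous_on S g"
    using Suc.prems by (simp cong: continuous_on_cong)
  moreover have "partial_deriv i f x = partial_deriv i g x" if "x \<in> S" "i < d" for i x
    using partial_deriv_cong[OF S that] Suc.prems(1) by blast
  moreover have "has_partial i g D x \<longleftrightarrow> has_partial i f D x" if "x \<in> S" "i < d" for i x D
    using has_partial_cong[OF S that] Suc.prems(1) by metis
  ultimately show ?case
    using Suc.prems Suc.IH by (simp, blast)
qed

text \<open>The working introduction rule: \<open>D\<close> is any formula for the partial
  derivatives on \<open>S\<close>. It may differ from \<open>partial_deriv\<close> outside
  \<open>S\<close>, which is harmless because \<open>S\<close> is open.\<close>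

lemma Ck_SucI:
  assumes S: "openin (Euclidean_space d) S" and "continuous_on S f"
    and "\<And>i x. i < d \<Longrightarrow> x \<in> S \<Longrightarrow> has_partial i f (D i x) x"
    and "\<And>i. i < d \<Longrightarrow> Ck d k S (D i)"
  shows "Ck d (Suc k) S f"
proof -
  have "partial_deriv i f x = D i x" if "i < d" "x \<in> S" for i x
    using assms(3)[OF that] by (rule partial_deriv_eqI)
  moreover from this have "Ck d k S (partial_deriv i f)" if "i < d" for i
    using Ck_cong[OF S _ assms(4)[OF that], of "partial_deriv i f"] that by simp
  ultimately show ?thesis
    using assms(2,3) by simp
qed

lemma Ck_Suc_lower: "Ck d (Suc k) S f \<Longrightarrow> Ck d k S f"
proof (induction k arbitrary: f)
  case (Suc k)
  have "continuous_on S f" "\<And>i. i < d \<Longrightarrow> Ck d (Suc k) S (partial_deriv i f)"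
      "\<And>i x. i < d \<Longrightarrow> x \<in> S \<Longrightarrow> has_partial i f (partial_deriv i f x) x"
    using Suc.prems by (simp_all only: Ck.simps(2)[of d "Suc k"])
  then show ?case
    using Suc.IH by simp
qed simp

lemma Ck_subset: "Ck d k S f \<Longrightarrow> T \<subseteq> S \<Longrightarrow> Ck d k T f"
  by (induction k arbitrary: f) (auto intro: continuous_on_subset)

text \<open>Existence of partial derivatives is a condition at single points, so in the induction
  only continuity has to be assembled from the pieces.\<close>

lemma Ck_local:
  assumes "S \<subseteq> espace d"
    and "\<And>x. x \<in> S \<Longrightarrow> \<exists>T. openin (Euclidean_space d) T \<and> x \<in> T \<and> Ck d k (S \<inter> T) f"
  shows "Ck d k S f"
proof -
  have cont: "continuous_on S g"
    if g: "\<And>x. x \<in> S \<Longrightarrow> \<exists>T. openin (Euclidean_space d) T \<and> x \<in> T \<and> continuous_on (S \<inter> T) g"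
    for g :: "(nat \<Rightarrow> real) \<Rightarrow> real"
    unfolding continuous_on_cube_iff[OF assms(1)]
  proof (intro ballI allI impI)
    fix x and h :: real assume x: "x \<in> S" "h > 0"
    with g obtain T where T: "openin (Euclidean_space d) T" "x \<in> T" "continuous_on (S \<inter> T) g"
      by blast
    have "S \<inter> T \<subseteq> espace d"
      using assms by auto
    then obtain e where e: "e > 0" "\<And>y. y \<in> S \<inter> T \<inter> cube d x e \<Longrightarrow> \<bar>g y - g x\<bar> < h"
      using T x continuous_on_cube_iff by (metis IntI)
    obtain e' where e': "e' > 0" "cube d x e' \<subseteq> T"
      using T by (auto simp: openin_Euclidean_iff)
    show "\<exists>e>0. \<forall>y\<in>S \<inter> cube d x e. \<bar>g y - g x\<bar> < h"
    proof (intro exI[of _ "min e e'"] conjI ballI)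
      fix y assume "y \<in> S \<inter> cube d x (min e e')"
      then show "\<bar>g y - g x\<bar> < h"
        using e(2)[of y] e'(2) cube_mono[of "min e e'" e d x] cube_mono[of "min e e'" e' d x] by auto
    qed (use e e' in auto)
  qed
  show ?thesis
    using assms(2)
  proof (induction k arbitrary: f)
    case 0
    then show ?case by (auto intro!: cont)
  next
    case (Suc k)
    have "continuous_on S f"
    proof (rule cont)
      fix x assume "x \<in> S"
      then show "\<exists>T. openin (Euclidean_space d) T \<and> x \<in> T \<and> continuous_on (S \<inter> T) f"
        using Suc.prems Ck_continuous by meson
    qed
    moreover have "has_partial i f (partial_deriv i f x) x" if "x \<in> S" "i < d" for i x
      using Suc.prems[OF that(1)] that by auto
    moreover have "Ck d k S (partial_deriv i f)" if "i < d" for i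
      using Suc.prems that by (intro Suc.IH) (meson Ck.simps(2))
    ultimately show ?case by simp
  qed
qed

lemma Ck_const: "openin (Euclidean_space d) S \<Longrightarrow> Ck d k S (\<lambda>x. c)"
proof (induction k arbitrary: c)
  case (Suc k)
  then show ?case
    by (intro Ck_SucI[where D = "\<lambda>_ _. 0"]) (auto intro: has_partial_const)
qed simp

lemma Ck_coord:
  assumes "openin (Euclidean_space d) S"
  shows "Ck d k S (\<lambda>x. x j)"
proof -
  have c: "continuous_on S (\<lambda>x. x j)"
    by (rule continuous_on_subset[OF continuous_on_product_coordinates]) simp
  show ?thesis
  proof (cases k)
    case (Suc k')
    show ?thesis
      unfolding Suc using assms c
      by (intro Ck_SucI[where D = "\<lambda>i _. if i = j then 1 else 0"] has_partial_coord Ck_const)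
  qed (simp add: c)
qed

lemma Ck_add:
  assumes "openin (Euclidean_space d) S" "Ck d k S f" "Ck d k S g"
  shows "Ck d k S (\<lambda>x. f x + g x)"
  using assms(2,3)
proof (induction k arbitrary: f g)
  case (Suc k)
  show ?case
  proof (rule Ck_SucI[OF assms(1)])
    show "has_partial i (\<lambda>x. f x + g x) (partial_deriv i f x + partial_deriv i g x) x"
      if "i < d" "x \<in> S" for i x
      using that Suc.prems by (intro has_partial_add) auto
  qed (use Suc in \<open>auto intro: continuous_on_add\<close>)
qed (auto intro: continuous_intros)

lemma Ck_mult:
  assumes "openin (Euclidean_space d) S" "Ck d k S f" "Ck d k S g"
  shows "Ck d k S (\<lambda>x. f x * g x)"
  using assms(2,3)
proof (induction k arbitrary: f g)
  case (Suc k)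
  note low = Suc.prems[THEN Ck_Suc_lower]
  show ?case
  proof (rule Ck_SucI[OF assms(1)])
    show "has_partial i (\<lambda>x. f x * g x) (partial_deriv i f x * g x + f x * partial_deriv i g x) x"
      if "i < d" "x \<in> S" for i x
      using that Suc.prems by (intro has_partial_mult) auto
    show "Ck d k S (\<lambda>x. partial_deriv i f x * g x + f x * partial_deriv i g x)" if "i < d" for i
      using that Suc.prems by (intro Ck_add[OF assms(1)] Suc.IH low) auto
  qed (use Suc.prems in \<open>auto intro: continuous_on_mult\<close>)
qed (auto intro: continuous_intros)

lemma Ck_sum:
  assumes "openin (Euclidean_space d) S" "\<And>l. l \<in> A \<Longrightarrow> Ck d k S (f l)"
  shows "Ck d k S (\<lambda>x. \<Sum>l\<in>A. f l x)"
  using assms(2)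
  by (induction A rule: infinite_finite_induct) (auto intro: Ck_const Ck_add assms(1))

text \<open>The derivative is again built from \<open>inverse (f x)\<close>, which has order
  \<open>k\<close> by induction; hence its form as a product with two factors
  \<open>inverse (f x)\<close>.\<close>

lemma Ck_inverse:
  assumes "openin (Euclidean_space d) S" "Ck d k S f" "\<And>x. x \<in> S \<Longrightarrow> f x \<noteq> 0"
  shows "Ck d k S (\<lambda>x. inverse (f x))"
  using assms(2)
proof (induction k)
  case 0
  then show ?case using assms(3) by (auto intro: continuous_intros)
next
  case (Suc k)
  have "Ck d k S (\<lambda>x. inverse (f x))"
    using Suc Ck_Suc_lower by blast
  then have "Ck d k S (\<lambda>x. - 1 * (inverse (f x) * partial_deriv i f x * inverse (f x)))" if "i < d" for i
    using Suc.prems that by (intro Ck_mult Ck_const assms(1)) auto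
  moreover have "has_partial i (\<lambda>x. inverse (f x))
      (- 1 * (inverse (f x) * partial_deriv i f x * inverse (f x))) x" if "i < d" "x \<in> S" for i x
    using that Suc.prems assms(3) by (intro has_partial_inverse) auto
  moreover have "continuous_on S (\<lambda>x. inverse (f x))"
    using Suc.prems assms(3) by (intro continuous_on_inverse) auto
  ultimately show ?case
    by (intro Ck_SucI[OF assms(1)])
qed

subsection \<open>The chain rule\<close>

text \<open>The coefficients \<open>D l y\<close> come from the mean value theorem along a path from \<open>x\<close> to \<open>y\<close> that
  changes one coordinate at a time.\<close>

lemma increment_by_partials:
  assumes x: "x \<in> espace d"
    and f: "\<And>y i. y \<in> cube d x e \<Longrightarrow> i < d \<Longrightarrow> has_partial i f (g i y) y"
  obtains D where "\<And>y. y \<in> cube d x e \<Longrightarrow> f y - f x = (\<Sum>l<d. D l y * (y l - x l))"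
    and "\<And>y l. y \<in> cube d x e \<Longrightarrow> l < d \<Longrightarrow>
      \<exists>z\<in>cube d x e. (\<forall>i. \<bar>z i - x i\<bar> \<le> \<bar>y i - x i\<bar>) \<and> D l y = g l z"
proof -
  define h where "h = (\<lambda>y l j. if j < l then y j else x j :: real)"
  have step: "\<exists>z\<in>cube d x e. (\<forall>i. \<bar>z i - x i\<bar> \<le> \<bar>y i - x i\<bar>) \<and>
      f (h y (Suc l)) - f (h y l) = g l z * (y l - x l)" if y: "y \<in> cube d x e" and l: "l < d" for y l
  proof -
    define z where "z = (\<lambda>t. (h y l)(l := t))"
    have z: "z t \<in> cube d x e" "\<And>i. \<bar>z t i - x i\<bar> \<le> \<bar>y i - x i\<bar>" if "\<bar>t - x l\<bar> \<le> \<bar>y l - x l\<bar>" for t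
    proof -
      show le: "\<bar>z t i - x i\<bar> \<le> \<bar>y i - x i\<bar>" for i
        using that by (simp add: z_def h_def)
      have "z t \<in> espace d"
        using y l x by (simp add: z_def h_def cube_def espace_iff)
      then show "z t \<in> cube d x e"
        using y le by (fastforce simp: cube_def intro: le_less_trans)
    qed
    have ends: "f (h y (Suc l)) = f (z (y l))" "f (h y l) = f (z (x l))"
      by (auto simp: z_def h_def less_Suc_eq fun_eq_iff intro!: arg_cong[where f = f])
    have der: "((\<lambda>s. f (z s)) has_field_derivative g l (z t)) (at t)" if "\<bar>t - x l\<bar> \<le> \<bar>y l - x l\<bar>" for t
      using f[OF z(1)[OF that] l] by (simp add: z_def has_partial_def)
    have "\<exists>t. \<bar>t - x l\<bar> \<le> \<bar>y l - x l\<bar> \<and> f (z (y l)) - f (z (x l)) = g l (z t) * (y l - x l)"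
    proof (cases "x l" "y l" rule: linorder_cases)
      case less
      then obtain t where "x l < t" "t < y l" "f (z (y l)) - f (z (x l)) = (y l - x l) * g l (z t)"
        using MVT2[of "x l" "y l" "\<lambda>s. f (z s)" "\<lambda>t. g l (z t)"] der by auto
      then show ?thesis by (intro exI[of _ t]) auto
    next
      case greater
      then obtain t where "y l < t" "t < x l" "f (z (x l)) - f (z (y l)) = (x l - y l) * g l (z t)"
        using MVT2[of "y l" "x l" "\<lambda>s. f (z s)" "\<lambda>t. g l (z t)"] der by auto
      then show ?thesis by (intro exI[of _ t]) (auto simp: algebra_simps)
    qed (auto intro: exI[of _ "x l"])
    then show ?thesis
      using z ends by metis
  qed
  then obtain \<zeta> where \<zeta>: "\<And>y l. y \<in> cube d x e \<Longrightarrow> l < d \<Longrightarrow> \<zeta> y l \<in> cube d x e \<and>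
      (\<forall>i. \<bar>\<zeta> y l i - x i\<bar> \<le> \<bar>y i - x i\<bar>) \<and>
      f (h y (Suc l)) - f (h y l) = g l (\<zeta> y l) * (y l - x l)"
    by metis
  show thesis
  proof (rule that[of "\<lambda>l y. g l (\<zeta> y l)"])
    fix y assume y: "y \<in> cube d x e"
    have "h y d = y" "h y 0 = x"
      using x y by (auto simp: h_def cube_def espace_iff fun_eq_iff)
    then have "f y - f x = (\<Sum>l<d. f (h y (Suc l)) - f (h y l))"
      using sum_lessThan_telescope[of "\<lambda>l. f (h y l)" d] by simp
    then show "f y - f x = (\<Sum>l<d. g l (\<zeta> y l) * (y l - x l))"
      using \<zeta>[OF y] by simp
  qed (use \<zeta> in blast)
qed

text \<open>The increments are exact, with coefficients \<open>E l\<close> that converge to the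
  partial derivatives: the intermediate points of the mean value theorem are squeezed towards
  \<open>\<gamma> t0\<close>. Of the curve only continuity at \<open>t0\<close> and staying in
  \<open>espace m\<close> is assumed, so the lemma also applies to curves whose differentiability is
  the thing to be shown, as in \<open>ex_inverse_of_primitive\<close>.\<close>

lemma increment_along_curve:
  assumes T: "openin (Euclidean_space m) T" "\<gamma> t0 \<in> T"
    and f: "\<And>y l. y \<in> T \<Longrightarrow> l < m \<Longrightarrow> has_partial l f (g l y) y"
    and g: "\<And>l. l < m \<Longrightarrow> continuous_on T (g l)"
    and \<gamma>: "\<forall>\<^sub>F t in at t0. \<gamma> t \<in> espace m" "\<And>l. l < m \<Longrightarrow> isCont (\<lambda>t. \<gamma> t l) t0"
  obtains E where "\<forall>\<^sub>F t in at t0. f (\<gamma> t) - f (\<gamma> t0) = (\<Sum>l<m. E l t * (\<gamma> t l - \<gamma> t0 l))"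
    and "\<And>l. l < m \<Longrightarrow> (E l \<longlongrightarrow> g l (\<gamma> t0)) (at t0)"
proof -
  let ?x = "\<gamma> t0"
  have x: "?x \<in> espace m"
    using T by (auto simp: openin_Euclidean_iff)
  obtain e where e: "e > 0" "cube m ?x e \<subseteq> T"
    using T by (auto simp: openin_Euclidean_iff)
  obtain D where D: "\<And>y. y \<in> cube m ?x e \<Longrightarrow> f y - f ?x = (\<Sum>l<m. D l y * (y l - ?x l))"
      "\<And>y l. y \<in> cube m ?x e \<Longrightarrow> l < m \<Longrightarrow>
        \<exists>z\<in>cube m ?x e. (\<forall>i. \<bar>z i - ?x i\<bar> \<le> \<bar>y i - ?x i\<bar>) \<and> D l y = g l z"
    using increment_by_partials[OF x, of e f g] f e(2) by blast
  have near: "\<forall>\<^sub>F t in at t0. \<gamma> t \<in> cube m ?x r" if "r > 0" for r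
  proof -
    have "\<forall>\<^sub>F t in at t0. \<forall>l\<in>{..<m}. \<bar>\<gamma> t l - ?x l\<bar> < r"
    proof (rule eventually_ball_finite)
      show "\<forall>l\<in>{..<m}. \<forall>\<^sub>F t in at t0. \<bar>\<gamma> t l - ?x l\<bar> < r"
        using tendstoD[OF \<gamma>(2)[unfolded isCont_def] that] by (auto simp: dist_real_def)
    qed auto
    then show ?thesis
      using \<gamma>(1) by eventually_elim (auto simp: cube_def)
  qed
  show thesis
  proof (rule that[of "\<lambda>l t. D l (\<gamma> t)"])
    show "\<forall>\<^sub>F t in at t0. f (\<gamma> t) - f ?x = (\<Sum>l<m. D l (\<gamma> t) * (\<gamma> t l - ?x l))"
      using near[OF e(1)] by eventually_elim (use D(1) in blast)
    fix l assume l: "l < m"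
    show "((\<lambda>t. D l (\<gamma> t)) \<longlongrightarrow> g l ?x) (at t0)"
    proof (rule tendstoI)
      fix h :: real assume "h > 0"
      then obtain r where r: "r > 0" "\<And>y. y \<in> T \<inter> cube m ?x r \<Longrightarrow> \<bar>g l y - g l ?x\<bar> < h"
        using g[OF l] T continuous_on_cube_iff[of T m "g l"] openin_subset by metis
      have "\<forall>\<^sub>F t in at t0. \<gamma> t \<in> cube m ?x (min e r)"
        using near e r by simp
      then show "\<forall>\<^sub>F t in at t0. dist (D l (\<gamma> t)) (g l ?x) < h"
      proof eventually_elim
        case (elim t)
        then have *: "\<gamma> t \<in> cube m ?x e" "\<gamma> t \<in> cube m ?x r"
          by (auto simp: cube_def)
        obtain z where "z \<in> cube m ?x e" "\<And>i. \<bar>z i - ?x i\<bar> \<le> \<bar>\<gamma> t i - ?x i\<bar>" "D l (\<gamma> t) = g l z"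
          using D(2)[OF *(1) l] by blast
        moreover have "z \<in> cube m ?x r"
          using calculation *(2) by (auto simp: cube_def intro: le_less_trans)
        ultimately show ?case
          using r(2)[of z] e(2) by (auto simp: dist_real_def)
      qed
    qed
  qed
qed

text \<open>The exact increments are divided by \<open>t - t0\<close>; coefficients and difference
  quotients converge separately.\<close>

lemma DERIV_chain_partials:
  assumes T: "openin (Euclidean_space m) T" "\<gamma> t0 \<in> T"
    and f: "\<And>y l. y \<in> T \<Longrightarrow> l < m \<Longrightarrow> has_partial l f (g l y) y"
    and g: "\<And>l. l < m \<Longrightarrow> continuous_on T (g l)"
    and \<gamma>: "\<forall>\<^sub>F t in at t0. \<gamma> t \<in> espace m"
      "\<And>l. l < m \<Longrightarrow> ((\<lambda>t. \<gamma> t l) has_field_derivative c l) (at t0)"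
  shows "((\<lambda>t. f (\<gamma> t)) has_field_derivative (\<Sum>l<m. g l (\<gamma> t0) * c l)) (at t0)"
proof -
  obtain E where E: "\<forall>\<^sub>F t in at t0. f (\<gamma> t) - f (\<gamma> t0) = (\<Sum>l<m. E l t * (\<gamma> t l - \<gamma> t0 l))"
      "\<And>l. l < m \<Longrightarrow> (E l \<longlongrightarrow> g l (\<gamma> t0)) (at t0)"
    using increment_along_curve[OF T f g \<gamma>(1) DERIV_isCont[OF \<gamma>(2)]] by blast
  have "((\<lambda>t. \<Sum>l<m. E l t * ((\<gamma> t l - \<gamma> t0 l) / (t - t0))) \<longlongrightarrow> (\<Sum>l<m. g l (\<gamma> t0) * c l)) (at t0)"
    using E(2) \<gamma>(2) by (intro tendsto_intros) (auto simp: has_field_derivative_iff)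
  moreover have "\<forall>\<^sub>F t in at t0. (\<Sum>l<m. E l t * ((\<gamma> t l - \<gamma> t0 l) / (t - t0))) =
      (f (\<gamma> t) - f (\<gamma> t0)) / (t - t0)"
    using E(1) by eventually_elim (simp add: sum_divide_distrib)
  ultimately show ?thesis
    unfolding has_field_derivative_iff by (rule Lim_transform_eventually)
qed

lemma has_partial_compose:
  assumes S: "openin (Euclidean_space d) S" "x \<in> S" "i < d"
    and T: "openin (Euclidean_space m) T" "\<And>y. y \<in> S \<Longrightarrow> h y \<in> T"
    and f: "Ck m (Suc 0) T f"
    and h: "\<And>l. l < m \<Longrightarrow> has_partial i (\<lambda>y. h y l) (c l) x"
  shows "has_partial i (\<lambda>y. f (h y)) (\<Sum>l<m. partial_deriv l f (h x) * c l) x"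
proof -
  have "((\<lambda>t. f (h (x(i := t)))) has_field_derivative
      (\<Sum>l<m. partial_deriv l f (h (x(i := x i))) * c l)) (at (x i))"
  proof (rule DERIV_chain_partials[OF T(1)])
    obtain e where e: "e > 0" "\<And>t. \<bar>t - x i\<bar> < e \<Longrightarrow> x(i := t) \<in> S"
      using eventually_upd_in[OF S] by metis
    have "T \<subseteq> espace m"
      using T(1) by (rule openin_subset)
    then show "\<forall>\<^sub>F t in at (x i). h (x(i := t)) \<in> espace m"
      unfolding eventually_at using e T(2) by (intro exI[of _ e]) (auto simp: dist_real_def)
    show "h (x(i := x i)) \<in> T"
      using T(2) S(2) by simp
    show "((\<lambda>t. h (x(i := t)) l) has_real_derivative c l) (at (x i))" if "l < m" for l
      using h[OF that] by (simp only: has_partial_def)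
  qed (use f in auto)
  then show ?thesis by (simp add: has_partial_def)
qed

lemma continuous_on_compose_coords:
  fixes h :: "'a :: topological_space \<Rightarrow> nat \<Rightarrow> real"
  assumes T: "T \<subseteq> espace m" and f: "continuous_on T f" and h: "\<And>y. y \<in> S \<Longrightarrow> h y \<in> T"
    "\<And>l. l < m \<Longrightarrow> continuous_on S (\<lambda>y. h y l)"
  shows "continuous_on S (\<lambda>y. f (h y))"
proof (rule continuous_on_compose2[OF f])
  show "continuous_on S h"
  proof (rule continuous_on_coordinatewise_then_product)
    fix l
    \<comment> \<open>Coordinates from \<open>m\<close> on are \<open>0\<close> because
      \<open>h\<close> takes values in \<open>espace m\<close>.\<close>
    have "continuous_on S (\<lambda>y. h y l) \<longleftrightarrow> continuous_on S (\<lambda>y. 0 :: real)" if "l \<ge> m"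
      using that subsetD[OF T h(1)] by (intro continuous_on_cong) (auto simp: espace_iff)
    then show "continuous_on S (\<lambda>y. h y l)"
      using h(2) by (cases "l < m") auto
  qed
qed (use h in auto)

text \<open>The chain rule gives sums of products of partial derivatives of \<open>f\<close>,
  composed with \<open>h\<close>, and partial derivatives of \<open>h\<close>. The induction varies
  \<open>f\<close> and keeps \<open>h\<close> fixed.\<close>

lemma Ck_compose:
  assumes S: "openin (Euclidean_space d) S" and T: "openin (Euclidean_space m) T"
    and h: "\<And>y. y \<in> S \<Longrightarrow> h y \<in> T" and f: "Ck m k T f" "\<And>l. l < m \<Longrightarrow> Ck d k S (\<lambda>y. h y l)"
  shows "Ck d k S (\<lambda>y. f (h y))"
  using f
proof (induction k arbitrary: f)
  case 0
  show ?case
    unfolding Ck.simps(1)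
    by (rule continuous_on_compose_coords[OF openin_subset[OF T], where h = h and f = f])
      (use 0 h in auto)
next
  case (Suc k)
  have 1: "Ck m (Suc 0) T f"
    using Suc.prems(1) by (auto intro: Ck_continuous)
  have low: "Ck d k S (\<lambda>y. h y l)" if "l < m" for l
    using Suc.prems(2)[OF that] by (rule Ck_Suc_lower)
  show ?case
  proof (rule Ck_SucI[OF S])
    show "continuous_on S (\<lambda>y. f (h y))"
      by (rule continuous_on_compose_coords[OF openin_subset[OF T], where h = h and f = f])
        (use Suc.prems[THEN Ck_continuous] h in auto)
    show "has_partial i (\<lambda>y. f (h y))
        (\<Sum>l<m. partial_deriv l f (h x) * partial_deriv i (\<lambda>y. h y l) x) x"
      if "i < d" "x \<in> S" for i x
      using Suc.prems(2) that by (intro has_partial_compose[OF S that(2,1) T h 1]) auto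
    show "Ck d k S (\<lambda>x. \<Sum>l<m. partial_deriv l f (h x) * partial_deriv i (\<lambda>y. h y l) x)"
      if "i < d" for i
    proof (intro Ck_sum Ck_mult S)
      fix l assume "l \<in> {..<m}"
      then show "Ck d k S (\<lambda>x. partial_deriv l f (h x))" "Ck d k S (partial_deriv i (\<lambda>y. h y l))"
        using Suc.prems that by (auto intro: Suc.IH low)
    qed
  qed
qed

subsection \<open>Smooth functions\<close>

lemma smooth_Ck: "smooth_real_on d S f \<Longrightarrow> Ck d k S f"
  by (simp add: smooth_real_on_iff)

lemma smooth_CkI: "openin (Euclidean_space d) S \<Longrightarrow> (\<And>k. Ck d k S f) \<Longrightarrow> smooth_real_on d S f"
  by (simp add: smooth_real_on_iff)

lemma smooth_const: "openin (Euclidean_space d) S \<Longrightarrow> smooth_real_on d S (\<lambda>x. c)"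
  by (simp add: smooth_real_on_iff Ck_const)

lemma smooth_coord: "openin (Euclidean_space d) S \<Longrightarrow> smooth_real_on d S (\<lambda>x. x j)"
  by (simp add: smooth_real_on_iff Ck_coord)

lemma smooth_add:
  "smooth_real_on d S f \<Longrightarrow> smooth_real_on d S g \<Longrightarrow> smooth_real_on d S (\<lambda>x. f x + g x)"
  by (simp add: smooth_real_on_iff Ck_add)

lemma smooth_mult:
  "smooth_real_on d S f \<Longrightarrow> smooth_real_on d S g \<Longrightarrow> smooth_real_on d S (\<lambda>x. f x * g x)"
  by (simp add: smooth_real_on_iff Ck_mult)

lemma smooth_minus: "smooth_real_on d S f \<Longrightarrow> smooth_real_on d S (\<lambda>x. - f x)"
  using smooth_mult[OF smooth_const[of d S "-1"]] smooth_real_on_open by fastforce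

lemma smooth_sum:
  "openin (Euclidean_space d) S \<Longrightarrow> (\<And>l. l \<in> A \<Longrightarrow> smooth_real_on d S (f l)) \<Longrightarrow>
    smooth_real_on d S (\<lambda>x. \<Sum>l\<in>A. f l x)"
  by (simp add: smooth_real_on_iff Ck_sum)

lemma smooth_subset:
  "smooth_real_on d S f \<Longrightarrow> T \<subseteq> S \<Longrightarrow> openin (Euclidean_space d) T \<Longrightarrow> smooth_real_on d T f"
  using Ck_subset smooth_Ck by (intro smooth_CkI) blast+

lemma smooth_cong:
  assumes "\<And>x. x \<in> S \<Longrightarrow> f x = g x"
  shows "smooth_real_on d S f \<longleftrightarrow> smooth_real_on d S g"
  using Ck_cong[of d S f g] Ck_cong[of d S g f] assms by (auto simp: smooth_real_on_iff)

lemma smooth_local: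
  assumes "\<And>x. x \<in> S \<Longrightarrow> \<exists>T. x \<in> T \<and> T \<subseteq> S \<and> smooth_real_on d T f"
  shows "smooth_real_on d S f"
proof (rule smooth_CkI)
  show S: "openin (Euclidean_space d) S"
    by (subst openin_subopen) (meson assms smooth_real_on_open)
  show "Ck d k S f" for k
  proof (rule Ck_local)
    fix x assume "x \<in> S"
    then obtain T where T: "x \<in> T" "T \<subseteq> S" "smooth_real_on d T f"
      using assms by blast
    then have "S \<inter> T = T" by blast
    then show "\<exists>T. openin (Euclidean_space d) T \<and> x \<in> T \<and> Ck d k (S \<inter> T) f"
      using T smooth_Ck smooth_real_on_open by metis
  qed (use S openin_subset in blast)
qed

lemma smooth_compose:
  assumes f: "smooth_real_on m T f" and S: "openin (Euclidean_space d) S"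
    and h: "\<And>y. y \<in> S \<Longrightarrow> h y \<in> T" "\<And>l. l < m \<Longrightarrow> smooth_real_on d S (\<lambda>y. h y l)"
  shows "smooth_real_on d S (\<lambda>y. f (h y))"
proof (rule smooth_CkI[OF S])
  show "Ck d k S (\<lambda>y. f (h y))" for k
    by (rule Ck_compose[OF S smooth_real_on_open[OF f]]) (use assms smooth_Ck in auto)
qed

lemma smooth_has_partial:
  assumes "smooth_real_on d S f" "x \<in> S" "i < d"
  shows "has_partial i f (partial_deriv i f x) x"
  using smooth_Ck[OF assms(1), of "Suc 0"] assms(2,3) by simp

lemma smooth_partial_deriv:
  assumes "smooth_real_on d S f" "i < d"
  shows "smooth_real_on d S (partial_deriv i f)"
  using smooth_Ck[OF assms(1), of "Suc _"] assms(2)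
  by (intro smooth_CkI smooth_real_on_open[OF assms(1)]) auto

lemma smooth_continuous: "smooth_real_on d S f \<Longrightarrow> continuous_on S f"
  using smooth_Ck[of d S f 0] by simp

subsection \<open>Integrals with parameters\<close>

text \<open>A map that is affine in each coordinate separately, with coefficients depending on
  \<open>t\<close>; coordinates from \<open>d\<close> on are set to \<open>0\<close> to stay in
  \<open>espace d\<close>. Three families occur: the contraction of a cube to its centre (Poincare),
  the motion of one coordinate at a time (Hadamard), and the scaling of the first of two
  coordinates.\<close>

definition daffine ::
    "nat \<Rightarrow> (nat \<Rightarrow> real \<Rightarrow> real) \<Rightarrow> (nat \<Rightarrow> real \<Rightarrow> real) \<Rightarrow> real \<Rightarrow> (nat \<Rightarrow> real) \<Rightarrow> nat \<Rightarrow> real"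
  where "daffine d \<alpha> \<beta> t y = (\<lambda>i. if i < d then \<alpha> i t * y i + \<beta> i t else 0)"

locale daffine_family =
  fixes d :: nat and S T :: "(nat \<Rightarrow> real) set" and \<alpha> \<beta> :: "nat \<Rightarrow> real \<Rightarrow> real"
  assumes S: "openin (Euclidean_space d) S" and T: "openin (Euclidean_space d) T"
    and cont_\<alpha>: "\<And>i. i < d \<Longrightarrow> continuous_on {0..1} (\<alpha> i)"
    and cont_\<beta>: "\<And>i. i < d \<Longrightarrow> continuous_on {0..1} (\<beta> i)"
    and maps: "\<And>y t. y \<in> S \<Longrightarrow> t \<in> {0..1} \<Longrightarrow> daffine d \<alpha> \<beta> t y \<in> T"
begin

lemma continuous_on_pair:
  assumes f: "continuous_on T f"
  shows "continuous_on (S \<times> {0..1}) (\<lambda>p. f (daffine d \<alpha> \<beta> (snd p) (fst p)))"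
proof (rule continuous_on_compose_coords[OF openin_subset[OF T] f,
      where h = "\<lambda>p. daffine d \<alpha> \<beta> (snd p) (fst p)"])
  fix l assume l: "l < d"
  have snd: "continuous_on (S \<times> {0..1}) (\<lambda>p. g (snd p))" if "continuous_on {0..1} g"
    for g :: "real \<Rightarrow> real"
    by (rule continuous_on_compose2[OF that continuous_on_snd[OF continuous_on_id]]) auto
  have "continuous_on (S \<times> {0..1::real}) (\<lambda>p. fst p l)"
    by (rule continuous_on_product_then_coordinatewise[OF continuous_on_fst[OF continuous_on_id]])
  then show "continuous_on (S \<times> {0..1}) (\<lambda>p. daffine d \<alpha> \<beta> (snd p) (fst p) l)"
    unfolding daffine_def using l snd[OF cont_\<alpha>[OF l]] snd[OF cont_\<beta>[OF l]]
    by (auto intro!: continuous_intros)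
qed (use maps in auto)

lemma continuous_on_param:
  assumes f: "continuous_on T f" and y: "y \<in> S"
  shows "continuous_on {0..1} (\<lambda>t. f (daffine d \<alpha> \<beta> t y))"
proof -
  have "continuous_on {0..1} (\<lambda>t. (\<lambda>p. f (daffine d \<alpha> \<beta> (snd p) (fst p))) (y, t))"
    by (rule continuous_on_compose2[OF continuous_on_pair[OF f]])
      (use y in \<open>auto intro!: continuous_intros\<close>)
  then show ?thesis by simp
qed

lemma continuous_on_integral:
  fixes f :: "(nat \<Rightarrow> real) \<Rightarrow> real" and w :: "real \<Rightarrow> real"
  assumes "continuous_on T f" "continuous_on {0..1} w"
  shows "continuous_on S (\<lambda>y. integral {0..1} (\<lambda>t. w t * f (daffine d \<alpha> \<beta> t y)))"
proof -
  have "continuous_on (S \<times> {0..1}) (\<lambda>p. w (snd p) * f (daffine d \<alpha> \<beta> (snd p) (fst p)))"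
    using continuous_on_pair[OF assms(1)]
    by (intro continuous_on_mult continuous_on_compose2[OF assms(2) continuous_on_snd[OF continuous_on_id]])
      auto
  then show ?thesis
    using integral_continuous_on_param[of S 0 1 "\<lambda>y t. w t * f (daffine d \<alpha> \<beta> t y)"]
    by (simp add: split_beta)
qed

text \<open>Differentiation under the integral sign. As the map is diagonal, the inner derivative in
  direction \<open>i\<close> is the single factor \<open>\<alpha> i t\<close>.\<close>

lemma has_partial_integral:
  assumes f: "Ck d (Suc 0) T f" and w: "continuous_on {0..1} w" and i: "i < d" and y: "y \<in> S"
  shows "has_partial i (\<lambda>y. integral {0..1} (\<lambda>t. w t * f (daffine d \<alpha> \<beta> t y)))
    (integral {0..1} (\<lambda>t. (w t * \<alpha> i t) * partial_deriv i f (daffine d \<alpha> \<beta> t y))) y"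
proof -
  obtain e where e: "e > 0" "\<And>r. \<bar>r - y i\<bar> < e \<Longrightarrow> y(i := r) \<in> S"
    using eventually_upd_in[OF S y i] by metis
  have U: "y(i := r) \<in> S" if "r \<in> ball (y i) e" for r
    using that e(2) by (simp add: dist_real_def abs_minus_commute)
  have pf: "continuous_on T (partial_deriv i f)" and cf: "continuous_on T f"
    using f i by auto
  have wa: "continuous_on {0..1} (\<lambda>t. w t * \<alpha> i t)"
    by (intro continuous_on_mult w cont_\<alpha>[OF i])
  have der: "((\<lambda>r. w t * f (daffine d \<alpha> \<beta> t (y(i := r)))) has_field_derivative
      (w t * \<alpha> i t) * partial_deriv i f (daffine d \<alpha> \<beta> t (y(i := r)))) (at r within ball (y i) e)"
    if r: "r \<in> ball (y i) e" and t: "t \<in> cbox 0 1" for r t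
  proof -
    let ?y = "y(i := r)"
    have "has_partial i (\<lambda>y. f (daffine d \<alpha> \<beta> t y))
        (\<Sum>l<d. partial_deriv l f (daffine d \<alpha> \<beta> t ?y) * (if l = i then \<alpha> i t else 0)) ?y"
    proof (rule has_partial_compose[OF S U[OF r] i T _ f])
      show "daffine d \<alpha> \<beta> t y \<in> T" if "y \<in> S" for y
        using maps that t by simp
      show "has_partial i (\<lambda>y. daffine d \<alpha> \<beta> t y l) (if l = i then \<alpha> i t else 0) ?y" if "l < d" for l
        using that by (auto simp: daffine_def has_partial_def intro!: derivative_eq_intros)
    qed
    then have "((\<lambda>r. f (daffine d \<alpha> \<beta> t (y(i := r)))) has_field_derivative
        partial_deriv i f (daffine d \<alpha> \<beta> t ?y) * \<alpha> i t) (at r)"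
      using i by (simp add: has_partial_def if_distrib sum.delta cong: if_cong)
    from has_field_derivative_at_within[OF DERIV_cmult[OF this, of "w t"]] show ?thesis
      by (simp add: mult.assoc mult.commute[of "\<alpha> i t"])
  qed
  have "((\<lambda>r. integral (cbox 0 1) (\<lambda>t. w t * f (daffine d \<alpha> \<beta> t (y(i := r))))) has_field_derivative
      integral (cbox 0 1) (\<lambda>t. (w t * \<alpha> i t) * partial_deriv i f (daffine d \<alpha> \<beta> t (y(i := y i)))))
      (at (y i) within ball (y i) e)"
  proof (rule leibniz_rule_field_derivative[OF der])
    show "(\<lambda>t. w t * f (daffine d \<alpha> \<beta> t (y(i := r)))) integrable_on cbox 0 1"
      if "r \<in> ball (y i) e" for r
      using continuous_on_mult[OF w continuous_on_param[OF cf U[OF that]]]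
      by (auto intro: integrable_continuous_real)
    have upd: "continuous_on (ball (y i) e \<times> {0..1::real}) (\<lambda>q. y(i := fst q))"
    proof (rule continuous_on_coordinatewise_then_product)
      show "continuous_on (ball (y i) e \<times> {0..1::real}) (\<lambda>q. (y(i := fst q)) j)" for j
        by (cases "j = i") (auto intro!: continuous_intros)
    qed
    have "continuous_on (ball (y i) e \<times> {0..1})
        (\<lambda>q. (\<lambda>p. partial_deriv i f (daffine d \<alpha> \<beta> (snd p) (fst p))) (y(i := fst q), snd q))"
      by (rule continuous_on_compose2[OF continuous_on_pair[OF pf]])
        (auto intro!: continuous_on_Pair upd continuous_on_snd continuous_on_id U)
    moreover have "continuous_on (ball (y i) e \<times> {0..1}) (\<lambda>q. w (snd q) * \<alpha> i (snd q))"
      by (rule continuous_on_compose2[OF wa continuous_on_snd[OF continuous_on_id]]) auto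
    ultimately show "continuous_on (ball (y i) e \<times> cbox 0 1)
        (\<lambda>(r, t). (w t * \<alpha> i t) * partial_deriv i f (daffine d \<alpha> \<beta> t (y(i := r))))"
      by (simp add: split_beta continuous_on_mult)
  qed (use e in auto)
  then show ?thesis
    using e(1) by (simp add: has_partial_def at_within_open[of _ "ball (y i) e"])
qed

text \<open>Each differentiation multiplies the weight \<open>w\<close> by some
  \<open>\<alpha> i\<close>, so the induction runs over all continuous weights.\<close>

lemma Ck_integral:
  assumes "Ck d k T f" "continuous_on {0..1} w"
  shows "Ck d k S (\<lambda>y. integral {0..1} (\<lambda>t. w t * f (daffine d \<alpha> \<beta> t y)))"
  using assms
proof (induction k arbitrary: f w)
  case 0
  then show ?case
    by (simp add: continuous_on_integral)
next
  case (Suc k)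
  show ?case
  proof (rule Ck_SucI[OF S])
    show "continuous_on S (\<lambda>y. integral {0..1} (\<lambda>t. w t * f (daffine d \<alpha> \<beta> t y)))"
      using Suc.prems by (intro continuous_on_integral) auto
    show "has_partial i (\<lambda>y. integral {0..1} (\<lambda>t. w t * f (daffine d \<alpha> \<beta> t y)))
        (integral {0..1} (\<lambda>t. (w t * \<alpha> i t) * partial_deriv i f (daffine d \<alpha> \<beta> t x))) x"
      if "i < d" "x \<in> S" for i x
      using Suc.prems that Ck_continuous by (intro has_partial_integral) auto
    show "Ck d k S (\<lambda>x. integral {0..1} (\<lambda>t. (w t * \<alpha> i t) * partial_deriv i f (daffine d \<alpha> \<beta> t x)))"
      if "i < d" for i
      using Suc.prems that by (intro Suc.IH continuous_on_mult cont_\<alpha>) auto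
  qed
qed

lemma smooth_integral:
  assumes "smooth_real_on d T f" "continuous_on {0..1} w"
  shows "smooth_real_on d S (\<lambda>y. integral {0..1} (\<lambda>t. w t * f (daffine d \<alpha> \<beta> t y)))"
  by (rule smooth_CkI[OF S]) (rule Ck_integral[OF smooth_Ck[OF assms(1)] assms(2)])

lemma smooth_integral_has_partial:
  assumes "smooth_real_on d T f" "continuous_on {0..1} w" "i < d" "y \<in> S"
  shows "has_partial i (\<lambda>y. integral {0..1} (\<lambda>t. w t * f (daffine d \<alpha> \<beta> t y)))
    (integral {0..1} (\<lambda>t. (w t * \<alpha> i t) * partial_deriv i f (daffine d \<alpha> \<beta> t y))) y"
  by (rule has_partial_integral[OF smooth_Ck[OF assms(1)] assms(2-4)])

lemma integrable:
  assumes "smooth_real_on d T f" "continuous_on {0..1} w" "y \<in> S"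
  shows "((\<lambda>t. w t * f (daffine d \<alpha> \<beta> t y)) has_integral
    integral {0..1} (\<lambda>t. w t * f (daffine d \<alpha> \<beta> t y))) {0..1}"
  using assms
  by (intro integrable_integral integrable_continuous_real continuous_on_mult continuous_on_param
      smooth_continuous)

end

lemma smooth_DERIV_curve:
  assumes f: "smooth_real_on d T f" "\<gamma> t0 \<in> T"
    and \<gamma>: "\<And>t. \<gamma> t \<in> espace d"
      "\<And>l. l < d \<Longrightarrow> ((\<lambda>t. \<gamma> t l) has_field_derivative c l) (at t0)"
  shows "((\<lambda>t. f (\<gamma> t)) has_field_derivative (\<Sum>l<d. partial_deriv l f (\<gamma> t0) * c l)) (at t0)"
  using assms by (intro DERIV_chain_partials[where T = T])
    (auto intro: smooth_real_on_open smooth_has_partial smooth_continuous smooth_partial_deriv)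

lemma integral_derivative_01:
  assumes "\<And>t. t \<in> {0..1} \<Longrightarrow> (\<phi> has_field_derivative \<phi>' t) (at t)"
  shows "(\<phi>' has_integral \<phi> 1 - \<phi> 0) {0..1::real}"
  using assms by (intro fundamental_theorem_of_calculus)
    (auto intro: has_field_derivative_at_within simp flip: has_real_derivative_iff_has_vector_derivative)

lemma daffine_segment_in_cube:
  assumes "y \<in> cube d p e"
    and "\<And>i. i < d \<Longrightarrow> \<alpha> i \<in> {0..1} \<and> v i = \<alpha> i * y i + (1 - \<alpha> i) * p i" "\<And>i. i \<ge> d \<Longrightarrow> v i = 0"
  shows "v \<in> cube d p e"
proof -
  have "\<bar>v i - p i\<bar> < e" if i: "i < d" for i
  proof -
    have "v i - p i = \<alpha> i * (y i - p i)"
      using assms(2)[OF i] by (simp add: algebra_simps)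
    then have "\<bar>v i - p i\<bar> \<le> 1 * \<bar>y i - p i\<bar>"
      using assms(2)[OF i] by (simp add: abs_mult mult_left_le_one_le)
    then show ?thesis
      using assms(1) i by (auto simp: cube_def)
  qed
  then show ?thesis
    using assms(3) by (simp add: cube_def espace_iff)
qed

subsection \<open>Hadamard's lemma\<close>

text \<open>\<open>D l\<close> is the mean of the \<open>l\<close>-th partial derivative over the
  segment on which only coordinate \<open>l\<close> moves, the earlier coordinates being already
  those of \<open>y\<close> and the later ones still those of \<open>p\<close>. Along this segment
  \<open>g\<close> increases by \<open>(y l - p l) * D l y\<close>, and these increments
  telescope.\<close>

lemma hadamard:
  assumes g: "smooth_real_on d (cube d p e) g" and p: "p \<in> espace d" and e: "e > 0"
  obtains D where "\<And>l. l < d \<Longrightarrow> smooth_real_on d (cube d p e) (D l)"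
    and "\<And>l. l < d \<Longrightarrow> D l p = partial_deriv l g p"
    and "\<And>y. y \<in> cube d p e \<Longrightarrow> g y = g p + (\<Sum>l<d. (y l - p l) * D l y)"
proof -
  \<comment> \<open>Value \<open>1\<close>: already moved to \<open>y\<close>; value
    \<open>t\<close>: moving; value \<open>0\<close>: still at \<open>p\<close>. Together with
    \<open>\<beta>\<close>, coordinate \<open>i\<close> of the path is the convex combination of
    \<open>y i\<close> and \<open>p i\<close> with weight \<open>\<alpha> l i t\<close>.\<close>
  define \<alpha> where "\<alpha> = (\<lambda>(l :: nat) i t. if i < l then 1 else if i = l then t else 0 :: real)"
  define \<beta> where "\<beta> = (\<lambda>l i t. (1 - \<alpha> l i t) * p i)"
  define c where "c = (\<lambda>l. daffine d (\<alpha> l) (\<beta> l))"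
  define D where "D = (\<lambda>l y. integral {0..1} (\<lambda>t. 1 * partial_deriv l g (c l t y)))"
  have fam: "daffine_family d (cube d p e) (cube d p e) (\<alpha> l) (\<beta> l)" for l
  proof
    show c\<alpha>: "continuous_on {0..1} (\<alpha> l i)" for i
      by (cases "i < l"; cases "i = l") (auto simp: \<alpha>_def)
    then show "continuous_on {0..1} (\<beta> l i)" for i
      unfolding \<beta>_def by (intro continuous_intros)
    show "daffine d (\<alpha> l) (\<beta> l) t y \<in> cube d p e" if "y \<in> cube d p e" "t \<in> {0..1}" for y t
      by (rule daffine_segment_in_cube[OF that(1), where \<alpha> = "\<lambda>i. \<alpha> l i t"])
        (use that in \<open>auto simp: \<alpha>_def \<beta>_def daffine_def\<close>)
  qed (rule openin_cube)+
  show thesis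
  proof (rule that)
    show "smooth_real_on d (cube d p e) (D l)" if "l < d" for l
      unfolding D_def c_def
      by (intro daffine_family.smooth_integral[OF fam] smooth_partial_deriv[OF g that]) auto
    have "c l t p = p" for l t
      using p by (auto simp: c_def daffine_def \<beta>_def fun_eq_iff espace_iff algebra_simps)
    then show "D l p = partial_deriv l g p" for l
      by (simp add: D_def)
    fix y assume y: "y \<in> cube d p e"
    define h where "h = (\<lambda>l j. if j < l then y j else p j)"
    have "g (h (Suc l)) - g (h l) = (y l - p l) * D l y" if l: "l < d" for l
    proof -
      have "((\<lambda>t. g (c l t y)) has_field_derivative
          (\<Sum>j<d. partial_deriv j g (c l t y) * (if j = l then y l - p l else 0))) (at t)"
        if t: "t \<in> {0..1}" for t
      proof (rule smooth_DERIV_curve[OF g])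
        show "c l t y \<in> cube d p e"
          unfolding c_def by (rule daffine_family.maps[OF fam y t])
        show "c l t y \<in> espace d" for t
          by (simp add: c_def daffine_def espace_iff)
        show "((\<lambda>t. c l t y j) has_field_derivative (if j = l then y l - p l else 0)) (at t)"
          if "j < d" for j
          using that
          by (cases "j < l"; cases "j = l")
            (auto simp: c_def daffine_def \<alpha>_def \<beta>_def intro!: derivative_eq_intros)
      qed
      then have "((\<lambda>t. partial_deriv l g (c l t y) * (y l - p l)) has_integral
          g (c l 1 y) - g (c l 0 y)) {0..1}"
        using l by (intro integral_derivative_01) (simp add: if_distrib sum.delta cong: if_cong)
      moreover have "((\<lambda>t. partial_deriv l g (c l t y) * (y l - p l)) has_integral
          D l y * (y l - p l)) {0..1}"
        using daffine_family.integrable[OF fam smooth_partial_deriv[OF g l] continuous_on_const y, of 1]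
        unfolding D_def c_def by (intro has_integral_mult_left) simp
      moreover have "c l 1 y = h (Suc l)" "c l 0 y = h l"
        using y p by (auto simp: c_def daffine_def \<alpha>_def \<beta>_def h_def fun_eq_iff cube_def espace_iff)
      ultimately show ?thesis
        by (metis has_integral_unique mult.commute)
    qed
    then have "(\<Sum>l<d. (y l - p l) * D l y) = (\<Sum>l<d. g (h (Suc l)) - g (h l))"
      by simp
    also have "\<dots> = g (h d) - g (h 0)"
      by (rule sum_lessThan_telescope)
    also have "\<dots> = g y - g p"
    proof -
      have "h d = y" "h 0 = p"
        using y p by (auto simp: h_def fun_eq_iff cube_def espace_iff)
      then show ?thesis by simp
    qed
    finally show "g y = g p + (\<Sum>l<d. (y l - p l) * D l y)"
      by simp
  qed
qed

subsection \<open>The Poincare lemma for 2-forms on a cube\<close>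

text \<open>The radial homotopy operator: \<open>c t y\<close> is the point
  \<open>p + t (y - p)\<close>, and the primitive \<open>lam\<close> contracts the form with the
  radial vector field \<open>y - p\<close> and integrates over \<open>t\<close> with weight
  \<open>t\<close>. Closedness turns the exterior derivative of \<open>lam\<close> into the integral
  of the \<open>t\<close>-derivative of \<open>t * t * \<omega> i j (c t x)\<close>, whose boundary
  values are \<open>\<omega> i j x\<close> and \<open>0\<close>.\<close>

lemma poincare_cube:
  assumes p: "p \<in> espace d" and e: "e > 0"
    and \<omega>: "\<And>i j. i < d \<Longrightarrow> j < d \<Longrightarrow> smooth_real_on d (cube d p e) (\<omega> i j)"
    and skew: "\<And>i j x. i < d \<Longrightarrow> j < d \<Longrightarrow> x \<in> cube d p e \<Longrightarrow> \<omega> i j x = - \<omega> j i x"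
    and closed: "\<And>i j k x. i < d \<Longrightarrow> j < d \<Longrightarrow> k < d \<Longrightarrow> x \<in> cube d p e \<Longrightarrow>
      partial_deriv i (\<omega> j k) x + partial_deriv j (\<omega> k i) x + partial_deriv k (\<omega> i j) x = 0"
  obtains \<eta> where "\<And>j. j < d \<Longrightarrow> smooth_real_on d (cube d p e) (\<eta> j)"
    and "\<And>i j x. i < d \<Longrightarrow> j < d \<Longrightarrow> x \<in> cube d p e \<Longrightarrow>
      \<omega> i j x = partial_deriv i (\<eta> j) x - partial_deriv j (\<eta> i) x"
proof -
  let ?Q = "cube d p e"
  define c where "c = daffine d (\<lambda>i t. t) (\<lambda>i t. (1 - t) * p i)"
  define K where "K = (\<lambda>i j y. integral {0..1} (\<lambda>t. t * \<omega> i j (c t y)))"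
  \<comment> \<open>\<open>L k i j\<close> is the \<open>k\<close>-th partial derivative of
    \<open>K i j\<close>; the inner derivative of the contraction contributes the second factor
    \<open>t\<close>.\<close>
  define L where "L = (\<lambda>k i j y. integral {0..1} (\<lambda>t. (t * t) * partial_deriv k (\<omega> i j) (c t y)))"
  define lam where "lam = (\<lambda>j y. \<Sum>i<d. (y i + - p i) * K i j y)"
  interpret daffine_family d ?Q ?Q "\<lambda>i t. t" "\<lambda>i t. (1 - t) * p i"
  proof
    show "daffine d (\<lambda>i t. t) (\<lambda>i t. (1 - t) * p i) t y \<in> ?Q" if "y \<in> ?Q" "t \<in> {0..1}" for y t
      by (rule daffine_segment_in_cube[OF that(1), where \<alpha> = "\<lambda>i. t"])
        (use that in \<open>auto simp: daffine_def\<close>)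
  qed (auto intro!: continuous_intros openin_cube)
  have smK: "smooth_real_on d ?Q (K i j)" if "i < d" "j < d" for i j
    unfolding K_def c_def by (intro smooth_integral \<omega> that continuous_on_id)
  have pK: "has_partial k (K i j) (L k i j x) x" if "i < d" "j < d" "k < d" "x \<in> ?Q" for i j k x
    unfolding K_def c_def L_def
    using smooth_integral_has_partial[OF \<omega>[OF that(1,2)] continuous_on_id that(3,4)] by simp
  have plam: "has_partial k (lam j) (K k j x + (\<Sum>i<d. (x i - p i) * L k i j x)) x"
    if "j < d" "k < d" "x \<in> ?Q" for j k x
  proof -
    have "has_partial k (lam j)
        (\<Sum>i<d. ((if k = i then 1 else 0) + 0) * K i j x + (x i + - p i) * L k i j x) x"
      unfolding lam_def using that
      by (intro has_partial_sum has_partial_mult has_partial_add has_partial_coord has_partial_const pK) auto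
    moreover have "(\<Sum>i<d. ((if k = i then 1 else 0) + 0) * K i j x + (x i + - p i) * L k i j x) =
        K k j x + (\<Sum>i<d. (x i - p i) * L k i j x)"
      using that(2) by (simp add: sum.distrib if_distrib[of "\<lambda>a. a * _"] cong: if_cong)
    ultimately show ?thesis by simp
  qed
  show thesis
  proof (rule that[of lam])
    show "smooth_real_on d ?Q (lam j)" if "j < d" for j
      unfolding lam_def using that
      by (intro smooth_sum smooth_mult smooth_add smooth_coord smooth_const smK openin_cube) auto
    fix i j x assume i: "i < d" and j: "j < d" and x: "x \<in> ?Q"
    have cin: "c t x \<in> ?Q" if "t \<in> {0..1}" for t
      unfolding c_def using maps[OF x that] .
    have skewD: "partial_deriv k (\<omega> a b) y = - partial_deriv k (\<omega> b a) y"
      if "a < d" "b < d" "k < d" "y \<in> ?Q" for a b k y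
    proof -
      have "has_partial k (\<lambda>y. - 1 * \<omega> b a y) (0 * \<omega> b a y + - 1 * partial_deriv k (\<omega> b a) y) y"
        by (rule has_partial_mult[OF has_partial_const smooth_has_partial[OF \<omega>[OF that(2,1)] that(4,3)]])
      then have "has_partial k (\<omega> a b) (- partial_deriv k (\<omega> b a) y) y"
        using skew[OF that(1,2)]
        by (subst has_partial_cong[OF openin_cube that(4,3), where g = "\<lambda>y. - 1 * \<omega> b a y"]) auto
      then show ?thesis by (rule partial_deriv_eqI)
    qed
    \<comment> \<open>Closedness for the indices \<open>i\<close>, \<open>l\<close>,
      \<open>j\<close>, put in order by skew-symmetry.\<close>
    have key: "partial_deriv i (\<omega> l j) y - partial_deriv j (\<omega> l i) y = partial_deriv l (\<omega> i j) y"
      if "l < d" "y \<in> ?Q" for l y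
      using closed[OF i that(1) j that(2)] skewD[OF j i that] skewD[OF i that(1) j that(2)] by simp
    have I1: "((\<lambda>t. t * \<omega> a b (c t x)) has_integral K a b x) {0..1}" if "a < d" "b < d" for a b
      unfolding K_def c_def by (intro integrable \<omega> that x continuous_on_id)
    have I2: "((\<lambda>t. (t * t) * partial_deriv k (\<omega> a b) (c t x)) has_integral L k a b x) {0..1}"
      if "a < d" "b < d" "k < d" for a b k
      unfolding L_def c_def
      by (intro integrable smooth_partial_deriv \<omega> that x continuous_on_mult continuous_on_id)
    \<comment> \<open>The same function of \<open>t\<close> is integrated twice: in \<open>A\<close>
      term by term, giving the coefficients of the exterior derivative of \<open>lam\<close>, and in
      \<open>B\<close> as a derivative, giving \<open>\<omega> i j x\<close>.\<close>
    have A: "((\<lambda>t. (t * \<omega> i j (c t x) - t * \<omega> j i (c t x)) +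
        (\<Sum>l<d. (x l - p l) * ((t * t) * partial_deriv i (\<omega> l j) (c t x)
          - (t * t) * partial_deriv j (\<omega> l i) (c t x)))) has_integral
        (K i j x - K j i x) + (\<Sum>l<d. (x l - p l) * (L i l j x - L j l i x))) {0..1}"
      using i j by (intro has_integral_add has_integral_diff has_integral_sum has_integral_mult_right I1 I2) auto
    have B: "((\<lambda>t. (t * \<omega> i j (c t x) - t * \<omega> j i (c t x)) +
        (\<Sum>l<d. (x l - p l) * ((t * t) * partial_deriv i (\<omega> l j) (c t x)
          - (t * t) * partial_deriv j (\<omega> l i) (c t x)))) has_integral
        (1 * 1) * \<omega> i j (c 1 x) - (0 * 0) * \<omega> i j (c 0 x)) {0..1}"
    proof (rule integral_derivative_01)
      fix t :: real assume t: "t \<in> {0..1}"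
      have "((\<lambda>t. \<omega> i j (c t x)) has_field_derivative
          (\<Sum>l<d. partial_deriv l (\<omega> i j) (c t x) * (x l - p l))) (at t)"
      proof (rule smooth_DERIV_curve[where T = ?Q and \<gamma> = "\<lambda>t. c t x" and f = "\<omega> i j"])
        show "smooth_real_on d ?Q (\<omega> i j)" "c t x \<in> ?Q"
          using \<omega>[OF i j] cin[OF t] .
        show "c t x \<in> espace d" for t
          by (simp add: c_def daffine_def espace_iff)
        show "((\<lambda>t. c t x l) has_field_derivative x l - p l) (at t)" if "l < d" for l
          using that by (auto simp: c_def daffine_def intro!: derivative_eq_intros)
      qed
      then have "((\<lambda>t. (t * t) * \<omega> i j (c t x)) has_field_derivative
          (1 * t + 1 * t) * \<omega> i j (c t x) +
          (\<Sum>l<d. partial_deriv l (\<omega> i j) (c t x) * (x l - p l)) * (t * t)) (at t)"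
        by (intro DERIV_mult DERIV_ident)
      moreover have "(1 * t + 1 * t) * \<omega> i j (c t x) +
          (\<Sum>l<d. partial_deriv l (\<omega> i j) (c t x) * (x l - p l)) * (t * t) =
        (t * \<omega> i j (c t x) - t * \<omega> j i (c t x)) +
        (\<Sum>l<d. (x l - p l) * ((t * t) * partial_deriv i (\<omega> l j) (c t x)
          - (t * t) * partial_deriv j (\<omega> l i) (c t x)))"
      proof -
        have summand: "(x l - p l) * ((t * t) * partial_deriv i (\<omega> l j) (c t x)
            - (t * t) * partial_deriv j (\<omega> l i) (c t x)) =
          partial_deriv l (\<omega> i j) (c t x) * (x l - p l) * (t * t)" if "l < d" for l
          unfolding key[OF that cin[OF t], symmetric] by (simp add: algebra_simps)
        have "(\<Sum>l<d. (x l - p l) * ((t * t) * partial_deriv i (\<omega> l j) (c t x)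
            - (t * t) * partial_deriv j (\<omega> l i) (c t x))) =
          (\<Sum>l<d. partial_deriv l (\<omega> i j) (c t x) * (x l - p l)) * (t * t)"
          unfolding sum_distrib_right by (rule sum.cong[OF refl]) (rule summand, simp)
        moreover have "t * \<omega> i j (c t x) - t * \<omega> j i (c t x) = (1 * t + 1 * t) * \<omega> i j (c t x)"
          unfolding skew[OF j i cin[OF t]] by (simp add: algebra_simps)
        ultimately show ?thesis by (simp only:)
      qed
      ultimately show "((\<lambda>t. (t * t) * \<omega> i j (c t x)) has_field_derivative
        (t * \<omega> i j (c t x) - t * \<omega> j i (c t x)) +
        (\<Sum>l<d. (x l - p l) * ((t * t) * partial_deriv i (\<omega> l j) (c t x)
          - (t * t) * partial_deriv j (\<omega> l i) (c t x)))) (at t)"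
        by (simp only:)
    qed
    have "c 1 x = x"
      using x by (auto simp: c_def daffine_def fun_eq_iff cube_def espace_iff)
    then have "\<omega> i j x = (K i j x - K j i x) + (\<Sum>l<d. (x l - p l) * (L i l j x - L j l i x))"
      using has_integral_unique[OF A B] by simp
    then show "\<omega> i j x = partial_deriv i (lam j) x - partial_deriv j (lam i) x"
      using partial_deriv_eqI[OF plam[OF j i x]] partial_deriv_eqI[OF plam[OF i j x]]
      by (simp add: right_diff_distrib sum_subtractf)
  qed
qed

subsection \<open>Inverting a function in its first argument\<close>

definition pt2 :: "real \<Rightarrow> real \<Rightarrow> nat \<Rightarrow> real"
  where "pt2 u v = (\<lambda>i. if i = 0 then u else if i = 1 then v else 0)"

lemma pt2_simps [simp]: "pt2 u v 0 = u" "pt2 u v (Suc 0) = v"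
  by (simp_all add: pt2_def)

lemma pt2_in_cube: "pt2 u v \<in> cube 2 (\<lambda>i. 0) e \<longleftrightarrow> \<bar>u\<bar> < e \<and> \<bar>v\<bar> < e"
  by (auto simp: cube_def espace_iff pt2_def less_2_cases_iff)

lemma cube2_iff:
  "x \<in> cube 2 p e \<longleftrightarrow> x \<in> espace 2 \<and> \<bar>x 0 - p 0\<bar> < e \<and> \<bar>x 1 - p 1\<bar> < e"
  by (auto simp: cube_def less_2_cases_iff)

lemma cube2_pt2: "x \<in> cube 2 (\<lambda>i. 0) e \<Longrightarrow> x = pt2 (x 0) (x 1)"
  by (auto simp: cube_def espace_iff pt2_def fun_eq_iff)

lemma sum_lessThan_2: "(\<Sum>i<2. f i) = f 0 + f (1 :: nat)"
  by (simp add: numeral_2_eq_2)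

text \<open>The solution \<open>s\<close> of \<open>A (s x, x 1) = x 0\<close>, where \<open>A\<close> is a primitive of \<open>a\<close> in the direction of the
  first coordinate.  Its smoothness is bootstrapped from the formulas for its partial derivatives.\<close>

lemma ex_inverse_of_primitive:
  assumes e: "e > 0" and c: "c > 0" and a: "smooth_real_on 2 (cube 2 (\<lambda>i. 0) e) a"
    and ac: "\<And>x. x \<in> cube 2 (\<lambda>i. 0) e \<Longrightarrow> a x \<ge> c"
  obtains r s where "r > 0" "r \<le> e" "smooth_real_on 2 (cube 2 (\<lambda>i. 0) r) s"
    and "\<And>x. x \<in> cube 2 (\<lambda>i. 0) r \<Longrightarrow> \<bar>s x\<bar> < e"
    and "\<And>x. x \<in> cube 2 (\<lambda>i. 0) r \<Longrightarrow> a (pt2 (s x) (x 1)) * partial_deriv 0 s x = 1"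
proof -
  let ?Q = "cube 2 (\<lambda>i. 0) e"
  define \<alpha> where "\<alpha> = (\<lambda>(i :: nat) t. if i = 0 then t else 1 :: real)"
  have \<alpha>0: "\<alpha> 0 t = t" for t
    by (simp add: \<alpha>_def)
  define \<beta> where "\<beta> = (\<lambda>(i :: nat) (t :: real). 0 :: real)"
  have dpt: "daffine 2 \<alpha> \<beta> t y = pt2 (t * y 0) (y 1)" for t y
    by (auto simp: daffine_def \<alpha>_def \<beta>_def pt2_def fun_eq_iff less_2_cases_iff)
  interpret daffine_family 2 ?Q ?Q \<alpha> \<beta>
  proof
    show "continuous_on {0..1} (\<alpha> i)" for i
      by (cases "i = 0") (auto simp: \<alpha>_def)
    show "continuous_on {0..1} (\<beta> i)" for i
      by (simp add: \<beta>_def)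
    show "daffine 2 \<alpha> \<beta> t y \<in> ?Q" if "y \<in> ?Q" "t \<in> {0..1}" for y t
    proof -
      have "\<bar>t * y 0\<bar> \<le> \<bar>y 0\<bar>"
        using that(2) by (simp add: abs_mult mult_left_le_one_le)
      moreover have "\<bar>y 0\<bar> < e" "\<bar>y 1\<bar> < e"
        using that(1) by (auto simp: cube_def)
      ultimately show ?thesis
        unfolding dpt pt2_in_cube by simp
    qed
  qed (rule openin_cube)+
  \<comment> \<open>\<open>A\<close> is the primitive of \<open>a\<close> in the first coordinate
    that vanishes at \<open>0\<close>, with the integral from \<open>0\<close> to \<open>y 0\<close>
    rescaled to \<open>[0, 1]\<close>. In this form \<open>smooth_integral\<close> gives its
    smoothness.\<close>
  define I where "I = (\<lambda>y :: nat \<Rightarrow> real. integral {0..1} (\<lambda>t. 1 * a (pt2 (t * y 0) (y 1))))"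
  define A where "A = (\<lambda>y. y 0 * I y)"
  have smI: "smooth_real_on 2 ?Q I"
    using smooth_integral[OF a continuous_on_const, of 1] by (simp add: I_def dpt)
  have smA: "smooth_real_on 2 ?Q A"
    unfolding A_def by (intro smooth_mult smooth_coord smI openin_cube)
  have pA: "has_partial 0 A (a x) x" if x: "x \<in> ?Q" for x
  proof -
    have "has_partial 0 I (integral {0..1} (\<lambda>t. t * partial_deriv 0 a (pt2 (t * x 0) (x 1)))) x"
      using smooth_integral_has_partial[OF a continuous_on_const[of _ 1], of 0 x] x
      by (simp add: I_def dpt \<alpha>0)
    from has_partial_mult[OF has_partial_coord[of 0 0] this]
    have 1: "has_partial 0 A
        (I x + x 0 * integral {0..1} (\<lambda>t. t * partial_deriv 0 a (pt2 (t * x 0) (x 1)))) x"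
      by (simp add: A_def)
    \<comment> \<open>The integrand is the \<open>t\<close>-derivative of
      \<open>t * a (pt2 (t * x 0) (x 1))\<close>; comparing \<open>2\<close> with \<open>3\<close>
      identifies the partial derivative of \<open>A\<close> as \<open>a\<close>.\<close>
    have 2: "((\<lambda>t. 1 * a (pt2 (t * x 0) (x 1)) + x 0 * (t * partial_deriv 0 a (pt2 (t * x 0) (x 1))))
        has_integral (I x + x 0 * integral {0..1} (\<lambda>t. t * partial_deriv 0 a (pt2 (t * x 0) (x 1))))) {0..1}"
      using integrable[OF a continuous_on_const[of _ 1] x]
        integrable[OF smooth_partial_deriv[OF a, of 0] continuous_on_id x]
      by (intro has_integral_add has_integral_mult_right) (simp_all add: I_def dpt)
    have 3: "((\<lambda>t. 1 * a (pt2 (t * x 0) (x 1)) + x 0 * (t * partial_deriv 0 a (pt2 (t * x 0) (x 1))))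
        has_integral (1 * a (pt2 (1 * x 0) (x 1)) - 0 * a (pt2 (0 * x 0) (x 1)))) {0..1}"
    proof (rule integral_derivative_01)
      fix t :: real assume t: "t \<in> {0..1}"
      have "((\<lambda>t. a (pt2 (t * x 0) (x 1))) has_field_derivative
          (\<Sum>l<2. partial_deriv l a (pt2 (t * x 0) (x 1)) * (if l = 0 then x 0 else 0))) (at t)"
      proof (rule smooth_DERIV_curve[where T = ?Q and f = a and \<gamma> = "\<lambda>t. pt2 (t * x 0) (x 1)"])
        show "pt2 (t * x 0) (x 1) \<in> ?Q"
          using maps[OF x t] by (simp add: dpt)
        show "pt2 (t * x 0) (x 1) \<in> espace 2" for t
          by (simp add: espace_iff pt2_def)
        show "((\<lambda>t. pt2 (t * x 0) (x 1) l) has_field_derivative (if l = 0 then x 0 else 0)) (at t)"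
          if "l < 2" for l
          using that by (auto simp: less_2_cases_iff intro!: derivative_eq_intros)
      qed (rule a)
      then have "((\<lambda>t. a (pt2 (t * x 0) (x 1))) has_field_derivative
          partial_deriv 0 a (pt2 (t * x 0) (x 1)) * x 0) (at t)"
        by (simp add: sum_lessThan_2)
      from DERIV_mult[OF DERIV_ident this]
      show "((\<lambda>t. t * a (pt2 (t * x 0) (x 1))) has_field_derivative
          1 * a (pt2 (t * x 0) (x 1)) + x 0 * (t * partial_deriv 0 a (pt2 (t * x 0) (x 1)))) (at t)"
        by (simp add: mult_ac)
    qed
    have "pt2 (1 * x 0) (x 1) = x"
      using cube2_pt2[OF x] by simp
    then have "I x + x 0 * integral {0..1} (\<lambda>t. t * partial_deriv 0 a (pt2 (t * x 0) (x 1))) = a x"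
      using has_integral_unique[OF 2 3] by simp
    then show ?thesis
      using 1 by simp
  qed
  \<comment> \<open>As \<open>a\<close> is bounded below by \<open>c\<close>, \<open>A\<close> grows
    in its first argument at least at rate \<open>c\<close>. This gives solvability by the
    intermediate value theorem and, through \<open>lower_abs\<close>, continuity of the
    solution.\<close>
  have lower: "c * (u' - u) \<le> A (pt2 u' v) - A (pt2 u v)"
    if "u \<le> u'" "\<bar>u\<bar> < e" "\<bar>u'\<bar> < e" "\<bar>v\<bar> < e" for u u' v
  proof (cases "u = u'")
    case False
    have der: "((\<lambda>t. A (pt2 t v)) has_field_derivative a (pt2 t v)) (at t)" if "u \<le> t" "t \<le> u'" for t
    proof -
      have "pt2 t v \<in> ?Q"
        unfolding pt2_in_cube using that \<open>\<bar>u\<bar> < e\<close> \<open>\<bar>u'\<bar> < e\<close> \<open>\<bar>v\<bar> < e\<close> by auto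
      moreover have "(pt2 t v)(0 := r) = pt2 r v" for r
        by (auto simp: pt2_def)
      ultimately show ?thesis
        using pA[of "pt2 t v"] by (simp add: has_partial_def)
    qed
    then obtain t where t: "u < t" "t < u'" "A (pt2 u' v) - A (pt2 u v) = (u' - u) * a (pt2 t v)"
      using MVT2[of u u' "\<lambda>t. A (pt2 t v)" "\<lambda>t. a (pt2 t v)"] False \<open>u \<le> u'\<close> by auto
    have "pt2 t v \<in> ?Q"
      unfolding pt2_in_cube using t that by auto
    then have "(u' - u) * c \<le> (u' - u) * a (pt2 t v)"
      using ac that by (intro mult_left_mono) auto
    then show ?thesis
      using t by (simp add: mult.commute)
  qed simp
  have lower_abs: "c * \<bar>u' - u\<bar> \<le> \<bar>A (pt2 u' v) - A (pt2 u v)\<bar>"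
    if "\<bar>u\<bar> < e" "\<bar>u'\<bar> < e" "\<bar>v\<bar> < e" for u u' v
    using lower[of u u' v] lower[of u' u v] that by (cases "u \<le> u'") (auto simp: abs_if)
  \<comment> \<open>At \<open>u = e / 2\<close> and \<open>u = - (e / 2)\<close> the primitive is at
    least \<open>c * e / 2\<close> and at most \<open>- (c * e / 2)\<close>, so every smaller
    \<open>x 0\<close> is attained in between; \<open>r \<le> e\<close> keeps \<open>x 1\<close> in
    range.\<close>
  define r where "r = min e (c * e / 2)"
  let ?P = "cube 2 (\<lambda>i. 0) r"
  have r: "r > 0" "r \<le> e"
    using e c by (auto simp: r_def)
  have contA: "continuous_on ?Q A"
    by (rule smooth_continuous[OF smA])
  have ex: "\<exists>u. \<bar>u\<bar> < e \<and> A (pt2 u (x 1)) = x 0" if x: "x \<in> ?P" for x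
  proof -
    have x01: "\<bar>x 0\<bar> < c * e / 2" "\<bar>x 1\<bar> < e"
      using x by (auto simp: cube2_iff r_def)
    have A0: "A (pt2 0 (x 1)) = 0"
      by (simp add: A_def)
    have "c * (e / 2) \<le> A (pt2 (e / 2) (x 1))" "c * (e / 2) \<le> - A (pt2 (- (e / 2)) (x 1))"
      using lower[of 0 "e / 2" "x 1"] lower[of "- (e / 2)" 0 "x 1"] e x01 A0 by auto
    moreover have "continuous_on {- (e / 2)..e / 2} (\<lambda>u. A (pt2 u (x 1)))"
      by (rule continuous_on_compose_coords[OF openin_subset[OF openin_cube] contA, where h = "\<lambda>u. pt2 u (x 1)"])
        (use x01 e in \<open>auto simp: pt2_in_cube less_2_cases_iff intro!: continuous_intros\<close>)
    moreover have "A (pt2 (- (e / 2)) (x 1)) \<le> x 0" "x 0 \<le> A (pt2 (e / 2) (x 1))"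
      using calculation(1,2) x01(1) by (auto simp: abs_less_iff)
    ultimately obtain u where "- (e / 2) \<le> u" "u \<le> e / 2" "A (pt2 u (x 1)) = x 0"
      using IVT'[of "\<lambda>u. A (pt2 u (x 1))" "- (e / 2)" "x 0" "e / 2"] e by auto
    then show ?thesis
      using e by (intro exI[of _ u]) auto
  qed
  define s where "s = (\<lambda>x :: nat \<Rightarrow> real. SOME u. \<bar>u\<bar> < e \<and> A (pt2 u (x 1)) = x 0)"
  have s: "\<bar>s x\<bar> < e" "A (pt2 (s x) (x 1)) = x 0" if "x \<in> ?P" for x
    using someI_ex[OF ex[OF that]] by (auto simp: s_def)
  have zQ: "pt2 (s x) (x 1) \<in> ?Q" if "x \<in> ?P" for x
    unfolding pt2_in_cube using s(1)[OF that] that r by (auto simp: cube2_iff)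
  have conts: "continuous_on ?P s"
    unfolding continuous_on_cube_iff[OF openin_subset[OF openin_cube]]
  proof (intro ballI allI impI)
    fix x and h :: real assume x: "x \<in> ?P" and h: "h > 0"
    let ?z = "pt2 (s x) (x 1)"
    have "c * h / 2 > 0"
      using c h by simp
    then obtain k where k: "k > 0" "\<And>y. y \<in> ?Q \<inter> cube 2 ?z k \<Longrightarrow> \<bar>A y - A ?z\<bar> < c * h / 2"
      using contA zQ[OF x] unfolding continuous_on_cube_iff[OF openin_subset[OF openin_cube]] by meson
    show "\<exists>k>0. \<forall>y\<in>?P \<inter> cube 2 x k. \<bar>s y - s x\<bar> < h"
    proof (intro exI[of _ "min k (c * h / 2)"] conjI ballI)
      fix y assume y: "y \<in> ?P \<inter> cube 2 x (min k (c * h / 2))"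
      have bd: "\<bar>y 1\<bar> < e" "\<bar>y 1 - x 1\<bar> < k" "\<bar>y 0 - x 0\<bar> < c * h / 2"
        using y r by (auto simp: cube2_iff)
      have "pt2 (s x) (y 1) \<in> ?Q \<inter> cube 2 ?z k"
        using bd s(1)[OF x] k(1) pt2_in_cube[of "s x" "y 1" e]
        by (auto simp: cube_def espace_iff less_2_cases_iff)
      then have "\<bar>A (pt2 (s x) (y 1)) - x 0\<bar> < c * h / 2"
        using k(2) s(2)[OF x] by simp
      \<comment> \<open>Both solutions are compared on the line with second coordinate
        \<open>y 1\<close>, where \<open>lower_abs\<close> applies; moving \<open>x 1\<close> to
        \<open>y 1\<close> is covered by the continuity of \<open>A\<close>.\<close>
      moreover have "c * \<bar>s y - s x\<bar> \<le> \<bar>y 0 - A (pt2 (s x) (y 1))\<bar>"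
        using lower_abs[of "s x" "s y" "y 1"] s[of y] s(1)[OF x] bd y by simp
      ultimately have "c * \<bar>s y - s x\<bar> < c * h"
        using bd by linarith
      then show "\<bar>s y - s x\<bar> < h"
        using c by simp
    qed (use k c h in auto)
  qed
  \<comment> \<open>Implicit differentiation of \<open>A (pt2 (s x) (x 1)) = x 0\<close>: the
    partial derivatives of \<open>s\<close> are \<open>1 / a\<close> and
    \<open>- partial_deriv 1 A / a\<close>, taken at \<open>pt2 (s x) (x 1)\<close>.\<close>
  define F where "F = (\<lambda>(i :: nat) z. (if i = 0 then 1 else - partial_deriv 1 A z) * inverse (a z))"
  have ps: "has_partial i s (F i (pt2 (s x) (x 1))) x" if i: "i < 2" and x: "x \<in> ?P" for i x
  proof -
    let ?t0 = "x i" and ?\<sigma> = "\<lambda>t. s (x(i := t))"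
    define \<gamma> where "\<gamma> = (\<lambda>t. pt2 (?\<sigma> t) ((x(i := t)) 1))"
    obtain k where k: "k > 0" "\<And>t. \<bar>t - x i\<bar> < k \<Longrightarrow> x(i := t) \<in> ?P"
      using eventually_upd_in[OF openin_cube x i] by metis
    have "continuous_on (ball ?t0 k) ?\<sigma>"
    proof (rule continuous_on_compose_coords[OF openin_subset[OF openin_cube] conts, where h = "\<lambda>t. x(i := t)"])
      show "x(i := t) \<in> ?P" if "t \<in> ball ?t0 k" for t
        using k(2)[of t] that by (simp add: dist_real_def abs_minus_commute)
      show "continuous_on (ball ?t0 k) (\<lambda>t. (x(i := t)) l)" for l
        by (cases "l = i") (auto intro!: continuous_intros)
    qed
    then have cs: "isCont ?\<sigma> ?t0"
      using k(1) by (simp add: continuous_on_eq_continuous_at)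
    have \<gamma>0: "\<gamma> ?t0 = pt2 (s x) (x 1)"
      by (simp add: \<gamma>_def)
    \<comment> \<open>So far \<open>s\<close> is only known to be continuous. The exact increments
      of \<open>A\<close> along \<open>\<gamma>\<close> can be solved for the difference quotient of
      \<open>s\<close>, since \<open>E 0\<close> tends to \<open>a \<noteq> 0\<close>.\<close>
    obtain E where E: "\<forall>\<^sub>F t in at ?t0. A (\<gamma> t) - A (\<gamma> ?t0) = (\<Sum>l<2. E l t * (\<gamma> t l - \<gamma> ?t0 l))"
      "\<And>l. l < 2 \<Longrightarrow> (E l \<longlongrightarrow> partial_deriv l A (\<gamma> ?t0)) (at ?t0)"
    proof (rule increment_along_curve[where \<gamma> = \<gamma> and ?t0.0 = ?t0 and T = ?Q and f = A
          and g = "\<lambda>l. partial_deriv l A" and m = 2])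
      show "\<gamma> ?t0 \<in> ?Q"
        using zQ[OF x] by (simp add: \<gamma>0)
      show "has_partial l A (partial_deriv l A y) y" if "y \<in> ?Q" "l < 2" for y l
        by (rule smooth_has_partial[OF smA that])
      show "continuous_on ?Q (partial_deriv l A)" if "l < 2" for l
        by (rule smooth_continuous[OF smooth_partial_deriv[OF smA that]])
      show "\<forall>\<^sub>F t in at ?t0. \<gamma> t \<in> espace 2"
        by (simp add: \<gamma>_def espace_iff pt2_def)
      show "isCont (\<lambda>t. \<gamma> t l) ?t0" if "l < 2" for l
      proof -
        have "isCont (\<lambda>t. (x(i := t)) 1) ?t0"
          by (cases "i = 1") auto
        then show ?thesis
          using that cs by (auto simp: \<gamma>_def less_2_cases_iff)
      qed
    qed (auto simp: openin_cube)
    have p0: "partial_deriv 0 A (\<gamma> ?t0) = a (\<gamma> ?t0)"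
      using pA[OF zQ[OF x]] by (simp add: \<gamma>0 partial_deriv_eqI)
    have a0: "a (\<gamma> ?t0) \<noteq> 0"
      using ac[OF zQ[OF x]] c by (simp add: \<gamma>0)
    have near: "\<forall>\<^sub>F t in at ?t0. x(i := t) \<in> ?P"
      unfolding eventually_at using k by (auto simp: dist_real_def)
    have "\<forall>\<^sub>F t in at ?t0. E 0 t \<noteq> 0"
      using tendsto_imp_eventually_ne[OF E(2)[of 0]] p0 a0 by simp
    then have "\<forall>\<^sub>F t in at ?t0.
      ((if i = 0 then 1 else 0) - E 1 t * (if i = 1 then 1 else 0)) / E 0 t = (?\<sigma> t - ?\<sigma> ?t0) / (t - ?t0)"
      using E(1) near eventually_neq_at_within[of ?t0 ?t0 UNIV]
    proof eventually_elim
      case (elim t)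
      have "A (\<gamma> t) = (x(i := t)) 0" "A (\<gamma> ?t0) = x 0"
        using s(2)[OF elim(3)] s(2)[OF x] by (simp_all only: \<gamma>_def fun_upd_triv)
      then have "(x(i := t)) 0 - x 0 = E 0 t * (?\<sigma> t - ?\<sigma> ?t0) + E 1 t * ((x(i := t)) 1 - x 1)"
        using elim(2) by (simp add: sum_lessThan_2 \<gamma>_def)
      moreover have "(x(i := t)) 0 - x 0 = (if i = 0 then 1 else 0) * (t - ?t0)"
        "(x(i := t)) 1 - x 1 = (if i = 1 then 1 else 0) * (t - ?t0)"
        by auto
      ultimately show ?case
        using elim(1,4) by (simp add: field_simps split: if_splits)
    qed
    moreover have "((\<lambda>t. ((if i = 0 then 1 else 0) - E 1 t * (if i = 1 then 1 else 0)) / E 0 t) \<longlongrightarrow>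
        ((if i = 0 then 1 else 0) - partial_deriv 1 A (\<gamma> ?t0) * (if i = 1 then 1 else 0)) / a (\<gamma> ?t0)) (at ?t0)"
      using E(2)[of 0] E(2)[of 1] a0 by (intro tendsto_intros) (auto simp: p0)
    ultimately have "((\<lambda>t. (?\<sigma> t - ?\<sigma> ?t0) / (t - ?t0)) \<longlongrightarrow>
        ((if i = 0 then 1 else 0) - partial_deriv 1 A (\<gamma> ?t0) * (if i = 1 then 1 else 0)) / a (\<gamma> ?t0)) (at ?t0)"
      by (rule Lim_transform_eventually[rotated])
    moreover have "((if i = 0 then 1 else 0) - partial_deriv 1 A (\<gamma> ?t0) * (if i = 1 then 1 else 0)) / a (\<gamma> ?t0)
        = F i (pt2 (s x) (x 1))"
      using i by (auto simp: F_def \<gamma>0 less_2_cases_iff field_simps)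
    ultimately show ?thesis
      by (simp add: has_partial_def has_field_derivative_iff)
  qed
  have smF: "smooth_real_on 2 ?Q (F i)" for i
  proof -
    have inv: "smooth_real_on 2 ?Q (\<lambda>z. inverse (a z))"
    proof (rule smooth_CkI[OF openin_cube])
      have "a z \<noteq> 0" if "z \<in> ?Q" for z
        using ac[OF that] c by auto
      then show "Ck 2 k ?Q (\<lambda>z. inverse (a z))" for k
        by (rule Ck_inverse[OF openin_cube smooth_Ck[OF a]])
    qed
    show ?thesis
    proof (cases "i = 0")
      case True
      then show ?thesis
        using inv by (simp add: F_def)
    next
      case False
      then show ?thesis
        using smooth_mult[OF smooth_minus[OF smooth_partial_deriv[OF smA, of 1]] inv]
        by (simp add: F_def)
    qed
  qed
  have "Ck 2 k ?P s" for k
  proof (induction k)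
    case 0
    then show ?case using conts by simp
  next
    case (Suc k)
    show ?case
    proof (rule Ck_SucI[OF openin_cube conts])
      show "has_partial i s (F i (pt2 (s x) (x 1))) x" if "i < 2" "x \<in> ?P" for i x
        by (rule ps[OF that])
      show "Ck 2 k ?P (\<lambda>x. F i (pt2 (s x) (x 1)))" for i
      proof (rule Ck_compose[OF openin_cube openin_cube zQ smooth_Ck[OF smF]])
        show "Ck 2 k ?P (\<lambda>x. pt2 (s x) (x 1) l)" if "l < 2" for l
          using that Suc Ck_coord[OF openin_cube, of 2 k "\<lambda>i. 0" r 1]
          by (cases "l = 0") (simp_all add: less_2_cases_iff)
      qed
    qed
  qed
  then have sms: "smooth_real_on 2 ?P s"
    by (intro smooth_CkI openin_cube)
  show thesis
  proof (rule that[OF r sms s(1)])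
    show "a (pt2 (s x) (x 1)) * partial_deriv 0 s x = 1" if x: "x \<in> ?P" for x
    proof -
      have "a (pt2 (s x) (x 1)) \<noteq> 0"
        using ac[OF zQ[OF x]] c by auto
      then show ?thesis
        using partial_deriv_eqI[OF ps[OF _ x, of 0]] by (simp add: F_def)
    qed
  qed
qed

section \<open>Smooth maps\<close>

lemma smooth_cong_imp:
  "smooth_real_on d S f \<Longrightarrow> (\<And>x. x \<in> S \<Longrightarrow> f x = g x) \<Longrightarrow> smooth_real_on d S g"
  using smooth_cong[of S f g d] by blast

subsection \<open>Charts\<close>

text \<open>The chart conditions of \<open>smooth_manifold\<close>, separated out because they pass
  to products and powers chart by chart.\<close>

definition smooth_atlas :: "('p, 'b) manifold_scheme \<Rightarrow> bool"
  where "smooth_atlas M \<longleftrightarrow>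
    \<Union>(fst ` atlas M) = topspace (mtop M) \<and>
    (\<forall>(V, \<phi>)\<in>atlas M.
      openin (mtop M) V \<and> openin (Euclidean_space (mdim M)) (\<phi> ` V) \<and>
      homeomorphic_map (subtopology (mtop M) V)
        (subtopology (Euclidean_space (mdim M)) (\<phi> ` V)) \<phi>) \<and>
    (\<forall>(V, \<phi>)\<in>atlas M. \<forall>(W, \<psi>)\<in>atlas M. \<forall>i<mdim M.
      smooth_real_on (mdim M) (\<phi> ` (V \<inter> W)) (\<lambda>x. \<psi> (inv_into V \<phi> x) i))"

lemma smooth_manifold_imp_atlas: "smooth_manifold M \<Longrightarrow> smooth_atlas M"
  unfolding smooth_manifold_def smooth_atlas_def by (elim conjE) (intro conjI)

lemma chart_cover:
  assumes "smooth_atlas M" "p \<in> topspace (mtop M)"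
  obtains V \<phi> where "(V, \<phi>) \<in> atlas M" "p \<in> V"
proof -
  have "p \<in> \<Union>(fst ` atlas M)"
    using assms by (simp add: smooth_atlas_def)
  then show thesis
    using that by auto
qed

lemma continuous_map_into_Euclidean:
  assumes "\<And>x. x \<in> topspace X \<Longrightarrow> h x \<in> espace n"
    and "\<And>i. i < n \<Longrightarrow> continuous_map X euclideanreal (\<lambda>x. h x i)"
  shows "continuous_map X (Euclidean_space n) h"
proof (rule continuous_map_eq)
  show "continuous_map X (Euclidean_space n) (\<lambda>x i. if i < n then h x i else 0)"
    unfolding continuous_map_componentwise_Euclidean_space using assms(2) by blast
qed (use assms(1) in \<open>auto simp: espace_iff fun_eq_iff\<close>)

lemma continuous_map_Euclidean_coord: "continuous_map (Euclidean_space n) euclideanreal (\<lambda>x. x i)"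
  unfolding Euclidean_space_def
  by (intro continuous_map_from_subtopology) (metis UNIV_I continuous_map_product_coordinates)

locale chart =
  fixes M :: "('p, 'b) manifold_scheme" and V :: "'p set" and \<phi> :: "'p \<Rightarrow> nat \<Rightarrow> real"
  assumes M: "smooth_atlas M" and in_atlas: "(V, \<phi>) \<in> atlas M"
begin

abbreviation "d \<equiv> mdim M"

lemma chart_open: "openin (mtop M) V"
  using M in_atlas by (fastforce simp: smooth_atlas_def)

lemma chart_image_open: "openin (Euclidean_space d) (\<phi> ` V)"
  using M in_atlas by (fastforce simp: smooth_atlas_def)

lemma chart_homeo:
  "homeomorphic_map (subtopology (mtop M) V) (subtopology (Euclidean_space d) (\<phi> ` V)) \<phi>"
  using M in_atlas by (fastforce simp: smooth_atlas_def)

lemma chart_subset: "V \<subseteq> topspace (mtop M)"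
  using chart_open openin_subset by blast

lemma topspace_chart: "topspace (subtopology (mtop M) V) = V"
  using chart_subset by auto

lemma chart_inj: "inj_on \<phi> V"
  using homeomorphic_imp_injective_map[OF chart_homeo] by (simp only: topspace_chart)

lemma chart_inv: "p \<in> V \<Longrightarrow> inv_into V \<phi> (\<phi> p) = p"
  using chart_inj by simp

lemma chart_espace: "p \<in> V \<Longrightarrow> \<phi> p \<in> espace d"
  using chart_image_open openin_subset by blast

lemma chart_image:
  assumes "openin (mtop M) W" "W \<subseteq> V"
  shows "openin (Euclidean_space d) (\<phi> ` W)"
proof -
  have "openin (subtopology (mtop M) V) W"
    using assms by (simp add: openin_subset_topspace_eq openin_open_subtopology chart_open)
  then have "openin (subtopology (Euclidean_space d) (\<phi> ` V)) (\<phi> ` W)"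
    using homeomorphic_imp_open_map[OF chart_homeo] by (simp add: open_map_def)
  then show ?thesis
    using chart_image_open openin_trans_full by blast
qed

lemma chart_preimage:
  assumes "openin (Euclidean_space d) S"
  shows "openin (mtop M) {p \<in> V. \<phi> p \<in> S}"
proof -
  have "continuous_map (subtopology (mtop M) V) (Euclidean_space d) \<phi>"
    using homeomorphic_imp_continuous_map[OF chart_homeo] continuous_map_in_subtopology by blast
  from openin_continuous_map_preimage[OF this assms]
  have "openin (subtopology (mtop M) V) {p \<in> V. \<phi> p \<in> S}"
    by (simp only: topspace_chart)
  then show ?thesis
    using chart_open openin_trans_full by blast
qed

lemma continuous_chart_inv:
  "continuous_map (subtopology (Euclidean_space d) (\<phi> ` V)) (mtop M) (inv_into V \<phi>)"
proof -
  obtain g where g: "homeomorphic_maps (subtopology (mtop M) V)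
      (subtopology (Euclidean_space d) (\<phi> ` V)) \<phi> g"
    using chart_homeo homeomorphic_map_maps by blast
  have "continuous_map (subtopology (Euclidean_space d) (\<phi> ` V)) (mtop M) g"
    using g continuous_map_in_subtopology unfolding homeomorphic_maps_def by blast
  moreover have "g x = inv_into V \<phi> x" if "x \<in> \<phi> ` V" for x
    using that g chart_inv chart_subset unfolding homeomorphic_maps_def by auto
  ultimately show ?thesis
    by (rule continuous_map_eq) auto
qed

lemma smooth_transition:
  assumes "(W, \<psi>) \<in> atlas M" "i < d"
  shows "smooth_real_on d (\<phi> ` (V \<inter> W)) (\<lambda>x. \<psi> (inv_into V \<phi> x) i)"
proof -
  have "\<forall>c\<in>atlas M. \<forall>e\<in>atlas M. \<forall>i<d.
      smooth_real_on d (snd c ` (fst c \<inter> fst e)) (\<lambda>x. snd e (inv_into (fst c) (snd c) x) i)"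
    using M by (simp add: smooth_atlas_def case_prod_beta)
  from this[rule_format, OF in_atlas assms] show ?thesis by simp
qed

end

subsection \<open>Smooth functions on manifolds\<close>

lemma smooth_fun_on_open: "smooth_fun_on M U g \<Longrightarrow> openin (mtop M) U"
  by (simp add: smooth_fun_on_def)

lemma smooth_fun_onD:
  "smooth_fun_on M U g \<Longrightarrow> (V, \<phi>) \<in> atlas M \<Longrightarrow>
    smooth_real_on (mdim M) (\<phi> ` (U \<inter> V)) (\<lambda>x. g (inv_into V \<phi> x))"
  by (auto simp: smooth_fun_on_def)

text \<open>The definition tests every chart; smooth transition maps reduce this to one chart around
  each point.\<close>

lemma smooth_fun_onI:
  assumes "smooth_atlas M" "openin (mtop M) U"
    and "\<And>p. p \<in> U \<Longrightarrow> \<exists>V \<phi> S. (V, \<phi>) \<in> atlas M \<and> p \<in> V \<and> \<phi> p \<in> S \<and>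
      smooth_real_on (mdim M) S (\<lambda>x. g (inv_into V \<phi> x))"
  shows "smooth_fun_on M U g"
  unfolding smooth_fun_on_def
proof (intro conjI ballI assms(2), clarify)
  fix W \<psi> assume W: "(W, \<psi>) \<in> atlas M"
  interpret W: chart M W \<psi> using assms(1) W by unfold_locales
  show "smooth_real_on (mdim M) (\<psi> ` (U \<inter> W)) (\<lambda>x. g (inv_into W \<psi> x))"
  proof (rule smooth_local)
    fix x assume "x \<in> \<psi> ` (U \<inter> W)"
    then obtain p where p: "p \<in> U" "p \<in> W" "x = \<psi> p" by auto
    obtain V \<phi> S where V: "(V, \<phi>) \<in> atlas M" "p \<in> V" "\<phi> p \<in> S"
      "smooth_real_on (mdim M) S (\<lambda>x. g (inv_into V \<phi> x))"
      using assms(3)[OF p(1)] by blast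
    interpret V: chart M V \<phi> using assms(1) V by unfold_locales
    define O' where "O' = U \<inter> W \<inter> {q \<in> V. \<phi> q \<in> S}"
    have O: "openin (mtop M) O'"
      unfolding O'_def using assms(2) W.chart_open V.chart_preimage[OF smooth_real_on_open[OF V(4)]]
      by (intro openin_Int)
    have im: "openin (Euclidean_space (mdim M)) (\<psi> ` O')"
      using O by (rule W.chart_image) (auto simp: O'_def)
    have "smooth_real_on (mdim M) (\<psi> ` O') (\<lambda>y. (\<lambda>x. g (inv_into V \<phi> x)) (\<phi> (inv_into W \<psi> y)))"
    proof (rule smooth_compose[OF V(4) im])
      show "\<phi> (inv_into W \<psi> y) \<in> S" if "y \<in> \<psi> ` O'" for y
        using that by (auto simp: O'_def W.chart_inv)
      show "smooth_real_on (mdim M) (\<psi> ` O') (\<lambda>y. \<phi> (inv_into W \<psi> y) l)" if "l < mdim M" for l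
        using W.smooth_transition[OF V(1) that] by (rule smooth_subset) (use im in \<open>auto simp: O'_def\<close>)
    qed
    then have "smooth_real_on (mdim M) (\<psi> ` O') (\<lambda>y. g (inv_into W \<psi> y))"
      by (rule smooth_cong_imp) (auto simp: O'_def W.chart_inv V.chart_inv)
    moreover have "x \<in> \<psi> ` O'" "\<psi> ` O' \<subseteq> \<psi> ` (U \<inter> W)"
      using p V by (auto simp: O'_def)
    ultimately show "\<exists>T. x \<in> T \<and> T \<subseteq> \<psi> ` (U \<inter> W) \<and> smooth_real_on (mdim M) T (\<lambda>x. g (inv_into W \<psi> x))"
      by (intro exI[of _ "\<psi> ` O'"] conjI)
  qed
qed

lemma smooth_fun_subset:
  assumes "smooth_atlas M" "smooth_fun_on M U g" "W \<subseteq> U" "openin (mtop M) W"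
  shows "smooth_fun_on M W g"
proof (rule smooth_fun_onI[OF assms(1,4)])
  fix p assume p: "p \<in> W"
  obtain V \<phi> where "(V, \<phi>) \<in> atlas M" "p \<in> V"
    using chart_cover[OF assms(1)] assms(4) p openin_subset by blast
  then show "\<exists>V \<phi> S. (V, \<phi>) \<in> atlas M \<and> p \<in> V \<and> \<phi> p \<in> S \<and>
      smooth_real_on (mdim M) S (\<lambda>x. g (inv_into V \<phi> x))"
    using smooth_fun_onD[OF assms(2)] p assms(3)
    by (intro exI[of _ V] exI[of _ \<phi>] exI[of _ "\<phi> ` (U \<inter> V)"]) auto
qed

lemma smooth_fun_local:
  assumes "smooth_atlas M"
    and "\<And>p. p \<in> U \<Longrightarrow> \<exists>W. p \<in> W \<and> W \<subseteq> U \<and> smooth_fun_on M W g"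
  shows "smooth_fun_on M U g"
proof (rule smooth_fun_onI[OF assms(1)])
  show "openin (mtop M) U"
    by (subst openin_subopen) (meson assms(2) smooth_fun_on_open)
  fix p assume "p \<in> U"
  then obtain W where W: "p \<in> W" "smooth_fun_on M W g"
    using assms(2) by blast
  obtain V \<phi> where "(V, \<phi>) \<in> atlas M" "p \<in> V"
    using chart_cover[OF assms(1)] smooth_fun_on_open[OF W(2)] W(1) openin_subset by blast
  then show "\<exists>V \<phi> S. (V, \<phi>) \<in> atlas M \<and> p \<in> V \<and> \<phi> p \<in> S \<and>
      smooth_real_on (mdim M) S (\<lambda>x. g (inv_into V \<phi> x))"
    using smooth_fun_onD[OF W(2)] W(1)
    by (intro exI[of _ V] exI[of _ \<phi>] exI[of _ "\<phi> ` (W \<inter> V)"]) auto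
qed

lemma smooth_fun_cong:
  assumes "smooth_atlas M" "smooth_fun_on M U f" "\<And>p. p \<in> U \<Longrightarrow> f p = g p"
  shows "smooth_fun_on M U g"
  unfolding smooth_fun_on_def
proof (intro conjI ballI smooth_fun_on_open[OF assms(2)], clarify)
  fix V \<phi> assume V: "(V, \<phi>) \<in> atlas M"
  interpret chart M V \<phi> using assms(1) V by unfold_locales
  show "smooth_real_on (mdim M) (\<phi> ` (U \<inter> V)) (\<lambda>x. g (inv_into V \<phi> x))"
    by (rule smooth_cong_imp[OF smooth_fun_onD[OF assms(2) V]]) (auto simp: chart_inv assms(3))
qed

lemma smooth_fun_compose_real:
  assumes M: "smooth_atlas M" and f: "smooth_real_on m T f"
    and U: "openin (mtop M) U" "\<And>p. p \<in> U \<Longrightarrow> h p \<in> T"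
    and h: "\<And>l. l < m \<Longrightarrow> smooth_fun_on M U (\<lambda>p. h p l)"
  shows "smooth_fun_on M U (\<lambda>p. f (h p))"
  unfolding smooth_fun_on_def
proof (intro conjI ballI U(1), clarify)
  fix V \<phi> assume V: "(V, \<phi>) \<in> atlas M"
  interpret chart M V \<phi> using M V by unfold_locales
  show "smooth_real_on (mdim M) (\<phi> ` (U \<inter> V)) (\<lambda>x. f (h (inv_into V \<phi> x)))"
  proof (rule smooth_compose[OF f])
    show "openin (Euclidean_space (mdim M)) (\<phi> ` (U \<inter> V))"
      by (intro chart_image openin_Int U chart_open) auto
    show "h (inv_into V \<phi> y) \<in> T" if "y \<in> \<phi> ` (U \<inter> V)" for y
      using that U(2) by (auto simp: chart_inv)
    show "smooth_real_on (mdim M) (\<phi> ` (U \<inter> V)) (\<lambda>y. h (inv_into V \<phi> y) l)" if "l < m" for l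
      by (rule smooth_fun_onD[OF h[OF that] V])
  qed
qed

text \<open>The constant is treated as a smooth function of no variables.\<close>

lemma smooth_fun_const:
  assumes M: "smooth_atlas M" and U: "openin (mtop M) U"
  shows "smooth_fun_on M U (\<lambda>p. c)"
  using smooth_fun_compose_real[OF M smooth_const[of 0 "espace 0" c] U, of "\<lambda>_ _. 0"]
  by (simp add: espace_iff)

lemma smooth_fun_op2:
  assumes M: "smooth_atlas M" and g: "smooth_fun_on M U g" and h: "smooth_fun_on M U h"
    and f: "smooth_real_on 2 (espace 2) (\<lambda>x. f (x 0) (x (Suc 0)))"
  shows "smooth_fun_on M U (\<lambda>p. f (g p) (h p))"
proof -
  have "smooth_fun_on M U (\<lambda>p. pt2 (g p) (h p) l)" if "l < 2" for l
    using that g h by (cases "l = 0") (simp_all add: less_2_cases_iff)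
  moreover have "pt2 (g p) (h p) \<in> espace 2" for p
    by (simp add: espace_iff pt2_def)
  ultimately show ?thesis
    using smooth_fun_compose_real[OF M f smooth_fun_on_open[OF g], where h = "\<lambda>p. pt2 (g p) (h p)"]
    by simp
qed

lemma smooth_fun_add:
  assumes "smooth_atlas M" "smooth_fun_on M U g" "smooth_fun_on M U h"
  shows "smooth_fun_on M U (\<lambda>p. g p + h p)"
  using assms by (rule smooth_fun_op2) (intro smooth_add smooth_coord openin_topspace)

lemma smooth_fun_mult:
  assumes "smooth_atlas M" "smooth_fun_on M U g" "smooth_fun_on M U h"
  shows "smooth_fun_on M U (\<lambda>p. g p * h p)"
  using assms by (rule smooth_fun_op2) (intro smooth_mult smooth_coord openin_topspace)

context chart
begin

lemma smooth_chart_coord: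
  assumes "i < d"
  shows "smooth_fun_on M V (\<lambda>q. \<phi> q i)"
proof (rule smooth_fun_onI[OF M chart_open])
  fix p assume p: "p \<in> V"
  show "\<exists>V \<phi>' S. (V, \<phi>') \<in> atlas M \<and> p \<in> V \<and> \<phi>' p \<in> S \<and>
      smooth_real_on d S (\<lambda>x. \<phi> (inv_into V \<phi>' x) i)"
    using in_atlas p smooth_transition[OF in_atlas assms]
    by (intro exI[of _ V] exI[of _ \<phi>] exI[of _ "\<phi> ` (V \<inter> V)"]) auto
qed

lemma smooth_fun_in_chart:
  assumes f: "smooth_real_on d S f"
  shows "smooth_fun_on M {q \<in> V. \<phi> q \<in> S} (\<lambda>q. f (\<phi> q))"
proof (rule smooth_fun_compose_real[OF M f])
  show O: "openin (mtop M) {q \<in> V. \<phi> q \<in> S}"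
    by (rule chart_preimage[OF smooth_real_on_open[OF f]])
  show "smooth_fun_on M {q \<in> V. \<phi> q \<in> S} (\<lambda>q. \<phi> q l)" if "l < d" for l
    by (rule smooth_fun_subset[OF M smooth_chart_coord[OF that]]) (use O in auto)
qed auto

end

subsection \<open>Smooth maps\<close>

lemma smooth_map_on_open: "smooth_map_on Y X U f \<Longrightarrow> openin (mtop Y) U"
  by (simp add: smooth_map_on_def)

lemma smooth_map_continuous:
  "smooth_map_on Y X U f \<Longrightarrow> continuous_map (subtopology (mtop Y) U) (mtop X) f"
  by (simp add: smooth_map_on_def)

lemma smooth_map_in_topspace: "smooth_map_on Y X U f \<Longrightarrow> y \<in> U \<Longrightarrow> f y \<in> topspace (mtop X)"
  using smooth_map_continuous[of Y X U f] openin_subset[OF smooth_map_on_open, of Y X U f]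
  by (auto simp: continuous_map_def Pi_iff)

lemma smooth_map_preimage:
  assumes "smooth_map_on Y X U f" "openin (mtop X) V"
  shows "openin (mtop Y) (U \<inter> f -` V)"
proof -
  have "openin (subtopology (mtop Y) U) {y \<in> topspace (subtopology (mtop Y) U). f y \<in> V}"
    by (rule openin_continuous_map_preimage[OF smooth_map_continuous[OF assms(1)] assms(2)])
  moreover have "{y \<in> topspace (subtopology (mtop Y) U). f y \<in> V} = U \<inter> f -` V"
    using openin_subset[OF smooth_map_on_open[OF assms(1)]] by auto
  ultimately show ?thesis
    using openin_trans_full smooth_map_on_open[OF assms(1)] by metis
qed

text \<open>The definition of a smooth map tests chart coordinates only; near \<open>f y\<close> the
  function \<open>g\<close> is a smooth function of such coordinates.\<close>

lemma smooth_map_compose_fun: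
  assumes Y: "smooth_atlas Y" and X: "smooth_atlas X"
    and f: "smooth_map_on Y X U f" and g: "smooth_fun_on X V g"
  shows "smooth_fun_on Y (U \<inter> f -` V) (\<lambda>y. g (f y))"
proof (rule smooth_fun_local[OF Y])
  fix y assume y: "y \<in> U \<inter> f -` V"
  obtain W \<psi> where W: "(W, \<psi>) \<in> atlas X" "f y \<in> W"
    using chart_cover[OF X smooth_map_in_topspace[OF f]] y by blast
  interpret chart X W \<psi> using X W by unfold_locales
  let ?O = "U \<inter> f -` (V \<inter> W)"
  have O: "openin (mtop Y) ?O"
    by (intro smooth_map_preimage[OF f] openin_Int smooth_fun_on_open[OF g] chart_open)
  have OW: "smooth_fun_on Y (U \<inter> f -` W) (\<lambda>y. \<psi> (f y) l)" if "l < mdim X" for l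
    using f W(1) that by (fastforce simp: smooth_map_on_def)
  have "smooth_fun_on Y ?O (\<lambda>y. (\<lambda>x. g (inv_into W \<psi> x)) (\<psi> (f y)))"
  proof (rule smooth_fun_compose_real[OF Y smooth_fun_onD[OF g W(1)] O])
    show "smooth_fun_on Y ?O (\<lambda>p. \<psi> (f p) l)" if "l < mdim X" for l
      by (rule smooth_fun_subset[OF Y OW[OF that]]) (use O in auto)
  qed auto
  then have "smooth_fun_on Y ?O (\<lambda>y. g (f y))"
    by (rule smooth_fun_cong[OF Y]) (auto simp: chart_inv)
  then show "\<exists>O'. y \<in> O' \<and> O' \<subseteq> U \<inter> f -` V \<and> smooth_fun_on Y O' (\<lambda>y. g (f y))"
    using y W by (intro exI[of _ ?O]) auto
qed

lemma smooth_map_compose: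
  assumes Z: "smooth_atlas Z" and Y: "smooth_atlas Y"
    and h: "smooth_map_on Z Y V h" and f: "smooth_map_on Y X U f" and hV: "h ` V \<subseteq> U"
  shows "smooth_map_on Z X V (\<lambda>z. f (h z))"
  unfolding smooth_map_on_def
proof (intro conjI ballI smooth_map_on_open[OF h], goal_cases)
  case 1
  have "continuous_map (subtopology (mtop Z) V) (subtopology (mtop Y) U) h"
    using smooth_map_continuous[OF h] hV by (auto simp: continuous_map_in_subtopology)
  from continuous_map_compose[OF this smooth_map_continuous[OF f]] show ?case
    by (simp add: comp_def)
next
  case (2 c)
  obtain W \<psi> where c: "c = (W, \<psi>)" by fastforce
  have "smooth_fun_on Z (V \<inter> (\<lambda>z. f (h z)) -` W) (\<lambda>z. \<psi> (f (h z)) i)" if i: "i < mdim X" for i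
  proof -
    have "smooth_fun_on Y (U \<inter> f -` W) (\<lambda>y. \<psi> (f y) i)"
      using f 2 c i by (fastforce simp: smooth_map_on_def)
    from smooth_map_compose_fun[OF Z Y h this]
    have "smooth_fun_on Z (V \<inter> h -` (U \<inter> f -` W)) (\<lambda>z. \<psi> (f (h z)) i)" .
    moreover have "V \<inter> h -` (U \<inter> f -` W) = V \<inter> (\<lambda>z. f (h z)) -` W"
      using hV by auto
    ultimately show ?thesis by simp
  qed
  then show ?case
    using c by simp
qed

lemma smooth_map_subset:
  assumes Y: "smooth_atlas Y" and f: "smooth_map_on Y X U f" and "W \<subseteq> U" "openin (mtop Y) W"
    and X: "smooth_atlas X"
  shows "smooth_map_on Y X W f"
  unfolding smooth_map_on_def
proof (intro conjI ballI assms(4), goal_cases)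
  case 1
  have "continuous_map (subtopology (subtopology (mtop Y) U) W) (mtop X) f"
    by (rule continuous_map_from_subtopology[OF smooth_map_continuous[OF f]])
  then show ?case
    using assms(3) by (simp add: subtopology_subtopology Int_absorb1)
next
  case (2 c)
  obtain V \<psi> where c: "c = (V, \<psi>)" by fastforce
  interpret chart X V \<psi> using X 2 c by unfold_locales auto
  have "smooth_fun_on Y (W \<inter> f -` V) (\<lambda>y. \<psi> (f y) i)" if i: "i < mdim X" for i
  proof (rule smooth_fun_subset[OF Y])
    show "smooth_fun_on Y (U \<inter> f -` V) (\<lambda>y. \<psi> (f y) i)"
      using f 2 c i by (fastforce simp: smooth_map_on_def)
    have "W \<inter> f -` V = W \<inter> (U \<inter> f -` V)"
      using assms(3) by auto
    then show "openin (mtop Y) (W \<inter> f -` V)"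
      using openin_Int[OF assms(4) smooth_map_preimage[OF f chart_open]] by simp
  qed (use assms(3) in auto)
  then show ?case
    using c by simp
qed

lemma smooth_map_id:
  assumes "smooth_atlas M" "openin (mtop M) U"
  shows "smooth_map_on M M U (\<lambda>x. x)"
  unfolding smooth_map_on_def
proof (intro conjI ballI assms(2), goal_cases)
  case (2 c)
  obtain V \<psi> where c: "c = (V, \<psi>)" by fastforce
  interpret chart M V \<psi> using assms(1) 2 c by unfold_locales auto
  have "smooth_fun_on M (U \<inter> V) (\<lambda>y. \<psi> y i)" if i: "i < mdim M" for i
    by (rule smooth_fun_subset[OF assms(1) smooth_chart_coord[OF i]])
      (use assms(2) chart_open in auto)
  then show ?case
    using c by simp
qed (simp add: continuous_map_from_subtopology)

lemma smooth_map_const: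
  assumes "smooth_atlas Y" "openin (mtop Y) U" "x \<in> topspace (mtop X)"
  shows "smooth_map_on Y X U (\<lambda>y. x)"
  unfolding smooth_map_on_def using assms
  by (auto intro!: smooth_fun_const simp: vimage_const)

lemma smooth_map_cong:
  assumes "smooth_atlas Y" "smooth_map_on Y X U f" "\<And>y. y \<in> U \<Longrightarrow> f y = g y"
  shows "smooth_map_on Y X U g"
  unfolding smooth_map_on_def
proof (intro conjI ballI smooth_map_on_open[OF assms(2)], goal_cases)
  case 1
  show ?case
    by (rule continuous_map_eq[OF smooth_map_continuous[OF assms(2)]]) (use assms(3) in auto)
next
  case (2 c)
  obtain V \<psi> where c: "c = (V, \<psi>)" by fastforce
  have "smooth_fun_on Y (U \<inter> f -` V) (\<lambda>y. \<psi> (g y) i)" if i: "i < mdim X" for i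
  proof (rule smooth_fun_cong[OF assms(1)])
    show "smooth_fun_on Y (U \<inter> f -` V) (\<lambda>y. \<psi> (f y) i)"
      using assms(2) 2 c i by (fastforce simp: smooth_map_on_def)
  qed (use assms(3) in auto)
  moreover have "U \<inter> f -` V = U \<inter> g -` V"
    using assms(3) by auto
  ultimately show ?case
    using c by simp
qed

section \<open>Tangent vectors\<close>

lemma smooth_near_add:
  "smooth_atlas M \<Longrightarrow> smooth_near M p g \<Longrightarrow> smooth_near M p h \<Longrightarrow> smooth_near M p (\<lambda>q. a * g q + b * h q)"
  unfolding smooth_near_def
proof (elim exE conjE)
  fix U W assume M: "smooth_atlas M" and U: "p \<in> U" "smooth_fun_on M U g" and W: "p \<in> W" "smooth_fun_on M W h"
  have O: "openin (mtop M) (U \<inter> W)"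
    using U W by (auto intro: smooth_fun_on_open)
  have "smooth_fun_on M (U \<inter> W) g" "smooth_fun_on M (U \<inter> W) h"
    using smooth_fun_subset[OF M U(2) _ O] smooth_fun_subset[OF M W(2) _ O] by auto
  then have "smooth_fun_on M (U \<inter> W) (\<lambda>q. a * g q + b * h q)"
    by (intro smooth_fun_add smooth_fun_mult smooth_fun_const M O)
  then show "\<exists>U. p \<in> U \<and> smooth_fun_on M U (\<lambda>q. a * g q + b * h q)"
    using U W by blast
qed

lemma smooth_near_mult:
  "smooth_atlas M \<Longrightarrow> smooth_near M p g \<Longrightarrow> smooth_near M p h \<Longrightarrow> smooth_near M p (\<lambda>q. g q * h q)"
  unfolding smooth_near_def
proof (elim exE conjE)
  fix U W assume M: "smooth_atlas M" and U: "p \<in> U" "smooth_fun_on M U g" and W: "p \<in> W" "smooth_fun_on M W h"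
  have O: "openin (mtop M) (U \<inter> W)"
    using U W by (auto intro: smooth_fun_on_open)
  have "smooth_fun_on M (U \<inter> W) g" "smooth_fun_on M (U \<inter> W) h"
    using smooth_fun_subset[OF M U(2) _ O] smooth_fun_subset[OF M W(2) _ O] by auto
  then have "smooth_fun_on M (U \<inter> W) (\<lambda>q. g q * h q)"
    by (intro smooth_fun_mult M)
  then show "\<exists>U. p \<in> U \<and> smooth_fun_on M U (\<lambda>q. g q * h q)"
    using U W by blast
qed

lemma smooth_near_const: "smooth_atlas M \<Longrightarrow> p \<in> topspace (mtop M) \<Longrightarrow> smooth_near M p (\<lambda>q. c)"
  unfolding smooth_near_def using smooth_fun_const[OF _ openin_topspace] by blast

lemma smooth_near_compose:
  assumes "smooth_atlas Y" "smooth_atlas X" "smooth_map_on Y X U f" "y \<in> U" "smooth_near X (f y) g"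
  shows "smooth_near Y y (\<lambda>q. g (f q))"
  using smooth_map_compose_fun[OF assms(1-3)] assms(4,5) unfolding smooth_near_def
  by (metis IntI vimageI)

lemma smooth_near_cong:
  assumes "smooth_atlas M" "smooth_near M p g" "openin (mtop M) U" "p \<in> U" "\<And>q. q \<in> U \<Longrightarrow> g q = h q"
  shows "smooth_near M p h"
proof -
  obtain W where W: "p \<in> W" "smooth_fun_on M W g"
    using assms(2) by (auto simp: smooth_near_def)
  have O: "openin (mtop M) (U \<inter> W)"
    using assms(3) smooth_fun_on_open[OF W(2)] by blast
  have "smooth_fun_on M (U \<inter> W) h"
    by (rule smooth_fun_cong[OF assms(1) smooth_fun_subset[OF assms(1) W(2) _ O]]) (use assms(5) in auto)
  then show ?thesis
    using W(1) assms(4) by (auto simp: smooth_near_def)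
qed

locale tangent =
  fixes M :: "('p, 'b) manifold_scheme" and p :: 'p and v :: "'p tvec"
  assumes M: "smooth_atlas M" and p: "p \<in> topspace (mtop M)" and v: "v \<in> tangent_space M p"
begin

lemma linear: "smooth_near M p g \<Longrightarrow> smooth_near M p h \<Longrightarrow> v (\<lambda>q. a * g q + b * h q) = a * v g + b * v h"
  using v by (simp add: tangent_space_def)

lemma leibniz: "smooth_near M p g \<Longrightarrow> smooth_near M p h \<Longrightarrow> v (\<lambda>q. g q * h q) = g p * v h + h p * v g"
  using v by (simp add: tangent_space_def)

lemma vanish: "\<not> smooth_near M p g \<Longrightarrow> v g = 0"
  using v by (simp add: tangent_space_def)

lemma const: "v (\<lambda>q. c) = 0"
proof -
  have 1: "v (\<lambda>q. 1) = 0"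
    using leibniz[OF smooth_near_const[OF M p, of 1] smooth_near_const[OF M p, of 1]] by simp
  show ?thesis
    using linear[OF smooth_near_const[OF M p, of 1] smooth_near_const[OF M p, of 1], of c 0] 1 by simp
qed

text \<open>If \<open>k\<close> vanishes near \<open>p\<close>, then \<open>k = k \<chi>\<close>, where \<open>\<chi>\<close> is \<open>0\<close> near \<open>p\<close> and \<open>1\<close> elsewhere.\<close>

lemma germ_zero:
  assumes U: "openin (mtop M) U" "p \<in> U" "\<And>q. q \<in> U \<Longrightarrow> k q = 0"
  shows "v k = 0"
proof -
  have z: "smooth_near M p h" if "\<And>q. q \<in> U \<Longrightarrow> h q = 0" for h
    by (rule smooth_near_cong[OF M smooth_near_const[OF M p, of 0] U(1,2)]) (use that in auto)
  let ?\<chi> = "\<lambda>q. if q \<in> U then 0 else 1 :: real"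
  have "v (\<lambda>q. k q * ?\<chi> q) = k p * v ?\<chi> + ?\<chi> p * v k"
    by (rule leibniz) (auto intro: z U)
  moreover have "(\<lambda>q. k q * ?\<chi> q) = k"
    using U(3) by auto
  ultimately show ?thesis
    using U by simp
qed

text \<open>Being smooth near \<open>p\<close> depends only on the germ, and vectors vanish on
  functions that are not smooth there. In the smooth case \<open>germ_zero\<close> applies to the
  difference.\<close>

lemma germ_cong:
  assumes U: "openin (mtop M) U" "p \<in> U" "\<And>q. q \<in> U \<Longrightarrow> g q = h q"
  shows "v g = v h"
proof (cases "smooth_near M p g")
  case True
  then have h: "smooth_near M p h"
    by (rule smooth_near_cong[OF M _ U])
  have "v (\<lambda>q. 1 * g q + (-1) * h q) = 0"
    by (rule germ_zero[OF U(1,2)]) (use U(3) in auto)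
  then show ?thesis
    using linear[OF True h, of 1 "-1"] by simp
next
  case False
  then have "\<not> smooth_near M p h"
    using smooth_near_cong[OF M _ U(1,2), of h g] U(3) by fastforce
  then show ?thesis
    using False vanish by simp
qed

lemma add:
  assumes "smooth_near M p g" "smooth_near M p h"
  shows "v (\<lambda>q. g q + h q) = v g + v h"
  using linear[OF assms, of 1 1] by simp

lemma sum:
  assumes "\<And>l. l \<in> A \<Longrightarrow> smooth_near M p (g l)"
  shows "smooth_near M p (\<lambda>q. \<Sum>l\<in>A. g l q) \<and> v (\<lambda>q. \<Sum>l\<in>A. g l q) = (\<Sum>l\<in>A. v (g l))"
  using assms
proof (induction A rule: infinite_finite_induct)
  case (insert x A)
  have "smooth_near M p (g x)" "smooth_near M p (\<lambda>q. \<Sum>l\<in>A. g l q)"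
    using insert by auto
  then show ?case
    using insert add[of "g x" "\<lambda>q. \<Sum>l\<in>A. g l q"] smooth_near_add[OF M, of p "g x" "\<lambda>q. \<Sum>l\<in>A. g l q" 1 1]
    by simp
qed (auto simp: const smooth_near_const M p)

text \<open>Hadamard's lemma writes \<open>g\<close> near \<open>p\<close> as a constant plus a sum
  of products \<open>(\<phi> q l - \<phi> p l) * D l (\<phi> q)\<close>. The first factor vanishes
  at \<open>p\<close>, so by the Leibniz rule only its derivative times
  \<open>D l (\<phi> p)\<close> survives.\<close>

lemma coordinates:
  assumes V: "(V, \<phi>) \<in> atlas M" "p \<in> V" and g: "smooth_near M p g"
  shows "v g = (\<Sum>i<mdim M. v (\<lambda>q. \<phi> q i) * partial_deriv i (\<lambda>x. g (inv_into V \<phi> x)) (\<phi> p))"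
proof -
  interpret chart M V \<phi> using M V by unfold_locales
  let ?G = "\<lambda>x. g (inv_into V \<phi> x)"
  obtain U where U: "p \<in> U" "smooth_fun_on M U g"
    using g by (auto simp: smooth_near_def)
  have sm: "smooth_real_on d (\<phi> ` (U \<inter> V)) ?G"
    by (rule smooth_fun_onD[OF U(2) V(1)])
  then obtain e where e: "e > 0" "cube d (\<phi> p) e \<subseteq> \<phi> ` (U \<inter> V)"
    using smooth_real_on_open[OF sm] U V unfolding openin_Euclidean_iff by blast
  have pE: "\<phi> p \<in> espace d"
    by (rule chart_espace[OF V(2)])
  have "smooth_real_on d (cube d (\<phi> p) e) ?G"
    by (rule smooth_subset[OF sm e(2) openin_cube])
  from hadamard[OF this pE e(1)] obtain D where
    D: "\<And>l. l < d \<Longrightarrow> smooth_real_on d (cube d (\<phi> p) e) (D l)"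
      "\<And>l. l < d \<Longrightarrow> D l (\<phi> p) = partial_deriv l ?G (\<phi> p)"
      "\<And>y. y \<in> cube d (\<phi> p) e \<Longrightarrow> ?G y = ?G (\<phi> p) + (\<Sum>l<d. (y l - \<phi> p l) * D l y)"
    by blast
  let ?W = "{q \<in> V. \<phi> q \<in> cube d (\<phi> p) e}"
  have W: "openin (mtop M) ?W" "p \<in> ?W"
    using chart_preimage[OF openin_cube] V(2) cube_center[OF pE e(1)] by auto
  have smD: "smooth_near M p (\<lambda>q. D l (\<phi> q))" if "l < d" for l
    unfolding smooth_near_def using W(2) by (intro exI[of _ ?W] conjI smooth_fun_in_chart[OF D(1)[OF that]])
  have sm\<phi>: "smooth_near M p (\<lambda>q. \<phi> q l)" if "l < d" for l
    unfolding smooth_near_def using smooth_chart_coord[OF that] V(2) by blast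
  have smd: "smooth_near M p (\<lambda>q. \<phi> q l - \<phi> p l)" if "l < d" for l
    using smooth_near_add[OF M sm\<phi>[OF that] smooth_near_const[OF M p, of "\<phi> p l"], of 1 "-1"] by simp
  have vd: "v (\<lambda>q. \<phi> q l - \<phi> p l) = v (\<lambda>q. \<phi> q l)" if "l < d" for l
    using linear[OF sm\<phi>[OF that] smooth_near_const[OF M p, of "\<phi> p l"], of 1 "-1"] const by simp
  have smt: "smooth_near M p (\<lambda>q. (\<phi> q l - \<phi> p l) * D l (\<phi> q))" if "l < d" for l
    by (rule smooth_near_mult[OF M smd[OF that] smD[OF that]])
  have sms: "smooth_near M p (\<lambda>q. \<Sum>l<d. (\<phi> q l - \<phi> p l) * D l (\<phi> q))"
    and vs: "v (\<lambda>q. \<Sum>l<d. (\<phi> q l - \<phi> p l) * D l (\<phi> q)) = (\<Sum>l<d. v (\<lambda>q. (\<phi> q l - \<phi> p l) * D l (\<phi> q)))"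
    using sum[of "{..<d}" "\<lambda>l q. (\<phi> q l - \<phi> p l) * D l (\<phi> q)"] smt by auto
  have "v g = v (\<lambda>q. g p + (\<Sum>l<d. (\<phi> q l - \<phi> p l) * D l (\<phi> q)))"
  proof (rule germ_cong[OF W])
    show "g q = g p + (\<Sum>l<d. (\<phi> q l - \<phi> p l) * D l (\<phi> q))" if "q \<in> ?W" for q
      using D(3)[of "\<phi> q"] that V(2) by (simp add: chart_inv)
  qed
  also have "\<dots> = (\<Sum>l<d. v (\<lambda>q. (\<phi> q l - \<phi> p l) * D l (\<phi> q)))"
    using add[OF smooth_near_const[OF M p, of "g p"] sms] by (simp add: const vs)
  also have "\<dots> = (\<Sum>l<d. v (\<lambda>q. \<phi> q l) * partial_deriv l ?G (\<phi> p))"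
    using leibniz[OF smd smD] by (intro sum.cong) (simp_all add: vd D(2) mult.commute)
  finally show ?thesis .
qed

end

lemma vzero_tangent: "vzero \<in> tangent_space M p"
  by (simp add: vzero_def tangent_space_def)

lemma tmap_in_tangent_space:
  assumes Y: "smooth_atlas Y" and X: "smooth_atlas X" and f: "smooth_map_on Y X U f" and y: "y \<in> U"
    and v: "v \<in> tangent_space Y y"
  shows "tmap X f y v \<in> tangent_space X (f y)"
proof -
  have near: "smooth_near Y y (\<lambda>q. g (f q))" if "smooth_near X (f y) g" for g
    by (rule smooth_near_compose[OF Y X f y that])
  show ?thesis
    using v near smooth_near_add[OF X] smooth_near_mult[OF X]
    by (simp add: tangent_space_def tmap_def)
qed

lemma tmap_compose:
  assumes "smooth_atlas Y" "smooth_atlas X" "smooth_map_on Y X U f" "y \<in> U" "smooth_map_on X W U' g" "f y \<in> U'"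
    "smooth_atlas W"
  shows "tmap W g (f y) (tmap X f y v) = tmap W (\<lambda>q. g (f q)) y v"
  unfolding tmap_def
  using smooth_near_compose[OF assms(2,7,5,6)] by (auto simp: fun_eq_iff)

lemma tmap_id:
  assumes "v \<in> tangent_space M p"
  shows "tmap M (\<lambda>q. q) p v = v"
  using assms by (auto simp: tmap_def tangent_space_def fun_eq_iff)

lemma tmap_const:
  assumes "smooth_atlas Y" "y \<in> topspace (mtop Y)" "v \<in> tangent_space Y y"
  shows "tmap X (\<lambda>q. x) y v = vzero"
proof -
  interpret tangent Y y v using assms by unfold_locales
  show ?thesis
    by (auto simp: tmap_def vzero_def const fun_eq_iff)
qed

lemma tmap_vadd: "tmap X f p (vadd v w) = vadd (tmap X f p v) (tmap X f p w)"
  by (auto simp: tmap_def vadd_def fun_eq_iff)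

lemma tmap_vzero: "tmap X f p vzero = vzero"
  by (auto simp: tmap_def vzero_def fun_eq_iff)

section \<open>Products and powers\<close>

lemma homeomorphic_chartI:
  assumes V: "V \<subseteq> topspace T"
    and \<phi>: "\<And>p. p \<in> V \<Longrightarrow> \<phi> p \<in> espace n"
      "\<And>i. i < n \<Longrightarrow> continuous_map (subtopology T V) euclideanreal (\<lambda>p. \<phi> p i)"
    and \<kappa>: "continuous_map (subtopology (Euclidean_space n) (\<phi> ` V)) T \<kappa>" "\<And>p. p \<in> V \<Longrightarrow> \<kappa> (\<phi> p) = p"
  shows "homeomorphic_map (subtopology T V) (subtopology (Euclidean_space n) (\<phi> ` V)) \<phi>"
proof (rule homeomorphic_maps_imp_map)
  have top: "topspace (subtopology T V) = V"
    using V by auto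
  have "continuous_map (subtopology T V) (Euclidean_space n) \<phi>"
    by (rule continuous_map_into_Euclidean) (use \<phi> in \<open>auto simp: top\<close>)
  then show "homeomorphic_maps (subtopology T V) (subtopology (Euclidean_space n) (\<phi> ` V)) \<phi> \<kappa>"
    unfolding homeomorphic_maps_def using \<kappa> V by (auto simp: continuous_map_in_subtopology)
qed

lemma openin_Collect_ball_finite:
  assumes "finite K" "\<And>k. k \<in> K \<Longrightarrow> openin T {x \<in> topspace T. Q k x}"
  shows "openin T {x \<in> topspace T. \<forall>k\<in>K. Q k x}"
  using assms
proof (induction K)
  case (insert k K)
  have "{x \<in> topspace T. \<forall>k\<in>insert k K. Q k x} = {x \<in> topspace T. Q k x} \<inter> {x \<in> topspace T. \<forall>k\<in>K. Q k x}"
    by auto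
  then show ?case
    using insert.IH insert.prems by (simp add: openin_Int)
qed auto

text \<open>Extracts the coordinates of one factor from concatenated ones; padding with zeros puts
  the result into \<open>espace n\<close>.\<close>

definition block :: "nat \<Rightarrow> nat \<Rightarrow> (nat \<Rightarrow> real) \<Rightarrow> nat \<Rightarrow> real"
  where "block s n x = (\<lambda>j. if j < n then x (s + j) else 0)"

lemma block_espace: "block s n x \<in> espace n"
  by (simp add: block_def espace_iff)

lemma continuous_map_block: "continuous_map (Euclidean_space m) (Euclidean_space n) (block s n)"
proof (rule continuous_map_into_Euclidean)
  show "continuous_map (Euclidean_space m) euclideanreal (\<lambda>x. block s n x i)" if "i < n" for i
    using that continuous_map_Euclidean_coord by (simp add: block_def)
qed (rule block_espace)

lemma openin_block_preimage:
  "openin (Euclidean_space n) S \<Longrightarrow> openin (Euclidean_space m) {x \<in> espace m. block s n x \<in> S}"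
  by (rule openin_continuous_map_preimage[OF continuous_map_block])

section \<open>Charts and smooth maps of a product of two manifolds\<close>

definition prod_coord ::
    "nat \<Rightarrow> ('a \<Rightarrow> nat \<Rightarrow> real) \<Rightarrow> ('b \<Rightarrow> nat \<Rightarrow> real) \<Rightarrow> 'a \<times> 'b \<Rightarrow> nat \<Rightarrow> real"
  where "prod_coord n \<phi> \<psi> p = (\<lambda>i. if i < n then \<phi> (fst p) i else \<psi> (snd p) (i - n))"

lemma prod_coord_apply: "prod_coord n \<phi> \<psi> (a, b) = (\<lambda>i. if i < n then \<phi> a i else \<psi> b (i - n))"
  unfolding prod_coord_def fst_conv snd_conv by (rule refl)

lemma prod_chart_eq: "prod_chart n c e = (fst c \<times> fst e, prod_coord n (snd c) (snd e))"
  by (simp add: prod_chart_def prod_coord_def case_prod_beta' fun_eq_iff)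

text \<open>Only topology, dimension and atlas of \<open>P\<close> are fixed, so that the locale
  covers both \<open>prod_symp\<close> and \<open>prod_acs\<close>.\<close>

locale prod_mfd =
  fixes P :: "('a \<times> 'b, 'e) manifold_scheme" and A :: "('a, 'f) manifold_scheme"
    and B :: "('b, 'g) manifold_scheme"
  assumes A: "smooth_atlas A" and B: "smooth_atlas B"
    and mtop_P: "mtop P = prod_topology (mtop A) (mtop B)" and mdim_P: "mdim P = mdim A + mdim B"
    and atlas_P: "atlas P = {prod_chart (mdim A) c e | c e. c \<in> atlas A \<and> e \<in> atlas B}"
begin

lemma top_P: "topspace (mtop P) = topspace (mtop A) \<times> topspace (mtop B)"
  by (simp add: mtop_P)

lemma atlas_PE:
  assumes "(W, \<xi>) \<in> atlas P"
  obtains V \<phi> V' \<phi>' where "(V, \<phi>) \<in> atlas A" "(V', \<phi>') \<in> atlas B" "W = V \<times> V'"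
    "\<xi> = prod_coord (mdim A) \<phi> \<phi>'"
proof -
  obtain c e where "c \<in> atlas A" "e \<in> atlas B" "W = fst c \<times> fst e" "\<xi> = prod_coord (mdim A) (snd c) (snd e)"
    using assms unfolding atlas_P prod_chart_eq by blast
  then show thesis
    using that[of "fst c" "snd c" "fst e" "snd e"] by simp
qed

lemma atlas_PI:
  assumes "(V, \<phi>) \<in> atlas A" "(V', \<phi>') \<in> atlas B"
  shows "(V \<times> V', prod_coord (mdim A) \<phi> \<phi>') \<in> atlas P"
  using assms unfolding atlas_P prod_chart_eq by fastforce

text \<open>The blocks of the product coordinates recover the coordinates of the factors. So the
  image is cut out by one open condition on each block, and the inverses of the factor charts,
  applied to the blocks, form a continuous inverse.\<close>

lemma prod_chart_facts:
  assumes V: "(V, \<phi>) \<in> atlas A" and V': "(V', \<phi>') \<in> atlas B"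
    and \<xi>_eq: "\<xi> = prod_coord (mdim A) \<phi> \<phi>'"
  shows "\<And>a b. a \<in> V \<Longrightarrow> block 0 (mdim A) (\<xi> (a, b)) = \<phi> a"
    and "\<And>a b. b \<in> V' \<Longrightarrow> block (mdim A) (mdim B) (\<xi> (a, b)) = \<phi>' b"
    and "openin (Euclidean_space (mdim P)) (\<xi> ` (V \<times> V'))"
    and "homeomorphic_map (subtopology (mtop P) (V \<times> V'))
      (subtopology (Euclidean_space (mdim P)) (\<xi> ` (V \<times> V'))) \<xi>"
    and "\<And>a b. a \<in> V \<Longrightarrow> b \<in> V' \<Longrightarrow> inv_into (V \<times> V') \<xi> (\<xi> (a, b)) = (a, b)"
proof -
  interpret V: chart A V \<phi> using A V by unfold_locales
  interpret V': chart B V' \<phi>' using B V' by unfold_locales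
  have \<xi>: "\<xi> (a, b) = (\<lambda>i. if i < mdim A then \<phi> a i else \<phi>' b (i - mdim A))" for a b
    by (simp only: \<xi>_eq prod_coord_apply)
  let ?\<kappa> = "\<lambda>x. (inv_into V \<phi> (block 0 (mdim A) x), inv_into V' \<phi>' (block (mdim A) (mdim B) x))"
  show b1: "block 0 (mdim A) (\<xi> (a, b)) = \<phi> a" if "a \<in> V" for a b
    using V.chart_espace[OF that] by (auto simp: block_def \<xi> espace_iff fun_eq_iff)
  show b2: "block (mdim A) (mdim B) (\<xi> (a, b)) = \<phi>' b" if "b \<in> V'" for a b
    using V'.chart_espace[OF that] by (auto simp: block_def \<xi> espace_iff fun_eq_iff)
  have esp: "\<xi> (a, b) \<in> espace (mdim P)" if "b \<in> V'" for a b
    using V'.chart_espace[OF that] by (auto simp: \<xi> espace_iff mdim_P)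
  have \<kappa>: "?\<kappa> (\<xi> p) = p" if "p \<in> V \<times> V'" for p
    using that b1 b2 V.chart_inv V'.chart_inv by auto
  have im: "\<xi> ` (V \<times> V') = {x \<in> espace (mdim P). block 0 (mdim A) x \<in> \<phi> ` V} \<inter>
      {x \<in> espace (mdim P). block (mdim A) (mdim B) x \<in> \<phi>' ` V'}" (is "_ = ?R")
  proof
    show "\<xi> ` (V \<times> V') \<subseteq> ?R"
      using b1 b2 esp by auto
    show "?R \<subseteq> \<xi> ` (V \<times> V')"
    proof
      fix x assume x: "x \<in> ?R"
      then obtain a b where ab: "a \<in> V" "b \<in> V'" "block 0 (mdim A) x = \<phi> a" "block (mdim A) (mdim B) x = \<phi>' b"
        by blast
      have "x i = \<xi> (a, b) i" for i
        using fun_cong[OF ab(3), of i] fun_cong[OF ab(4), of "i - mdim A"] x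
        by (auto simp: \<xi> block_def espace_iff mdim_P split: if_splits)
      then show "x \<in> \<xi> ` (V \<times> V')"
        using ab by auto
    qed
  qed
  show "openin (Euclidean_space (mdim P)) (\<xi> ` (V \<times> V'))"
    unfolding im by (intro openin_Int openin_block_preimage V.chart_image_open V'.chart_image_open)
  have sub: "V \<times> V' \<subseteq> topspace (mtop P)"
    using V.chart_subset V'.chart_subset by (auto simp: top_P)
  show homeo: "homeomorphic_map (subtopology (mtop P) (V \<times> V'))
      (subtopology (Euclidean_space (mdim P)) (\<xi> ` (V \<times> V'))) \<xi>"
  proof (rule homeomorphic_chartI[OF sub, where \<kappa> = ?\<kappa>])
    show "\<xi> p \<in> espace (mdim P)" if "p \<in> V \<times> V'" for p
      using that esp by auto
    have co: "continuous_map (subtopology (mtop C) W) euclideanreal (\<lambda>p. \<psi> p i)"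
      if "chart C W \<psi>" for C :: "('c, 'h) manifold_scheme" and W \<psi> i
    proof -
      have "continuous_map (subtopology (mtop C) W) (Euclidean_space (mdim C)) \<psi>"
        using homeomorphic_imp_continuous_map[OF chart.chart_homeo[OF that]]
        by (simp add: continuous_map_in_subtopology)
      from continuous_map_compose[OF this continuous_map_Euclidean_coord] show ?thesis
        by (simp add: comp_def)
    qed
    show "continuous_map (subtopology (mtop P) (V \<times> V')) euclideanreal (\<lambda>p. \<xi> p i)" for i
    proof -
      have "continuous_map (subtopology (mtop P) (V \<times> V')) (subtopology (mtop A) V) fst"
        "continuous_map (subtopology (mtop P) (V \<times> V')) (subtopology (mtop B) V') snd"
        unfolding mtop_P by (auto simp: continuous_map_in_subtopology continuous_map_from_subtopology
            continuous_map_fst continuous_map_snd)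
      from continuous_map_compose[OF this(1) co[OF V.chart_axioms, of i]]
        continuous_map_compose[OF this(2) co[OF V'.chart_axioms, of "i - mdim A"]]
      have "continuous_map (subtopology (mtop P) (V \<times> V')) euclideanreal
          (\<lambda>p. if i < mdim A then \<phi> (fst p) i else \<phi>' (snd p) (i - mdim A))"
        by (cases "i < mdim A") (simp_all add: comp_def)
      then show ?thesis
        by (simp add: \<xi>_eq prod_coord_def)
    qed
    have "continuous_map (subtopology (Euclidean_space (mdim P)) (\<xi> ` (V \<times> V')))
        (subtopology (Euclidean_space (mdim A)) (\<phi> ` V)) (block 0 (mdim A))"
      "continuous_map (subtopology (Euclidean_space (mdim P)) (\<xi> ` (V \<times> V')))
        (subtopology (Euclidean_space (mdim B)) (\<phi>' ` V')) (block (mdim A) (mdim B))"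
      using im by (auto simp: continuous_map_in_subtopology continuous_map_block intro!: continuous_map_from_subtopology)
    from continuous_map_compose[OF this(1) V.continuous_chart_inv]
      continuous_map_compose[OF this(2) V'.continuous_chart_inv]
    show "continuous_map (subtopology (Euclidean_space (mdim P)) (\<xi> ` (V \<times> V'))) (mtop P) ?\<kappa>"
      unfolding mtop_P by (simp add: continuous_map_pairwise comp_def)
  qed (rule \<kappa>)
  have "inj_on \<xi> (V \<times> V')"
    by (rule inj_on_inverseI[of _ ?\<kappa>]) (rule \<kappa>)
  then show "inv_into (V \<times> V') \<xi> (\<xi> (a, b)) = (a, b)" if "a \<in> V" "b \<in> V'" for a b
    using that by (simp add: inv_into_f_f)
qed

text \<open>Each coordinate of a transition map depends on the block of one factor only, and there
  it is a coordinate of a transition map of that factor.\<close>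

lemma smooth_atlas_P: "smooth_atlas P"
  unfolding smooth_atlas_def
proof (intro conjI ballI, goal_cases)
  case 1
  have "\<Union> (fst ` atlas P) = \<Union> (fst ` atlas A) \<times> \<Union> (fst ` atlas B)"
    unfolding atlas_P prod_chart_def by force
  then show ?case
    using A B by (simp add: top_P smooth_atlas_def)
next
  case (2 w)
  obtain W \<xi> where w: "w = (W, \<xi>)" by fastforce
  obtain V \<phi> V' \<phi>' where V: "(V, \<phi>) \<in> atlas A" "(V', \<phi>') \<in> atlas B" "W = V \<times> V'"
    "\<xi> = prod_coord (mdim A) \<phi> \<phi>'"
    using 2 unfolding w by (rule atlas_PE)
  interpret V: chart A V \<phi> using A V by unfold_locales
  interpret V': chart B V' \<phi>' using B V by unfold_locales
  show ?case
    using prod_chart_facts[OF V(1,2,4)] V.chart_open V'.chart_open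
    by (simp add: w V(3) mtop_P openin_prod_Times_iff)
next
  case (3 w)
  obtain W \<xi> where w: "w = (W, \<xi>)" by fastforce
  obtain V \<phi> V' \<phi>' where V: "(V, \<phi>) \<in> atlas A" "(V', \<phi>') \<in> atlas B" "W = V \<times> V'"
    "\<xi> = prod_coord (mdim A) \<phi> \<phi>'"
    using 3 unfolding w by (rule atlas_PE)
  note F = prod_chart_facts[OF V(1,2,4)]
  interpret V: chart A V \<phi> using A V by unfold_locales
  interpret V': chart B V' \<phi>' using B V by unfold_locales
  have "smooth_real_on (mdim P) (\<xi> ` (W \<inter> W')) (\<lambda>x. \<xi>' (inv_into W \<xi> x) i)"
    if w': "(W', \<xi>') \<in> atlas P" and i: "i < mdim P" for W' \<xi>' i
  proof -
    obtain N \<psi> N' \<psi>' where N: "(N, \<psi>) \<in> atlas A" "(N', \<psi>') \<in> atlas B" "W' = N \<times> N'"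
      "\<xi>' = prod_coord (mdim A) \<psi> \<psi>'"
      using w' by (rule atlas_PE)
    interpret N: chart A N \<psi> using A N by unfold_locales
    interpret N': chart B N' \<psi>' using B N by unfold_locales
    have Wint: "W \<inter> W' = (V \<inter> N) \<times> (V' \<inter> N')"
      using V(3) N(3) by auto
    have op: "openin (mtop P) (W \<inter> W')"
      unfolding Wint mtop_P openin_prod_Times_iff
      using V.chart_open V'.chart_open N.chart_open N'.chart_open by blast
    have "openin (subtopology (mtop P) (V \<times> V')) (W \<inter> W')"
      using op V(3) by (simp add: openin_subtopology) blast
    then have "openin (subtopology (Euclidean_space (mdim P)) (\<xi> ` (V \<times> V'))) (\<xi> ` (W \<inter> W'))"
      using homeomorphic_imp_open_map[OF F(4)] by (simp add: open_map_def)
    then have opim: "openin (Euclidean_space (mdim P)) (\<xi> ` (W \<inter> W'))"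
      using F(3) openin_trans_full by blast
    show ?thesis
    proof (cases "i < mdim A")
      case True
      have "smooth_real_on (mdim P) (\<xi> ` (W \<inter> W')) (\<lambda>x. \<psi> (inv_into V \<phi> (block 0 (mdim A) x)) i)"
      proof (rule smooth_compose[OF V.smooth_transition[OF N(1) True] opim])
        show "block 0 (mdim A) y \<in> \<phi> ` (V \<inter> N)" if "y \<in> \<xi> ` (W \<inter> W')" for y
          using that F(1) unfolding Wint by auto
        show "smooth_real_on (mdim P) (\<xi> ` (W \<inter> W')) (\<lambda>y. block 0 (mdim A) y l)" if "l < mdim A" for l
          using that by (simp add: block_def smooth_coord[OF opim])
      qed
      then show ?thesis
        by (rule smooth_cong_imp) (use True F(1,5) in \<open>auto simp: Wint V(3) N(4) prod_coord_apply V.chart_inv\<close>)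
    next
      case False
      then have i': "i - mdim A < mdim B"
        using i by (simp add: mdim_P)
      have "smooth_real_on (mdim P) (\<xi> ` (W \<inter> W'))
          (\<lambda>x. \<psi>' (inv_into V' \<phi>' (block (mdim A) (mdim B) x)) (i - mdim A))"
      proof (rule smooth_compose[OF V'.smooth_transition[OF N(2) i'] opim])
        show "block (mdim A) (mdim B) y \<in> \<phi>' ` (V' \<inter> N')" if "y \<in> \<xi> ` (W \<inter> W')" for y
          using that F(2) unfolding Wint by auto
        show "smooth_real_on (mdim P) (\<xi> ` (W \<inter> W')) (\<lambda>y. block (mdim A) (mdim B) y l)" if "l < mdim B" for l
          using that by (simp add: block_def smooth_coord[OF opim])
      qed
      then show ?thesis
        by (rule smooth_cong_imp) (use False F(2,5) in \<open>auto simp: Wint V(3) N(4) prod_coord_apply V'.chart_inv\<close>)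
    qed
  qed
  then show ?case
    using w by auto
qed

lemma smooth_fst: "smooth_map_on P A (topspace (mtop P)) fst"
  unfolding smooth_map_on_def
proof (intro conjI ballI openin_topspace, goal_cases)
  case 1
  show ?case
    unfolding mtop_P by (intro continuous_map_from_subtopology continuous_map_fst)
next
  case (2 c)
  obtain W \<psi> where c: "c = (W, \<psi>)" by fastforce
  interpret W: chart A W \<psi> using A 2 c by unfold_locales auto
  have "smooth_fun_on P (topspace (mtop P) \<inter> fst -` W) (\<lambda>p. \<psi> (fst p) i)" if i: "i < mdim A" for i
  proof (rule smooth_fun_onI[OF smooth_atlas_P])
    have "topspace (mtop P) \<inter> fst -` W = W \<times> topspace (mtop B)"
      using W.chart_subset by (auto simp: top_P)
    then show "openin (mtop P) (topspace (mtop P) \<inter> fst -` W)"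
      using W.chart_open by (simp add: mtop_P openin_prod_Times_iff)
    fix p assume p: "p \<in> topspace (mtop P) \<inter> fst -` W"
    obtain V' \<phi>' where V': "(V', \<phi>') \<in> atlas B" "snd p \<in> V'"
    proof (rule chart_cover[OF B])
      show "snd p \<in> topspace (mtop B)"
        using p by (auto simp: top_P)
    qed
    \<comment> \<open>Any chart of \<open>B\<close> completes \<open>(W, \<psi>)\<close> to a
      product chart, in which the function is the coordinate projection \<open>x i\<close>.\<close>
    let ?\<xi> = "prod_coord (mdim A) \<psi> \<phi>'"
    have W: "(W, \<psi>) \<in> atlas A" using 2 c by simp
    note F = prod_chart_facts[OF W V'(1), OF refl]
    have "smooth_real_on (mdim P) (?\<xi> ` (W \<times> V')) (\<lambda>x. \<psi> (fst (inv_into (W \<times> V') ?\<xi> x)) i)"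
      by (rule smooth_cong_imp[OF smooth_coord[OF F(3), of i]]) (use i F(5) in \<open>auto simp: prod_coord_def\<close>)
    then show "\<exists>V \<phi> S. (V, \<phi>) \<in> atlas P \<and> p \<in> V \<and> \<phi> p \<in> S \<and>
        smooth_real_on (mdim P) S (\<lambda>x. \<psi> (fst (inv_into V \<phi> x)) i)"
      using atlas_PI[OF W V'(1)] p V'(2)
      by (intro exI[of _ "W \<times> V'"] exI[of _ ?\<xi>] exI[of _ "?\<xi> ` (W \<times> V')"]) (auto simp: mem_Times_iff)
  qed
  then show ?case
    using c by simp
qed

lemma smooth_snd: "smooth_map_on P B (topspace (mtop P)) snd"
  unfolding smooth_map_on_def
proof (intro conjI ballI openin_topspace, goal_cases)
  case 1
  show ?case
    unfolding mtop_P by (intro continuous_map_from_subtopology continuous_map_snd)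
next
  case (2 c)
  obtain W \<psi> where c: "c = (W, \<psi>)" by fastforce
  interpret W: chart B W \<psi> using B 2 c by unfold_locales auto
  have "smooth_fun_on P (topspace (mtop P) \<inter> snd -` W) (\<lambda>p. \<psi> (snd p) i)" if i: "i < mdim B" for i
  proof (rule smooth_fun_onI[OF smooth_atlas_P])
    have "topspace (mtop P) \<inter> snd -` W = topspace (mtop A) \<times> W"
      using W.chart_subset by (auto simp: top_P)
    then show "openin (mtop P) (topspace (mtop P) \<inter> snd -` W)"
      using W.chart_open by (simp add: mtop_P openin_prod_Times_iff)
    fix p assume p: "p \<in> topspace (mtop P) \<inter> snd -` W"
    obtain V \<phi> where V: "(V, \<phi>) \<in> atlas A" "fst p \<in> V"
    proof (rule chart_cover[OF A])
      show "fst p \<in> topspace (mtop A)"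
        using p by (auto simp: top_P)
    qed
    let ?\<xi> = "prod_coord (mdim A) \<phi> \<psi>"
    have W: "(W, \<psi>) \<in> atlas B" using 2 c by simp
    note F = prod_chart_facts[OF V(1) W, OF refl]
    have "smooth_real_on (mdim P) (?\<xi> ` (V \<times> W)) (\<lambda>x. \<psi> (snd (inv_into (V \<times> W) ?\<xi> x)) i)"
      by (rule smooth_cong_imp[OF smooth_coord[OF F(3), of "mdim A + i"]]) (use F(5) in \<open>auto simp: prod_coord_def\<close>)
    then show "\<exists>V \<phi> S. (V, \<phi>) \<in> atlas P \<and> p \<in> V \<and> \<phi> p \<in> S \<and>
        smooth_real_on (mdim P) S (\<lambda>x. \<psi> (snd (inv_into V \<phi> x)) i)"
      using atlas_PI[OF V(1) W] p V(2)
      by (intro exI[of _ "V \<times> W"] exI[of _ ?\<xi>] exI[of _ "?\<xi> ` (V \<times> W)"]) (auto simp: mem_Times_iff)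
  qed
  then show ?case
    using c by simp
qed

lemma smooth_Pair:
  assumes W: "smooth_atlas W" and f: "smooth_map_on W A U f" and g: "smooth_map_on W B U g"
  shows "smooth_map_on W P U (\<lambda>w. (f w, g w))"
  unfolding smooth_map_on_def
proof (intro conjI ballI smooth_map_on_open[OF f], goal_cases)
  case 1
  show ?case
    unfolding mtop_P
    by (intro continuous_map_pairedI smooth_map_continuous[OF f] smooth_map_continuous[OF g])
next
  case (2 c)
  obtain N \<xi> where c: "c = (N, \<xi>)" by fastforce
  obtain V \<phi> V' \<phi>' where V: "(V, \<phi>) \<in> atlas A" "(V', \<phi>') \<in> atlas B" "N = V \<times> V'"
    "\<xi> = prod_coord (mdim A) \<phi> \<phi>'"
    using 2 unfolding c by (rule atlas_PE)
  interpret V: chart A V \<phi> using A V by unfold_locales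
  interpret V': chart B V' \<phi>' using B V by unfold_locales
  let ?O = "(U \<inter> f -` V) \<inter> (U \<inter> g -` V')"
  have O: "openin (mtop W) ?O"
    by (intro openin_Int smooth_map_preimage[OF f] smooth_map_preimage[OF g] V.chart_open V'.chart_open)
  have eq: "U \<inter> (\<lambda>w. (f w, g w)) -` N = ?O"
    using V(3) by auto
  have "smooth_fun_on W ?O (\<lambda>w. \<xi> (f w, g w) i)" if i: "i < mdim P" for i
  proof (cases "i < mdim A")
    case True
    then have "smooth_fun_on W (U \<inter> f -` V) (\<lambda>w. \<phi> (f w) i)"
      using f V(1) by (fastforce simp: smooth_map_on_def)
    from smooth_fun_subset[OF W this _ O] show ?thesis
      using True by (auto simp: V(4) prod_coord_apply)
  next
    case False
    then have "smooth_fun_on W (U \<inter> g -` V') (\<lambda>w. \<phi>' (g w) (i - mdim A))"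
      using g V(2) i by (fastforce simp: smooth_map_on_def mdim_P)
    from smooth_fun_subset[OF W this _ O] show ?thesis
      using False by (auto simp: V(4) prod_coord_apply)
  qed
  then show ?case
    using c eq by simp
qed

end

section \<open>Charts and smooth maps of a power; coordinate \<open>i\<close> is coordinate
  \<open>i mod D\<close> of factor \<open>i div D\<close>\<close>

locale power_mfd =
  fixes P :: "(nat \<Rightarrow> 'm, 'e) manifold_scheme" and M :: "('m, 'f) manifold_scheme" and n :: nat
  assumes M: "smooth_atlas M"
    and mtop_P: "mtop P = product_topology (\<lambda>_. mtop M) {..<n}" and mdim_P: "mdim P = n * mdim M"
    and atlas_P: "atlas P = {power_chart (mdim M) n c | c. c \<in> {..<n} \<rightarrow> atlas M}"
begin

abbreviation "D \<equiv> mdim M"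

abbreviation "blk k \<equiv> block (k * D) D"

lemma top_P: "topspace (mtop P) = (\<Pi>\<^sub>E k\<in>{..<n}. topspace (mtop M))"
  by (simp add: mtop_P)

lemma index_eq: "j < D \<Longrightarrow> (k * D + j) div D = k" "j < D \<Longrightarrow> (k * D + j) mod D = j"
  by (simp_all add: div_mult_self3 mod_mult_self3)

lemma index_less: "k < n \<Longrightarrow> j < D \<Longrightarrow> k * D + j < n * D"
proof -
  assume "k < n" "j < D"
  then have "k * D + j < Suc k * D"
    by simp
  also have "\<dots> \<le> n * D"
    using \<open>k < n\<close> by (intro mult_le_mono1) simp
  finally show ?thesis .
qed

lemma div_less: "i < n * D \<Longrightarrow> i div D < n"
  by (simp add: less_mult_imp_div_less)

lemma mod_less: "i < n * D \<Longrightarrow> i mod D < D"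
  by (cases "D = 0") auto

context
  fixes c
  assumes c: "c \<in> {..<n} \<rightarrow> atlas M"
begin

abbreviation "V \<equiv> fst (power_chart D n c)"

abbreviation "\<xi> \<equiv> snd (power_chart D n c)"

lemma V_eq: "V = (\<Pi>\<^sub>E k\<in>{..<n}. fst (c k))"
  by (simp add: power_chart_def)

lemma \<xi>_eq: "\<xi> m i = (if i < n * D then snd (c (i div D)) (m (i div D)) (i mod D) else 0)"
  by (simp add: power_chart_def)

lemma chart_c: "k < n \<Longrightarrow> chart M (fst (c k)) (snd (c k))"
  using c M by unfold_locales auto

lemma blk_\<xi>:
  assumes "m \<in> V" "k < n"
  shows "blk k (\<xi> m) = snd (c k) (m k)"
proof
  interpret chart M "fst (c k)" "snd (c k)" using chart_c[OF assms(2)] .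
  fix j
  have "m k \<in> fst (c k)"
    using assms by (auto simp: V_eq)
  then show "blk k (\<xi> m) j = snd (c k) (m k) j"
    using chart_espace[of "m k"] index_less[OF assms(2)] index_eq[of j k]
    by (cases "j < D") (auto simp: block_def \<xi>_eq espace_iff)
qed

definition \<kappa> where "\<kappa> x = (\<lambda>k\<in>{..<n}. inv_into (fst (c k)) (snd (c k)) (blk k x))"

lemma \<kappa>_\<xi>:
  assumes "m \<in> V"
  shows "\<kappa> (\<xi> m) = m"
proof
  fix k
  show "\<kappa> (\<xi> m) k = m k"
  proof (cases "k < n")
    case True
    interpret chart M "fst (c k)" "snd (c k)" using chart_c[OF True] .
    have "m k \<in> fst (c k)"
      using assms True by (auto simp: V_eq)
    then show ?thesis
      using True blk_\<xi>[OF assms True] chart_inv by (simp add: \<kappa>_def)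
  next
    case False
    then show ?thesis
      using assms by (auto simp: \<kappa>_def V_eq PiE_def extensional_def)
  qed
qed

lemma inv_\<xi>: "m \<in> V \<Longrightarrow> inv_into V \<xi> (\<xi> m) = m"
  by (rule inv_into_f_f) (auto intro: inj_on_inverseI[where g = \<kappa>] \<kappa>_\<xi>)

lemma \<xi>_espace: "\<xi> m \<in> espace (mdim P)"
  by (simp add: espace_iff mdim_P \<xi>_eq)

lemma image_\<xi>: "\<xi> ` V = {x \<in> espace (mdim P). \<forall>k\<in>{..<n}. blk k x \<in> snd (c k) ` fst (c k)}"
proof
  show "\<xi> ` V \<subseteq> {x \<in> espace (mdim P). \<forall>k\<in>{..<n}. blk k x \<in> snd (c k) ` fst (c k)}"
    using blk_\<xi> \<xi>_espace by (auto simp: V_eq)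
  show "{x \<in> espace (mdim P). \<forall>k\<in>{..<n}. blk k x \<in> snd (c k) ` fst (c k)} \<subseteq> \<xi> ` V"
  proof
    fix x assume x: "x \<in> {x \<in> espace (mdim P). \<forall>k\<in>{..<n}. blk k x \<in> snd (c k) ` fst (c k)}"
    have k: "\<kappa> x k \<in> fst (c k)" "snd (c k) (\<kappa> x k) = blk k x" if "k < n" for k
      using x that by (auto simp: \<kappa>_def inv_into_into f_inv_into_f)
    have "\<kappa> x \<in> V"
      using k(1) by (auto simp: V_eq \<kappa>_def)
    moreover have "\<xi> (\<kappa> x) i = x i" for i
    proof (cases "i < n * D")
      case True
      then show ?thesis
        using k(2)[OF div_less[OF True]] mod_less[OF True] div_mult_mod_eq[of i D]
        by (simp add: \<xi>_eq block_def)
    next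
      case False
      then show ?thesis
        using x by (simp add: \<xi>_eq espace_iff mdim_P)
    qed
    ultimately show "x \<in> \<xi> ` V"
      by (metis ext imageI)
  qed
qed

lemma V_open: "openin (mtop P) V"
  unfolding V_eq mtop_P using chart.chart_open[OF chart_c] by (auto simp: openin_PiE_gen)

lemma image_open: "openin (Euclidean_space (mdim P)) (\<xi> ` V)"
  unfolding image_\<xi>
  by (intro openin_Collect_ball_finite openin_block_preimage)
    (auto intro: chart.chart_image_open[OF chart_c])

lemma homeo: "homeomorphic_map (subtopology (mtop P) V) (subtopology (Euclidean_space (mdim P)) (\<xi> ` V)) \<xi>"
proof (rule homeomorphic_chartI[OF openin_subset[OF V_open], where \<kappa> = \<kappa>])
  show "continuous_map (subtopology (mtop P) V) euclideanreal (\<lambda>p. \<xi> p i)" if i: "i < mdim P" for i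
  proof -
    let ?k = "i div D"
    have k: "?k < n" "i < n * D"
      using i div_less by (simp_all add: mdim_P)
    interpret chart M "fst (c ?k)" "snd (c ?k)" using chart_c[OF k(1)] .
    have "continuous_map (subtopology (mtop P) V) (mtop M) (\<lambda>m. m ?k)"
      unfolding mtop_P by (intro continuous_map_from_subtopology continuous_map_product_projection) (use k in auto)
    moreover have "m ?k \<in> fst (c ?k)" if "m \<in> V" for m
      using that k by (auto simp: V_eq)
    ultimately have "continuous_map (subtopology (mtop P) V) (subtopology (mtop M) (fst (c ?k))) (\<lambda>m. m ?k)"
      by (auto simp: continuous_map_in_subtopology)
    moreover have "continuous_map (subtopology (mtop M) (fst (c ?k))) (Euclidean_space D) (snd (c ?k))"
      using homeomorphic_imp_continuous_map[OF chart_homeo] by (simp add: continuous_map_in_subtopology)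
    ultimately have "continuous_map (subtopology (mtop P) V) euclideanreal
        ((\<lambda>x. x (i mod D)) \<circ> (snd (c ?k) \<circ> (\<lambda>m. m ?k)))"
      by (intro continuous_map_compose[OF _ continuous_map_Euclidean_coord] continuous_map_compose)
    then show ?thesis
      using k by (simp add: comp_def \<xi>_eq)
  qed
  have "continuous_map (subtopology (Euclidean_space (mdim P)) (\<xi> ` V)) (mtop M)
      (\<lambda>x. inv_into (fst (c k)) (snd (c k)) (blk k x))" if k: "k < n" for k
  proof -
    interpret chart M "fst (c k)" "snd (c k)" using chart_c[OF k] .
    have "continuous_map (subtopology (Euclidean_space (mdim P)) (\<xi> ` V))
        (subtopology (Euclidean_space D) (snd (c k) ` fst (c k))) (blk k)"
      using k image_\<xi> by (auto simp: continuous_map_in_subtopology intro!: continuous_map_from_subtopology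
          continuous_map_block)
    from continuous_map_compose[OF this continuous_chart_inv] show ?thesis
      by (simp add: comp_def)
  qed
  then show "continuous_map (subtopology (Euclidean_space (mdim P)) (\<xi> ` V)) (mtop P) \<kappa>"
    unfolding mtop_P continuous_map_componentwise by (auto simp: \<kappa>_def)
qed (rule \<xi>_espace \<kappa>_\<xi>, assumption?)+

lemma image_open_subset:
  assumes "openin (mtop P) W" "W \<subseteq> V"
  shows "openin (Euclidean_space (mdim P)) (\<xi> ` W)"
proof -
  have "openin (subtopology (mtop P) V) W"
    using assms by (auto simp: openin_subtopology)
  then have "openin (subtopology (Euclidean_space (mdim P)) (\<xi> ` V)) (\<xi> ` W)"
    using homeomorphic_imp_open_map[OF homeo] by (simp add: open_map_def)
  then show ?thesis
    using image_open openin_trans_full by blast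
qed

end

lemma atlas_PE:
  assumes "w \<in> atlas P"
  obtains c where "c \<in> {..<n} \<rightarrow> atlas M" "w = power_chart D n c"
  using assms unfolding atlas_P by blast

lemma atlas_cover:
  assumes "m \<in> topspace (mtop P)"
  obtains c where "c \<in> {..<n} \<rightarrow> atlas M" "m \<in> V c"
proof -
  have "\<exists>w\<in>atlas M. m k \<in> fst w" if "k < n" for k
  proof -
    have "m k \<in> topspace (mtop M)"
      using assms that by (auto simp: top_P)
    then show ?thesis
      using M by (auto simp: smooth_atlas_def)
  qed
  then obtain c where c: "\<And>k. k < n \<Longrightarrow> c k \<in> atlas M \<and> m k \<in> fst (c k)"
    by metis
  then have "c \<in> {..<n} \<rightarrow> atlas M" by auto
  moreover have "m \<in> V c"
    using c assms by (auto simp: V_eq[OF calculation] top_P)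
  ultimately show thesis by (rule that)
qed

lemma smooth_atlas_P: "smooth_atlas P"
  unfolding smooth_atlas_def
proof (intro conjI ballI, goal_cases)
  case 1
  show ?case
  proof
    show "\<Union> (fst ` atlas P) \<subseteq> topspace (mtop P)"
    proof (intro Union_least, clarify)
      fix W \<psi> m assume "(W, \<psi>) \<in> atlas P" "m \<in> fst (W, \<psi>)"
      then obtain c where "c \<in> {..<n} \<rightarrow> atlas M" "m \<in> V c"
        by (metis atlas_PE)
      then show "m \<in> topspace (mtop P)"
        using openin_subset[OF V_open] by blast
    qed
    show "topspace (mtop P) \<subseteq> \<Union> (fst ` atlas P)"
    proof
      fix m assume "m \<in> topspace (mtop P)"
      then obtain c where "c \<in> {..<n} \<rightarrow> atlas M" "m \<in> V c"
        by (rule atlas_cover)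
      then show "m \<in> \<Union> (fst ` atlas P)"
        unfolding atlas_P by blast
    qed
  qed
next
  case (2 w)
  then obtain c where "c \<in> {..<n} \<rightarrow> atlas M" "w = power_chart D n c"
    by (rule atlas_PE)
  then show ?case
    using V_open image_open homeo by (simp add: case_prod_beta)
next
  case (3 w)
  then obtain c where c: "c \<in> {..<n} \<rightarrow> atlas M" "w = power_chart D n c"
    by (rule atlas_PE)
  have "smooth_real_on (mdim P) (\<xi> c ` (V c \<inter> V e)) (\<lambda>x. \<xi> e (inv_into (V c) (\<xi> c) x) i)"
    if e: "e \<in> {..<n} \<rightarrow> atlas M" and i: "i < mdim P" for e i
  proof -
    let ?k = "i div D"
    have k: "?k < n" "i < n * D" "i mod D < D"
      using i div_less mod_less by (simp_all add: mdim_P)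
    interpret chart M "fst (c ?k)" "snd (c ?k)" using chart_c[OF c(1) k(1)] .
    have im: "openin (Euclidean_space (mdim P)) (\<xi> c ` (V c \<inter> V e))"
      by (intro image_open_subset[OF c(1)] openin_Int V_open c(1) e) auto
    have ek: "(fst (e ?k), snd (e ?k)) \<in> atlas M"
      using e k by auto
    have mk: "m ?k \<in> fst (c ?k) \<inter> fst (e ?k)" if "m \<in> V c \<inter> V e" for m
      using that k by (auto simp: V_eq[OF c(1)] V_eq[OF e])
    have "smooth_real_on (mdim P) (\<xi> c ` (V c \<inter> V e))
        (\<lambda>x. snd (e ?k) (inv_into (fst (c ?k)) (snd (c ?k)) (blk ?k x)) (i mod D))"
    proof (rule smooth_compose[OF smooth_transition[OF ek k(3)] im])
      show "blk ?k y \<in> snd (c ?k) ` (fst (c ?k) \<inter> fst (e ?k))" if "y \<in> \<xi> c ` (V c \<inter> V e)" for y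
        using that mk blk_\<xi>[OF c(1) _ k(1)] by auto
      show "smooth_real_on (mdim P) (\<xi> c ` (V c \<inter> V e)) (\<lambda>y. blk ?k y l)" if "l < D" for l
        using that by (simp add: block_def smooth_coord[OF im])
    qed
    then show ?thesis
    proof (rule smooth_cong_imp)
      fix x assume "x \<in> \<xi> c ` (V c \<inter> V e)"
      then obtain m where m: "m \<in> V c \<inter> V e" "x = \<xi> c m" by blast
      then show "snd (e ?k) (inv_into (fst (c ?k)) (snd (c ?k)) (blk ?k x)) (i mod D) =
          \<xi> e (inv_into (V c) (\<xi> c) x) i"
        using mk[OF m(1)] blk_\<xi>[OF c(1) _ k(1), of m] inv_\<xi>[OF c(1), of m] k
        by (simp add: \<xi>_eq[OF e] chart_inv)
    qed
  qed
  moreover have "\<exists>e. e \<in> {..<n} \<rightarrow> atlas M \<and> u = power_chart D n e" if "u \<in> atlas P" for u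
    using that by (blast elim: atlas_PE)
  ultimately show ?case
    unfolding c(2) case_prod_beta by metis
qed

lemma smooth_proj:
  assumes k: "k < n"
  shows "smooth_map_on P M (topspace (mtop P)) (\<lambda>m. m k)"
  unfolding smooth_map_on_def
proof (intro conjI ballI openin_topspace, goal_cases)
  case 1
  show ?case
    unfolding mtop_P by (intro continuous_map_from_subtopology continuous_map_product_projection) (use k in auto)
next
  case (2 w)
  obtain W \<psi> where w: "w = (W, \<psi>)" by fastforce
  interpret W: chart M W \<psi> using M 2 w by unfold_locales auto
  have "smooth_fun_on P (topspace (mtop P) \<inter> (\<lambda>m. m k) -` W) (\<lambda>m. \<psi> (m k) i)" if i: "i < D" for i
  proof (rule smooth_fun_onI[OF smooth_atlas_P])
    have "continuous_map (mtop P) (mtop M) (\<lambda>m. m k)"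
      unfolding mtop_P by (intro continuous_map_product_projection) (use k in auto)
    from openin_continuous_map_preimage[OF this W.chart_open]
    show "openin (mtop P) (topspace (mtop P) \<inter> (\<lambda>m. m k) -` W)"
      by (simp add: Int_def vimage_def)
    fix m assume m: "m \<in> topspace (mtop P) \<inter> (\<lambda>m. m k) -` W"
    then have "m \<in> topspace (mtop P)" by simp
    then obtain c0 where c0: "c0 \<in> {..<n} \<rightarrow> atlas M" "m \<in> V c0"
      by (rule atlas_cover)
    \<comment> \<open>A chart around \<open>m\<close> with the prescribed chart in factor
      \<open>k\<close>; in it the function is the coordinate \<open>k * D + i\<close>.\<close>
    define c where "c = c0(k := (W, \<psi>))"
    have c: "c \<in> {..<n} \<rightarrow> atlas M"
      using c0(1) 2 w by (auto simp: c_def)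
    have mV: "m \<in> V c"
    proof -
      have "m j \<in> fst (c j)" if "j < n" for j
        using c0(2) m that by (auto simp: V_eq[OF c0(1)] c_def)
      then show ?thesis
        using c0(2) by (simp add: V_eq[OF c] V_eq[OF c0(1)] PiE_iff)
    qed
    have "\<psi> (inv_into (V c) (\<xi> c) x k) i = x (k * D + i)" if x: "x \<in> \<xi> c ` V c" for x
    proof -
      obtain m' where m': "m' \<in> V c" "x = \<xi> c m'" using x by blast
      show ?thesis
        using m' inv_\<xi>[OF c m'(1)] index_less[OF k i] index_eq[OF i, of k]
        by (simp add: \<xi>_eq[OF c]) (simp add: c_def)
    qed
    then have "smooth_real_on (mdim P) (\<xi> c ` V c) (\<lambda>x. \<psi> (inv_into (V c) (\<xi> c) x k) i)"
      using smooth_cong_imp[OF smooth_coord[OF image_open[OF c], of "k * D + i"]] by simp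
    moreover have "(V c, \<xi> c) \<in> atlas P"
      using c unfolding atlas_P by auto
    ultimately show "\<exists>V \<phi> S. (V, \<phi>) \<in> atlas P \<and> m \<in> V \<and> \<phi> m \<in> S \<and>
        smooth_real_on (mdim P) S (\<lambda>x. \<psi> (inv_into V \<phi> x k) i)"
      using mV by (intro exI[of _ "V c"] exI[of _ "\<xi> c"] exI[of _ "\<xi> c ` V c"]) auto
  qed
  then show ?case
    using w by simp
qed

text \<open>Continuity into the product topology and the coordinates of a power chart are both
  componentwise; \<open>ext\<close> makes \<open>f w\<close> a point of the power.\<close>

lemma smooth_tuple:
  assumes W: "smooth_atlas W" and U: "openin (mtop W) U"
    and f: "\<And>k. k < n \<Longrightarrow> smooth_map_on W M U (\<lambda>w. f w k)"
    and ext: "\<And>w. w \<in> U \<Longrightarrow> f w \<in> extensional {..<n}"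
  shows "smooth_map_on W P U f"
  unfolding smooth_map_on_def
proof (intro conjI ballI U, goal_cases)
  case 1
  show ?case
    unfolding mtop_P continuous_map_componentwise
    using smooth_map_continuous[OF f] ext by auto
next
  case (2 w)
  then obtain c where c: "c \<in> {..<n} \<rightarrow> atlas M" "w = power_chart D n c"
    by (rule atlas_PE)
  have "openin (mtop W) {y \<in> U. \<forall>k\<in>{..<n}. f y k \<in> fst (c k)}"
  proof -
    have "openin (mtop W) {y \<in> topspace (mtop W). \<forall>k\<in>{..<n}. y \<in> U \<and> f y k \<in> fst (c k)}"
    proof (rule openin_Collect_ball_finite)
      fix k assume k: "k \<in> {..<n}"
      have "openin (mtop W) (U \<inter> (\<lambda>w. f w k) -` fst (c k))"
        using k by (intro smooth_map_preimage[OF f] chart.chart_open[OF chart_c[OF c(1)]]) auto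
      moreover have "{y \<in> topspace (mtop W). y \<in> U \<and> f y k \<in> fst (c k)} = U \<inter> (\<lambda>w. f w k) -` fst (c k)"
        using openin_subset[OF U] by auto
      ultimately show "openin (mtop W) {y \<in> topspace (mtop W). y \<in> U \<and> f y k \<in> fst (c k)}"
        by simp
    qed simp
    from openin_Int[OF U this] show ?thesis
      using openin_subset[OF U] by (auto elim!: back_subst[where P = "openin _"])
  qed
  moreover have O_eq: "U \<inter> f -` V c = {y \<in> U. \<forall>k\<in>{..<n}. f y k \<in> fst (c k)}"
    using ext by (auto simp: V_eq[OF c(1)] PiE_def Pi_def)
  ultimately have O: "openin (mtop W) (U \<inter> f -` V c)"
    by simp
  have "smooth_fun_on W (U \<inter> f -` V c) (\<lambda>y. \<xi> c (f y) i)" if i: "i < mdim P" for i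
  proof -
    let ?k = "i div D"
    have k: "?k < n" "i < n * D" "i mod D < D"
      using i div_less mod_less by (simp_all add: mdim_P)
    have "c ?k \<in> atlas M"
      using c k by auto
    then have "smooth_fun_on W (U \<inter> (\<lambda>w. f w ?k) -` fst (c ?k)) (\<lambda>y. snd (c ?k) (f y ?k) (i mod D))"
      using f[OF k(1)] k(3) by (fastforce simp: smooth_map_on_def)
    from smooth_fun_subset[OF W this _ O] show ?thesis
      using k by (auto simp: O_eq \<xi>_eq[OF c(1)])
  qed
  then show ?case
    by (simp add: c(2) case_prod_beta)
qed

end

section \<open>Local structure of symplectic forms\<close>

subsection \<open>Coordinate expressions\<close>

text \<open>Seen in any other chart, the map is \<open>h\<close> followed by a transition
  map.\<close>

lemma smooth_map_into_chart:
  assumes W: "smooth_atlas W" and M: "smooth_atlas M" and V: "(V, \<phi>) \<in> atlas M"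
    and U: "openin (mtop W) U" and h: "\<And>w. w \<in> U \<Longrightarrow> h w \<in> \<phi> ` V"
      "\<And>l. l < mdim M \<Longrightarrow> smooth_fun_on W U (\<lambda>w. h w l)"
    and hc: "\<And>l. l < mdim M \<Longrightarrow> continuous_map (subtopology (mtop W) U) euclideanreal (\<lambda>w. h w l)"
  shows "smooth_map_on W M U (\<lambda>w. inv_into V \<phi> (h w))"
proof -
  interpret chart M V \<phi> using M V by unfold_locales
  have cont: "continuous_map (subtopology (mtop W) U) (mtop M) (\<lambda>w. inv_into V \<phi> (h w))"
  proof -
    have "h w \<in> espace d" if "w \<in> U" for w
      using h(1)[OF that] openin_subset[OF chart_image_open] by blast
    then have "continuous_map (subtopology (mtop W) U) (Euclidean_space d) h"
      by (intro continuous_map_into_Euclidean hc) auto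
    then have "continuous_map (subtopology (mtop W) U) (subtopology (Euclidean_space d) (\<phi> ` V)) h"
      using h(1) by (auto simp: continuous_map_in_subtopology)
    from continuous_map_compose[OF this continuous_chart_inv] show ?thesis
      by (simp add: comp_def)
  qed
  show ?thesis
    unfolding smooth_map_on_def
  proof (intro conjI ballI U cont, goal_cases)
    case (1 c)
    obtain N \<psi> where c: "c = (N, \<psi>)" by fastforce
    interpret N: chart M N \<psi> using M 1 c by unfold_locales auto
    let ?O = "U \<inter> (\<lambda>w. inv_into V \<phi> (h w)) -` N"
    have "openin (subtopology (mtop W) U)
        {w \<in> topspace (subtopology (mtop W) U). inv_into V \<phi> (h w) \<in> N}"
      by (rule openin_continuous_map_preimage[OF cont N.chart_open])
    moreover have "{w \<in> topspace (subtopology (mtop W) U). inv_into V \<phi> (h w) \<in> N} = ?O"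
      using openin_subset[OF U] by auto
    ultimately have O: "openin (mtop W) ?O"
      using openin_trans_full[OF _ U] by simp
    have "smooth_fun_on W ?O (\<lambda>w. \<psi> (inv_into V \<phi> (h w)) i)" if i: "i < mdim M" for i
    proof (rule smooth_fun_compose_real[OF W _ O, where h = h and m = d and T = "\<phi> ` (V \<inter> N)"
          and f = "\<lambda>x. \<psi> (inv_into V \<phi> x) i"])
      show "smooth_real_on d (\<phi> ` (V \<inter> N)) (\<lambda>x. \<psi> (inv_into V \<phi> x) i)"
        using smooth_transition[of N \<psi> i] 1 c i by simp
      show "h w \<in> \<phi> ` (V \<inter> N)" if "w \<in> ?O" for w
      proof -
        have "h w \<in> \<phi> ` V"
          using that h(1) by blast
        then obtain q where "q \<in> V" "h w = \<phi> q"
          by blast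
        then show ?thesis
          using that chart_inv by auto
      qed
      show "smooth_fun_on W ?O (\<lambda>p. h p l)" if "l < d" for l
        by (rule smooth_fun_subset[OF W h(2)[OF that] _ O]) auto
    qed
    then show ?case
      using c by simp
  qed
qed

lemma smooth_fun_continuous:
  assumes M: "smooth_atlas M" and g: "smooth_fun_on M U g"
  shows "continuous_map (subtopology (mtop M) U) euclideanreal g"
proof -
  have U: "openin (mtop M) U"
    by (rule smooth_fun_on_open[OF g])
  have top: "topspace (subtopology (mtop M) U) = U"
    using openin_subset[OF U] by auto
  have loc: "\<exists>T. openin (subtopology (mtop M) U) T \<and> p \<in> T \<and> (\<forall>q\<in>T. g q \<in> N)"
    if p: "p \<in> U" and N: "open N" "g p \<in> N" for p N
  proof -
    obtain V \<phi> where V: "(V, \<phi>) \<in> atlas M" "p \<in> V"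
      using chart_cover[OF M] p openin_subset[OF U] by blast
    interpret chart M V \<phi> using M V by unfold_locales
    let ?S = "\<phi> ` (U \<inter> V)"
    have sm: "smooth_real_on d ?S (\<lambda>x. g (inv_into V \<phi> x))"
      by (rule smooth_fun_onD[OF g V(1)])
    have oS: "openin (Euclidean_space d) ?S"
      by (rule smooth_real_on_open[OF sm])
    have "continuous_map (subtopology (Euclidean_space d) ?S) euclideanreal (\<lambda>x. g (inv_into V \<phi> x))"
      using smooth_continuous[OF sm] continuous_map_Euclidean_iff[OF openin_subset[OF oS]] by blast
    from openin_continuous_map_preimage[OF this, of N] N(1)
    have "openin (subtopology (Euclidean_space d) ?S)
        {x \<in> topspace (subtopology (Euclidean_space d) ?S). g (inv_into V \<phi> x) \<in> N}"
      by simp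
    then have "openin (Euclidean_space d) {x \<in> topspace (subtopology (Euclidean_space d) ?S). g (inv_into V \<phi> x) \<in> N}"
      using openin_trans_full oS by blast
    then have O: "openin (mtop M) ({q \<in> V. \<phi> q \<in>
        {x \<in> topspace (subtopology (Euclidean_space d) ?S). g (inv_into V \<phi> x) \<in> N}} \<inter> U)"
      using U by (intro openin_Int chart_preimage)
    moreover have "{q \<in> V. \<phi> q \<in> {x \<in> topspace (subtopology (Euclidean_space d) ?S).
        g (inv_into V \<phi> x) \<in> N}} \<inter> U = {q \<in> U \<inter> V. g q \<in> N}"
      using chart_inv chart_espace by (auto dest: inj_onD[OF chart_inj])
    ultimately have "openin (subtopology (mtop M) U) {q \<in> U \<inter> V. g q \<in> N}"
      by (auto simp: openin_open_subtopology[OF U])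
    then show ?thesis
      using p N V(2) by (intro exI[of _ "{q \<in> U \<inter> V. g q \<in> N}"]) auto
  qed
  have "openin (subtopology (mtop M) U) {q \<in> U. g q \<in> N}" if N: "open N" for N
  proof (subst openin_subopen, intro ballI)
    fix p assume "p \<in> {q \<in> U. g q \<in> N}"
    then obtain T where T: "openin (subtopology (mtop M) U) T" "p \<in> T" "\<forall>q\<in>T. g q \<in> N"
      using loc[of p N] N by auto
    have "T \<subseteq> U"
      using openin_subset[OF T(1)] by (simp only: top)
    then show "\<exists>T. openin (subtopology (mtop M) U) T \<and> p \<in> T \<and> T \<subseteq> {q \<in> U. g q \<in> N}"
      using T by blast
  qed
  then show ?thesis
    by (simp add: continuous_map top del: topspace_subtopology)
qed

section \<open>Coordinate vectors and the form in coordinates\<close>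

context chart
begin

lemma has_partial_smooth_near:
  assumes "smooth_near M p g" "p \<in> V" "i < d"
  shows "has_partial i (\<lambda>x. g (inv_into V \<phi> x)) (partial_deriv i (\<lambda>x. g (inv_into V \<phi> x)) (\<phi> p)) (\<phi> p)"
proof -
  obtain U where U: "p \<in> U" "smooth_fun_on M U g"
    using assms(1) by (auto simp: smooth_near_def)
  show ?thesis
    by (rule smooth_has_partial[OF smooth_fun_onD[OF U(2) in_atlas] _ assms(3)]) (use U assms in auto)
qed

lemma coord_vec_tangent:
  assumes p: "p \<in> V" and i: "i < d"
  shows "coord_vec M V \<phi> i p \<in> tangent_space M p"
  unfolding tangent_space_def
proof (intro CollectI conjI allI impI)
  show "coord_vec M V \<phi> i p g = 0" if "\<not> smooth_near M p g" for g
    using that by (simp add: coord_vec_def)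
next
  fix a b g h assume gh: "smooth_near M p g \<and> smooth_near M p h"
  note G = has_partial_smooth_near[OF conjunct1[OF gh] p i]
  note H = has_partial_smooth_near[OF conjunct2[OF gh] p i]
  from has_partial_add[OF has_partial_mult[OF has_partial_const G] has_partial_mult[OF has_partial_const H], of a b]
  have "partial_deriv i (\<lambda>x. a * g (inv_into V \<phi> x) + b * h (inv_into V \<phi> x)) (\<phi> p) =
      a * partial_deriv i (\<lambda>x. g (inv_into V \<phi> x)) (\<phi> p) + b * partial_deriv i (\<lambda>x. h (inv_into V \<phi> x)) (\<phi> p)"
    by (intro partial_deriv_eqI) simp
  then show "coord_vec M V \<phi> i p (\<lambda>q. a * g q + b * h q) =
      a * coord_vec M V \<phi> i p g + b * coord_vec M V \<phi> i p h"
    using gh smooth_near_add[OF M] by (simp add: coord_vec_def)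
next
  fix g h assume gh: "smooth_near M p g \<and> smooth_near M p h"
  note G = has_partial_smooth_near[OF conjunct1[OF gh] p i]
  note H = has_partial_smooth_near[OF conjunct2[OF gh] p i]
  from partial_deriv_eqI[OF has_partial_mult[OF G H]]
  show "coord_vec M V \<phi> i p (\<lambda>q. g q * h q) = g p * coord_vec M V \<phi> i p h + h p * coord_vec M V \<phi> i p g"
    using gh smooth_near_mult[OF M] by (simp add: coord_vec_def chart_inv[OF p])
qed

lemma smooth_near_coord: "p \<in> V \<Longrightarrow> i < d \<Longrightarrow> smooth_near M p (\<lambda>q. \<phi> q i)"
  unfolding smooth_near_def using smooth_chart_coord by blast

lemma coord_vec_coord:
  assumes "p \<in> V" "i < d" "j < d"
  shows "coord_vec M V \<phi> i p (\<lambda>q. \<phi> q j) = (if i = j then 1 else 0)"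
proof -
  have "has_partial i (\<lambda>x. \<phi> (inv_into V \<phi> x) j) (if i = j then 1 else 0) (\<phi> p) \<longleftrightarrow>
      has_partial i (\<lambda>x. x j) (if i = j then 1 else 0) (\<phi> p)"
    by (rule has_partial_cong[OF chart_image_open _ assms(2)]) (use assms in \<open>auto simp: chart_inv\<close>)
  then show ?thesis
    using has_partial_coord[of i j "\<phi> p"] smooth_near_coord[OF assms(1,3)]
    by (simp add: coord_vec_def partial_deriv_eqI)
qed

lemma tangent_expand:
  assumes "p \<in> V" "v \<in> tangent_space M p"
  shows "v = (\<lambda>g. \<Sum>i<d. v (\<lambda>q. \<phi> q i) * coord_vec M V \<phi> i p g)"
proof
  fix g
  interpret tangent M p v
    using M assms chart_subset by unfold_locales auto
  show "v g = (\<Sum>i<d. v (\<lambda>q. \<phi> q i) * coord_vec M V \<phi> i p g)"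
    using coordinates[OF in_atlas assms(1), of g] vanish[of g]
    by (cases "smooth_near M p g") (simp_all add: coord_vec_def)
qed

lemma tangent_chart_fun:
  assumes pV: "p \<in> V" and "v \<in> tangent_space M p" and f: "smooth_real_on d S f" "\<phi> p \<in> S" "S \<subseteq> \<phi> ` V"
  shows "v (\<lambda>q. f (\<phi> q)) = (\<Sum>i<d. v (\<lambda>q. \<phi> q i) * partial_deriv i f (\<phi> p))"
proof -
  interpret tangent M p v
    using M assms chart_subset by unfold_locales auto
  have "smooth_near M p (\<lambda>q. f (\<phi> q))"
    unfolding smooth_near_def using smooth_fun_in_chart[OF f(1)] pV f(2)
    by (intro exI[of _ "{q \<in> V. \<phi> q \<in> S}"]) auto
  moreover have "partial_deriv i (\<lambda>x. f (\<phi> (inv_into V \<phi> x))) (\<phi> p) = partial_deriv i f (\<phi> p)" if "i < d" for i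
    by (rule partial_deriv_cong[OF smooth_real_on_open[OF f(1)] f(2) that]) (use f(3) chart_inv in auto)
  ultimately show ?thesis
    using coordinates[OF in_atlas pV] by simp
qed

end

locale symplectic_chart = chart M V \<phi> for M :: "('p, 'b) symp_manifold_scheme" and V \<phi> +
  assumes symp: "symplectic_manifold M"
begin

lemma form_axioms:
  assumes "p \<in> topspace (mtop M)"
  shows "\<forall>u\<in>tangent_space M p. \<forall>v\<in>tangent_space M p. \<forall>w\<in>tangent_space M p. \<forall>a b.
      form M p (vadd (vscale a u) (vscale b v)) w = a * form M p u w + b * form M p v w"
    and "\<forall>u\<in>tangent_space M p. \<forall>v\<in>tangent_space M p. form M p u v = - form M p v u"
    and "\<forall>u\<in>tangent_space M p. (\<forall>v\<in>tangent_space M p. form M p u v = 0) \<longrightarrow> u = vzero"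
  using symp[unfolded symplectic_manifold_def Let_def, THEN conjunct2, THEN conjunct1, rule_format, OF assms]
  by - (elim conjE, assumption)+

lemma form_linear:
  assumes "p \<in> topspace (mtop M)" "u \<in> tangent_space M p" "v \<in> tangent_space M p" "w \<in> tangent_space M p"
  shows "form M p (vadd (vscale a u) (vscale b v)) w = a * form M p u w + b * form M p v w"
  using form_axioms(1)[OF assms(1)] assms by blast

lemma form_skew:
  assumes "p \<in> topspace (mtop M)" "u \<in> tangent_space M p" "v \<in> tangent_space M p"
  shows "form M p u v = - form M p v u"
  using form_axioms(2)[OF assms(1)] assms by blast

lemma form_nondegenerate:
  assumes "p \<in> topspace (mtop M)" "u \<in> tangent_space M p" "u \<noteq> vzero"
  shows "\<exists>v\<in>tangent_space M p. form M p u v \<noteq> 0"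
  using form_axioms(3)[OF assms(1)] assms by blast

lemma form_coeff_smooth:
  "i < d \<Longrightarrow> j < d \<Longrightarrow> smooth_real_on d (\<phi> ` V) (form_coeff M V \<phi> i j)"
  using symp in_atlas by (fastforce simp: symplectic_manifold_def)

lemma form_coeff_closed:
  "i < d \<Longrightarrow> j < d \<Longrightarrow> k < d \<Longrightarrow> x \<in> \<phi> ` V \<Longrightarrow>
    partial_deriv i (form_coeff M V \<phi> j k) x + partial_deriv j (form_coeff M V \<phi> k i) x
      + partial_deriv k (form_coeff M V \<phi> i j) x = 0"
  using symp in_atlas by (fastforce simp: symplectic_manifold_def)

lemma form_coeff_eq:
  "p \<in> V \<Longrightarrow> form_coeff M V \<phi> i j (\<phi> p) = form M p (coord_vec M V \<phi> i p) (coord_vec M V \<phi> j p)"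
  by (simp add: form_coeff_def chart_inv)

lemma form_coeff_skew:
  assumes "x \<in> \<phi> ` V" "i < d" "j < d"
  shows "form_coeff M V \<phi> i j x = - form_coeff M V \<phi> j i x"
proof -
  obtain p where p: "p \<in> V" "x = \<phi> p" using assms(1) by blast
  show ?thesis
    unfolding p(2) form_coeff_eq[OF p(1)]
    using p chart_subset assms by (intro form_skew coord_vec_tangent) auto
qed

text \<open>Linearity is given for combinations of two tangent vectors; finite sums follow by
  induction, the empty one being the combination of \<open>w\<close> and \<open>w\<close> with
  coefficients \<open>0\<close>.\<close>

lemma form_sum:
  assumes p: "p \<in> V" and w: "w \<in> tangent_space M p" and m: "m \<le> d"
  shows "(\<lambda>g. \<Sum>i<m. c i * coord_vec M V \<phi> i p g) \<in> tangent_space M p \<and>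
    form M p (\<lambda>g. \<Sum>i<m. c i * coord_vec M V \<phi> i p g) w = (\<Sum>i<m. c i * form M p (coord_vec M V \<phi> i p) w)"
  using m
proof (induction m)
  case 0
  have "form M p (vadd (vscale 0 w) (vscale 0 w)) w = 0"
    using form_linear[of p w w w 0 0] p w chart_subset by auto
  then show ?case
    using vzero_tangent by (simp add: vadd_def vscale_def vzero_def)
next
  case (Suc m)
  let ?s = "\<lambda>g. \<Sum>i<m. c i * coord_vec M V \<phi> i p g" and ?e = "coord_vec M V \<phi> m p"
  have s: "?s \<in> tangent_space M p" and e: "?e \<in> tangent_space M p"
    using Suc coord_vec_tangent[OF p] by auto
  have eq: "(\<lambda>g. \<Sum>i<Suc m. c i * coord_vec M V \<phi> i p g) = vadd (vscale 1 ?s) (vscale (c m) ?e)"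
    by (simp add: vadd_def vscale_def)
  have "vadd (vscale 1 ?s) (vscale (c m) ?e) \<in> tangent_space M p"
    using s e by (auto simp: tangent_space_def vadd_def vscale_def algebra_simps)
  then show ?case
    unfolding eq using form_linear[OF _ s e w, of 1 "c m"] p chart_subset Suc by auto
qed

text \<open>Linearity in the second argument is derived from linearity in the first by
  skew-symmetry.\<close>

lemma form_coords:
  assumes p: "p \<in> V" and v: "v \<in> tangent_space M p" and w: "w \<in> tangent_space M p"
  shows "form M p v w = (\<Sum>i<d. \<Sum>j<d. v (\<lambda>q. \<phi> q i) * w (\<lambda>q. \<phi> q j) * form_coeff M V \<phi> i j (\<phi> p))"
proof -
  have pt: "p \<in> topspace (mtop M)"
    using p chart_subset by auto
  have left: "form M p u u' = (\<Sum>i<d. u (\<lambda>q. \<phi> q i) * form M p (coord_vec M V \<phi> i p) u')"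
    if u: "u \<in> tangent_space M p" and u': "u' \<in> tangent_space M p" for u u'
    using form_sum[OF p u', of d "\<lambda>i. u (\<lambda>q. \<phi> q i)"] tangent_expand[OF p u] by simp
  have right: "form M p (coord_vec M V \<phi> i p) w = (\<Sum>j<d. w (\<lambda>q. \<phi> q j) * form_coeff M V \<phi> i j (\<phi> p))"
    if i: "i < d" for i
  proof -
    have e: "coord_vec M V \<phi> i p \<in> tangent_space M p"
      by (rule coord_vec_tangent[OF p i])
    have "form M p (coord_vec M V \<phi> i p) w = - form M p w (coord_vec M V \<phi> i p)"
      by (rule form_skew[OF pt e w])
    also have "\<dots> = (\<Sum>j<d. w (\<lambda>q. \<phi> q j) * - form M p (coord_vec M V \<phi> j p) (coord_vec M V \<phi> i p))"
      by (simp add: left[OF w e] sum_negf)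
    also have "\<dots> = (\<Sum>j<d. w (\<lambda>q. \<phi> q j) * form_coeff M V \<phi> i j (\<phi> p))"
    proof (intro sum.cong refl)
      fix j assume "j \<in> {..<d}"
      then show "w (\<lambda>q. \<phi> q j) * - form M p (coord_vec M V \<phi> j p) (coord_vec M V \<phi> i p) =
          w (\<lambda>q. \<phi> q j) * form_coeff M V \<phi> i j (\<phi> p)"
        using form_skew[OF pt e coord_vec_tangent[OF p, of j]] by (simp add: form_coeff_eq[OF p])
    qed
    finally show ?thesis .
  qed
  show ?thesis
    unfolding left[OF v w] by (intro sum.cong refl) (simp add: right sum_distrib_left mult.assoc)
qed

end

subsection \<open>Local exactness\<close>

text \<open>The value of \<open>da \<and> db\<close> on \<open>v\<close> and \<open>w\<close>:
  tangent vectors are derivations, so \<open>da\<close> applied to \<open>v\<close> is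
  \<open>v a\<close>.\<close>

definition wedge :: "('p \<Rightarrow> real) \<times> ('p \<Rightarrow> real) \<Rightarrow> 'p tvec \<Rightarrow> 'p tvec \<Rightarrow> real"
  where "wedge ab v w = v (fst ab) * w (snd ab) - v (snd ab) * w (fst ab)"

text \<open>Any number of terms is allowed, unlike in Darboux's theorem. Such expressions can be
  added and pulled back along smooth maps, which carries the property to products.\<close>

definition local_exact :: "('p, 'b) symp_manifold_scheme \<Rightarrow> bool"
  where "local_exact A \<longleftrightarrow> (\<forall>p\<in>topspace (mtop A). \<exists>U abs. openin (mtop A) U \<and> p \<in> U \<and>
    (\<forall>ab\<in>set abs. smooth_fun_on A U (fst ab) \<and> smooth_fun_on A U (snd ab)) \<and>
    (\<forall>q\<in>U. \<forall>v\<in>tangent_space A q. \<forall>w\<in>tangent_space A q. form A q v w = (\<Sum>ab\<leftarrow>abs. wedge ab v w)))"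

lemma symplectic_atlas: "symplectic_manifold M \<Longrightarrow> smooth_atlas M"
  unfolding symplectic_manifold_def by (rule smooth_manifold_imp_atlas) simp

text \<open>With a primitive \<open>\<eta>\<close> from the Poincare lemma, the form is the sum over
  \<open>j\<close> of \<open>d(\<eta> j) \<and> d(\<phi> j)\<close>, where \<open>\<phi> j\<close>
  is the \<open>j\<close>-th coordinate.\<close>

lemma symplectic_local_exact:
  assumes symp: "symplectic_manifold M"
  shows "local_exact M"
  unfolding local_exact_def
proof
  fix p assume "p \<in> topspace (mtop M)"
  then obtain V \<phi> where V: "(V, \<phi>) \<in> atlas M" "p \<in> V"
    using chart_cover[OF symplectic_atlas[OF symp]] by blast
  interpret symplectic_chart M V \<phi>
    using symp symplectic_atlas[OF symp] V by unfold_locales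
  obtain e where e: "e > 0" "cube d (\<phi> p) e \<subseteq> \<phi> ` V"
    using chart_image_open V(2) unfolding openin_Euclidean_iff by blast
  let ?Q = "cube d (\<phi> p) e" and ?\<omega> = "form_coeff M V \<phi>"
  obtain \<eta> where \<eta>: "\<And>j. j < d \<Longrightarrow> smooth_real_on d ?Q (\<eta> j)"
    "\<And>i j x. i < d \<Longrightarrow> j < d \<Longrightarrow> x \<in> ?Q \<Longrightarrow> ?\<omega> i j x = partial_deriv i (\<eta> j) x - partial_deriv j (\<eta> i) x"
  proof (rule poincare_cube[OF chart_espace[OF V(2)] e(1), of ?\<omega>])
    show "smooth_real_on d ?Q (?\<omega> i j)" if "i < d" "j < d" for i j
      by (rule smooth_subset[OF form_coeff_smooth[OF that] e(2) openin_cube])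
    show "?\<omega> i j x = - ?\<omega> j i x" if "i < d" "j < d" "x \<in> ?Q" for i j x
      using form_coeff_skew that e(2) by blast
    show "partial_deriv i (?\<omega> j k) x + partial_deriv j (?\<omega> k i) x + partial_deriv k (?\<omega> i j) x = 0"
      if "i < d" "j < d" "k < d" "x \<in> ?Q" for i j k x
      by (rule form_coeff_closed[OF that(1-3)]) (use that(4) e(2) in blast)
  qed (rule that)
  let ?U = "{q \<in> V. \<phi> q \<in> ?Q}"
  define abs where "abs = map (\<lambda>j. (\<lambda>q. \<eta> j (\<phi> q), \<lambda>q. \<phi> q j)) [0..<d]"
  have U: "openin (mtop M) ?U"
    by (rule chart_preimage[OF openin_cube])
  have form: "form M q v w = (\<Sum>ab\<leftarrow>abs. wedge ab v w)"
    if q: "q \<in> ?U" and v: "v \<in> tangent_space M q" and w: "w \<in> tangent_space M q" for q v w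
  proof -
    have qV: "q \<in> V" "\<phi> q \<in> ?Q" using q by auto
    have ve: "u (\<lambda>q. \<eta> j (\<phi> q)) = (\<Sum>i<d. u (\<lambda>q. \<phi> q i) * partial_deriv i (\<eta> j) (\<phi> q))"
      if "u \<in> tangent_space M q" "j < d" for u j
      by (rule tangent_chart_fun[OF qV(1) that(1) \<eta>(1)[OF that(2)] qV(2) e(2)])
    have "(\<Sum>ab\<leftarrow>abs. wedge ab v w) =
        (\<Sum>j<d. v (\<lambda>q. \<eta> j (\<phi> q)) * w (\<lambda>q. \<phi> q j) - v (\<lambda>q. \<phi> q j) * w (\<lambda>q. \<eta> j (\<phi> q)))"
      by (simp add: abs_def comp_def wedge_def interv_sum_list_conv_sum_set_nat atLeast0LessThan)
    also have "\<dots> = (\<Sum>j<d. \<Sum>i<d. v (\<lambda>q. \<phi> q i) * w (\<lambda>q. \<phi> q j) * partial_deriv i (\<eta> j) (\<phi> q)) -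
        (\<Sum>j<d. \<Sum>i<d. v (\<lambda>q. \<phi> q j) * w (\<lambda>q. \<phi> q i) * partial_deriv i (\<eta> j) (\<phi> q))"
      by (simp add: ve[OF v] ve[OF w] sum_subtractf sum_distrib_left sum_distrib_right mult_ac)
    also have "(\<Sum>j<d. \<Sum>i<d. v (\<lambda>q. \<phi> q i) * w (\<lambda>q. \<phi> q j) * partial_deriv i (\<eta> j) (\<phi> q)) =
        (\<Sum>i<d. \<Sum>j<d. v (\<lambda>q. \<phi> q i) * w (\<lambda>q. \<phi> q j) * partial_deriv i (\<eta> j) (\<phi> q))"
      by (rule sum.swap)
    also have "\<dots> - (\<Sum>i<d. \<Sum>j<d. v (\<lambda>q. \<phi> q i) * w (\<lambda>q. \<phi> q j) * partial_deriv j (\<eta> i) (\<phi> q)) =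
        (\<Sum>i<d. \<Sum>j<d. v (\<lambda>q. \<phi> q i) * w (\<lambda>q. \<phi> q j) * ?\<omega> i j (\<phi> q))"
      unfolding sum_subtractf[symmetric] right_diff_distrib[symmetric]
      by (intro sum.cong refl) (simp add: \<eta>(2) qV)
    also have "\<dots> = form M q v w"
      by (rule form_coords[OF qV(1) v w, symmetric])
    finally show ?thesis by simp
  qed
  have "smooth_fun_on M ?U (fst ab) \<and> smooth_fun_on M ?U (snd ab)" if "ab \<in> set abs" for ab
  proof -
    obtain j where j: "j < d" "ab = (\<lambda>q. \<eta> j (\<phi> q), \<lambda>q. \<phi> q j)"
      using \<open>ab \<in> set abs\<close> by (auto simp: abs_def)
    then show ?thesis
      using smooth_fun_in_chart[OF \<eta>(1)[OF j(1)]] smooth_fun_subset[OF M smooth_chart_coord[OF j(1)] _ U]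
      by auto
  qed
  moreover have "p \<in> ?U"
    using V(2) cube_center[OF chart_espace[OF V(2)] e(1)] by simp
  ultimately show "\<exists>U abs. openin (mtop M) U \<and> p \<in> U \<and>
    (\<forall>ab\<in>set abs. smooth_fun_on M U (fst ab) \<and> smooth_fun_on M U (snd ab)) \<and>
    (\<forall>q\<in>U. \<forall>v\<in>tangent_space M q. \<forall>w\<in>tangent_space M q. form M q v w = (\<Sum>ab\<leftarrow>abs. wedge ab v w))"
    using U form by blast
qed

text \<open>Every \<open>wedge\<close> term vanishes on \<open>vzero\<close>. This is how constant
  maps come to contribute nothing to a pulled-back form.\<close>

lemma local_exact_vzero:
  assumes "local_exact A" "p \<in> topspace (mtop A)" "w \<in> tangent_space A p"
  shows "form A p vzero w = 0" "form A p w vzero = 0"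
proof -
  obtain U abs where "p \<in> U" "\<And>v w. v \<in> tangent_space A p \<Longrightarrow> w \<in> tangent_space A p \<Longrightarrow>
      form A p v w = (\<Sum>ab\<leftarrow>abs. wedge ab v w)"
    using assms(1,2) unfolding local_exact_def by meson
  then show "form A p vzero w = 0" "form A p w vzero = 0"
    using assms(3) vzero_tangent[of A p] by (simp_all add: wedge_def vzero_def sum_list_0)
qed

subsection \<open>Symplectic planes\<close>

definition euclid :: "nat \<Rightarrow> (nat \<Rightarrow> real) manifold"
  where "euclid n = \<lparr>mtop = Euclidean_space n, mdim = n, atlas = {(espace n, \<lambda>x. x)}\<rparr>"

lemma inv_into_ident: "x \<in> S \<Longrightarrow> inv_into S (\<lambda>x. x) x = x"
  by (simp add: inv_into_f_f inj_on_def)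

lemma euclid_atlas: "smooth_atlas (euclid n)"
proof -
  have "homeomorphic_map (Euclidean_space n) (Euclidean_space n) (\<lambda>x. x)"
    by (simp add: homeomorphic_map_id[unfolded id_def])
  moreover have "smooth_real_on n (espace n) (\<lambda>x. inv_into (espace n) (\<lambda>x. x) x i)" for i
    by (rule smooth_cong_imp[OF smooth_coord[OF openin_topspace, of n i]]) (simp add: inv_into_ident)
  ultimately show ?thesis
    by (simp add: smooth_atlas_def euclid_def)
qed

lemma euclid_smooth_fun: "smooth_fun_on (euclid n) U g \<longleftrightarrow> smooth_real_on n U g"
proof (cases "openin (Euclidean_space n) U")
  case True
  then have "U \<inter> espace n = U"
    using openin_subset by blast
  moreover have "smooth_real_on n U (\<lambda>x. g (inv_into (espace n) (\<lambda>x. x) x)) \<longleftrightarrow> smooth_real_on n U g"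
    using openin_subset[OF True] by (intro smooth_cong) (auto simp: inv_into_ident)
  ultimately show ?thesis
    using True by (simp add: smooth_fun_on_def euclid_def)
next
  case False
  then show ?thesis
    by (auto simp: smooth_fun_on_def euclid_def smooth_real_on_def)
qed

lemma euclid_sel [simp]: "mtop (euclid n) = Euclidean_space n" "mdim (euclid n) = n"
  by (simp_all add: euclid_def)

lemma smooth_map_into_euclid:
  assumes W: "smooth_atlas W" and U: "openin (mtop W) U" and h: "\<And>w. w \<in> U \<Longrightarrow> h w \<in> espace n"
    "\<And>l. l < n \<Longrightarrow> smooth_fun_on W U (\<lambda>w. h w l)"
  shows "smooth_map_on W (euclid n) U h"
proof (rule smooth_map_cong[OF W])
  show "smooth_map_on W (euclid n) U (\<lambda>w. inv_into (espace n) (\<lambda>x. x) (h w))"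
    by (rule smooth_map_into_chart[OF W euclid_atlas _ U])
      (use h smooth_fun_continuous[OF W] in \<open>auto simp: euclid_def\<close>)
  show "inv_into (espace n) (\<lambda>x. x) (h w) = h w" if "w \<in> U" for w
    by (rule inv_into_ident[OF h(1)[OF that]])
qed

lemma euclid_smooth_near:
  "x \<in> S \<Longrightarrow> smooth_real_on n S f \<Longrightarrow> smooth_near (euclid n) x f"
  unfolding smooth_near_def using euclid_smooth_fun by blast

lemma euclid_tangent_fun:
  assumes "x \<in> S" "v \<in> tangent_space (euclid n) x" "smooth_real_on n S f"
  shows "v f = (\<Sum>i<n. v (\<lambda>x. x i) * partial_deriv i f x)"
proof -
  have sub: "S \<subseteq> espace n"
    using openin_subset[OF smooth_real_on_open[OF assms(3)]] .
  interpret chart "euclid n" "espace n" "\<lambda>x. x"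
    using euclid_atlas by unfold_locales (auto simp: euclid_def)
  have "v (\<lambda>q. f q) = (\<Sum>i<d. v (\<lambda>q. q i) * partial_deriv i f x)"
    by (rule tangent_chart_fun[where S = S]) (use assms sub in auto)
  then show ?thesis by simp
qed

text \<open>The pull-back is \<open>dx \<and> dy\<close> itself and not a multiple of it by a
  function, so that composing with a map \<open>(f, g)\<close> into the square pulls the form of
  \<open>A\<close> back to \<open>df \<and> dg\<close>.\<close>

definition has_plane :: "('p, 'b) symp_manifold_scheme \<Rightarrow> bool"
  where "has_plane A \<longleftrightarrow> (\<exists>e q. e > 0 \<and> smooth_map_on (euclid 2) A (cube 2 (\<lambda>i. 0) e) q \<and>
    (\<forall>x\<in>cube 2 (\<lambda>i. 0) e. \<forall>v\<in>tangent_space (euclid 2) x. \<forall>w\<in>tangent_space (euclid 2) x.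
      form A (q x) (tmap A q x v) (tmap A q x w) = wedge (\<lambda>x. x 0, \<lambda>x. x 1) v w))"

definition zero_form :: "('p, 'b) symp_manifold_scheme \<Rightarrow> bool"
  where "zero_form A \<longleftrightarrow> (\<forall>p\<in>topspace (mtop A). \<forall>v\<in>tangent_space A p. \<forall>w\<in>tangent_space A p. form A p v w = 0)"

text \<open>In positive dimension nondegeneracy makes some coefficient of the form nonzero at
  \<open>\<phi> p\<close>, and positive after a possible exchange of \<open>i\<close> and
  \<open>j\<close>. The coordinate plane in directions \<open>i\<close> and \<open>j\<close> then
  carries \<open>a dx \<and> dy\<close> with \<open>a \<ge> c > 0\<close>. Replacing the first
  parameter by \<open>s\<close> with \<open>a (pt2 (s x) (x 1)) * partial_deriv 0 s x = 1\<close>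
  normalises the coefficient to \<open>1\<close>.\<close>

lemma symplectic_plane_or_zero:
  assumes symp: "symplectic_manifold M"
  shows "has_plane M \<or> zero_form M"
proof (cases "mdim M = 0")
  case True
  have "form M p v w = 0" if p: "p \<in> topspace (mtop M)" and v: "v \<in> tangent_space M p" and w: "w \<in> tangent_space M p" for p v w
  proof -
    obtain V \<phi> where V: "(V, \<phi>) \<in> atlas M" "p \<in> V"
      using chart_cover[OF symplectic_atlas[OF symp] p] .
    interpret symplectic_chart M V \<phi>
      using symp symplectic_atlas[OF symp] V by unfold_locales
    show ?thesis
      using form_coords[OF V(2) v w] True by simp
  qed
  then show ?thesis
    by (simp add: zero_form_def)
next
  case False
  have "topspace (mtop M) \<noteq> {}"
    using symp unfolding symplectic_manifold_def smooth_manifold_def by (elim conjE)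
  then obtain p where "p \<in> topspace (mtop M)"
    by blast
  then obtain V \<phi> where V: "(V, \<phi>) \<in> atlas M" "p \<in> V"
    using chart_cover[OF symplectic_atlas[OF symp]] by blast
  interpret symplectic_chart M V \<phi>
    using symp symplectic_atlas[OF symp] V by unfold_locales
  let ?\<omega> = "form_coeff M V \<phi>" and ?z = "\<phi> p"
  have z: "?z \<in> espace d" "?z \<in> \<phi> ` V"
    using chart_espace V(2) by auto
  have "\<exists>i j. i < d \<and> j < d \<and> ?\<omega> i j ?z \<noteq> 0"
  proof -
    have e0: "coord_vec M V \<phi> 0 p \<in> tangent_space M p"
      using coord_vec_tangent[OF V(2)] False by simp
    have "coord_vec M V \<phi> 0 p \<noteq> vzero"
      using coord_vec_coord[OF V(2), of 0 0] False by (auto simp: vzero_def)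
    then obtain w where w: "w \<in> tangent_space M p" "form M p (coord_vec M V \<phi> 0 p) w \<noteq> 0"
      using form_nondegenerate[OF _ e0] V(2) chart_subset by blast
    have "\<exists>i\<in>{..<d}. \<exists>j\<in>{..<d}. coord_vec M V \<phi> 0 p (\<lambda>q. \<phi> q i) * w (\<lambda>q. \<phi> q j) * ?\<omega> i j ?z \<noteq> 0"
      using w(2) unfolding form_coords[OF V(2) e0 w(1)] by (meson sum.neutral)
    then show ?thesis
      by auto
  qed
  then obtain i j where ij: "i < d" "j < d" "?\<omega> i j ?z > 0"
    using form_coeff_skew[OF z(2)] by (metis linorder_neqE_linordered_idom neg_0_less_iff_less)
  have neq: "i \<noteq> j"
    using form_coeff_skew[OF z(2) ij(1,1)] ij(3) by auto
  have diag: "?\<omega> l l x = 0" if "x \<in> \<phi> ` V" "l < d" for l x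
    using form_coeff_skew[OF that(1) that(2) that(2)] by simp
  define pt where "pt = (\<lambda>u v. ?z(i := ?z i + u, j := ?z j + v :: real))"
  \<comment> \<open>Half the value at the centre: by continuity the coefficient does not fall below
    it on a small cube.\<close>
  define c where "c = ?\<omega> i j ?z / 2"
  have c: "c > 0"
    using ij by (simp add: c_def)
  obtain e0 where e0: "e0 > 0" "cube d ?z e0 \<subseteq> \<phi> ` V"
    using chart_image_open z(2) unfolding openin_Euclidean_iff by blast
  have cont: "continuous_on (\<phi> ` V) (?\<omega> i j)"
    by (rule smooth_continuous[OF form_coeff_smooth[OF ij(1,2)]])
  then obtain e1 where e1: "e1 > 0" "\<And>y. y \<in> \<phi> ` V \<inter> cube d ?z e1 \<Longrightarrow> \<bar>?\<omega> i j y - ?\<omega> i j ?z\<bar> < c"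
    using continuous_on_cube_iff[OF openin_subset[OF chart_image_open]] z(2) c by meson
  define e where "e = min e0 e1"
  have e: "e > 0" "cube d ?z e \<subseteq> \<phi> ` V" "\<And>y. y \<in> cube d ?z e \<Longrightarrow> ?\<omega> i j y \<ge> c"
  proof -
    show "e > 0" using e0 e1 by (simp add: e_def)
    show sub: "cube d ?z e \<subseteq> \<phi> ` V"
      using e0(2) cube_mono[of e e0 d ?z] by (auto simp: e_def)
    show "?\<omega> i j y \<ge> c" if "y \<in> cube d ?z e" for y
    proof -
      have "y \<in> \<phi> ` V \<inter> cube d ?z e1"
        using that sub cube_mono[of e e1 d ?z] by (auto simp: e_def)
      then have "\<bar>?\<omega> i j y - ?\<omega> i j ?z\<bar> < c"
        by (rule e1(2))
      then show ?thesis
        using c_def by linarith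
    qed
  qed
  have pt_cube: "pt u v \<in> cube d ?z e" if "\<bar>u\<bar> < e" "\<bar>v\<bar> < e" for u v
    using that e(1) z(1) ij neq by (auto simp: pt_def cube_def espace_iff)
  have pt_l: "pt u v l = (if l = j then ?z j + v else if l = i then ?z i + u else ?z l)" for u v l
    by (auto simp: pt_def)
  let ?Q = "cube 2 (\<lambda>i. 0) e"
  define a where "a = (\<lambda>x :: nat \<Rightarrow> real. ?\<omega> i j (pt (x 0) (x 1)))"
  have inQ: "\<bar>x 0\<bar> < e'" "\<bar>x 1\<bar> < e'" if "x \<in> cube 2 (\<lambda>i. 0) e'" for x e'
    using that by (auto simp: cube2_iff)
  have smpt: "smooth_real_on 2 S (\<lambda>x. pt (f x) (x 1) l)" if "smooth_real_on 2 S f" for S f l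
  proof -
    have S: "openin (Euclidean_space 2) S"
      by (rule smooth_real_on_open[OF that])
    show ?thesis
      using smooth_add[OF smooth_const[OF S] smooth_coord[OF S]] smooth_add[OF smooth_const[OF S] that]
        smooth_const[OF S] by (cases "l = j"; cases "l = i") (simp_all add: pt_l)
  qed
  have sma: "smooth_real_on 2 ?Q a"
    unfolding a_def
  proof (rule smooth_compose[where f = "?\<omega> i j" and T = "cube d ?z e" and m = d])
    show "smooth_real_on d (cube d ?z e) (?\<omega> i j)"
      by (rule smooth_subset[OF form_coeff_smooth[OF ij(1,2)] e(2) openin_cube])
    show "smooth_real_on 2 ?Q (\<lambda>x. pt (x 0) (x 1) l)" for l
      by (rule smpt) (rule smooth_coord[OF openin_cube])
  qed (use pt_cube inQ openin_cube in auto)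
  obtain r s where r: "r > 0" "r \<le> e" and sms: "smooth_real_on 2 (cube 2 (\<lambda>i. 0) r) s"
    and s: "\<And>x. x \<in> cube 2 (\<lambda>i. 0) r \<Longrightarrow> \<bar>s x\<bar> < e"
      "\<And>x. x \<in> cube 2 (\<lambda>i. 0) r \<Longrightarrow> a (pt2 (s x) (x 1)) * partial_deriv 0 s x = 1"
    using ex_inverse_of_primitive[OF e(1) c sma] e(3) pt_cube inQ by (metis a_def)
  let ?P = "cube 2 (\<lambda>i. 0) r"
  define q where "q = (\<lambda>x. inv_into V \<phi> (pt (s x) (x 1)))"
  have ptV: "pt (s x) (x 1) \<in> cube d ?z e" if "x \<in> ?P" for x
    using pt_cube s(1)[OF that] inQ(2)[OF that] r by auto
  have qV: "q x \<in> V" "\<phi> (q x) = pt (s x) (x 1)" if "x \<in> ?P" for x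
    using ptV[OF that] e(2) by (auto simp: q_def inv_into_into f_inv_into_f subset_iff)
  have smq: "smooth_map_on (euclid 2) M ?P q"
    unfolding q_def
  proof (rule smooth_map_into_chart[OF euclid_atlas M in_atlas])
    show "pt (s w) (w 1) \<in> \<phi> ` V" if "w \<in> ?P" for w
      using ptV[OF that] e(2) by blast
    show l: "smooth_fun_on (euclid 2) ?P (\<lambda>w. pt (s w) (w 1) l)" for l
      unfolding euclid_smooth_fun by (rule smpt[OF sms])
    show "continuous_map (subtopology (mtop (euclid 2)) ?P) euclideanreal (\<lambda>w. pt (s w) (w 1) l)" for l
      by (rule smooth_fun_continuous[OF euclid_atlas l])
  qed (simp add: openin_cube)
  have "form M (q x) (tmap M q x v) (tmap M q x w) = wedge (\<lambda>x. x 0, \<lambda>x. x 1) v w"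
    if x: "x \<in> ?P" and v: "v \<in> tangent_space (euclid 2) x" and w: "w \<in> tangent_space (euclid 2) x" for x v w
  proof -
    have xtop: "x \<in> topspace (mtop (euclid 2))"
      using x openin_subset[OF openin_cube] by auto
    \<comment> \<open>Only components \<open>i\<close> and \<open>j\<close> of a pushed vector are
      nonzero. Component \<open>i\<close> also contains the derivative of \<open>s\<close> in the
      second direction, which cancels in the determinant below.\<close>
    have comp: "tmap M q x u (\<lambda>q. \<phi> q l) = (if l = j then u (\<lambda>x. x 1)
        else if l = i then u (\<lambda>x. x 0) * partial_deriv 0 s x + u (\<lambda>x. x 1) * partial_deriv 1 s x else 0)"
      if u: "u \<in> tangent_space (euclid 2) x" and l: "l < d" for u l
    proof -
      interpret u: tangent "euclid 2" x u
        using euclid_atlas xtop u by unfold_locales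
      have "tmap M q x u (\<lambda>q. \<phi> q l) = u (\<lambda>y. \<phi> (q y) l)"
        using smooth_near_coord[OF qV(1)[OF x] l] by (simp add: tmap_def)
      also have "\<dots> = u (\<lambda>y. pt (s y) (y 1) l)"
        by (rule u.germ_cong[of ?P]) (use x qV(2) openin_cube in auto)
      also have "\<dots> = (\<Sum>k<2. u (\<lambda>x. x k) * partial_deriv k (\<lambda>y. pt (s y) (y 1) l) x)"
        by (rule euclid_tangent_fun[OF x u smpt[OF sms]])
      also have "partial_deriv k (\<lambda>y. pt (s y) (y 1) l) x =
          (if l = j then (if k = 1 then 1 else 0) else if l = i then partial_deriv k s x else 0)" if "k < 2" for k
      proof (rule partial_deriv_eqI)
        have "has_partial k (\<lambda>y. ?z m + f y) (0 + D) x" if "has_partial k f D x" for f D m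
          by (intro has_partial_add has_partial_const that)
        then show "has_partial k (\<lambda>y. pt (s y) (y 1) l)
            (if l = j then (if k = 1 then 1 else 0) else if l = i then partial_deriv k s x else 0) x"
          unfolding pt_l using has_partial_coord[of k 1 x] has_partial_const[of k _ x]
            smooth_has_partial[OF sms x that] by auto
      qed
      then have "(\<Sum>k<2. u (\<lambda>x. x k) * partial_deriv k (\<lambda>y. pt (s y) (y 1) l) x) =
          (if l = j then u (\<lambda>x. x 1)
           else if l = i then u (\<lambda>x. x 0) * partial_deriv 0 s x + u (\<lambda>x. x 1) * partial_deriv 1 s x else 0)"
        by (simp add: sum_lessThan_2)
      finally show ?thesis .
    qed
    have T: "tmap M q x u \<in> tangent_space M (q x)" if "u \<in> tangent_space (euclid 2) x" for u
      by (rule tmap_in_tangent_space[OF euclid_atlas M smq x that])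
    let ?v = "\<lambda>l. tmap M q x v (\<lambda>q. \<phi> q l)" and ?w = "\<lambda>l. tmap M q x w (\<lambda>q. \<phi> q l)"
    have yV: "\<phi> (q x) \<in> \<phi> ` V"
      using qV(1)[OF x] by blast
    have "form M (q x) (tmap M q x v) (tmap M q x w) =
        (\<Sum>l<d. \<Sum>m<d. ?v l * ?w m * ?\<omega> l m (\<phi> (q x)))"
      by (rule form_coords[OF qV(1)[OF x] T[OF v] T[OF w]])
    also have "\<dots> = (\<Sum>l\<in>{i, j}. \<Sum>m<d. ?v l * ?w m * ?\<omega> l m (\<phi> (q x)))"
      by (rule sum.mono_neutral_right) (use ij comp[OF v] in auto)
    also have "\<dots> = (\<Sum>l\<in>{i, j}. \<Sum>m\<in>{i, j}. ?v l * ?w m * ?\<omega> l m (\<phi> (q x)))"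
      by (intro sum.cong refl sum.mono_neutral_right) (use ij comp[OF w] in auto)
    also have "\<dots> = (?v i * ?w j - ?v j * ?w i) * ?\<omega> i j (\<phi> (q x))"
      using neq diag[OF yV ij(1)] diag[OF yV ij(2)] form_coeff_skew[OF yV ij(2,1)]
      by (simp add: algebra_simps)
    also have "?v i * ?w j - ?v j * ?w i =
        partial_deriv 0 s x * (v (\<lambda>x. x 0) * w (\<lambda>x. x 1) - v (\<lambda>x. x 1) * w (\<lambda>x. x 0))"
      using neq comp[OF v ij(1)] comp[OF v ij(2)] comp[OF w ij(1)] comp[OF w ij(2)] by (simp add: algebra_simps)
    also have "?\<omega> i j (\<phi> (q x)) = a (pt2 (s x) (x 1))"
      by (simp add: a_def qV(2)[OF x])
    finally show ?thesis
      using s(2)[OF x] by (simp add: wedge_def mult_ac)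
  qed
  then have "has_plane M"
    unfolding has_plane_def using r(1) smq by blast
  then show ?thesis ..
qed

subsection \<open>Products\<close>

text \<open>Products and powers are symplectic again, but only the following weaker properties are needed.\<close>

locale tame =
  fixes A :: "('p, 'b) symp_manifold_scheme"
  assumes atlas: "smooth_atlas A" and nonempty: "topspace (mtop A) \<noteq> {}"
    and exact: "local_exact A" and plane: "has_plane A \<or> zero_form A"

lemma symplectic_tame: "symplectic_manifold M \<Longrightarrow> tame M"
  using symplectic_atlas symplectic_local_exact symplectic_plane_or_zero
  by unfold_locales (auto simp: symplectic_manifold_def smooth_manifold_def)

lemma prod_symp_sel [simp]: "mtop (prod_symp A B) = prod_topology (mtop A) (mtop B)"
  "mdim (prod_symp A B) = mdim A + mdim B" "form (prod_symp A B) = prod_form A B"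
  by (simp_all add: prod_symp_def)

lemma power_symp_sel [simp]: "mtop (power_symp M n) = product_topology (\<lambda>_. mtop M) {..<n}"
  "mdim (power_symp M n) = n * mdim M" "form (power_symp M n) = power_form M n"
  by (simp_all add: power_symp_def)

lemma prod_symp_mfd: "smooth_atlas A \<Longrightarrow> smooth_atlas B \<Longrightarrow> prod_mfd (prod_symp A B) A B"
  by unfold_locales (simp_all add: prod_symp_def)

lemma power_symp_mfd: "smooth_atlas M \<Longrightarrow> power_mfd (power_symp M n) M n"
  by unfold_locales (simp_all add: power_symp_def)

lemma tmap_apply_smooth: "smooth_near X (f p) g \<Longrightarrow> tmap X f p v g = v (\<lambda>q. g (f q))"
  by (simp add: tmap_def)

lemma pull_wedge:
  assumes "smooth_near X (f p) (fst ab)" "smooth_near X (f p) (snd ab)"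
  shows "wedge ab (tmap X f p v) (tmap X f p w) = wedge (\<lambda>q. fst ab (f q), \<lambda>q. snd ab (f q)) v w"
  using assms by (simp add: wedge_def tmap_apply_smooth)

text \<open>Stated for the pulled-back form rather than for \<open>form P\<close>, because the form
  of a product or power is a sum of such pull-backs.\<close>

lemma local_exact_pull:
  assumes P: "smooth_atlas P" and A: "smooth_atlas A" "local_exact A"
    and f: "smooth_map_on P A (topspace (mtop P)) f" and p: "p \<in> topspace (mtop P)"
  obtains U abs where "openin (mtop P) U" "p \<in> U"
    "\<And>ab. ab \<in> set abs \<Longrightarrow> smooth_fun_on P U (fst ab) \<and> smooth_fun_on P U (snd ab)"
    "\<And>q v w. q \<in> U \<Longrightarrow> v \<in> tangent_space P q \<Longrightarrow> w \<in> tangent_space P q \<Longrightarrow>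
      form A (f q) (tmap A f q v) (tmap A f q w) = (\<Sum>ab\<leftarrow>abs. wedge ab v w)"
proof -
  obtain U abs where U: "openin (mtop A) U" "f p \<in> U"
    "\<And>ab. ab \<in> set abs \<Longrightarrow> smooth_fun_on A U (fst ab) \<and> smooth_fun_on A U (snd ab)"
    "\<And>q v w. q \<in> U \<Longrightarrow> v \<in> tangent_space A q \<Longrightarrow> w \<in> tangent_space A q \<Longrightarrow>
      form A q v w = (\<Sum>ab\<leftarrow>abs. wedge ab v w)"
    using A(2) smooth_map_in_topspace[OF f p] unfolding local_exact_def by meson
  let ?U = "topspace (mtop P) \<inter> f -` U"
  show thesis
  proof (rule that[of ?U "map (\<lambda>ab. (\<lambda>q. fst ab (f q), \<lambda>q. snd ab (f q))) abs"])
    show "openin (mtop P) ?U"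
      by (rule smooth_map_preimage[OF f U(1)])
    show "p \<in> ?U"
      using p U(2) by simp
    show "smooth_fun_on P ?U (fst ab) \<and> smooth_fun_on P ?U (snd ab)"
      if "ab \<in> set (map (\<lambda>ab. (\<lambda>q. fst ab (f q), \<lambda>q. snd ab (f q))) abs)" for ab
      using that U(3) smooth_map_compose_fun[OF P A(1) f] by auto
    fix q v w assume q: "q \<in> ?U" and v: "v \<in> tangent_space P q" and w: "w \<in> tangent_space P q"
    have "form A (f q) (tmap A f q v) (tmap A f q w) = (\<Sum>ab\<leftarrow>abs. wedge ab (tmap A f q v) (tmap A f q w))"
      using q by (intro U(4) tmap_in_tangent_space[OF P A(1) f] v w) auto
    also have "\<dots> = (\<Sum>ab\<leftarrow>abs. wedge (\<lambda>q. fst ab (f q), \<lambda>q. snd ab (f q)) v w)"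
    proof (intro arg_cong[where f = sum_list] map_cong refl pull_wedge)
      fix ab assume "ab \<in> set abs"
      then have "smooth_fun_on A U (fst ab) \<and> smooth_fun_on A U (snd ab)" "f q \<in> U"
        using U(3) q by auto
      then show "smooth_near A (f q) (fst ab)" "smooth_near A (f q) (snd ab)"
        by (auto simp: smooth_near_def)
    qed
    finally show "form A (f q) (tmap A f q v) (tmap A f q w) =
        (\<Sum>ab\<leftarrow>map (\<lambda>ab. (\<lambda>q. fst ab (f q), \<lambda>q. snd ab (f q))) abs. wedge ab v w)"
      by (simp add: comp_def)
  qed
qed

text \<open>The lists for the summands are concatenated over the intersection of their
  domains.\<close>

lemma local_exact_sum:
  assumes P: "smooth_atlas P" and K: "finite K"
    and form: "\<And>q v w. q \<in> topspace (mtop P) \<Longrightarrow> v \<in> tangent_space P q \<Longrightarrow> w \<in> tangent_space P q \<Longrightarrow>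
      form P q v w = (\<Sum>k\<in>K. F k q v w)"
    and F: "\<And>k p. k \<in> K \<Longrightarrow> p \<in> topspace (mtop P) \<Longrightarrow> \<exists>U abs. openin (mtop P) U \<and> p \<in> U \<and>
      (\<forall>ab\<in>set abs. smooth_fun_on P U (fst ab) \<and> smooth_fun_on P U (snd ab)) \<and>
      (\<forall>q\<in>U. \<forall>v\<in>tangent_space P q. \<forall>w\<in>tangent_space P q. F k q v w = (\<Sum>ab\<leftarrow>abs. wedge ab v w))"
  shows "local_exact P"
  unfolding local_exact_def
proof
  fix p assume p: "p \<in> topspace (mtop P)"
  have "\<exists>U abs. openin (mtop P) U \<and> p \<in> U \<and>
      (\<forall>ab\<in>set abs. smooth_fun_on P U (fst ab) \<and> smooth_fun_on P U (snd ab)) \<and>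
      (\<forall>q\<in>U. \<forall>v\<in>tangent_space P q. \<forall>w\<in>tangent_space P q. (\<Sum>k\<in>K. F k q v w) = (\<Sum>ab\<leftarrow>abs. wedge ab v w))"
    using K F
  proof (induction K)
    case empty
    show ?case
      using p by (intro exI[of _ "topspace (mtop P)"] exI[of _ "[]"]) auto
  next
    case (insert k K)
    obtain U abs where U: "openin (mtop P) U" "p \<in> U"
      "\<And>ab. ab \<in> set abs \<Longrightarrow> smooth_fun_on P U (fst ab) \<and> smooth_fun_on P U (snd ab)"
      "\<And>q v w. q \<in> U \<Longrightarrow> v \<in> tangent_space P q \<Longrightarrow> w \<in> tangent_space P q \<Longrightarrow>
        (\<Sum>k\<in>K. F k q v w) = (\<Sum>ab\<leftarrow>abs. wedge ab v w)"
    proof -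
      have "\<exists>U abs. openin (mtop P) U \<and> p \<in> U \<and>
          (\<forall>ab\<in>set abs. smooth_fun_on P U (fst ab) \<and> smooth_fun_on P U (snd ab)) \<and>
          (\<forall>q\<in>U. \<forall>v\<in>tangent_space P q. \<forall>w\<in>tangent_space P q.
            (\<Sum>k\<in>K. F k q v w) = (\<Sum>ab\<leftarrow>abs. wedge ab v w))"
        by (rule insert.IH) (rule insert.prems, simp_all)
      then show ?thesis
        using that by blast
    qed
    obtain U' abs' where U': "openin (mtop P) U'" "p \<in> U'"
      "\<And>ab. ab \<in> set abs' \<Longrightarrow> smooth_fun_on P U' (fst ab) \<and> smooth_fun_on P U' (snd ab)"
      "\<And>q v w. q \<in> U' \<Longrightarrow> v \<in> tangent_space P q \<Longrightarrow> w \<in> tangent_space P q \<Longrightarrow>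
        F k q v w = (\<Sum>ab\<leftarrow>abs'. wedge ab v w)"
      using insert.prems[OF insertI1 p] by blast
    have O: "openin (mtop P) (U \<inter> U')"
      using U U' by auto
    show ?case
    proof (intro exI[of _ "U \<inter> U'"] exI[of _ "abs' @ abs"] conjI ballI O)
      fix ab assume "ab \<in> set (abs' @ abs)"
      then consider "ab \<in> set abs" | "ab \<in> set abs'" by auto
      then show "smooth_fun_on P (U \<inter> U') (fst ab)" "smooth_fun_on P (U \<inter> U') (snd ab)"
        using U(3) U'(3) smooth_fun_subset[OF P _ _ O] by (metis inf_le1 inf_le2)+
    qed (use U U' insert.hyps in auto)
  qed
  then show "\<exists>U abs. openin (mtop P) U \<and> p \<in> U \<and>
    (\<forall>ab\<in>set abs. smooth_fun_on P U (fst ab) \<and> smooth_fun_on P U (snd ab)) \<and>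
    (\<forall>q\<in>U. \<forall>v\<in>tangent_space P q. \<forall>w\<in>tangent_space P q. form P q v w = (\<Sum>ab\<leftarrow>abs. wedge ab v w))"
    using form openin_subset by (smt (verit, best) subset_iff)
qed

lemma has_plane_map:
  assumes A: "has_plane A" "smooth_atlas A" and P: "smooth_atlas P"
    and f: "smooth_map_on A P (topspace (mtop A)) f"
    and form: "\<And>p v w. p \<in> topspace (mtop A) \<Longrightarrow> v \<in> tangent_space A p \<Longrightarrow> w \<in> tangent_space A p \<Longrightarrow>
      form P (f p) (tmap P f p v) (tmap P f p w) = form A p v w"
  shows "has_plane P"
proof -
  obtain e q where e: "e > 0" and q: "smooth_map_on (euclid 2) A (cube 2 (\<lambda>i. 0) e) q"
    "\<And>x v w. x \<in> cube 2 (\<lambda>i. 0) e \<Longrightarrow> v \<in> tangent_space (euclid 2) x \<Longrightarrow> w \<in> tangent_space (euclid 2) x \<Longrightarrow>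
      form A (q x) (tmap A q x v) (tmap A q x w) = wedge (\<lambda>x. x 0, \<lambda>x. x 1) v w"
    using A(1) unfolding has_plane_def by blast
  have qA: "q ` cube 2 (\<lambda>i. 0) e \<subseteq> topspace (mtop A)"
    using smooth_map_in_topspace[OF q(1)] by blast
  have "smooth_map_on (euclid 2) P (cube 2 (\<lambda>i. 0) e) (\<lambda>x. f (q x))"
    by (rule smooth_map_compose[OF euclid_atlas A(2) q(1) f qA])
  moreover have "form P (f (q x)) (tmap P (\<lambda>x. f (q x)) x v) (tmap P (\<lambda>x. f (q x)) x w) =
      wedge (\<lambda>x. x 0, \<lambda>x. x 1) v w"
    if x: "x \<in> cube 2 (\<lambda>i. 0) e" and v: "v \<in> tangent_space (euclid 2) x" and w: "w \<in> tangent_space (euclid 2) x"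
    for x v w
  proof -
    have "q x \<in> topspace (mtop A)"
      using x qA by blast
    then have "tmap P (\<lambda>x. f (q x)) x u = tmap P f (q x) (tmap A q x u)" for u
      using tmap_compose[OF euclid_atlas A(2) q(1) x f _ P] by metis
    then show ?thesis
      using form tmap_in_tangent_space[OF euclid_atlas A(2) q(1) x] v w q(2)[OF x v w]
        \<open>q x \<in> topspace (mtop A)\<close> by simp
  qed
  ultimately show ?thesis
    unfolding has_plane_def using e by (intro exI[of _ e] exI[of _ "\<lambda>x. f (q x)"]) blast
qed

lemma prod_form_pull:
  assumes A: "smooth_atlas A" and B: "smooth_atlas B" and W: "smooth_atlas W"
    and f: "smooth_map_on W A U f" and g: "smooth_map_on W B U g" and y: "y \<in> U"
  shows "prod_form A B (f y, g y) (tmap (prod_symp A B) (\<lambda>w. (f w, g w)) y v)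
      (tmap (prod_symp A B) (\<lambda>w. (f w, g w)) y w) =
    form A (f y) (tmap A f y v) (tmap A f y w) + form B (g y) (tmap B g y v) (tmap B g y w)"
proof -
  interpret prod_mfd "prod_symp A B" A B by (rule prod_symp_mfd[OF A B])
  have top: "(f y, g y) \<in> topspace (mtop (prod_symp A B))"
    using smooth_map_in_topspace[OF f y] smooth_map_in_topspace[OF g y] by (simp add: top_P)
  have "tmap A fst (f y, g y) (tmap (prod_symp A B) (\<lambda>w. (f w, g w)) y u) = tmap A f y u"
    "tmap B snd (f y, g y) (tmap (prod_symp A B) (\<lambda>w. (f w, g w)) y u) = tmap B g y u" for u
    using tmap_compose[OF W smooth_atlas_P smooth_Pair[OF W f g] y smooth_fst top A, of u]
      tmap_compose[OF W smooth_atlas_P smooth_Pair[OF W f g] y smooth_snd top B, of u] by simp_all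
  then show ?thesis
    by (simp add: prod_form_def)
qed

lemma power_form_pull:
  assumes M: "smooth_atlas M" and W: "smooth_atlas W"
    and f: "\<And>k. k < n \<Longrightarrow> smooth_map_on W M U (\<lambda>w. f w k)"
    and ext: "\<And>w. w \<in> U \<Longrightarrow> f w \<in> extensional {..<n}" and y: "y \<in> U" "openin (mtop W) U"
  shows "power_form M n (f y) (tmap (power_symp M n) f y v) (tmap (power_symp M n) f y w) =
    (\<Sum>k<n. form M (f y k) (tmap M (\<lambda>w. f w k) y v) (tmap M (\<lambda>w. f w k) y w))"
proof -
  interpret power_mfd "power_symp M n" M n by (rule power_symp_mfd[OF M])
  have sm: "smooth_map_on W (power_symp M n) U f"
    by (rule smooth_tuple[OF W y(2) f ext])
  have "tmap M (\<lambda>m. m k) (f y) (tmap (power_symp M n) f y u) = tmap M (\<lambda>w. f w k) y u" if "k < n" for k u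
    by (rule tmap_compose[OF W smooth_atlas_P sm y(1) smooth_proj[OF that] smooth_map_in_topspace[OF sm y(1)] M])
  then show ?thesis
    by (simp add: power_form_def)
qed

text \<open>A plane in one factor stays a plane when it is placed at a fixed point of the other,
  because the constant component contributes the form on \<open>vzero\<close>, hence
  \<open>0\<close>. If no factor has a plane, both forms vanish and so does their sum.\<close>

lemma tame_prod:
  assumes "tame A" "tame B"
  shows "tame (prod_symp A B)"
proof -
  interpret A: tame A by (rule assms)
  interpret B: tame B by (rule assms)
  interpret prod_mfd "prod_symp A B" A B by (rule prod_symp_mfd[OF A.atlas B.atlas])
  let ?P = "prod_symp A B"
  have ne: "topspace (mtop ?P) \<noteq> {}"
    using A.nonempty B.nonempty by (simp add: top_P)
  \<comment> \<open>The two summands of \<open>prod_form\<close> are indexed by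
    \<open>bool\<close>.\<close>
  have ex: "local_exact ?P"
  proof (rule local_exact_sum[OF smooth_atlas_P, where K = "UNIV :: bool set" and
        F = "\<lambda>b q v w. if b then form A (fst q) (tmap A fst q v) (tmap A fst q w)
          else form B (snd q) (tmap B snd q v) (tmap B snd q w)"])
    fix b p assume p: "p \<in> topspace (mtop ?P)"
    show "\<exists>U abs. openin (mtop ?P) U \<and> p \<in> U \<and>
      (\<forall>ab\<in>set abs. smooth_fun_on ?P U (fst ab) \<and> smooth_fun_on ?P U (snd ab)) \<and>
      (\<forall>q\<in>U. \<forall>v\<in>tangent_space ?P q. \<forall>w\<in>tangent_space ?P q.
        (if b then form A (fst q) (tmap A fst q v) (tmap A fst q w)
          else form B (snd q) (tmap B snd q v) (tmap B snd q w)) = (\<Sum>ab\<leftarrow>abs. wedge ab v w))"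
    proof (cases b)
      case True
      then show ?thesis
        using local_exact_pull[OF smooth_atlas_P A.atlas A.exact smooth_fst p] by (smt (verit, best))
    next
      case False
      then show ?thesis
        using local_exact_pull[OF smooth_atlas_P B.atlas B.exact smooth_snd p] by (smt (verit, best))
    qed
  qed (simp_all add: prod_form_def UNIV_bool)
  have "has_plane ?P \<or> zero_form ?P"
  proof -
    obtain a b where ab: "a \<in> topspace (mtop A)" "b \<in> topspace (mtop B)"
      using A.nonempty B.nonempty by blast
    have idA: "smooth_map_on A A (topspace (mtop A)) (\<lambda>x. x)" and idB: "smooth_map_on B B (topspace (mtop B)) (\<lambda>x. x)"
      by (intro smooth_map_id A.atlas B.atlas openin_topspace)+
    have cA: "smooth_map_on A B (topspace (mtop A)) (\<lambda>x. b)" and cB: "smooth_map_on B A (topspace (mtop B)) (\<lambda>x. a)"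
      using ab by (auto intro!: smooth_map_const A.atlas B.atlas)
    consider "has_plane A" | "has_plane B" | "zero_form A" "zero_form B"
      using A.plane B.plane by blast
    then show ?thesis
    proof cases
      case 1
      have "has_plane ?P"
      proof (rule has_plane_map[OF 1 A.atlas smooth_atlas_P smooth_Pair[OF A.atlas idA cA]])
        fix p v w assume p: "p \<in> topspace (mtop A)" and v: "v \<in> tangent_space A p" and w: "w \<in> tangent_space A p"
        show "form ?P (p, b) (tmap ?P (\<lambda>w. (w, b)) p v) (tmap ?P (\<lambda>w. (w, b)) p w) = form A p v w"
          using prod_form_pull[OF A.atlas B.atlas A.atlas idA cA p, of v w]
            local_exact_vzero(1)[OF B.exact ab(2) vzero_tangent]
          by (simp add: tmap_const[OF A.atlas p v] tmap_const[OF A.atlas p w] tmap_id[OF v] tmap_id[OF w])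
      qed
      then show ?thesis ..
    next
      case 2
      have "has_plane ?P"
      proof (rule has_plane_map[OF 2 B.atlas smooth_atlas_P smooth_Pair[OF B.atlas cB idB]])
        fix p v w assume p: "p \<in> topspace (mtop B)" and v: "v \<in> tangent_space B p" and w: "w \<in> tangent_space B p"
        show "form ?P (a, p) (tmap ?P (\<lambda>w. (a, w)) p v) (tmap ?P (\<lambda>w. (a, w)) p w) = form B p v w"
          using prod_form_pull[OF A.atlas B.atlas B.atlas cB idB p, of v w]
            local_exact_vzero(1)[OF A.exact ab(1) vzero_tangent]
          by (simp add: tmap_const[OF B.atlas p v] tmap_const[OF B.atlas p w] tmap_id[OF v] tmap_id[OF w])
      qed
      then show ?thesis ..
    next
      case 3
      have "zero_form ?P"
        unfolding zero_form_def
      proof (intro ballI)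
        fix p v w assume p: "p \<in> topspace (mtop ?P)" and v: "v \<in> tangent_space ?P p" and w: "w \<in> tangent_space ?P p"
        have "fst p \<in> topspace (mtop A)" "snd p \<in> topspace (mtop B)"
          using p by (auto simp: top_P)
        moreover note tmap_in_tangent_space[OF smooth_atlas_P A.atlas smooth_fst p]
          tmap_in_tangent_space[OF smooth_atlas_P B.atlas smooth_snd p]
        ultimately show "form ?P p v w = 0"
          using 3 v w by (simp add: zero_form_def prod_form_def)
      qed
      then show ?thesis ..
    qed
  qed
  then show ?thesis
    using smooth_atlas_P ne ex by unfold_locales
qed

lemma tame_power:
  assumes "tame M"
  shows "tame (power_symp M n)"
proof -
  interpret M: tame M by (rule assms)
  interpret power_mfd "power_symp M n" M n by (rule power_symp_mfd[OF M.atlas])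
  let ?P = "power_symp M n"
  obtain p0 where p0: "p0 \<in> topspace (mtop M)"
    using M.nonempty by blast
  have ne: "topspace (mtop ?P) \<noteq> {}"
    using M.nonempty by (simp add: top_P PiE_eq_empty_iff)
  have ex: "local_exact ?P"
  proof (rule local_exact_sum[OF smooth_atlas_P, where K = "{..<n}" and
        F = "\<lambda>k q v w. form M (q k) (tmap M (\<lambda>m. m k) q v) (tmap M (\<lambda>m. m k) q w)"])
    fix k p assume "k \<in> {..<n}" and p: "p \<in> topspace (mtop ?P)"
    then show "\<exists>U abs. openin (mtop ?P) U \<and> p \<in> U \<and>
      (\<forall>ab\<in>set abs. smooth_fun_on ?P U (fst ab) \<and> smooth_fun_on ?P U (snd ab)) \<and>
      (\<forall>q\<in>U. \<forall>v\<in>tangent_space ?P q. \<forall>w\<in>tangent_space ?P q.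
        form M (q k) (tmap M (\<lambda>m. m k) q v) (tmap M (\<lambda>m. m k) q w) = (\<Sum>ab\<leftarrow>abs. wedge ab v w))"
      using local_exact_pull[OF smooth_atlas_P M.atlas M.exact smooth_proj[of k] p] by (smt (verit, best) lessThan_iff)
  qed (simp_all add: power_form_def)
  \<comment> \<open>A plane is put into factor \<open>0\<close>, with the other factors resting at
    \<open>p0\<close>. For \<open>n = 0\<close> there is no factor to hold it, but then the form is
    an empty sum.\<close>
  have "has_plane ?P \<or> zero_form ?P"
  proof (cases "n > 0 \<and> has_plane M")
    case True
    let ?f = "\<lambda>q. \<lambda>k\<in>{..<n}. if k = 0 then q else p0"
    have sm: "smooth_map_on M M (topspace (mtop M)) (\<lambda>q. ?f q k)" if "k < n" for k
      using that p0 smooth_map_id[OF M.atlas openin_topspace] smooth_map_const[OF M.atlas openin_topspace p0]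
      by (cases "k = 0") simp_all
    have ext: "?f q \<in> extensional {..<n}" for q
      by simp
    have "has_plane ?P"
    proof (rule has_plane_map[OF _ M.atlas smooth_atlas_P smooth_tuple[OF M.atlas openin_topspace sm ext]])
      fix p v w assume p: "p \<in> topspace (mtop M)" and v: "v \<in> tangent_space M p" and w: "w \<in> tangent_space M p"
      have "form M (?f p k) (tmap M (\<lambda>q. ?f q k) p v) (tmap M (\<lambda>q. ?f q k) p w) = (if k = 0 then form M p v w else 0)"
        if "k < n" for k
        using that local_exact_vzero(1)[OF M.exact p0 vzero_tangent]
        by (cases "k = 0")
          (simp_all add: tmap_id[OF v] tmap_id[OF w] tmap_const[OF M.atlas p v] tmap_const[OF M.atlas p w])
      then have "form ?P (?f p) (tmap ?P ?f p v) (tmap ?P ?f p w) = (\<Sum>k<n. if k = 0 then form M p v w else 0)"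
        using power_form_pull[OF M.atlas M.atlas sm ext p openin_topspace, of v w] by simp
      then show "form ?P (?f p) (tmap ?P ?f p v) (tmap ?P ?f p w) = form M p v w"
        using True by simp
    qed (use True in simp_all)
    then show ?thesis ..
  next
    case False
    have "power_form M n p v w = 0"
      if p: "p \<in> topspace (mtop ?P)" and v: "v \<in> tangent_space ?P p" and w: "w \<in> tangent_space ?P p" for p v w
      unfolding power_form_def
    proof (rule sum.neutral, intro ballI)
      fix k assume k: "k \<in> {..<n}"
      then have "zero_form M"
        using False M.plane by auto
      moreover have "p k \<in> topspace (mtop M)"
        using p k by (auto simp: top_P)
      moreover note tmap_in_tangent_space[OF smooth_atlas_P M.atlas smooth_proj[of k] p]
      ultimately show "form M (p k) (tmap M (\<lambda>m. m k) p v) (tmap M (\<lambda>m. m k) p w) = 0"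
        using v w k by (simp add: zero_form_def)
    qed
    then have "zero_form ?P"
      by (simp add: zero_form_def)
    then show ?thesis ..
  qed
  then show ?thesis
    using smooth_atlas_P ne ex by unfold_locales
qed

section \<open>Germs of multivalued maps\<close>

text \<open>\<open>mono\<close> is a form of functoriality: equal restrictions stay equal on smaller
  sets. It is supplied by \<open>restr_mono\<close> for plain restriction and by
  \<open>JCor_restr_mono\<close> for \<open>JCor_restr\<close>.\<close>

lemma germ_eqI:
  assumes mono: "\<And>W W' a b. W' \<subseteq> W \<Longrightarrow> r W a = r W b \<Longrightarrow> r W' a = r W' b"
    and W: "openin T W" "y \<in> W" "W \<subseteq> U \<inter> U'" "r W s = r W s'"
  shows "germ T P r U s y = germ T P r U' s' y"
proof -
  have sub: "germ T P r U s y \<subseteq> germ T P r U' s' y"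
    if W: "W \<subseteq> U \<inter> U'" "r W s = r W s'" for U U' s s'
  proof clarify
    fix V t assume "(V, t) \<in> germ T P r U s y"
    then obtain W1 where V: "openin T V" "y \<in> V" "t \<in> P V"
      and W1: "openin T W1" "y \<in> W1" "W1 \<subseteq> U \<inter> V" "r W1 s = r W1 t"
      by (auto simp: germ_def)
    have "r (W \<inter> W1) s = r (W \<inter> W1) s'" "r (W \<inter> W1) s = r (W \<inter> W1) t"
      using mono[OF _ W(2), of "W \<inter> W1"] mono[OF _ W1(4), of "W \<inter> W1"] by auto
    then have "openin T (W \<inter> W1) \<and> y \<in> W \<inter> W1 \<and> W \<inter> W1 \<subseteq> U' \<inter> V \<and> r (W \<inter> W1) s' = r (W \<inter> W1) t"
      using W W1 assms(2,3) by auto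
    then show "(V, t) \<in> germ T P r U' s' y"
      unfolding germ_def using V by blast
  qed
  show ?thesis
    by (rule equalityI[OF sub[OF W(3,4)] sub]) (use W(3,4) in auto)
qed

lemma germ_self: "openin T U \<Longrightarrow> y \<in> U \<Longrightarrow> s \<in> P U \<Longrightarrow> (U, s) \<in> germ T P r U s y"
  unfolding germ_def by blast

text \<open>A section of \<open>P\<close> belongs to its own germ; its membership in the other germ
  exhibits a common neighbourhood.\<close>

lemma germ_eqD:
  assumes "openin T U" "y \<in> U" "s \<in> P U" "germ T P r U s y = germ T P r U' s' y"
  obtains W where "openin T W" "y \<in> W" "W \<subseteq> U \<inter> U'" "r W s = r W s'"
proof -
  have "(U, s) \<in> germ T P r U' s' y"
    using germ_self[of T U y s P r, OF assms(1-3)] assms(4) by simp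
  then show thesis
    using that by (auto simp: germ_def)
qed

lemma restr_mono: "W' \<subseteq> W \<Longrightarrow> restr W a = restr W b \<Longrightarrow> restr W' a = restr W' b"
  by (metis Int_absorb1 restrict_restrict)

lemma restr_eq_iff: "restr W a = restr W b \<longleftrightarrow> (\<forall>z\<in>W. a z = b z)"
  by (metis restrict_apply' restrict_ext)

lemma germ_restr_eqI:
  assumes "openin T W" "y \<in> W" "W \<subseteq> U \<inter> U'" "\<And>z. z \<in> W \<Longrightarrow> s z = s' z"
  shows "germ T P restr U s y = germ T P restr U' s' y"
  by (rule germ_eqI[OF restr_mono assms(1-3)]) (use assms(4) in \<open>auto simp: restr_eq_iff\<close>)

lemma mval_apply: "z \<in> U \<Longrightarrow> mval U fs z = mset (map (\<lambda>f. f z) fs)"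
  by (simp add: mval_def)

text \<open>Covers symplectic, isotropic and pseudoholomorphic tuples alike.\<close>

locale tuple_sheaf =
  fixes T :: "'y topology" and adm :: "'y set \<Rightarrow> ('y \<Rightarrow> 'x) list \<Rightarrow> bool"
  assumes adm_subset: "adm U fs \<Longrightarrow> openin T U \<Longrightarrow> openin T W \<Longrightarrow> W \<subseteq> U \<Longrightarrow> adm W fs"
begin

lemma tuplesI: "adm U fs \<Longrightarrow> mval U fs \<in> tuples adm (length fs) U"
  by (auto simp: tuples_def)

lemma germ_mval_subset:
  "openin T W \<Longrightarrow> y \<in> W \<Longrightarrow> W \<subseteq> U \<Longrightarrow>
    germ T (tuples adm n) restr W (mval W fs) y = germ T (tuples adm n) restr U (mval U fs) y"
  by (rule germ_restr_eqI[where W = W]) (auto simp: mval_apply)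

lemma ncor_tuple_restr: "openin T W \<Longrightarrow> W \<subseteq> U \<Longrightarrow> restr W (ncor_tuple T adm U fs) = ncor_tuple T adm W fs"
  by (auto simp: ncor_tuple_def fun_eq_iff germ_mval_subset)

text \<open>Translates the germ condition of \<open>sheafify\<close> into tuples, the form in which
  sections are restricted, added and compared.\<close>

lemma ncors_local:
  assumes "F \<in> ncors T adm n U" "y \<in> U"
  obtains W fs where "openin T W" "y \<in> W" "W \<subseteq> U" "length fs = n" "adm W fs"
    "restr W F = ncor_tuple T adm W fs"
proof -
  obtain W s where W: "openin T W" "y \<in> W" "W \<subseteq> U" "s \<in> tuples adm n W"
    "\<forall>z\<in>W. F z = germ T (tuples adm n) restr W s z"
    using assms unfolding ncors_def sheafify_def by blast
  then obtain fs where fs: "s = mval W fs" "length fs = n" "adm W fs"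
    by (auto simp: tuples_def)
  then have "restr W F = ncor_tuple T adm W fs"
    unfolding ncor_tuple_def using W(5) by (intro restrict_ext) (simp add: fs)
  then show thesis
    using that W fs by blast
qed

lemma ncorsI:
  assumes "F \<in> extensional U"
    and "\<And>y. y \<in> U \<Longrightarrow> \<exists>W fs. openin T W \<and> y \<in> W \<and> W \<subseteq> U \<and> length fs = n \<and> adm W fs \<and>
      restr W F = ncor_tuple T adm W fs"
  shows "F \<in> ncors T adm n U"
  unfolding ncors_def sheafify_def
proof (intro CollectI conjI ballI assms(1))
  fix y assume "y \<in> U"
  then obtain W fs where W: "openin T W" "y \<in> W" "W \<subseteq> U" "length fs = n" "adm W fs"
    "restr W F = ncor_tuple T adm W fs"
    using assms(2) by blast
  have "F z = germ T (tuples adm n) restr W (mval W fs) z" if "z \<in> W" for z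
    using fun_cong[OF W(6), of z] that W(4) by (simp add: ncor_tuple_def)
  then show "\<exists>W s. openin T W \<and> y \<in> W \<and> W \<subseteq> U \<and> s \<in> tuples adm n W \<and>
      (\<forall>z\<in>W. F z = germ T (tuples adm n) restr W s z)"
    using W(1-3) tuplesI[OF W(5)] W(4) by (intro exI[of _ W] exI[of _ "mval W fs"]) simp
qed

lemma ncor_tuple_in: "openin T U \<Longrightarrow> adm U fs \<Longrightarrow> ncor_tuple T adm U fs \<in> ncors T adm (length fs) U"
proof (rule ncorsI)
  show "\<exists>W gs. openin T W \<and> y \<in> W \<and> W \<subseteq> U \<and> length gs = length fs \<and> adm W gs \<and>
      restr W (ncor_tuple T adm U fs) = ncor_tuple T adm W gs"
    if "openin T U" "adm U fs" "y \<in> U" for y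
    using that ncor_tuple_restr by (intro exI[of _ U] exI[of _ fs]) auto
qed (simp add: ncor_tuple_def)

lemma ncors_restr:
  assumes "F \<in> ncors T adm n U" "openin T W" "W \<subseteq> U"
  shows "restr W F \<in> ncors T adm n W"
proof (rule ncorsI)
  fix y assume "y \<in> W"
  then obtain V fs where V: "openin T V" "y \<in> V" "V \<subseteq> U" "length fs = n" "adm V fs"
    "restr V F = ncor_tuple T adm V fs"
    using ncors_local[OF assms(1)] assms(3) by blast
  have O: "openin T (V \<inter> W)"
    using V assms by blast
  have "restr (V \<inter> W) F = restr (V \<inter> W) (restr V F)"
    by (simp add: restrict_restrict Int_absorb1 Int_commute)
  also have "\<dots> = ncor_tuple T adm (V \<inter> W) fs"
    unfolding V(6) by (rule ncor_tuple_restr[OF O]) auto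
  finally have "restr (V \<inter> W) (restr W F) = ncor_tuple T adm (V \<inter> W) fs"
    by (simp add: restrict_restrict Int_ac)
  then show "\<exists>V fs. openin T V \<and> y \<in> V \<and> V \<subseteq> W \<and> length fs = n \<and> adm V fs \<and>
      restr V (restr W F) = ncor_tuple T adm V fs"
    using V O \<open>y \<in> W\<close> adm_subset[OF V(5,1) O] by (intro exI[of _ "V \<inter> W"] exI[of _ fs]) auto
qed simp

end

text \<open>Tuples enter through \<open>mval\<close> only, so their order is immaterial; this makes
  \<open>A + (B + H)\<close> and \<open>B + (A + H)\<close> equal.\<close>

lemma ncor_tuple_mset_cong:
  assumes "length fs = length gs" "\<And>y. y \<in> U \<Longrightarrow> mset (map (\<lambda>f. f y) fs) = mset (map (\<lambda>f. f y) gs)"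
  shows "ncor_tuple T adm U fs = ncor_tuple T adm U gs"
proof -
  have "mval U fs = mval U gs"
    using assms(2) by (auto simp: mval_def fun_eq_iff)
  then show ?thesis
    by (simp add: ncor_tuple_def assms(1))
qed

text \<open>The union in \<open>ncor_add\<close> runs over all representatives of two germs. All of
  them give the same germ and there is at least one pair, so the union is that germ. Three
  admissibility predicates occur because an isotropic section is added to a symplectic one.\<close>

lemma ncor_add_tuple:
  assumes "openin T U" "adm1 U fs" "adm2 U gs"
  shows "ncor_add T adm (length fs + length gs) U (ncor_tuple T adm1 U fs) (ncor_tuple T adm2 U gs) =
    ncor_tuple T adm U (fs @ gs)"
proof
  fix y
  show "ncor_add T adm (length fs + length gs) U (ncor_tuple T adm1 U fs) (ncor_tuple T adm2 U gs) y =
    ncor_tuple T adm U (fs @ gs) y"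
  proof (cases "y \<in> U")
    case True
    let ?n = "length fs + length gs"
    let ?A = "germ T (tuples adm1 (length fs)) restr U (mval U fs) y"
    let ?B = "germ T (tuples adm2 (length gs)) restr U (mval U gs) y"
    let ?C = "germ T (tuples adm ?n) restr U (mval U (fs @ gs)) y"
    have "(U, mval U fs) \<in> ?A" "(U, mval U gs) \<in> ?B"
      using assms True by (auto intro!: germ_self simp: tuples_def)
    moreover have "germ T (tuples adm ?n) restr (V \<inter> W) (\<lambda>z\<in>V \<inter> W. s z + t z) y = ?C"
      if st: "(V, s) \<in> ?A" "(W, t) \<in> ?B" for V s W t
    proof -
      obtain W1 where W1: "openin T W1" "y \<in> W1" "W1 \<subseteq> U \<inter> V" "restr W1 (mval U fs) = restr W1 s"
        using st(1) by (auto simp: germ_def)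
      obtain W2 where W2: "openin T W2" "y \<in> W2" "W2 \<subseteq> U \<inter> W" "restr W2 (mval U gs) = restr W2 t"
        using st(2) by (auto simp: germ_def)
      show ?thesis
      proof (rule germ_restr_eqI[where W = "W1 \<inter> W2"])
        fix z assume z: "z \<in> W1 \<inter> W2"
        then have "mval U fs z = s z" "mval U gs z = t z" "z \<in> U" "z \<in> V" "z \<in> W"
          using W1 W2 by (auto simp: restr_eq_iff)
        then show "(\<lambda>z\<in>V \<inter> W. s z + t z) z = mval U (fs @ gs) z"
          by (simp add: mval_apply)
      qed (use W1 W2 in auto)
    qed
    ultimately have "(\<Union>(V, s)\<in>?A. \<Union>(W, t)\<in>?B. germ T (tuples adm ?n) restr (V \<inter> W) (\<lambda>z\<in>V \<inter> W. s z + t z) y) = ?C"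
      by fast
    then show ?thesis
      using True by (simp add: ncor_add_def ncor_tuple_def)
  qed (simp add: ncor_add_def ncor_tuple_def)
qed

lemma ncor_add_restr:
  "W \<subseteq> U \<Longrightarrow> restr W (ncor_add T adm n U F G) = ncor_add T adm n W (restr W F) (restr W G)"
  by (auto simp: ncor_add_def fun_eq_iff)

section \<open>Symplectic correspondences have a single germ\<close>

subsection \<open>Symplectic tuples\<close>

lemma pullback_sum_append: "pullback_sum X (fs @ gs) y v w = pullback_sum X fs y v w + pullback_sum X gs y v w"
  by (simp add: pullback_sum_def)

lemma symp_tuple_subset:
  "smooth_atlas Y \<Longrightarrow> smooth_atlas X \<Longrightarrow> symp_tuple Y X U fs \<Longrightarrow> openin (mtop Y) W \<Longrightarrow> W \<subseteq> U \<Longrightarrow>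
    symp_tuple Y X W fs"
  unfolding symp_tuple_def using smooth_map_subset by blast

lemma iso_tuple_subset:
  "smooth_atlas Y \<Longrightarrow> smooth_atlas X \<Longrightarrow> iso_tuple Y X U fs \<Longrightarrow> openin (mtop Y) W \<Longrightarrow> W \<subseteq> U \<Longrightarrow>
    iso_tuple Y X W fs"
  unfolding iso_tuple_def using smooth_map_subset by blast

lemma symp_sheaf: "smooth_atlas Y \<Longrightarrow> smooth_atlas X \<Longrightarrow> tuple_sheaf (mtop Y) (symp_tuple Y X)"
  by unfold_locales (rule symp_tuple_subset)

lemma iso_sheaf: "smooth_atlas Y \<Longrightarrow> smooth_atlas X \<Longrightarrow> tuple_sheaf (mtop Y) (iso_tuple Y X)"
  by unfold_locales (rule iso_tuple_subset)

text \<open>If the form is \<open>\<Sum> da \<and> db\<close> near a point, the maps \<open>(b, a)\<close> into a symplectic plane of \<open>B\<close> pull the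
  form of \<open>B\<close> back to its negative.\<close>

lemma ex_negative_tuple:
  assumes "tame A" "tame B" and fs: "symp_tuple A B U fs" and U: "openin (mtop A) U" "p \<in> U"
  obtains W hs where "openin (mtop A) W" "p \<in> W" "W \<subseteq> U" "\<And>h. h \<in> set hs \<Longrightarrow> smooth_map_on A B W h"
    "\<And>y v w. y \<in> W \<Longrightarrow> v \<in> tangent_space A y \<Longrightarrow> w \<in> tangent_space A y \<Longrightarrow>
      pullback_sum B hs y v w = - form A y v w"
proof -
  interpret A: tame A by (rule assms)
  interpret B: tame B by (rule assms)
  have Usub: "U \<subseteq> topspace (mtop A)"
    using U(1) openin_subset by blast
  show thesis
  proof (cases "has_plane B")
    case False
    then have Z: "zero_form B"
      using B.plane by blast
    \<comment> \<open>The given tuple \<open>fs\<close> pulls the zero form of \<open>B\<close> back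
      to the form of \<open>A\<close>. So the latter vanishes on \<open>U\<close>, and the empty
      tuple serves as negative tuple.\<close>
    have "form A y v w = 0" if y: "y \<in> U" and v: "v \<in> tangent_space A y" and w: "w \<in> tangent_space A y" for y v w
    proof -
      have "pullback_sum B fs y v w = (\<Sum>f\<leftarrow>fs. 0)"
        unfolding pullback_sum_def
      proof (intro arg_cong[where f = sum_list] map_cong refl)
        fix f assume "f \<in> set fs"
        then have f: "smooth_map_on A B U f"
          using fs by (simp add: symp_tuple_def)
        show "form B (f y) (tmap B f y v) (tmap B f y w) = 0"
          using Z smooth_map_in_topspace[OF f y] tmap_in_tangent_space[OF A.atlas B.atlas f y] v w
          by (simp add: zero_form_def)
      qed
      then show ?thesis
        using fs y v w by (simp add: symp_tuple_def)
    qed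
    then show thesis
      using U by (intro that[of U "[]"]) (auto simp: pullback_sum_def)
  next
    case True
    obtain e q where e: "e > 0" and q: "smooth_map_on (euclid 2) B (cube 2 (\<lambda>i. 0) e) q"
      "\<And>x v w. x \<in> cube 2 (\<lambda>i. 0) e \<Longrightarrow> v \<in> tangent_space (euclid 2) x \<Longrightarrow> w \<in> tangent_space (euclid 2) x \<Longrightarrow>
        form B (q x) (tmap B q x v) (tmap B q x w) = wedge (\<lambda>x. x 0, \<lambda>x. x 1) v w"
      using True unfolding has_plane_def by blast
    let ?Q = "cube 2 (\<lambda>i. 0) e"
    have "p \<in> topspace (mtop A)"
      using U(2) Usub by blast
    from bspec[OF A.exact[unfolded local_exact_def] this]
    obtain U1 abs where "openin (mtop A) U1 \<and> p \<in> U1 \<and>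
      (\<forall>ab\<in>set abs. smooth_fun_on A U1 (fst ab) \<and> smooth_fun_on A U1 (snd ab)) \<and>
      (\<forall>q\<in>U1. \<forall>v\<in>tangent_space A q. \<forall>w\<in>tangent_space A q. form A q v w = (\<Sum>ab\<leftarrow>abs. wedge ab v w))"
      by (elim exE)
    then have U1: "openin (mtop A) U1" "p \<in> U1"
      "\<And>ab. ab \<in> set abs \<Longrightarrow> smooth_fun_on A U1 (fst ab) \<and> smooth_fun_on A U1 (snd ab)"
      "\<And>q v w. q \<in> U1 \<Longrightarrow> v \<in> tangent_space A q \<Longrightarrow> w \<in> tangent_space A q \<Longrightarrow>
        form A q v w = (\<Sum>ab\<leftarrow>abs. wedge ab v w)"
      by blast+
    \<comment> \<open>The functions are exchanged to reverse the sign, and shifted so that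
      \<open>p\<close> goes to the origin and hence into the square; derivations do not notice the
      added constants.\<close>
    define c where "c = (\<lambda>ab x. pt2 (snd ab x - snd ab p) (fst ab x - fst ab p) :: nat \<Rightarrow> real)"
    have c: "smooth_map_on A (euclid 2) U1 (c ab)" if ab: "ab \<in> set abs" for ab
    proof (rule smooth_map_into_euclid[OF A.atlas U1(1)])
      show "c ab w \<in> espace 2" for w
        by (simp add: c_def espace_iff pt2_def)
      show "smooth_fun_on A U1 (\<lambda>w. c ab w l)" if "l < 2" for l
      proof -
        have "smooth_fun_on A U1 (\<lambda>w. snd ab w - snd ab p)" "smooth_fun_on A U1 (\<lambda>w. fst ab w - fst ab p)"
          using smooth_fun_add[OF A.atlas _ smooth_fun_const[OF A.atlas U1(1)], of _ "- snd ab p"]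
            smooth_fun_add[OF A.atlas _ smooth_fun_const[OF A.atlas U1(1)], of _ "- fst ab p"] U1(3)[OF ab]
          by simp_all
        then show ?thesis
          using that by (auto simp: c_def less_2_cases_iff)
      qed
    qed
    define W where "W = (U \<inter> U1) \<inter> {x \<in> topspace (mtop A). \<forall>ab\<in>set abs. x \<in> U1 \<and> c ab x \<in> ?Q}"
    have W: "openin (mtop A) W"
      unfolding W_def
    proof (intro openin_Int U U1 openin_Collect_ball_finite)
      fix ab assume "ab \<in> set abs"
      from smooth_map_preimage[OF c[OF this], of ?Q]
      have "openin (mtop A) (U1 \<inter> c ab -` ?Q)"
        by (simp add: openin_cube)
      moreover have "{x \<in> topspace (mtop A). x \<in> U1 \<and> c ab x \<in> ?Q} = U1 \<inter> c ab -` ?Q"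
        using openin_subset[OF U1(1)] by auto
      ultimately show "openin (mtop A) {x \<in> topspace (mtop A). x \<in> U1 \<and> c ab x \<in> ?Q}"
        by simp
    qed simp
    have cW: "c ab y \<in> ?Q" "y \<in> U1" if "ab \<in> set abs" "y \<in> W" for ab y
      using that by (auto simp: W_def)
    have csm: "smooth_map_on A (euclid 2) W (c ab)" if "ab \<in> set abs" for ab
      by (rule smooth_map_subset[OF A.atlas c[OF that] _ W euclid_atlas]) (auto simp: W_def)
    show thesis
    proof (rule that[of W "map (\<lambda>ab x. q (c ab x)) abs"])
      have "c ab p \<in> ?Q" for ab
        using e by (simp add: c_def pt2_in_cube)
      then show "p \<in> W"
        using U U1 Usub by (auto simp: W_def)
      show "W \<subseteq> U"
        by (auto simp: W_def)
      show "smooth_map_on A B W h" if h: "h \<in> set (map (\<lambda>ab x. q (c ab x)) abs)" for h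
      proof -
        obtain ab where ab: "ab \<in> set abs" "h = (\<lambda>x. q (c ab x))"
          using h by auto
        show ?thesis
          unfolding ab(2) using cW[OF ab(1)]
          by (intro smooth_map_compose[OF A.atlas euclid_atlas csm[OF ab(1)] q(1)]) auto
      qed
      fix y v w assume y: "y \<in> W" and v: "v \<in> tangent_space A y" and w: "w \<in> tangent_space A y"
      have ytop: "y \<in> topspace (mtop A)"
        using y by (auto simp: W_def)
      have "form B (q (c ab y)) (tmap B (\<lambda>x. q (c ab x)) y v) (tmap B (\<lambda>x. q (c ab x)) y w) = - wedge ab v w"
        if ab: "ab \<in> set abs" for ab
      proof -
        note cy = cW[OF ab y]
        have "tmap B (\<lambda>x. q (c ab x)) y u = tmap B q (c ab y) (tmap (euclid 2) (c ab) y u)" for u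
          using tmap_compose[OF A.atlas euclid_atlas csm[OF ab] y q(1) cy(1) B.atlas, of u] by simp
        then have "form B (q (c ab y)) (tmap B (\<lambda>x. q (c ab x)) y v) (tmap B (\<lambda>x. q (c ab x)) y w) =
            wedge (\<lambda>x. x 0, \<lambda>x. x 1) (tmap (euclid 2) (c ab) y v) (tmap (euclid 2) (c ab) y w)"
          using q(2)[OF cy(1)] tmap_in_tangent_space[OF A.atlas euclid_atlas csm[OF ab] y] v w by simp
        also have "\<dots> = wedge (\<lambda>x. c ab x 0, \<lambda>x. c ab x 1) v w"
          using pull_wedge[of "euclid 2" "c ab" y "(\<lambda>x. x 0, \<lambda>x. x 1)" v w]
            euclid_smooth_near[OF cy(1) smooth_coord[OF openin_cube]] by simp
        also have "\<dots> = wedge (snd ab, fst ab) v w"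
        proof -
          have sn: "smooth_near A y (fst ab)" "smooth_near A y (snd ab)"
            using U1(3)[OF ab] cy(2) by (auto simp: smooth_near_def)
          have shift: "u (\<lambda>x. g x - k) = u g" if "u \<in> tangent_space A y" "smooth_near A y g" for u g k
          proof -
            interpret tangent A y u using A.atlas ytop that by unfold_locales
            show ?thesis
              using add[OF that(2) smooth_near_const[OF A.atlas ytop, of "- k"]] const by simp
          qed
          show ?thesis
            by (simp add: wedge_def c_def shift[OF v] shift[OF w] sn)
        qed
        finally show ?thesis
          by (simp add: wedge_def)
      qed
      then have "pullback_sum B (map (\<lambda>ab x. q (c ab x)) abs) y v w = (\<Sum>ab\<leftarrow>abs. - wedge ab v w)"
        by (simp add: pullback_sum_def comp_def cong: map_cong)
      also have "\<dots> = - (\<Sum>ab\<leftarrow>abs. wedge ab v w)"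
        by (induction abs) auto
      also have "\<dots> = - form A y v w"
        using U1(4) y v w by (simp add: W_def)
      finally show "pullback_sum B (map (\<lambda>ab x. q (c ab x)) abs) y v w = - form A y v w" .
    qed (rule W)
  qed
qed

subsection \<open>The collapse\<close>

lemma SCor_rel_sym: "(a, b) \<in> SCor_rel Y X U \<Longrightarrow> (b, a) \<in> SCor_rel Y X U"
  by (auto simp: SCor_rel_def intro: equivclp_sym)

lemma SCor_rel_trans: "(a, b) \<in> SCor_rel Y X U \<Longrightarrow> (b, c) \<in> SCor_rel Y X U \<Longrightarrow> (a, c) \<in> SCor_rel Y X U"
  by (auto simp: SCor_rel_def intro: equivclp_trans)

lemma SCor_rel_refl: "a \<in> SCor_coprod Y X U \<Longrightarrow> (a, a) \<in> SCor_rel Y X U"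
  by (auto simp: SCor_rel_def)

lemma SCor_rel_Image: "(a, b) \<in> SCor_rel Y X U \<Longrightarrow> SCor_rel Y X U `` {a} = SCor_rel Y X U `` {b}"
  using SCor_rel_sym SCor_rel_trans by (metis (no_types, lifting) Image_singleton_iff subsetI subset_antisym)

lemma equivclp_map:
  assumes "equivclp R a b" "\<And>a b. R a b \<Longrightarrow> R' (f a) (f b)"
  shows "equivclp R' (f a) (f b)"
  using assms(1)
proof (induction rule: equivclp_induct)
  case (step y z)
  then have "equivclp R' (f y) (f z)"
    using assms(2) by (metis equivclp_sym r_into_equivclp)
  then show ?case
    using step.IH equivclp_trans by metis
qed simp

locale tame_pair = Y: tame Y + X: tame X
  for Y :: "'y symp_manifold" and X :: "'x symp_manifold"
begin

sublocale S: tuple_sheaf "mtop Y" "symp_tuple Y X"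
  by (rule symp_sheaf[OF Y.atlas X.atlas])

sublocale I: tuple_sheaf "mtop Y" "iso_tuple Y X"
  by (rule iso_sheaf[OF Y.atlas X.atlas])

lemma coprod_restr:
  "a \<in> SCor_coprod Y X U \<Longrightarrow> openin (mtop Y) W \<Longrightarrow> W \<subseteq> U \<Longrightarrow> (fst a, restr W (snd a)) \<in> SCor_coprod Y X W"
  using S.ncors_restr by (auto simp: SCor_coprod_def SCors_def)

lemma SCor_rel_restr:
  assumes "(a, b) \<in> SCor_rel Y X U" "openin (mtop Y) W" "W \<subseteq> U"
  shows "((fst a, restr W (snd a)), (fst b, restr W (snd b))) \<in> SCor_rel Y X W"
proof -
  have "add_isotropic Y X W (fst a, restr W (snd a)) (fst b, restr W (snd b))"
    if "add_isotropic Y X U a b" for a b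
  proof -
    obtain n F m G where "F \<in> SCors Y X n U" "G \<in> SCors0 Y X m U" "a = (n, F)"
      "b = (n + m, ncor_add (mtop Y) (symp_tuple Y X) (n + m) U F G)"
      using \<open>add_isotropic Y X U a b\<close> unfolding add_isotropic_def by blast
    moreover have "restr W F \<in> SCors Y X n W" "restr W G \<in> SCors0 Y X m W"
      using calculation(1,2) S.ncors_restr[OF _ assms(2,3)] I.ncors_restr[OF _ assms(2,3)]
      by (auto simp: SCors_def SCors0_def)
    ultimately show ?thesis
      unfolding add_isotropic_def
      by (intro exI[of _ n] exI[of _ "restr W F"] exI[of _ m] exI[of _ "restr W G"])
        (simp add: ncor_add_restr[OF assms(3)])
  qed
  moreover have "equivclp (add_isotropic Y X U) a b" "a \<in> SCor_coprod Y X U" "b \<in> SCor_coprod Y X U"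
    using assms(1) by (auto simp: SCor_rel_def)
  ultimately show ?thesis
    using coprod_restr[OF _ assms(2,3)]
      equivclp_map[of "add_isotropic Y X U" a b "add_isotropic Y X W" "\<lambda>a. (fst a, restr W (snd a))"]
    by (simp add: SCor_rel_def)
qed

text \<open>\<open>SCor_restr\<close> is a union over all representatives of the class; by
  \<open>SCor_rel_restr\<close> they contribute the same class over \<open>W\<close>.\<close>

lemma SCor_restr_class:
  assumes a: "a \<in> SCor_coprod Y X U" and W: "openin (mtop Y) W" "W \<subseteq> U"
  shows "SCor_restr Y X W (SCor_rel Y X U `` {a}) = SCor_rel Y X W `` {(fst a, restr W (snd a))}"
proof -
  have "SCor_rel Y X W `` {(fst b, restr W (snd b))} = SCor_rel Y X W `` {(fst a, restr W (snd a))}"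
    if "b \<in> SCor_rel Y X U `` {a}" for b
    using that SCor_rel_Image[OF SCor_rel_restr[OF _ W]] by blast
  moreover have "a \<in> SCor_rel Y X U `` {a}"
    using SCor_rel_refl[OF a] by blast
  ultimately show ?thesis
    unfolding SCor_restr_def case_prod_beta by blast
qed

lemma tuple_in_coprod:
  "openin (mtop Y) U \<Longrightarrow> symp_tuple Y X U fs \<Longrightarrow>
    (length fs, ncor_tuple (mtop Y) (symp_tuple Y X) U fs) \<in> SCor_coprod Y X U"
  using S.ncor_tuple_in by (auto simp: SCor_coprod_def SCors_def)

text \<open>An isotropic tuple does not change the sum of the pull-backs, so \<open>fs @ gs\<close>
  is symplectic again, and it arises from \<open>fs\<close> by one generating step of the
  relation.\<close>

lemma add_iso_rel:
  assumes U: "openin (mtop Y) U" and fs: "symp_tuple Y X U fs" and gs: "iso_tuple Y X U gs"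
  shows "((length fs, ncor_tuple (mtop Y) (symp_tuple Y X) U fs),
    (length (fs @ gs), ncor_tuple (mtop Y) (symp_tuple Y X) U (fs @ gs))) \<in> SCor_rel Y X U"
proof -
  have "symp_tuple Y X U (fs @ gs)"
    using fs gs by (auto simp: symp_tuple_def iso_tuple_def pullback_sum_append)
  moreover have "add_isotropic Y X U (length fs, ncor_tuple (mtop Y) (symp_tuple Y X) U fs)
      (length (fs @ gs), ncor_tuple (mtop Y) (symp_tuple Y X) U (fs @ gs))"
    unfolding add_isotropic_def
    using S.ncor_tuple_in[OF U fs] I.ncor_tuple_in[OF U gs]
      ncor_add_tuple[OF U, of "symp_tuple Y X" fs "iso_tuple Y X" gs "symp_tuple Y X"] fs gs
    by (intro exI[of _ "length fs"] exI[of _ "ncor_tuple (mtop Y) (symp_tuple Y X) U fs"]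
        exI[of _ "length gs"] exI[of _ "ncor_tuple (mtop Y) (iso_tuple Y X) U gs"])
      (auto simp: SCors_def SCors0_def)
  ultimately show ?thesis
    using tuple_in_coprod[OF U fs] tuple_in_coprod[OF U, of "fs @ gs"]
    by (auto simp: SCor_rel_def intro: r_into_equivclp)
qed

text \<open>\<open>A \<sim> A + (B + H) = B + (A + H) \<sim> B\<close>\<close>

lemma tuples_rel:
  assumes U: "openin (mtop Y) U" and fs: "symp_tuple Y X U fs" and gs: "symp_tuple Y X U gs"
    and hs: "\<And>h. h \<in> set hs \<Longrightarrow> smooth_map_on Y X U h"
      "\<And>y v w. y \<in> U \<Longrightarrow> v \<in> tangent_space Y y \<Longrightarrow> w \<in> tangent_space Y y \<Longrightarrow>
        pullback_sum X hs y v w = - form Y y v w"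
  shows "((length fs, ncor_tuple (mtop Y) (symp_tuple Y X) U fs),
    (length gs, ncor_tuple (mtop Y) (symp_tuple Y X) U gs)) \<in> SCor_rel Y X U"
proof -
  have iso: "iso_tuple Y X U (ks @ hs)" if "symp_tuple Y X U ks" for ks
    using that hs by (auto simp: symp_tuple_def iso_tuple_def pullback_sum_append)
  have "ncor_tuple (mtop Y) (symp_tuple Y X) U (fs @ gs @ hs) =
      ncor_tuple (mtop Y) (symp_tuple Y X) U (gs @ fs @ hs)"
    by (rule ncor_tuple_mset_cong) simp_all
  then show ?thesis
    using add_iso_rel[OF U fs iso[OF gs]] SCor_rel_sym[OF add_iso_rel[OF U gs iso[OF fs]]] SCor_rel_trans
    by (simp add: add.left_commute) blast
qed

text \<open>The restrictions are described over every smaller \<open>W'\<close> as well, since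
  \<open>collapse\<close> shrinks the neighbourhood further.\<close>

lemma presheaf_local_tuple:
  assumes "c \<in> SCor_presheaf Y X U" "y \<in> U"
  obtains W fs where "openin (mtop Y) W" "y \<in> W" "W \<subseteq> U" "symp_tuple Y X W fs"
    "\<And>W'. openin (mtop Y) W' \<Longrightarrow> W' \<subseteq> W \<Longrightarrow> SCor_restr Y X W' c =
      SCor_rel Y X W' `` {(length fs, ncor_tuple (mtop Y) (symp_tuple Y X) W' fs)}"
proof -
  obtain a where a: "a \<in> SCor_coprod Y X U" "c = SCor_rel Y X U `` {a}"
    using assms(1) by (auto simp: SCor_presheaf_def quotient_def)
  then have "snd a \<in> ncors (mtop Y) (symp_tuple Y X) (fst a) U"
    by (auto simp: SCor_coprod_def SCors_def)
  then obtain W fs where W: "openin (mtop Y) W" "y \<in> W" "W \<subseteq> U" "length fs = fst a" "symp_tuple Y X W fs"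
    "restr W (snd a) = ncor_tuple (mtop Y) (symp_tuple Y X) W fs"
    using S.ncors_local assms(2) by blast
  show thesis
  proof (rule that[OF W(1-3,5)])
    fix W' assume W': "openin (mtop Y) W'" "W' \<subseteq> W"
    have "restr W' (snd a) = restr W' (restr W (snd a))"
      using W'(2) by (simp add: restrict_restrict Int_absorb1)
    then have "restr W' (snd a) = ncor_tuple (mtop Y) (symp_tuple Y X) W' fs"
      using W(6) S.ncor_tuple_restr[OF W'] by simp
    then show "SCor_restr Y X W' c =
      SCor_rel Y X W' `` {(length fs, ncor_tuple (mtop Y) (symp_tuple Y X) W' fs)}"
      using SCor_restr_class[OF a(1) W'(1)] W' W(3,4) a(2) by auto
  qed
qed

text \<open>The neighbourhood shrinks twice: to the common domain of two representing tuples, then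
  to where \<open>ex_negative_tuple\<close> provides a negative tuple.\<close>

lemma collapse:
  assumes c: "c \<in> SCor_presheaf Y X U" and c': "c' \<in> SCor_presheaf Y X U'" and y: "y \<in> U" "y \<in> U'"
  obtains W where "openin (mtop Y) W" "y \<in> W" "W \<subseteq> U \<inter> U'" "SCor_restr Y X W c = SCor_restr Y X W c'"
proof -
  obtain W1 fs where W1: "openin (mtop Y) W1" "y \<in> W1" "W1 \<subseteq> U" "symp_tuple Y X W1 fs"
    "\<And>W'. openin (mtop Y) W' \<Longrightarrow> W' \<subseteq> W1 \<Longrightarrow> SCor_restr Y X W' c =
      SCor_rel Y X W' `` {(length fs, ncor_tuple (mtop Y) (symp_tuple Y X) W' fs)}"
    using presheaf_local_tuple[OF c y(1)] by blast
  obtain W2 gs where W2: "openin (mtop Y) W2" "y \<in> W2" "W2 \<subseteq> U'" "symp_tuple Y X W2 gs"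
    "\<And>W'. openin (mtop Y) W' \<Longrightarrow> W' \<subseteq> W2 \<Longrightarrow> SCor_restr Y X W' c' =
      SCor_rel Y X W' `` {(length gs, ncor_tuple (mtop Y) (symp_tuple Y X) W' gs)}"
    using presheaf_local_tuple[OF c' y(2)] by blast
  have O: "openin (mtop Y) (W1 \<inter> W2)"
    using W1 W2 by blast
  have "symp_tuple Y X (W1 \<inter> W2) fs"
    by (rule S.adm_subset[OF W1(4,1) O]) auto
  from ex_negative_tuple[OF Y.tame_axioms X.tame_axioms this O]
  obtain W hs where W: "openin (mtop Y) W" "y \<in> W" "W \<subseteq> W1 \<inter> W2"
    and hs: "\<And>h. h \<in> set hs \<Longrightarrow> smooth_map_on Y X W h"
      "\<And>y v w. y \<in> W \<Longrightarrow> v \<in> tangent_space Y y \<Longrightarrow> w \<in> tangent_space Y y \<Longrightarrow>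
        pullback_sum X hs y v w = - form Y y v w"
    using W1(2) W2(2) by blast
  have sW: "symp_tuple Y X W fs" "symp_tuple Y X W gs"
    using S.adm_subset[OF W1(4,1) W(1)] S.adm_subset[OF W2(4,1) W(1)] W(3) by auto
  have "SCor_restr Y X W c = SCor_rel Y X W `` {(length fs, ncor_tuple (mtop Y) (symp_tuple Y X) W fs)}"
    using W1(5)[OF W(1)] W(3) by simp
  also have "\<dots> = SCor_rel Y X W `` {(length gs, ncor_tuple (mtop Y) (symp_tuple Y X) W gs)}"
    by (rule SCor_rel_Image[OF tuples_rel[OF W(1) sW hs]])
  also have "\<dots> = SCor_restr Y X W c'"
    using W2(5)[OF W(1)] W(3) by simp
  finally have "SCor_restr Y X W c = SCor_restr Y X W c'" .
  then show thesis
    using that[OF W(1,2)] W(3) W1(3) W2(3) by blast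
qed

text \<open>By \<open>collapse\<close> the germ of any section at \<open>y\<close> contains every
  section defined near \<open>y\<close>. So all germs at \<open>y\<close> are this one set, and it
  can be named without knowing whether sections exist.\<close>

definition star :: "('y, 'x) scor"
  where "star = (\<lambda>y\<in>topspace (mtop Y). {(V, t). openin (mtop Y) V \<and> y \<in> V \<and> t \<in> SCor_presheaf Y X V})"

lemma germ_eq_star:
  assumes "c \<in> SCor_presheaf Y X U" "openin (mtop Y) U" "y \<in> U"
  shows "germ (mtop Y) (SCor_presheaf Y X) (SCor_restr Y X) U c y = star y"
proof -
  have "y \<in> topspace (mtop Y)"
    using assms openin_subset by blast
  moreover have "\<exists>W. openin (mtop Y) W \<and> y \<in> W \<and> W \<subseteq> U \<inter> V \<and> SCor_restr Y X W c = SCor_restr Y X W t"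
    if t: "t \<in> SCor_presheaf Y X V" "y \<in> V" for V t
  proof -
    obtain W where "openin (mtop Y) W" "y \<in> W" "W \<subseteq> U \<inter> V" "SCor_restr Y X W c = SCor_restr Y X W t"
      by (rule collapse[OF assms(1) t(1) assms(3) t(2)])
    then show ?thesis by (intro exI[of _ W] conjI)
  qed
  ultimately show ?thesis
    by (auto simp: germ_def star_def)
qed

lemma SCor_eq_star: "F \<in> SCor Y X \<Longrightarrow> F = star"
  unfolding SCor_def sheafify_def
proof (rule extensionalityI[where A = "topspace (mtop Y)"], goal_cases)
  case (3 y)
  then obtain W s where "openin (mtop Y) W" "y \<in> W" "s \<in> SCor_presheaf Y X W"
      "\<forall>z\<in>W. F z = germ (mtop Y) (SCor_presheaf Y X) (SCor_restr Y X) W s z"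
    by blast
  then show ?case
    using germ_eq_star by simp
qed (auto simp: star_def)

lemma tuple_class:
  "openin (mtop Y) U \<Longrightarrow> symp_tuple Y X U fs \<Longrightarrow>
    SCor_rel Y X U `` {(length fs, ncor_tuple (mtop Y) (symp_tuple Y X) U fs)} \<in> SCor_presheaf Y X U"
  using tuple_in_coprod by (auto simp: SCor_presheaf_def quotient_def)

text \<open>Local sections agree automatically because all their germs are \<open>star\<close>; what
  remains is that symplectic tuples exist near every point.\<close>

lemma star_in_SCor:
  assumes "\<And>y. y \<in> topspace (mtop Y) \<Longrightarrow> \<exists>W fs. openin (mtop Y) W \<and> y \<in> W \<and> symp_tuple Y X W fs"
  shows "star \<in> SCor Y X"
  unfolding SCor_def sheafify_def
proof (intro CollectI conjI ballI)
  fix y assume "y \<in> topspace (mtop Y)"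
  then obtain W fs where W: "openin (mtop Y) W" "y \<in> W" "symp_tuple Y X W fs"
    using assms by blast
  then show "\<exists>W s. openin (mtop Y) W \<and> y \<in> W \<and> W \<subseteq> topspace (mtop Y) \<and> s \<in> SCor_presheaf Y X W \<and>
      (\<forall>z\<in>W. star z = germ (mtop Y) (SCor_presheaf Y X) (SCor_restr Y X) W s z)"
    using tuple_class[OF W(1,3)] germ_eq_star openin_subset[OF W(1)]
    by (intro exI[of _ W] exI[of _ "SCor_rel Y X W `` {(length fs, ncor_tuple (mtop Y) (symp_tuple Y X) W fs)}"]) auto
qed (simp add: star_def)

lemma SCor_local:
  assumes "F \<in> SCor Y X" "y \<in> topspace (mtop Y)"
  obtains W fs where "openin (mtop Y) W" "y \<in> W" "symp_tuple Y X W fs"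
proof -
  obtain W s where "openin (mtop Y) W" "y \<in> W" "s \<in> SCor_presheaf Y X W"
    using assms unfolding SCor_def sheafify_def by blast
  then show thesis
    using presheaf_local_tuple that by metis
qed

text \<open>Every symplectic tuple on an open set represents \<open>star\<close>, which settles the
  requirements on representations in the definitions by \<open>THE\<close>.\<close>

lemma star_rep: "SCor_rep Y X star U fs \<longleftrightarrow> openin (mtop Y) U \<and> symp_tuple Y X U fs"
  using germ_eq_star[OF tuple_class] by (auto simp: SCor_rep_def SCor_germ_def)

lemma SCor_of_in:
  assumes "symp_tuple Y X (topspace (mtop Y)) [f]"
  shows "SCor_of Y X f \<in> SCor Y X"
proof -
  have "SCor_germ Y X (topspace (mtop Y)) [f] y = star y" if "y \<in> topspace (mtop Y)" for y
    unfolding SCor_germ_def by (rule germ_eq_star[OF tuple_class[OF openin_topspace assms] openin_topspace that])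
  then have "SCor_of Y X f = star"
    by (auto simp: SCor_of_def star_def fun_eq_iff)
  then show ?thesis
    using star_in_SCor assms by (metis openin_topspace)
qed

end

section \<open>Chain maps between cubical complexes\<close>

declare One_nat_def [simp del]

lemma hom_finprod:
  assumes "comm_group G" "comm_group H" and h: "h \<in> hom G H" and f: "f \<in> A \<rightarrow> carrier G"
  shows "h (finprod G f A) = finprod H (\<lambda>x. h (f x)) A"
proof -
  interpret G: comm_group G by fact
  interpret H: comm_group H by fact
  interpret group_hom G H h
    using h by unfold_locales
  show ?thesis
    using f
  proof (induction A rule: infinite_finite_induct)
    case (insert x A)
    then have "(\<lambda>x. h (f x)) \<in> A \<rightarrow> carrier H" "h (f x) \<in> carrier H" "f \<in> A \<rightarrow> carrier G" "f x \<in> carrier G"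
      by (auto simp: Pi_iff)
    then show ?case
      using insert by simp
  qed (simp_all add: hom_one)
qed

lemma sign_int: "(-1 :: int) ^ k = 1 \<or> (-1 :: int) ^ k = -1"
  by (cases "even k") auto

lemma hom_sign_pow:
  assumes "comm_group G" "comm_group H" "h \<in> hom G H" "x \<in> carrier G"
  shows "h (x [^]\<^bsub>G\<^esub> ((-1) ^ k :: int)) = h x [^]\<^bsub>H\<^esub> ((-1) ^ k :: int)"
proof -
  interpret G: comm_group G by fact
  interpret H: comm_group H by fact
  interpret group_hom G H h
    using assms(3) by unfold_locales
  show ?thesis
    using sign_int[of k] assms(4) by (auto simp: G.int_pow_neg H.int_pow_neg)
qed

lemma (in comm_group) sign_pow_mult:
  assumes "x \<in> carrier G" "y \<in> carrier G"
  shows "(x \<otimes> y) [^] ((-1) ^ k :: int) = x [^] ((-1) ^ k :: int) \<otimes> y [^] ((-1) ^ k :: int)"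
  using sign_int[of k] assms by (auto simp: int_pow_neg inv_mult)

text \<open>Neither the definition of the homology groups nor the induced maps use \<open>d\<^sup>2 = 0\<close>: two cosets of
  the boundaries are multiplied as cosets in the whole chain group.\<close>

lemma induces_on_homologyI:
  assumes C: "\<And>n. comm_group (C n)" and C': "\<And>n. comm_group (C' n)"
    and d: "\<And>n. d n \<in> hom (C n) (C (n - 1))" and d': "\<And>n. d' n \<in> hom (C' n) (C' (n - 1))"
    and \<phi>: "\<And>n. \<phi> n \<in> hom (C n) (C' n)"
    and comm: "\<And>n \<sigma>. \<sigma> \<in> carrier (C n) \<Longrightarrow> \<phi> (n - 1) (d n \<sigma>) = d' n (\<phi> n \<sigma>)"
  shows "induces_on_homology C d C' d' \<phi>"
  unfolding induces_on_homology_def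
proof (intro allI conjI ballI \<phi>)
  fix n
  interpret A: comm_group "C n" by (rule C)
  interpret B: comm_group "C' n" by (rule C')
  interpret A': comm_group "C (n - 1)" by (rule C)
  interpret B': comm_group "C' (n - 1)" by (rule C')
  interpret \<phi>: group_hom "C n" "C' n" "\<phi> n"
    using \<phi> by unfold_locales
  interpret \<phi>': group_hom "C (n - 1)" "C' (n - 1)" "\<phi> (n - 1)"
    using \<phi> by unfold_locales
  show ker: "\<phi> n \<sigma> \<in> kernel (C' n) (C' (n - 1)) (d' n)" if "\<sigma> \<in> kernel (C n) (C (n - 1)) (d n)" for \<sigma>
    using that comm[of \<sigma> n] by (auto simp: kernel_def)
  let ?H = "d (Suc n) ` carrier (C (Suc n))" and ?H' = "d' (Suc n) ` carrier (C' (Suc n))"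
  have sub: "subgroup ?H (C n)"
    using group_hom.img_is_subgroup[of "C (Suc n)" "C n" "d (Suc n)"] C d[of "Suc n"]
    by (simp add: group_hom_def group_hom_axioms_def comm_group.axioms)
  have sub': "subgroup ?H' (C' n)"
    using group_hom.img_is_subgroup[of "C' (Suc n)" "C' n" "d' (Suc n)"] C' d'[of "Suc n"]
    by (simp add: group_hom_def group_hom_axioms_def comm_group.axioms)
  interpret H: normal ?H "C n"
    using A.subgroup_imp_normal[OF sub] .
  interpret H': normal ?H' "C' n"
    using B.subgroup_imp_normal[OF sub'] .
  have \<phi>H: "\<phi> n h \<in> ?H'" if h: "h \<in> ?H" for h
  proof -
    obtain x where x: "x \<in> carrier (C (Suc n))" "h = d (Suc n) x"
      using h by blast
    then have "\<phi> n h = d' (Suc n) (\<phi> (Suc n) x)"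
      using comm[of x "Suc n"] by simp
    then show ?thesis
      using x \<phi>[of "Suc n"] by (auto simp: hom_def)
  qed
  \<comment> \<open>The image of a coset under \<open>\<phi> n\<close> need not be a full coset of
    \<open>?H'\<close>. Multiplying by \<open>?H'\<close> completes it and defines the map on cosets
    without a choice of representatives.\<close>
  define \<Phi> where "\<Phi> = (\<lambda>S. ?H' <#>\<^bsub>C' n\<^esub> (\<phi> n ` S))"
  have \<Phi>: "\<Phi> (?H #>\<^bsub>C n\<^esub> a) = ?H' #>\<^bsub>C' n\<^esub> \<phi> n a" if a: "a \<in> carrier (C n)" for a
  proof
    show "\<Phi> (?H #>\<^bsub>C n\<^esub> a) \<subseteq> ?H' #>\<^bsub>C' n\<^esub> \<phi> n a"
    proof
      fix z assume "z \<in> \<Phi> (?H #>\<^bsub>C n\<^esub> a)"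
      then obtain h' h where h: "h' \<in> ?H'" "h \<in> ?H" "z = h' \<otimes>\<^bsub>C' n\<^esub> \<phi> n (h \<otimes>\<^bsub>C n\<^esub> a)"
        unfolding \<Phi>_def set_mult_def r_coset_def by blast
      have carr: "h \<in> carrier (C n)" "h' \<in> carrier (C' n)" "\<phi> n h \<in> carrier (C' n)" "\<phi> n a \<in> carrier (C' n)"
        using h H.subset H'.subset a by auto
      then have "z = (h' \<otimes>\<^bsub>C' n\<^esub> \<phi> n h) \<otimes>\<^bsub>C' n\<^esub> \<phi> n a"
        using h(3) a by (simp add: B.m_assoc)
      moreover have "h' \<otimes>\<^bsub>C' n\<^esub> \<phi> n h \<in> ?H'"
        by (rule H'.m_closed[OF h(1) \<phi>H[OF h(2)]])
      ultimately show "z \<in> ?H' #>\<^bsub>C' n\<^esub> \<phi> n a"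
        unfolding r_coset_def by blast
    qed
    show "?H' #>\<^bsub>C' n\<^esub> \<phi> n a \<subseteq> \<Phi> (?H #>\<^bsub>C n\<^esub> a)"
    proof
      fix z assume "z \<in> ?H' #>\<^bsub>C' n\<^esub> \<phi> n a"
      then obtain h' where h: "h' \<in> ?H'" "z = h' \<otimes>\<^bsub>C' n\<^esub> \<phi> n a"
        unfolding r_coset_def by blast
      have "a \<in> ?H #>\<^bsub>C n\<^esub> a"
        by (rule A.rcos_self[OF a sub])
      then show "z \<in> \<Phi> (?H #>\<^bsub>C n\<^esub> a)"
        unfolding \<Phi>_def set_mult_def using h by blast
    qed
  qed
  have "\<Phi> \<in> hom (homology C d n) (homology C' d' n)"
  proof (rule homI)
    fix S assume "S \<in> carrier (homology C d n)"
    then obtain a where a: "a \<in> kernel (C n) (C (n - 1)) (d n)" "S = ?H #>\<^bsub>C n\<^esub> a"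
      by (auto simp: homology_def FactGroup_def RCOSETS_def r_coset_def)
    have "\<Phi> S = ?H' #>\<^bsub>C' n\<^esub> \<phi> n a"
      using a \<Phi> by (simp add: kernel_def)
    then show "\<Phi> S \<in> carrier (homology C' d' n)"
      using ker[OF a(1)] by (auto simp: homology_def FactGroup_def RCOSETS_def r_coset_def)
  next
    fix S R assume "S \<in> carrier (homology C d n)" "R \<in> carrier (homology C d n)"
    then obtain a b where ab: "a \<in> carrier (C n)" "S = ?H #>\<^bsub>C n\<^esub> a" "b \<in> carrier (C n)" "R = ?H #>\<^bsub>C n\<^esub> b"
      by (auto simp: homology_def FactGroup_def RCOSETS_def r_coset_def kernel_def)
    have "S \<otimes>\<^bsub>homology C d n\<^esub> R = ?H #>\<^bsub>C n\<^esub> (a \<otimes>\<^bsub>C n\<^esub> b)"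
      using ab H.rcos_sum by (simp add: homology_def FactGroup_def set_mult_def)
    then have "\<Phi> (S \<otimes>\<^bsub>homology C d n\<^esub> R) = ?H' #>\<^bsub>C' n\<^esub> (\<phi> n a \<otimes>\<^bsub>C' n\<^esub> \<phi> n b)"
      using \<Phi>[of "a \<otimes>\<^bsub>C n\<^esub> b"] ab by simp
    also have "\<dots> = \<Phi> S \<otimes>\<^bsub>homology C' d' n\<^esub> \<Phi> R"
      using ab \<Phi> H'.rcos_sum[of "\<phi> n a" "\<phi> n b"] by (simp add: homology_def FactGroup_def set_mult_def)
    finally show "\<Phi> (S \<otimes>\<^bsub>homology C d n\<^esub> R) = \<Phi> S \<otimes>\<^bsub>homology C' d' n\<^esub> \<Phi> R" .
  qed
  then show "\<exists>\<Phi>\<in>hom (homology C d n) (homology C' d' n). \<forall>\<sigma>\<in>kernel (C n) (C (n - 1)) (d n).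
      \<Phi> (homology_class C d n \<sigma>) = homology_class C' d' n (\<phi> n \<sigma>)"
    using \<Phi> by (intro bexI[of _ \<Phi>]) (auto simp: homology_class_def kernel_def)
qed

locale cubical =
  fixes C :: "nat \<Rightarrow> 'c monoid" and face :: "nat \<Rightarrow> nat \<Rightarrow> nat \<Rightarrow> 'c \<Rightarrow> 'c"
  assumes C: "\<And>n. comm_group (C n)"
    and face: "\<And>n i e. i < n \<Longrightarrow> e \<in> {0..1} \<Longrightarrow> face n i e \<in> hom (C n) (C (n - 1))"
begin

lemma cubical_diff_closed:
  assumes \<sigma>: "\<sigma> \<in> carrier (C n)"
  shows "(\<lambda>(e, i). face n i e \<sigma> [^]\<^bsub>C (n - 1)\<^esub> ((-1) ^ (e + i) :: int)) \<in> {0..1} \<times> {..<n} \<rightarrow> carrier (C (n - 1))"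
proof -
  interpret comm_group "C (n - 1)" by (rule C)
  show ?thesis
    using face \<sigma> by (auto simp: hom_def Pi_iff intro!: int_pow_closed)
qed

lemma cubical_diff_hom: "cubical_diff C face n \<in> hom (C n) (C (n - 1))"
proof -
  interpret comm_group "C (n - 1)" by (rule C)
  note closed = cubical_diff_closed
  show ?thesis
  proof (rule homI)
    show "cubical_diff C face n \<sigma> \<in> carrier (C (n - 1))" if "\<sigma> \<in> carrier (C n)" for \<sigma>
      unfolding cubical_diff_def by (intro finprod_closed closed that)
    fix \<sigma> \<tau> assume \<sigma>: "\<sigma> \<in> carrier (C n)" and \<tau>: "\<tau> \<in> carrier (C n)"
    have st: "\<sigma> \<otimes>\<^bsub>C n\<^esub> \<tau> \<in> carrier (C n)"
      using C[of n] \<sigma> \<tau> by (simp add: comm_group_def monoid.m_closed comm_monoid_def)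
    have "cubical_diff C face n (\<sigma> \<otimes>\<^bsub>C n\<^esub> \<tau>) = finprod (C (n - 1))
      (\<lambda>x. (\<lambda>(e, i). face n i e \<sigma> [^]\<^bsub>C (n - 1)\<^esub> ((-1) ^ (e + i) :: int)) x \<otimes>\<^bsub>C (n - 1)\<^esub>
        (\<lambda>(e, i). face n i e \<tau> [^]\<^bsub>C (n - 1)\<^esub> ((-1) ^ (e + i) :: int)) x) ({0..1} \<times> {..<n})"
      unfolding cubical_diff_def
    proof (rule finprod_cong'[OF refl])
      fix x :: "nat \<times> nat" assume "x \<in> {0..1} \<times> {..<n}"
      then obtain e i where x: "x = (e, i)" "e \<in> {0..1}" "i < n" by auto
      have h: "face n i e \<in> hom (C n) (C (n - 1))"
        by (rule face[OF x(3,2)])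
      then have "face n i e (\<sigma> \<otimes>\<^bsub>C n\<^esub> \<tau>) = face n i e \<sigma> \<otimes>\<^bsub>C (n - 1)\<^esub> face n i e \<tau>"
        "face n i e \<sigma> \<in> carrier (C (n - 1))" "face n i e \<tau> \<in> carrier (C (n - 1))"
        using \<sigma> \<tau> by (auto simp: hom_def)
      then show "(\<lambda>(e, i). face n i e (\<sigma> \<otimes>\<^bsub>C n\<^esub> \<tau>) [^]\<^bsub>C (n - 1)\<^esub> ((-1) ^ (e + i) :: int)) x =
          (\<lambda>(e, i). face n i e \<sigma> [^]\<^bsub>C (n - 1)\<^esub> ((-1) ^ (e + i) :: int)) x \<otimes>\<^bsub>C (n - 1)\<^esub>
          (\<lambda>(e, i). face n i e \<tau> [^]\<^bsub>C (n - 1)\<^esub> ((-1) ^ (e + i) :: int)) x"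
        by (simp add: x(1) sign_pow_mult)
    qed (use closed[OF \<sigma>] closed[OF \<tau>] in \<open>simp add: Pi_iff\<close>)
    also have "\<dots> = cubical_diff C face n \<sigma> \<otimes>\<^bsub>C (n - 1)\<^esub> cubical_diff C face n \<tau>"
      unfolding cubical_diff_def by (rule finprod_multf[OF closed[OF \<sigma>] closed[OF \<tau>]])
    finally show "cubical_diff C face n (\<sigma> \<otimes>\<^bsub>C n\<^esub> \<tau>) =
        cubical_diff C face n \<sigma> \<otimes>\<^bsub>C (n - 1)\<^esub> cubical_diff C face n \<tau>" .
  qed
qed

end

text \<open>Both differentials are products over the same index set with the same exponents
  \<open>1\<close> and \<open>-1\<close>, so a homomorphism commuting with the faces commutes with
  them.\<close>

lemma cubical_map_induces:
  assumes "cubical C face" "cubical C' face'"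
    and \<phi>: "\<And>n. \<phi> n \<in> hom (C n) (C' n)"
    and comm: "\<And>n i e \<sigma>. i < n \<Longrightarrow> e \<in> {0..1} \<Longrightarrow> \<sigma> \<in> carrier (C n) \<Longrightarrow>
      \<phi> (n - 1) (face n i e \<sigma>) = face' n i e (\<phi> n \<sigma>)"
  shows "induces_on_homology C (cubical_diff C face) C' (cubical_diff C' face') \<phi>"
proof -
  interpret C: cubical C face by fact
  interpret C': cubical C' face' by fact
  show ?thesis
  proof (rule induces_on_homologyI)
    fix n \<sigma> assume \<sigma>: "\<sigma> \<in> carrier (C n)"
    have \<phi>\<sigma>: "\<phi> n \<sigma> \<in> carrier (C' n)"
      using \<phi>[of n] \<sigma> by (auto simp: hom_def)
    interpret B: comm_group "C' (n - 1)" by (rule C'.C)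
    have "\<phi> (n - 1) (cubical_diff C face n \<sigma>) = finprod (C' (n - 1))
        (\<lambda>x. \<phi> (n - 1) ((\<lambda>(e, i). face n i e \<sigma> [^]\<^bsub>C (n - 1)\<^esub> ((-1) ^ (e + i) :: int)) x)) ({0..1} \<times> {..<n})"
      unfolding cubical_diff_def
      by (rule hom_finprod[OF C.C C'.C \<phi> C.cubical_diff_closed[OF \<sigma>]])
    also have "\<dots> = cubical_diff C' face' n (\<phi> n \<sigma>)"
      unfolding cubical_diff_def
    proof (rule B.finprod_cong'[OF refl])
      fix x :: "nat \<times> nat" assume "x \<in> {0..1} \<times> {..<n}"
      then obtain e i where x: "x = (e, i)" "e \<in> {0..1}" "i < n" by auto
      have "face n i e \<sigma> \<in> carrier (C (n - 1))"
        using C.face[OF x(3,2)] \<sigma> by (auto simp: hom_def)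
      then show "\<phi> (n - 1) ((\<lambda>(e, i). face n i e \<sigma> [^]\<^bsub>C (n - 1)\<^esub> ((-1) ^ (e + i) :: int)) x) =
          (\<lambda>(e, i). face' n i e (\<phi> n \<sigma>) [^]\<^bsub>C' (n - 1)\<^esub> ((-1) ^ (e + i) :: int)) x"
        using comm[OF x(3,2) \<sigma>] hom_sign_pow[OF C.C C'.C \<phi>] by (simp add: x(1))
    qed (use C'.cubical_diff_closed[OF \<phi>\<sigma>] in simp)
    finally show "\<phi> (n - 1) (cubical_diff C face n \<sigma>) = cubical_diff C' face' n (\<phi> n \<sigma>)" .
  qed (rule C.C C'.C C.cubical_diff_hom C'.cubical_diff_hom \<phi>)+
qed

declare One_nat_def [simp]

subsection \<open>Face maps\<close>

lemma insert_point_apply: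
  "k < n \<Longrightarrow> insert_point n i p m k = (if k < i then m k else if k = i then p else m (k - 1))"
  by (simp add: insert_point_def)

lemma face_map_eq: "face_map p0 p1 n i e = (\<lambda>w. (fst w, insert_point n i (if e = 0 then p0 else p1) (snd w)))"
  by (auto simp: face_map_def)

text \<open>Each component of the map is a projection or the constant \<open>p\<close>.\<close>

lemma smooth_insert_point:
  assumes "power_mfd P' M (n - 1)" "power_mfd P M n" and i: "i < n" and p: "p \<in> topspace (mtop M)"
  shows "\<And>k. k < n \<Longrightarrow> smooth_map_on P' M (topspace (mtop P')) (\<lambda>w. insert_point n i p w k)"
    and "smooth_map_on P' P (topspace (mtop P')) (insert_point n i p)"
proof -
  interpret P': power_mfd P' M "n - 1" by fact
  interpret P: power_mfd P M n by fact
  show comp: "smooth_map_on P' M (topspace (mtop P')) (\<lambda>w. insert_point n i p w k)" if "k < n" for k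
    using that i P'.smooth_proj[of k] P'.smooth_proj[of "k - 1"]
      smooth_map_const[OF P'.smooth_atlas_P openin_topspace p]
    by (cases k i rule: linorder_cases) (simp_all add: insert_point_apply)
  show "smooth_map_on P' P (topspace (mtop P')) (insert_point n i p)"
    by (rule P.smooth_tuple[OF P'.smooth_atlas_P openin_topspace]) (rule comp, auto simp: insert_point_def)
qed

section \<open>The symplectic complex\<close>

subsection \<open>Augmentations\<close>

text \<open>As \<open>SCor\<close> has at most one element, this integer determines an element of
  \<open>SC\<close>, and composition multiplies it.\<close>

definition aug :: "('a \<Rightarrow>\<^sub>0 int) \<Rightarrow> int"
  where "aug c = (\<Sum>i\<in>Poly_Mapping.keys c. poly_mapping.lookup c i)"

lemma aug_frag_of [simp]: "aug (frag_of x) = 1"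
  by (simp add: aug_def keys_frag_of)

lemma aug_superset: "finite A \<Longrightarrow> Poly_Mapping.keys c \<subseteq> A \<Longrightarrow> aug c = (\<Sum>i\<in>A. poly_mapping.lookup c i)"
  unfolding aug_def by (rule sum.mono_neutral_left) (auto simp: in_keys_iff)

lemma aug_add: "aug (a + b) = aug a + aug b"
proof -
  let ?A = "Poly_Mapping.keys a \<union> Poly_Mapping.keys b"
  have "Poly_Mapping.keys (a + b) \<subseteq> ?A"
    by (rule Poly_Mapping.keys_add)
  then show ?thesis
    using aug_superset[of ?A a] aug_superset[of ?A b] aug_superset[of ?A "a + b"]
    by (simp add: lookup_add sum.distrib)
qed

lemma aug_cmul: "aug (frag_cmul k c) = k * aug c"
proof -
  have "Poly_Mapping.keys (frag_cmul k c) \<subseteq> Poly_Mapping.keys c"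
    by (auto simp: in_keys_iff)
  then show ?thesis
    using aug_superset[of "Poly_Mapping.keys c" "frag_cmul k c"] by (simp add: aug_def sum_distrib_left)
qed

lemma sum_frag_cmul: "(\<Sum>i\<in>A. frag_cmul (f i) a) = frag_cmul (\<Sum>i\<in>A. f i) a"
  by (induction A rule: infinite_finite_induct) (auto simp: frag_cmul_distrib)

lemma frag_extend_const:
  "(\<And>x. x \<in> Poly_Mapping.keys c \<Longrightarrow> f x = a) \<Longrightarrow> frag_extend f c = frag_cmul (aug c) a"
  unfolding frag_extend_def aug_def by (simp add: sum_frag_cmul)

lemma keys_frag_cmul_subset: "Poly_Mapping.keys (frag_cmul k c) \<subseteq> Poly_Mapping.keys c"
  by (auto simp: in_keys_iff)

text \<open>All maps of the symplectic complex turn out to have this shape. If \<open>S\<close> is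
  empty, the source is trivial and \<open>aug\<close> vanishes on it; the alternative
  \<open>k = 0\<close> serves targets without generators.\<close>

lemma aug_hom:
  assumes "S \<noteq> {} \<Longrightarrow> s \<in> S' \<or> k = 0"
  shows "(\<lambda>\<sigma>. frag_cmul (k * aug \<sigma>) (frag_of s)) \<in> hom (free_Abelian_group S) (free_Abelian_group S')"
proof (rule homI)
  fix \<sigma> assume \<sigma>: "\<sigma> \<in> carrier (free_Abelian_group S)"
  show "frag_cmul (k * aug \<sigma>) (frag_of s) \<in> carrier (free_Abelian_group S')"
  proof (cases "s \<in> S'")
    case True
    then show ?thesis
      using keys_frag_cmul_subset[of "k * aug \<sigma>" "frag_of s"] by (simp add: keys_frag_of subset_iff)
  next
    case False
    then have "k * aug \<sigma> = 0"
      using assms \<sigma> by (cases "S = {}") (auto simp: aug_def)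
    then have zero: "frag_cmul (k * aug \<sigma>) (frag_of s) = 0"
      by (simp only: frag_cmul_zero)
    show ?thesis
      unfolding zero by simp
  qed
qed (simp add: aug_add distrib_left frag_cmul_distrib)

subsection \<open>Composition\<close>

lemma pullback_sum_concat: "pullback_sum X (concat fss) y v w = (\<Sum>fs\<leftarrow>fss. pullback_sum X fs y v w)"
  by (induction fss) (simp_all add: pullback_sum_append, simp add: pullback_sum_def)

lemma comp_tuple_mem:
  assumes "h \<in> set (comp_tuple fs gss)" "length gss = length fs"
  obtains i g where "i < length fs" "g \<in> set (gss ! i)" "h = g \<circ> fs ! i"
proof -
  obtain c where c: "c \<in> set (zip fs gss)" "h \<in> set (case c of (f, gs) \<Rightarrow> map (\<lambda>g. g \<circ> f) gs)"
    using assms(1) unfolding comp_tuple_def set_concat set_map by blast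
  obtain g where g: "g \<in> set (snd c)" "h = g \<circ> fst c"
    using c(2) by (cases c) auto
  obtain i where i: "i < length fs" "fst c = fs ! i" "snd c = gss ! i"
    using c(1) assms(2) by (auto simp: in_set_zip)
  show thesis
    using that[of i g] g i by simp
qed

text \<open>Summing over the maps attached to \<open>fs ! i\<close> gives the pull-back of the form
  of \<open>Y\<close> by \<open>fs ! i\<close>; summing these over \<open>i\<close> gives the form
  of \<open>Z\<close>.\<close>

lemma symp_tuple_comp:
  assumes Z: "smooth_atlas Z" and Y: "smooth_atlas Y" and X: "smooth_atlas X"
    and fs: "symp_tuple Z Y U fs" and len: "length gss = length fs"
    and gss: "\<And>i. i < length fs \<Longrightarrow> symp_tuple Y X (Vs ! i) (gss ! i) \<and> (fs ! i) ` U \<subseteq> Vs ! i"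
  shows "symp_tuple Z X U (comp_tuple fs gss)"
  unfolding symp_tuple_def
proof (intro conjI ballI)
  fix h assume "h \<in> set (comp_tuple fs gss)"
  then obtain i g where h: "i < length fs" "g \<in> set (gss ! i)" "h = g \<circ> fs ! i"
    using comp_tuple_mem len by metis
  have "smooth_map_on Z Y U (fs ! i)" "smooth_map_on Y X (Vs ! i) g"
    using fs gss[OF h(1)] h by (auto simp: symp_tuple_def)
  from smooth_map_compose[OF Z Y this] gss[OF h(1)] show "smooth_map_on Z X U h"
    by (simp add: h(3) comp_def)
next
  fix z v w assume z: "z \<in> U" and v: "v \<in> tangent_space Z z" and w: "w \<in> tangent_space Z z"
  have "pullback_sum X (map (\<lambda>g. g \<circ> fs ! i) (gss ! i)) z v w =
      form Y ((fs ! i) z) (tmap Y (fs ! i) z v) (tmap Y (fs ! i) z w)" if i: "i < length fs" for i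
  proof -
    let ?f = "fs ! i"
    have f: "smooth_map_on Z Y U ?f" and g: "\<And>g. g \<in> set (gss ! i) \<Longrightarrow> smooth_map_on Y X (Vs ! i) g"
      and fz: "?f z \<in> Vs ! i"
      using fs gss[OF i] i z by (auto simp: symp_tuple_def)
    have "tmap X (g \<circ> ?f) z u = tmap X g (?f z) (tmap Y ?f z u)" if "g \<in> set (gss ! i)" for g u
      using tmap_compose[OF Z Y f z g[OF that] fz X, of u] by (simp add: comp_def)
    then have "pullback_sum X (map (\<lambda>g. g \<circ> ?f) (gss ! i)) z v w =
        pullback_sum X (gss ! i) (?f z) (tmap Y ?f z v) (tmap Y ?f z w)"
      unfolding pullback_sum_def by (simp add: comp_def cong: map_cong)
    also have "\<dots> = form Y (?f z) (tmap Y ?f z v) (tmap Y ?f z w)"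
      using gss[OF i] fz tmap_in_tangent_space[OF Z Y f z] v w by (simp add: symp_tuple_def)
    finally show ?thesis .
  qed
  then have "pullback_sum X (comp_tuple fs gss) z v w =
      (\<Sum>i\<leftarrow>[0..<length fs]. form Y ((fs ! i) z) (tmap Y (fs ! i) z v) (tmap Y (fs ! i) z w))"
    unfolding comp_tuple_def pullback_sum_concat using len
    by (simp add: comp_def sum_list_sum_nth)
  also have "\<dots> = pullback_sum Y fs z v w"
    by (simp add: pullback_sum_def sum_list_sum_nth)
  also have "\<dots> = form Z z v w"
    using fs z v w by (simp add: symp_tuple_def)
  finally show "pullback_sum X (comp_tuple fs gss) z v w = form Z z v w" .
qed

text \<open>Local representations of \<open>F\<close> and of \<open>G\<close> near the finitely many values of \<open>F\<close> at \<open>z\<close>.\<close>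

lemma composable_reps:
  assumes fs: "openin (mtop Z) W" "z \<in> W" "\<And>f. f \<in> set fs \<Longrightarrow> smooth_map_on Z Y W f"
    and G: "\<And>y. y \<in> topspace (mtop Y) \<Longrightarrow> \<exists>V gs. openin (mtop Y) V \<and> y \<in> V \<and> Q V gs"
  obtains U Vs gss where "openin (mtop Z) U" "z \<in> U" "U \<subseteq> W" "length Vs = length fs" "length gss = length fs"
    "\<And>i. i < length fs \<Longrightarrow> Q (Vs ! i) (gss ! i) \<and> openin (mtop Y) (Vs ! i) \<and> (fs ! i) ` U \<subseteq> Vs ! i"
proof -
  have "\<exists>V gs. openin (mtop Y) V \<and> (fs ! i) z \<in> V \<and> Q V gs" if "i < length fs" for i
    using G smooth_map_in_topspace[OF fs(3) fs(2)] that nth_mem by blast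
  then obtain V gs where V: "\<And>i. i < length fs \<Longrightarrow> openin (mtop Y) (V i) \<and> (fs ! i) z \<in> V i \<and> Q (V i) (gs i)"
    by metis
  define U where "U = W \<inter> {x \<in> topspace (mtop Z). \<forall>i\<in>{..<length fs}. x \<in> W \<and> (fs ! i) x \<in> V i}"
  have Wsub: "W \<subseteq> topspace (mtop Z)"
    by (rule openin_subset[OF fs(1)])
  have "openin (mtop Z) U"
    unfolding U_def
  proof (intro openin_Int fs(1) openin_Collect_ball_finite)
    fix i assume i: "i \<in> {..<length fs}"
    have "openin (mtop Z) (W \<inter> (fs ! i) -` V i)"
      using V i by (intro smooth_map_preimage[OF fs(3)]) auto
    moreover have "{x \<in> topspace (mtop Z). x \<in> W \<and> (fs ! i) x \<in> V i} = W \<inter> (fs ! i) -` V i"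
      using Wsub by auto
    ultimately show "openin (mtop Z) {x \<in> topspace (mtop Z). x \<in> W \<and> (fs ! i) x \<in> V i}"
      by simp
  qed simp
  moreover have "z \<in> U" "U \<subseteq> W"
    using fs(2) V Wsub by (auto simp: U_def)
  ultimately show thesis
    using V by (intro that[of U "map V [0..<length fs]" "map gs [0..<length fs]"]) (auto simp: U_def)
qed

text \<open>Composites of local tuples for \<open>f\<close> and \<open>g\<close> are the symplectic
  tuples that \<open>star_in_SCor\<close> asks for.\<close>

lemma star_comp_in:
  assumes "tame Z" "tame Y" "tame X" and f: "f \<in> SCor Z Y" and g: "g \<in> SCor Y X"
  shows "tame_pair.star Z X \<in> SCor Z X"
proof -
  interpret ZX: tame_pair Z X using assms by (simp add: tame_pair_def)
  interpret ZY: tame_pair Z Y using assms by (simp add: tame_pair_def)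
  interpret YX: tame_pair Y X using assms by (simp add: tame_pair_def)
  show ?thesis
  proof (rule ZX.star_in_SCor)
    fix z assume "z \<in> topspace (mtop Z)"
    then obtain W fs where W: "openin (mtop Z) W" "z \<in> W" "symp_tuple Z Y W fs"
      using ZY.SCor_local[OF f] by blast
    have sm: "smooth_map_on Z Y W f" if "f \<in> set fs" for f
      using that W(3) by (simp add: symp_tuple_def)
    have "\<exists>V gs. openin (mtop Y) V \<and> y \<in> V \<and> symp_tuple Y X V gs" if "y \<in> topspace (mtop Y)" for y
      using YX.SCor_local[OF g] that by metis
    from composable_reps[OF W(1,2) sm this] obtain U Vs gss where U: "openin (mtop Z) U" "z \<in> U" "U \<subseteq> W"
      "length Vs = length fs" "length gss = length fs"
      "\<And>i. i < length fs \<Longrightarrow> symp_tuple Y X (Vs ! i) (gss ! i) \<and> openin (mtop Y) (Vs ! i) \<and> (fs ! i) ` U \<subseteq> Vs ! i"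
      by blast
    have "symp_tuple Z X U (comp_tuple fs gss)"
    proof (rule symp_tuple_comp[OF assms(1-3)[THEN tame.atlas]])
      show "symp_tuple Z Y U fs"
        by (rule symp_tuple_subset[OF assms(1,2)[THEN tame.atlas] W(3) U(1,3)])
    qed (use U in auto)
    then show "\<exists>W fs. openin (mtop Z) W \<and> z \<in> W \<and> symp_tuple Z X W fs"
      using U by blast
  qed
qed

text \<open>Uniqueness holds since \<open>star\<close> is the only possible element of
  \<open>SCor Z X\<close>; existence holds because \<open>star_rep\<close> accepts every composite
  tuple.\<close>

lemma SCor_comp_eq:
  assumes "tame Z" "tame Y" "tame X" and f: "f \<in> SCor Z Y" and g: "g \<in> SCor Y X"
  shows "SCor_comp Z Y X g f = tame_pair.star Z X"
proof -
  interpret ZX: tame_pair Z X using assms by (simp add: tame_pair_def)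
  interpret ZY: tame_pair Z Y using assms by (simp add: tame_pair_def)
  interpret YX: tame_pair Y X using assms by (simp add: tame_pair_def)
  show ?thesis
    unfolding SCor_comp_def cor_comp_def
  proof (rule the_equality)
    show "ZX.star \<in> SCor Z X \<and> (\<forall>U fs Vs gss. SCor_rep Z Y f U fs \<and> length Vs = length fs \<and> length gss = length fs \<and>
      (\<forall>i<length fs. SCor_rep Y X g (Vs ! i) (gss ! i) \<and> (fs ! i) ` U \<subseteq> Vs ! i) \<longrightarrow>
      SCor_rep Z X ZX.star U (comp_tuple fs gss))"
    proof (intro conjI allI impI star_comp_in[OF assms])
      fix U fs Vs gss
      assume *: "SCor_rep Z Y f U fs \<and> length Vs = length fs \<and> length gss = length fs \<and>
        (\<forall>i<length fs. SCor_rep Y X g (Vs ! i) (gss ! i) \<and> (fs ! i) ` U \<subseteq> Vs ! i)"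
      have "symp_tuple Z X U (comp_tuple fs gss)"
        by (rule symp_tuple_comp[OF assms(1-3)[THEN tame.atlas], where Vs = Vs])
          (use * in \<open>auto simp: SCor_rep_def\<close>)
      then show "SCor_rep Z X ZX.star U (comp_tuple fs gss)"
        unfolding ZX.star_rep using * by (auto simp: SCor_rep_def)
    qed
  qed (use ZX.SCor_eq_star in blast)
qed

lemma SC_comp_eq:
  assumes "tame Z" "tame Y" "tame X" and F: "F \<in> carrier (SC Z Y)" and G: "G \<in> carrier (SC Y X)"
  shows "SC_comp Z Y X G F = frag_cmul (aug G * aug F) (frag_of (tame_pair.star Z X))"
proof -
  have "frag_extend (\<lambda>f. frag_of (SCor_comp Z Y X g f)) F = frag_cmul (aug F) (frag_of (tame_pair.star Z X))"
    if "g \<in> Poly_Mapping.keys G" for g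
  proof (rule frag_extend_const)
    fix f assume "f \<in> Poly_Mapping.keys F"
    then have "f \<in> SCor Z Y" "g \<in> SCor Y X"
      using that F G by (auto simp: SC_def)
    then show "frag_of (SCor_comp Z Y X g f) = frag_of (tame_pair.star Z X)"
      by (simp add: SCor_comp_eq[OF assms(1-3)])
  qed
  then have "SC_comp Z Y X G F = frag_cmul (aug G) (frag_cmul (aug F) (frag_of (tame_pair.star Z X)))"
    unfolding SC_comp_def by (rule frag_extend_const)
  then show ?thesis by simp
qed

subsection \<open>Faces and products\<close>

text \<open>Inserting a constant factor at position \<open>i\<close> shifts the later factors by one
  and contributes \<open>0\<close> itself. Both the form and the almost complex structure of a power
  are sums over its factors.\<close>

lemma sum_skip:
  fixes b :: "nat \<Rightarrow> real"
  assumes i: "i < n"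
  shows "(\<Sum>k<n. if k < i then b k else if k = i then 0 else b (k - 1)) = (\<Sum>k<n - 1. b k)"
proof -
  have "(\<Sum>k<n. if k < i then b k else if k = i then 0 else b (k - 1)) =
      (\<Sum>k\<in>{..<n} - {i}. if k < i then b k else if k = i then 0 else b (k - 1))"
    using i by (subst sum.remove[of "{..<n}" i]) auto
  also have "\<dots> = (\<Sum>k\<in>{..<n} - {i}. if k < i then b k else b (k - 1))"
    by (rule sum.cong) auto
  also have "\<dots> = (\<Sum>k<n - 1. b k)"
    by (rule sum.reindex_bij_witness[of _ "\<lambda>k. if k < i then k else k + 1" "\<lambda>k. if k < i then k else k - 1"])
      (use i in auto)
  finally show ?thesis .
qed

text \<open>The inserted factor is constant, so its tangent component is \<open>vzero\<close> and
  its summand is \<open>0\<close>.\<close>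

lemma form_insert_point:
  assumes M: "tame M" and i: "i < n" and p: "p \<in> topspace (mtop M)"
    and m: "m \<in> topspace (mtop (power_symp M (n - 1)))"
    and v: "v \<in> tangent_space (power_symp M (n - 1)) m" and w: "w \<in> tangent_space (power_symp M (n - 1)) m"
  shows "power_form M n (insert_point n i p m) (tmap (power_symp M n) (insert_point n i p) m v)
      (tmap (power_symp M n) (insert_point n i p) m w) = power_form M (n - 1) m v w"
proof -
  interpret M: tame M by fact
  interpret P': power_mfd "power_symp M (n - 1)" M "n - 1" by (rule power_symp_mfd[OF M.atlas])
  interpret P: power_mfd "power_symp M n" M n by (rule power_symp_mfd[OF M.atlas])
  let ?P' = "power_symp M (n - 1)"
  define b where "b = (\<lambda>k. form M (m k) (tmap M (\<lambda>m. m k) m v) (tmap M (\<lambda>m. m k) m w))"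
  have "form M (insert_point n i p m k) (tmap M (\<lambda>m. insert_point n i p m k) m v)
      (tmap M (\<lambda>m. insert_point n i p m k) m w) = (if k < i then b k else if k = i then 0 else b (k - 1))"
    if k: "k < n" for k
    using k local_exact_vzero(1)[OF M.exact p vzero_tangent]
    by (simp add: insert_point_apply b_def tmap_const[OF P'.smooth_atlas_P m v] tmap_const[OF P'.smooth_atlas_P m w])
  then have "(\<Sum>k<n. form M (insert_point n i p m k) (tmap M (\<lambda>m. insert_point n i p m k) m v)
      (tmap M (\<lambda>m. insert_point n i p m k) m w)) = (\<Sum>k<n. if k < i then b k else if k = i then 0 else b (k - 1))"
    by (intro sum.cong) auto
  also have "\<dots> = (\<Sum>k<n - 1. b k)"
    by (rule sum_skip[OF i])
  also have "\<dots> = power_form M (n - 1) m v w"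
    by (simp add: power_form_def b_def)
  finally have "(\<Sum>k<n. form M (insert_point n i p m k) (tmap M (\<lambda>m. insert_point n i p m k) m v)
      (tmap M (\<lambda>m. insert_point n i p m k) m w)) = power_form M (n - 1) m v w" .
  moreover have "power_form M n (insert_point n i p m) (tmap (power_symp M n) (insert_point n i p) m v)
      (tmap (power_symp M n) (insert_point n i p) m w) =
    (\<Sum>k<n. form M (insert_point n i p m k) (tmap M (\<lambda>m. insert_point n i p m k) m v)
      (tmap M (\<lambda>m. insert_point n i p m k) m w))"
  proof (rule power_form_pull[where U = "topspace (mtop ?P')", OF M.atlas P'.smooth_atlas_P])
    show "smooth_map_on ?P' M (topspace (mtop ?P')) (\<lambda>w. insert_point n i p w k)" if "k < n" for k
      by (rule smooth_insert_point(1)[OF P'.power_mfd_axioms P.power_mfd_axioms i p that])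
  qed (rule m openin_topspace | simp add: insert_point_def extensional_def)+
  ultimately show ?thesis
    by simp
qed

text \<open>The face map is the identity on \<open>Y\<close> and inserts a constant factor, so it
  preserves both summands of the product form.\<close>

lemma face_symp:
  assumes Y: "tame Y" and M: "tame M" and i: "i < n" and p: "p0 \<in> topspace (mtop M)" "p1 \<in> topspace (mtop M)"
  shows "symp_tuple (prod_symp Y (power_symp M (n - 1))) (prod_symp Y (power_symp M n))
    (topspace (mtop (prod_symp Y (power_symp M (n - 1))))) [face_map p0 p1 n i e]"
proof -
  interpret Y: tame Y by fact
  interpret M: tame M by fact
  interpret P': power_mfd "power_symp M (n - 1)" M "n - 1" by (rule power_symp_mfd[OF M.atlas])
  interpret P: power_mfd "power_symp M n" M n by (rule power_symp_mfd[OF M.atlas])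
  interpret A: prod_mfd "prod_symp Y (power_symp M (n - 1))" Y "power_symp M (n - 1)"
    by (rule prod_symp_mfd[OF Y.atlas P'.smooth_atlas_P])
  interpret B: prod_mfd "prod_symp Y (power_symp M n)" Y "power_symp M n"
    by (rule prod_symp_mfd[OF Y.atlas P.smooth_atlas_P])
  let ?A = "prod_symp Y (power_symp M (n - 1))" and ?B = "prod_symp Y (power_symp M n)"
  define p where "p = (if e = 0 then p0 else p1)"
  have pM: "p \<in> topspace (mtop M)"
    using p by (simp add: p_def)
  let ?ins = "insert_point n i p"
  have ins: "smooth_map_on (power_symp M (n - 1)) (power_symp M n) (topspace (mtop (power_symp M (n - 1)))) ?ins"
    by (rule smooth_insert_point(2)[OF P'.power_mfd_axioms P.power_mfd_axioms i pM])
  have snd_sub: "snd ` topspace (mtop ?A) \<subseteq> topspace (mtop (power_symp M (n - 1)))"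
    by (auto simp: A.top_P)
  have insnd: "smooth_map_on ?A (power_symp M n) (topspace (mtop ?A)) (\<lambda>w. ?ins (snd w))"
    by (rule smooth_map_compose[OF A.smooth_atlas_P P'.smooth_atlas_P A.smooth_snd ins snd_sub])
  have face: "face_map p0 p1 n i e = (\<lambda>w. (fst w, ?ins (snd w)))"
    by (simp add: face_map_eq p_def)
  show ?thesis
    unfolding symp_tuple_def face
  proof (intro conjI ballI)
    show "smooth_map_on ?A ?B (topspace (mtop ?A)) f" if "f \<in> set [\<lambda>w. (fst w, ?ins (snd w))]" for f
      using that B.smooth_Pair[OF A.smooth_atlas_P A.smooth_fst insnd] by simp
    fix y v w assume y: "y \<in> topspace (mtop ?A)" and v: "v \<in> tangent_space ?A y" and w: "w \<in> tangent_space ?A y"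
    have sy: "snd y \<in> topspace (mtop (power_symp M (n - 1)))"
      using y snd_sub by blast
    have "tmap (power_symp M n) (\<lambda>w. ?ins (snd w)) y u =
        tmap (power_symp M n) ?ins (snd y) (tmap (power_symp M (n - 1)) snd y u)" for u
      using tmap_compose[OF A.smooth_atlas_P P'.smooth_atlas_P A.smooth_snd y ins sy P.smooth_atlas_P, of u] by simp
    then have "power_form M n (?ins (snd y)) (tmap (power_symp M n) (\<lambda>w. ?ins (snd w)) y v)
        (tmap (power_symp M n) (\<lambda>w. ?ins (snd w)) y w) =
      power_form M (n - 1) (snd y) (tmap (power_symp M (n - 1)) snd y v) (tmap (power_symp M (n - 1)) snd y w)"
      using form_insert_point[OF M i pM sy]
        tmap_in_tangent_space[OF A.smooth_atlas_P P'.smooth_atlas_P A.smooth_snd y] v w by simp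
    then show "pullback_sum ?B [\<lambda>w. (fst w, ?ins (snd w))] y v w = form ?A y v w"
      using prod_form_pull[OF Y.atlas P.smooth_atlas_P A.smooth_atlas_P A.smooth_fst insnd y, where v = v and w = w]
      by (simp add: pullback_sum_def prod_form_def)
  qed
qed

text \<open>As \<open>{f_i \<times> id}\<close> need not be symplectic, membership of
  \<open>star\<close> is shown with another tuple: the maps
  \<open>(z, m) \<mapsto> (f_i z, n0)\<close> and the single map
  \<open>(z, m) \<mapsto> (y0, m)\<close> for fixed points \<open>n0\<close> and \<open>y0\<close>.
  The former contribute the form of \<open>Z\<close>, the latter that of \<open>N\<close>.\<close>

lemma SCor_times_eq:
  assumes "tame Z" "tame Y" "tame N" and f: "f \<in> SCor Z Y"
  shows "SCor_times Z Y N f = tame_pair.star (prod_symp Z N) (prod_symp Y N)"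
    and "tame_pair.star (prod_symp Z N) (prod_symp Y N) \<in> SCor (prod_symp Z N) (prod_symp Y N)"
proof -
  interpret Z: tame Z by fact
  interpret Y: tame Y by fact
  interpret N: tame N by fact
  let ?ZN = "prod_symp Z N" and ?YN = "prod_symp Y N"
  interpret ZN: prod_mfd ?ZN Z N by (rule prod_symp_mfd[OF Z.atlas N.atlas])
  interpret YN: prod_mfd ?YN Y N by (rule prod_symp_mfd[OF Y.atlas N.atlas])
  interpret ZY: tame_pair Z Y by unfold_locales
  interpret T: tame_pair ?ZN ?YN
    by (simp add: tame_pair_def tame_prod assms)
  obtain y0 n0 where y0: "y0 \<in> topspace (mtop Y)" and n0: "n0 \<in> topspace (mtop N)"
    using Y.nonempty N.nonempty by blast
  show star: "T.star \<in> SCor ?ZN ?YN"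
  proof (rule T.star_in_SCor)
    fix p assume p: "p \<in> topspace (mtop ?ZN)"
    then have "fst p \<in> topspace (mtop Z)"
      by (auto simp: ZN.top_P)
    then obtain W fs where W: "openin (mtop Z) W" "fst p \<in> W" "symp_tuple Z Y W fs"
      using ZY.SCor_local[OF f] by blast
    let ?U = "W \<times> topspace (mtop N)"
    have U: "openin (mtop ?ZN) ?U"
      using W by (simp add: openin_prod_Times_iff)
    then have Usub: "?U \<subseteq> topspace (mtop ?ZN)"
      by (rule openin_subset)
    have pU: "p \<in> ?U"
      using p W by (cases p) (simp add: ZN.top_P)
    have fstU: "smooth_map_on ?ZN Z ?U fst" and sndU: "smooth_map_on ?ZN N ?U snd"
      using smooth_map_subset[OF ZN.smooth_atlas_P ZN.smooth_fst Usub U Z.atlas]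
        smooth_map_subset[OF ZN.smooth_atlas_P ZN.smooth_snd Usub U N.atlas] by auto
    have ffst: "smooth_map_on ?ZN Y ?U (\<lambda>w. f (fst w))" if "f \<in> set fs" for f
      using that W(3) by (intro smooth_map_compose[OF ZN.smooth_atlas_P Z.atlas fstU]) (auto simp: symp_tuple_def)
    have cN: "smooth_map_on ?ZN N ?U (\<lambda>w. n0)" and cY: "smooth_map_on ?ZN Y ?U (\<lambda>w. y0)"
      by (rule smooth_map_const[OF ZN.smooth_atlas_P U n0], rule smooth_map_const[OF ZN.smooth_atlas_P U y0])
    let ?gs = "map (\<lambda>f w. (f (fst w), n0)) fs @ [\<lambda>w. (y0, snd w)]"
    have "symp_tuple ?ZN ?YN ?U ?gs"
      unfolding symp_tuple_def
    proof (intro conjI ballI)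
      show "smooth_map_on ?ZN ?YN ?U g" if "g \<in> set ?gs" for g
        using that YN.smooth_Pair[OF ZN.smooth_atlas_P ffst cN] YN.smooth_Pair[OF ZN.smooth_atlas_P cY sndU] by auto
      fix y v w assume y: "y \<in> ?U" and v: "v \<in> tangent_space ?ZN y" and w: "w \<in> tangent_space ?ZN y"
      have ytop: "y \<in> topspace (mtop ?ZN)"
        using y Usub by blast
      have z: "form N n0 vzero vzero = 0" "form Y y0 vzero vzero = 0"
        by (rule local_exact_vzero(1)[OF N.exact n0 vzero_tangent], rule local_exact_vzero(1)[OF Y.exact y0 vzero_tangent])
      note c = tmap_const[OF ZN.smooth_atlas_P ytop v] tmap_const[OF ZN.smooth_atlas_P ytop w]
      have "form ?YN (f (fst y), n0) (tmap ?YN (\<lambda>w. (f (fst w), n0)) y v) (tmap ?YN (\<lambda>w. (f (fst w), n0)) y w) =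
          form Y (f (fst y)) (tmap Y f (fst y) (tmap Z fst y v)) (tmap Y f (fst y) (tmap Z fst y w))"
        if "f \<in> set fs" for f
      proof -
        have "smooth_map_on Z Y W f"
          using that W(3) by (simp add: symp_tuple_def)
        from tmap_compose[OF ZN.smooth_atlas_P Z.atlas fstU y this _ Y.atlas] y
        have "tmap Y (\<lambda>w. f (fst w)) y u = tmap Y f (fst y) (tmap Z fst y u)" for u
          by auto
        then show ?thesis
          using prod_form_pull[OF Y.atlas N.atlas ZN.smooth_atlas_P ffst[OF that] cN y, where v = v and w = w]
          by (simp add: c z)
      qed
      then have "pullback_sum ?YN (map (\<lambda>f w. (f (fst w), n0)) fs) y v w =
          pullback_sum Y fs (fst y) (tmap Z fst y v) (tmap Z fst y w)"
        unfolding pullback_sum_def by (simp add: comp_def cong: map_cong)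
      also have "\<dots> = form Z (fst y) (tmap Z fst y v) (tmap Z fst y w)"
        using W(3) y v w tmap_in_tangent_space[OF ZN.smooth_atlas_P Z.atlas fstU y] by (auto simp: symp_tuple_def)
      finally show "pullback_sum ?YN ?gs y v w = form ?ZN y v w"
        using prod_form_pull[OF Y.atlas N.atlas ZN.smooth_atlas_P cY sndU y, where v = v and w = w]
        by (simp add: pullback_sum_append pullback_sum_def[of _ "[_]"] c z prod_form_def)
    qed
    then show "\<exists>W fs. openin (mtop ?ZN) W \<and> p \<in> W \<and> symp_tuple ?ZN ?YN W fs"
      using U pU by blast
  qed
  show "SCor_times Z Y N f = T.star"
    unfolding SCor_times_def Let_def
  proof (rule the_equality)
    show "T.star \<in> SCor ?ZN ?YN \<and> (\<forall>U fs. SCor_rep Z Y f U fs \<and>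
        symp_tuple ?ZN ?YN (U \<times> topspace (mtop N)) (map (\<lambda>f. map_prod f id) fs) \<longrightarrow>
        SCor_rep ?ZN ?YN T.star (U \<times> topspace (mtop N)) (map (\<lambda>f. map_prod f id) fs))"
    proof (intro conjI allI impI star)
      fix U fs assume *: "SCor_rep Z Y f U fs \<and>
        symp_tuple ?ZN ?YN (U \<times> topspace (mtop N)) (map (\<lambda>f. map_prod f id) fs)"
      then have "openin (mtop ?ZN) (U \<times> topspace (mtop N))"
        by (auto simp: SCor_rep_def openin_prod_Times_iff)
      then show "SCor_rep ?ZN ?YN T.star (U \<times> topspace (mtop N)) (map (\<lambda>f. map_prod f id) fs)"
        unfolding T.star_rep using * by blast
    qed
  qed (use T.SCor_eq_star in blast)
qed

subsection \<open>Induced maps\<close>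

locale symp_setting =
  fixes X :: "'x symp_manifold" and Y :: "'y symp_manifold" and Z :: "'z symp_manifold"
    and M :: "'m symp_manifold" and p0 p1 :: 'm
  assumes X: "tame X" and Y: "tame Y" and Z: "tame Z" and M: "tame M"
    and p0: "p0 \<in> topspace (mtop M)" and p1: "p1 \<in> topspace (mtop M)"

definition SC_face ::
    "'m symp_manifold \<Rightarrow> 'm \<Rightarrow> 'm \<Rightarrow> 'y symp_manifold \<Rightarrow> 'x symp_manifold \<Rightarrow> nat \<Rightarrow> nat \<Rightarrow> nat
      \<Rightarrow> (('y \<times> (nat \<Rightarrow> 'm), 'x) scor \<Rightarrow>\<^sub>0 int) \<Rightarrow> (('y \<times> (nat \<Rightarrow> 'm), 'x) scor \<Rightarrow>\<^sub>0 int)"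
  where "SC_face M p0 p1 Y X n i e \<sigma> =
    (let A = prod_symp Y (power_symp M (n - 1)); B = prod_symp Y (power_symp M n) in
      SC_comp A B X \<sigma> (SC_of A B (face_map p0 p1 n i e)))"

lemma SC_diff_eq: "SC_diff M p0 p1 Y X = cubical_diff (SC_chain M Y X) (SC_face M p0 p1 Y X)"
  unfolding SC_diff_def SC_face_def by (rule refl)

lemma hom_cong:
  assumes "f \<in> hom G H" "group G" "\<And>x. x \<in> carrier G \<Longrightarrow> f x = g x"
  shows "g \<in> hom G H"
proof (rule homI)
  fix x y assume x: "x \<in> carrier G" and y: "y \<in> carrier G"
  then have "x \<otimes>\<^bsub>G\<^esub> y \<in> carrier G"
    using assms(2) by (simp add: group.is_monoid monoid.m_closed)
  then have "g (x \<otimes>\<^bsub>G\<^esub> y) = f (x \<otimes>\<^bsub>G\<^esub> y)"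
    using assms(3) by metis
  also have "\<dots> = f x \<otimes>\<^bsub>H\<^esub> f y"
    using assms(1) x y by (simp add: hom_def)
  finally show "g (x \<otimes>\<^bsub>G\<^esub> y) = g x \<otimes>\<^bsub>H\<^esub> g y"
    using assms(3) x y by metis
qed (use assms in \<open>auto simp: hom_def Pi_iff\<close>)

text \<open>A face map gives a single generator, so faces preserve augmentations; the factor
  \<open>1\<close> is the \<open>k\<close> of \<open>aug_hom\<close>.\<close>

lemma SC_face_props:
  assumes Y: "tame Y" and X: "tame X" and M: "tame M" and p: "p0 \<in> topspace (mtop M)" "p1 \<in> topspace (mtop M)"
    and i: "i < n"
  shows "\<sigma> \<in> carrier (SC_chain M Y X n) \<Longrightarrow> SC_face M p0 p1 Y X n i e \<sigma> =
      frag_cmul (1 * aug \<sigma>) (frag_of (tame_pair.star (prod_symp Y (power_symp M (n - 1))) X))"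
    and "SC_face M p0 p1 Y X n i e \<in> hom (SC_chain M Y X n) (SC_chain M Y X (n - 1))"
proof -
  let ?A = "prod_symp Y (power_symp M (n - 1))" and ?B = "prod_symp Y (power_symp M n)"
  have A: "tame ?A" and B: "tame ?B"
    by (intro tame_prod tame_power Y M)+
  interpret AB: tame_pair ?A ?B using A B by (simp add: tame_pair_def)
  have of: "SCor_of ?A ?B (face_map p0 p1 n i e) \<in> SCor ?A ?B"
    by (rule AB.SCor_of_in[OF face_symp[OF Y M i p]])
  then have "SC_of ?A ?B (face_map p0 p1 n i e) \<in> carrier (SC ?A ?B)"
    by (simp add: SC_of_def SC_def keys_frag_of)
  then show eq: "SC_face M p0 p1 Y X n i e \<sigma> = frag_cmul (1 * aug \<sigma>) (frag_of (tame_pair.star ?A X))"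
    if "\<sigma> \<in> carrier (SC_chain M Y X n)" for \<sigma>
    using that SC_comp_eq[OF A B X, of "SC_of ?A ?B (face_map p0 p1 n i e)" \<sigma>]
    by (simp add: SC_face_def SC_chain_def SC_of_def)
  have "(\<lambda>\<sigma>. frag_cmul (1 * aug \<sigma>) (frag_of (tame_pair.star ?A X))) \<in> hom (SC_chain M Y X n) (SC_chain M Y X (n - 1))"
    unfolding SC_chain_def SC_def
  proof (rule aug_hom)
    assume "SCor ?B X \<noteq> {}"
    then show "tame_pair.star ?A X \<in> SCor ?A X \<or> (1 :: int) = 0"
      using star_comp_in[OF A B X of] by blast
  qed
  then show "SC_face M p0 p1 Y X n i e \<in> hom (SC_chain M Y X n) (SC_chain M Y X (n - 1))"
    by (rule hom_cong) (simp_all add: eq, simp add: SC_chain_def SC_def)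
qed

lemma SC_cubical:
  assumes "tame Y" "tame X" "tame M" "p0 \<in> topspace (mtop M)" "p1 \<in> topspace (mtop M)"
  shows "cubical (SC_chain M Y X) (SC_face M p0 p1 Y X)"
  by (rule cubical.intro) (simp add: SC_chain_def SC_def abelian_free_Abelian_group, rule SC_face_props(2)[OF assms])

context symp_setting
begin

text \<open>A face preserves \<open>aug\<close>, the push multiplies it by \<open>aug G\<close>, and
  both routes end in multiples of the same generator \<open>star\<close>.\<close>

lemma SC_push_induces:
  assumes G: "G \<in> carrier (SC Y X)"
  shows "induces_on_homology (SC_chain M Z Y) (SC_diff M p0 p1 Z Y)
    (SC_chain M Z X) (SC_diff M p0 p1 Z X) (SC_push M Z Y X G)"
  unfolding SC_diff_eq
proof (rule cubical_map_induces[OF SC_cubical[OF Z Y M p0 p1] SC_cubical[OF Z X M p0 p1]])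
  let ?Z = "\<lambda>n. prod_symp Z (power_symp M n)"
  have Zn: "tame (?Z n)" for n
    by (intro tame_prod tame_power Z M)
  have eq: "SC_push M Z Y X G n \<sigma> = frag_cmul (aug G * aug \<sigma>) (frag_of (tame_pair.star (?Z n) X))"
    if "\<sigma> \<in> carrier (SC_chain M Z Y n)" for n \<sigma>
    using SC_comp_eq[OF Zn Y X _ G] that by (simp add: SC_push_def SC_chain_def)
  show hom: "SC_push M Z Y X G n \<in> hom (SC_chain M Z Y n) (SC_chain M Z X n)" for n
  proof (rule hom_cong)
    show "(\<lambda>\<sigma>. frag_cmul (aug G * aug \<sigma>) (frag_of (tame_pair.star (?Z n) X))) \<in> hom (SC_chain M Z Y n) (SC_chain M Z X n)"
      unfolding SC_chain_def SC_def
    proof (rule aug_hom)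
      assume ne: "SCor (?Z n) Y \<noteq> {}"
      \<comment> \<open>For \<open>G = 0\<close> the target may have no generator, but then
        \<open>aug G = 0\<close>. Otherwise a generator in \<open>G\<close> composes with one of the
        chain group.\<close>
      show "tame_pair.star (?Z n) X \<in> SCor (?Z n) X \<or> aug G = 0"
      proof (cases "Poly_Mapping.keys G = {}")
        case False
        show ?thesis
        proof -
          obtain f g where "f \<in> SCor (?Z n) Y" "g \<in> Poly_Mapping.keys G"
            using ne False by blast
          moreover from this have "g \<in> SCor Y X"
            using G by (auto simp: SC_def)
          ultimately have "tame_pair.star (?Z n) X \<in> SCor (?Z n) X"
            by (intro star_comp_in[OF Zn Y X])
          then show ?thesis ..
        qed
      qed (simp add: aug_def)
    qed
  qed (simp_all add: eq, simp add: SC_chain_def SC_def)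
  fix n i e :: nat and \<sigma> assume i: "i < n" and \<sigma>: "\<sigma> \<in> carrier (SC_chain M Z Y n)"
  have "SC_face M p0 p1 Z Y n i e \<sigma> \<in> carrier (SC_chain M Z Y (n - 1))" "SC_push M Z Y X G n \<sigma> \<in> carrier (SC_chain M Z X n)"
    by (rule hom_in_carrier[OF SC_face_props(2)[OF Z Y M p0 p1 i] \<sigma>], rule hom_in_carrier[OF hom \<sigma>])
  then show "SC_push M Z Y X G (n - 1) (SC_face M p0 p1 Z Y n i e \<sigma>) = SC_face M p0 p1 Z X n i e (SC_push M Z Y X G n \<sigma>)"
    by (simp add: eq \<sigma> SC_face_props(1)[OF Z Y M p0 p1 i] SC_face_props(1)[OF Z X M p0 p1 i] aug_cmul)
qed

text \<open>As for the push, with the factor \<open>aug F\<close>; \<open>SCor_times_eq\<close>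
  provides that the product of a correspondence with the identity is again an element.\<close>

lemma SC_pull_induces:
  assumes F: "F \<in> carrier (SC Z Y)"
  shows "induces_on_homology (SC_chain M Y X) (SC_diff M p0 p1 Y X)
    (SC_chain M Z X) (SC_diff M p0 p1 Z X) (SC_pull M Z Y X F)"
  unfolding SC_diff_eq
proof (rule cubical_map_induces[OF SC_cubical[OF Y X M p0 p1] SC_cubical[OF Z X M p0 p1]])
  let ?Z = "\<lambda>n. prod_symp Z (power_symp M n)" and ?Y = "\<lambda>n. prod_symp Y (power_symp M n)"
  have Zn: "tame (?Z n)" and Yn: "tame (?Y n)" and Mn: "tame (power_symp M n)" for n
    by (intro tame_prod tame_power Z Y M)+
  have times: "SCor_times Z Y (power_symp M n) f \<in> SCor (?Z n) (?Y n)" if "f \<in> SCor Z Y" for f n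
    using SCor_times_eq[OF Z Y Mn that] by simp
  have eq: "SC_pull M Z Y X F n \<sigma> = frag_cmul (aug F * aug \<sigma>) (frag_of (tame_pair.star (?Z n) X))"
    if \<sigma>: "\<sigma> \<in> carrier (SC_chain M Y X n)" for n \<sigma>
  proof -
    have "SC_comp (?Z n) (?Y n) X \<sigma> (frag_of (SCor_times Z Y (power_symp M n) f)) =
        frag_cmul (aug \<sigma>) (frag_of (tame_pair.star (?Z n) X))" if "f \<in> Poly_Mapping.keys F" for f
      using SC_comp_eq[OF Zn Yn X, where F = "frag_of (SCor_times Z Y (power_symp M n) f)" and G = \<sigma>] times[of f n] that F \<sigma>
      by (auto simp: SC_def SC_chain_def keys_frag_of)
    then have "SC_pull M Z Y X F n \<sigma> = frag_cmul (aug F) (frag_cmul (aug \<sigma>) (frag_of (tame_pair.star (?Z n) X)))"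
      unfolding SC_pull_def Let_def by (rule frag_extend_const)
    then show ?thesis by simp
  qed
  show hom: "SC_pull M Z Y X F n \<in> hom (SC_chain M Y X n) (SC_chain M Z X n)" for n
  proof (rule hom_cong)
    show "(\<lambda>\<sigma>. frag_cmul (aug F * aug \<sigma>) (frag_of (tame_pair.star (?Z n) X))) \<in> hom (SC_chain M Y X n) (SC_chain M Z X n)"
      unfolding SC_chain_def SC_def
    proof (rule aug_hom)
      assume ne: "SCor (?Y n) X \<noteq> {}"
      show "tame_pair.star (?Z n) X \<in> SCor (?Z n) X \<or> aug F = 0"
      proof (cases "Poly_Mapping.keys F = {}")
        case False
        then obtain f g where f': "f \<in> Poly_Mapping.keys F" and g: "g \<in> SCor (?Y n) X"
          using ne by blast
        have f: "f \<in> SCor Z Y"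
          using f' F by (auto simp: SC_def)
        have "tame_pair.star (?Z n) X \<in> SCor (?Z n) X"
          by (rule star_comp_in[OF Zn Yn X times[OF f] g])
        then show ?thesis ..
      qed (simp add: aug_def)
    qed
  qed (simp_all add: eq, simp add: SC_chain_def SC_def)
  fix n i e :: nat and \<sigma> assume i: "i < n" and \<sigma>: "\<sigma> \<in> carrier (SC_chain M Y X n)"
  have "SC_face M p0 p1 Y X n i e \<sigma> \<in> carrier (SC_chain M Y X (n - 1))" "SC_pull M Z Y X F n \<sigma> \<in> carrier (SC_chain M Z X n)"
    by (rule hom_in_carrier[OF SC_face_props(2)[OF Y X M p0 p1 i] \<sigma>], rule hom_in_carrier[OF hom \<sigma>])
  then show "SC_pull M Z Y X F (n - 1) (SC_face M p0 p1 Y X n i e \<sigma>) = SC_face M p0 p1 Z X n i e (SC_pull M Z Y X F n \<sigma>)"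
    by (simp add: eq \<sigma> SC_face_props(1)[OF Y X M p0 p1 i] SC_face_props(1)[OF Z X M p0 p1 i] aug_cmul)
qed

end

lemma SC_of_in:
  assumes "tame Z" "tame Y" "symplectic_embedding Z Y f"
  shows "SC_of Z Y f \<in> carrier (SC Z Y)"
proof -
  interpret tame_pair Z Y using assms by (simp add: tame_pair_def)
  have "symp_tuple Z Y (topspace (mtop Z)) [f]"
    using assms(3) by (simp add: symplectic_embedding_def symp_tuple_def pullback_sum_def)
  then show ?thesis
    using SCor_of_in by (simp add: SC_of_def SC_def keys_frag_of)
qed

section \<open>Pseudoholomorphic maps\<close>

subsection \<open>Products\<close>

text \<open>\<open>tmap\<close> reads only these three fields of the target, so the truncated
  records inside \<open>prod_acs\<close> and \<open>power_acs\<close> can be replaced by the full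
  ones.\<close>

lemma tmap_fields_cong:
  "mtop A = mtop B \<Longrightarrow> mdim A = mdim B \<Longrightarrow> atlas A = atlas B \<Longrightarrow> tmap A f p = tmap B f p"
  by (simp add: fun_eq_iff tmap_def smooth_near_def smooth_fun_on_def)

lemma prod_acs_sel [simp]:
  "mtop (prod_acs A B) = prod_topology (mtop A) (mtop B)"
  "mdim (prod_acs A B) = mdim A + mdim B"
  "atlas (prod_acs A B) = {prod_chart (mdim A) c e | c e. c \<in> atlas A \<and> e \<in> atlas B}"
  by (simp_all add: prod_acs_def Let_def prod_symp_def symp_manifold.truncate_def)

lemma power_acs_sel [simp]:
  "mtop (power_acs M n) = product_topology (\<lambda>_. mtop M) {..<n}"
  "mdim (power_acs M n) = n * mdim M"
  "atlas (power_acs M n) = {power_chart (mdim M) n c | c. c \<in> {..<n} \<rightarrow> atlas M}"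
  by (simp_all add: power_acs_def Let_def power_symp_def symp_manifold.truncate_def)

lemma prod_acs_mfd: "smooth_atlas A \<Longrightarrow> smooth_atlas B \<Longrightarrow> prod_mfd (prod_acs A B) A B"
  by unfold_locales simp_all

lemma power_acs_mfd: "smooth_atlas M \<Longrightarrow> power_mfd (power_acs M n) M n"
  by unfold_locales simp_all

lemma tmap_prod_acs:
  "tmap (prod_symp (symp_manifold.truncate A) (symp_manifold.truncate B)) f p = tmap (prod_acs A B) f p"
  by (rule tmap_fields_cong) (simp_all add: prod_symp_def symp_manifold.truncate_def)

lemma tmap_power_acs:
  "tmap (power_symp (symp_manifold.truncate M) n) f p = tmap (power_acs M n) f p"
  by (rule tmap_fields_cong) (simp_all add: power_symp_def symp_manifold.truncate_def)

lemma acs_prod: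
  "acs (prod_acs A B) p v = vadd
    (tmap (prod_acs A B) (\<lambda>a. (a, snd p)) (fst p) (acs A (fst p) (tmap A fst p v)))
    (tmap (prod_acs A B) (\<lambda>b. (fst p, b)) (snd p) (acs B (snd p) (tmap B snd p v)))"
  unfolding tmap_prod_acs[symmetric] by (simp add: prod_acs_def Let_def)

lemma acs_power:
  "acs (power_acs M n) m v = (\<lambda>g. \<Sum>k<n.
    tmap (power_acs M n) (\<lambda>q. m(k := q)) (m k) (acs M (m k) (tmap M (\<lambda>m. m k) m v)) g)"
  unfolding tmap_power_acs[symmetric] by (simp add: power_acs_def Let_def)

lemma (in prod_mfd) smooth_inclusions:
  assumes "p \<in> topspace (mtop P)"
  shows "smooth_map_on A P (topspace (mtop A)) (\<lambda>a. (a, snd p))"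
    and "smooth_map_on B P (topspace (mtop B)) (\<lambda>b. (fst p, b))"
proof -
  have p: "fst p \<in> topspace (mtop A)" "snd p \<in> topspace (mtop B)"
    using assms by (auto simp: top_P)
  show "smooth_map_on A P (topspace (mtop A)) (\<lambda>a. (a, snd p))"
    by (rule smooth_Pair[OF A smooth_map_id[OF A openin_topspace] smooth_map_const[OF A openin_topspace p(2)]])
  show "smooth_map_on B P (topspace (mtop B)) (\<lambda>b. (fst p, b))"
    by (rule smooth_Pair[OF B smooth_map_const[OF B openin_topspace p(1)] smooth_map_id[OF B openin_topspace]])
qed

lemma (in power_mfd) smooth_inclusion:
  assumes m: "m \<in> topspace (mtop P)" and k: "k < n"
  shows "smooth_map_on M P (topspace (mtop M)) (\<lambda>q. m(k := q))"
proof (rule smooth_tuple[OF M openin_topspace])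
  show "smooth_map_on M M (topspace (mtop M)) (\<lambda>q. (m(k := q)) j)" if "j < n" for j
  proof (cases "j = k")
    case True
    then show ?thesis
      using smooth_map_id[OF M openin_topspace] by simp
  next
    case False
    have "m j \<in> topspace (mtop M)"
      using m that by (auto simp: top_P)
    then show ?thesis
      using False smooth_map_const[OF M openin_topspace] by simp
  qed
  show "m(k := q) \<in> extensional {..<n}" for q
    using m k by (auto simp: top_P PiE_def extensional_def)
qed

text \<open>The product structure acts through the inclusions and projections of the factors. A
  product map commutes with both, which reduces the claim to \<open>f\<close> and
  \<open>g\<close>.\<close>

lemma pseudoholomorphic_map_prod:
  assumes A: "smooth_atlas A" and B: "smooth_atlas B" and C: "smooth_atlas C" and D: "smooth_atlas D"
    and f: "pseudoholomorphic_on A C U f" and g: "pseudoholomorphic_on B D V g"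
  shows "pseudoholomorphic_on (prod_acs A B) (prod_acs C D) (U \<times> V) (map_prod f g)"
proof -
  let ?P = "prod_acs A B" and ?Q = "prod_acs C D"
  interpret P: prod_mfd ?P A B by (rule prod_acs_mfd[OF A B])
  interpret Q: prod_mfd ?Q C D by (rule prod_acs_mfd[OF C D])
  have fs: "smooth_map_on A C U f" and gs: "smooth_map_on B D V g"
    using f g by (simp_all add: pseudoholomorphic_on_def)
  have O: "openin (mtop ?P) (U \<times> V)"
    using smooth_map_on_open[OF fs] smooth_map_on_open[OF gs] by (simp add: openin_prod_Times_iff)
  have sub: "U \<times> V \<subseteq> topspace (mtop ?P)"
    by (rule openin_subset[OF O])
  have fst: "smooth_map_on ?P A (U \<times> V) fst" and snd: "smooth_map_on ?P B (U \<times> V) snd"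
    by (rule smooth_map_subset[OF P.smooth_atlas_P P.smooth_fst sub O A],
        rule smooth_map_subset[OF P.smooth_atlas_P P.smooth_snd sub O B])
  have ff: "smooth_map_on ?P C (U \<times> V) (\<lambda>w. f (fst w))"
    by (rule smooth_map_compose[OF P.smooth_atlas_P A fst fs]) auto
  have gg: "smooth_map_on ?P D (U \<times> V) (\<lambda>w. g (snd w))"
    by (rule smooth_map_compose[OF P.smooth_atlas_P B snd gs]) auto
  have mp: "map_prod f g = (\<lambda>w. (f (fst w), g (snd w)))"
    by auto
  have h: "smooth_map_on ?P ?Q (U \<times> V) (\<lambda>w. (f (fst w), g (snd w)))"
    by (rule Q.smooth_Pair[OF P.smooth_atlas_P ff gg])
  show ?thesis
    unfolding mp pseudoholomorphic_on_def
  proof (intro conjI h ballI)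
    fix p v assume p: "p \<in> U \<times> V" and v: "v \<in> tangent_space ?P p"
    let ?h = "\<lambda>w. (f (fst w), g (snd w))"
    have pt: "p \<in> topspace (mtop ?P)" and pUV: "fst p \<in> U" "snd p \<in> V"
      using p sub by auto
    have pAB: "fst p \<in> topspace (mtop A)" "snd p \<in> topspace (mtop B)"
      using pt by auto
    have hp: "?h p \<in> topspace (mtop ?Q)"
      by (rule smooth_map_in_topspace[OF h p])
    have hC: "f (fst p) \<in> topspace (mtop C)" and hD: "g (snd p) \<in> topspace (mtop D)"
      using hp by auto
    have 1: "tmap ?Q ?h p (tmap ?P (\<lambda>a. (a, snd p)) (fst p) u) =
        tmap ?Q (\<lambda>a. (a, g (snd p))) (f (fst p)) (tmap C f (fst p) u)" for u
      using tmap_compose[OF A P.smooth_atlas_P P.smooth_inclusions(1)[OF pt] pAB(1) h _ Q.smooth_atlas_P, of u]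
        tmap_compose[OF A C fs pUV(1) Q.smooth_inclusions(1)[OF hp] _ Q.smooth_atlas_P, of u] p hC by simp
    have 2: "tmap ?Q ?h p (tmap ?P (\<lambda>b. (fst p, b)) (snd p) u) =
        tmap ?Q (\<lambda>b. (f (fst p), b)) (g (snd p)) (tmap D g (snd p) u)" for u
      using tmap_compose[OF B P.smooth_atlas_P P.smooth_inclusions(2)[OF pt] pAB(2) h _ Q.smooth_atlas_P, of u]
        tmap_compose[OF B D gs pUV(2) Q.smooth_inclusions(2)[OF hp] _ Q.smooth_atlas_P, of u] p hD by simp
    have 3: "tmap C fst (?h p) (tmap ?Q ?h p v) = tmap C f (fst p) (tmap A fst p v)"
      using tmap_compose[OF P.smooth_atlas_P Q.smooth_atlas_P h p Q.smooth_fst hp C, of v]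
        tmap_compose[OF P.smooth_atlas_P A fst p fs pUV(1) C, of v] by simp
    have 4: "tmap D snd (?h p) (tmap ?Q ?h p v) = tmap D g (snd p) (tmap B snd p v)"
      using tmap_compose[OF P.smooth_atlas_P Q.smooth_atlas_P h p Q.smooth_snd hp D, of v]
        tmap_compose[OF P.smooth_atlas_P B snd p gs pUV(2) D, of v] by simp
    have 5: "tmap C f (fst p) (acs A (fst p) (tmap A fst p v)) = acs C (f (fst p)) (tmap C f (fst p) (tmap A fst p v))"
      using f pUV(1) tmap_in_tangent_space[OF P.smooth_atlas_P A fst p v] by (simp add: pseudoholomorphic_on_def)
    have 6: "tmap D g (snd p) (acs B (snd p) (tmap B snd p v)) = acs D (g (snd p)) (tmap D g (snd p) (tmap B snd p v))"
      using g pUV(2) tmap_in_tangent_space[OF P.smooth_atlas_P B snd p v] by (simp add: pseudoholomorphic_on_def)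
    show "tmap ?Q ?h p (acs ?P p v) = acs ?Q (?h p) (tmap ?Q ?h p v)"
      unfolding acs_prod tmap_vadd 1 2 3 4 5 6 by simp
  qed
qed

lemma pseudoholomorphic_compose:
  assumes Z: "smooth_atlas Z" and Y: "smooth_atlas Y" and X: "smooth_atlas X"
    and f: "pseudoholomorphic_on Z Y U f" and g: "pseudoholomorphic_on Y X V g" and sub: "f ` U \<subseteq> V"
  shows "pseudoholomorphic_on Z X U (\<lambda>z. g (f z))"
proof -
  have fs: "smooth_map_on Z Y U f" and gs: "smooth_map_on Y X V g"
    using f g by (simp_all add: pseudoholomorphic_on_def)
  have "tmap X (\<lambda>z. g (f z)) z (acs Z z v) = acs X (g (f z)) (tmap X (\<lambda>z. g (f z)) z v)"
    if z: "z \<in> U" and v: "v \<in> tangent_space Z z" for z v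
  proof -
    have fz: "f z \<in> V"
      using z sub by blast
    note c = tmap_compose[OF Z Y fs z gs fz X, symmetric]
    show ?thesis
      unfolding c using f g z fz v tmap_in_tangent_space[OF Z Y fs z v] by (simp add: pseudoholomorphic_on_def)
  qed
  then show ?thesis
    using smooth_map_compose[OF Z Y fs gs sub] by (simp add: pseudoholomorphic_on_def)
qed

text \<open>Two properties of the structure that powers inherit: preserving tangent spaces makes the
  identity pseudoholomorphic, and fixing \<open>vzero\<close> handles the constant factor in
  \<open>insert_point\<close>.\<close>

locale almost_complex =
  fixes A :: "'a acs_manifold"
  assumes atlas: "smooth_atlas A"
    and acs_tangent: "\<And>p v. p \<in> topspace (mtop A) \<Longrightarrow> v \<in> tangent_space A p \<Longrightarrow> acs A p v \<in> tangent_space A p"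
    and acs_vzero: "\<And>p. p \<in> topspace (mtop A) \<Longrightarrow> acs A p vzero = vzero"

lemma pseudoholomorphic_almost_complex:
  assumes "pseudoholomorphic_manifold A"
  shows "almost_complex A"
proof
  show "smooth_atlas A"
    using assms symplectic_atlas by (auto simp: pseudoholomorphic_manifold_def)
  fix p assume p: "p \<in> topspace (mtop A)"
  have J: "\<forall>v\<in>tangent_space A p. acs A p v \<in> tangent_space A p \<and> acs A p (acs A p v) = vscale (-1) v"
    "\<forall>v\<in>tangent_space A p. \<forall>w\<in>tangent_space A p. \<forall>a b.
      acs A p (vadd (vscale a v) (vscale b w)) = vadd (vscale a (acs A p v)) (vscale b (acs A p w))"
    using assms p by (simp_all add: pseudoholomorphic_manifold_def compatible_acs_def Let_def)
  show "acs A p v \<in> tangent_space A p" if "v \<in> tangent_space A p" for v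
    using J(1) that by blast
  have z: "vadd (vscale 0 v) (vscale 0 w) = vzero" for v w :: "'a tvec"
    by (simp add: vadd_def vscale_def vzero_def)
  show "acs A p vzero = vzero"
    using J(2)[rule_format, OF vzero_tangent vzero_tangent, of 0 0] by (simp only: z)
qed

lemma tangent_space_sum:
  "(\<And>k. k \<in> K \<Longrightarrow> w k \<in> tangent_space M p) \<Longrightarrow> (\<lambda>g. \<Sum>k\<in>K. w k g) \<in> tangent_space M p"
  unfolding tangent_space_def by (auto simp: sum.distrib sum_distrib_left)

lemma tmap_sum: "tmap X f p (\<lambda>g. \<Sum>k\<in>K. w k g) = (\<lambda>g. \<Sum>k\<in>K. tmap X f p (w k) g)"
  by (auto simp: tmap_def fun_eq_iff)

lemma almost_complex_power:
  assumes "almost_complex M"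
  shows "almost_complex (power_acs M n)"
proof
  interpret M: almost_complex M by fact
  let ?P = "power_acs M n"
  interpret P: power_mfd ?P M n by (rule power_acs_mfd[OF M.atlas])
  show "smooth_atlas ?P"
    by (rule P.smooth_atlas_P)
  fix m assume m: "m \<in> topspace (mtop ?P)"
  have mk: "m k \<in> topspace (mtop M)" if "k < n" for k
    using m that by auto
  have inc: "tmap ?P (\<lambda>q. m(k := q)) (m k) u \<in> tangent_space ?P m" if "k < n" "u \<in> tangent_space M (m k)" for k u
    using tmap_in_tangent_space[OF M.atlas P.smooth_atlas_P P.smooth_inclusion[OF m that(1)] mk[OF that(1)] that(2)]
    by simp
  show "acs ?P m v \<in> tangent_space ?P m" if v: "v \<in> tangent_space ?P m" for v
    unfolding acs_power
  proof (rule tangent_space_sum)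
    fix k assume "k \<in> {..<n}"
    then have k: "k < n" by simp
    show "tmap ?P (\<lambda>q. m(k := q)) (m k) (acs M (m k) (tmap M (\<lambda>m. m k) m v)) \<in> tangent_space ?P m"
      by (intro inc k M.acs_tangent mk tmap_in_tangent_space[OF P.smooth_atlas_P M.atlas P.smooth_proj[OF k] m v])
  qed
  have "tmap ?P (\<lambda>q. m(k := q)) (m k) (acs M (m k) (tmap M (\<lambda>m. m k) m vzero)) = vzero" if "k < n" for k
    using M.acs_vzero[OF mk[OF that]] by (simp add: tmap_vzero)
  then show "acs ?P m vzero = vzero"
    unfolding acs_power by (simp add: vzero_def)
qed

lemma (in almost_complex) pseudoholomorphic_id:
  assumes "openin (mtop A) U"
  shows "pseudoholomorphic_on A A U id"
  unfolding pseudoholomorphic_on_def id_def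
proof (intro conjI ballI smooth_map_id atlas assms)
  fix y v assume "y \<in> U" and v: "v \<in> tangent_space A y"
  then have "y \<in> topspace (mtop A)"
    using openin_subset[OF assms] by blast
  then show "tmap A (\<lambda>x. x) y (acs A y v) = acs A y (tmap A (\<lambda>x. x) y v)"
    by (simp add: tmap_id[OF v] tmap_id[OF acs_tangent[OF _ v]])
qed

text \<open>Factor \<open>k\<close> of the smaller power goes to factor \<open>s k\<close> of the
  larger one, where \<open>s\<close> enumerates the indices other than \<open>i\<close> in
  increasing order. At \<open>i\<close> the component of the vector is \<open>vzero\<close>, which
  the almost complex structure fixes.\<close>

lemma pseudoholomorphic_insert_point:
  assumes M: "almost_complex M" and i: "i < n" and p: "p \<in> topspace (mtop M)"
  shows "pseudoholomorphic_on (power_acs M (n - 1)) (power_acs M n) (topspace (mtop (power_acs M (n - 1))))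
    (insert_point n i p)"
proof -
  interpret M: almost_complex M by fact
  let ?P' = "power_acs M (n - 1)" and ?P = "power_acs M n" and ?ins = "insert_point n i p"
  interpret P': power_mfd ?P' M "n - 1" by (rule power_acs_mfd[OF M.atlas])
  interpret P: power_mfd ?P M n by (rule power_acs_mfd[OF M.atlas])
  note ins = smooth_insert_point(2)[OF P'.power_mfd_axioms P.power_mfd_axioms i p]
  show ?thesis
    unfolding pseudoholomorphic_on_def
  proof (intro conjI ins ballI ext)
    fix m v g assume m: "m \<in> topspace (mtop ?P')" and v: "v \<in> tangent_space ?P' m"
    have im: "?ins m \<in> topspace (mtop ?P)"
      by (rule smooth_map_in_topspace[OF ins m])
    define s where "s = (\<lambda>k. if k < i then k else k + 1)"
    have s: "s k < n" "?ins m (s k) = m k" "?ins (m(k := q)) = (?ins m)(s k := q)" if "k < n - 1" for k q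
      using that i by (auto simp: s_def insert_point_def fun_eq_iff)
    define b where "b = (\<lambda>k. tmap ?P (\<lambda>q. (?ins m)(s k := q)) (m k) (acs M (m k) (tmap M (\<lambda>m. m k) m v)) g)"
    have 1: "tmap ?P ?ins m (tmap ?P' (\<lambda>q. m(k := q)) (m k) u) = tmap ?P (\<lambda>q. (?ins m)(s k := q)) (m k) u"
      if k: "k < n - 1" for k u
    proof -
      have mk: "m k \<in> topspace (mtop M)"
        using m k by auto
      show ?thesis
        using tmap_compose[OF M.atlas P'.smooth_atlas_P P'.smooth_inclusion[OF m k] mk ins _ P.smooth_atlas_P, of u] m
        by (simp add: s(3)[OF k])
    qed
    have 2: "tmap M (\<lambda>m. m k) (?ins m) (tmap ?P ?ins m v) = tmap M (\<lambda>w. ?ins w k) m v" if "k < n" for k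
      by (rule tmap_compose[OF P'.smooth_atlas_P P.smooth_atlas_P ins m P.smooth_proj[OF that] _ M.atlas]) (rule im)
    have 3: "tmap ?P (\<lambda>q. (?ins m)(k := q)) (?ins m k) (acs M (?ins m k) (tmap M (\<lambda>w. ?ins w k) m v)) g =
        (if k < i then b k else if k = i then 0 else b (k - 1))" if k: "k < n" for k
    proof (cases k i rule: linorder_cases)
      case equal
      have "tmap M (\<lambda>w. ?ins w k) m v = vzero"
        using tmap_const[OF P'.smooth_atlas_P m v, of M p] i by (simp add: equal insert_point_apply)
      then show ?thesis
        using i M.acs_vzero[OF p] by (simp add: equal insert_point_apply tmap_vzero) (simp add: vzero_def)
    qed (use k in \<open>auto simp: b_def s_def insert_point_apply\<close>)
    have "tmap ?P ?ins m (acs ?P' m v) g = (\<Sum>k<n - 1. b k)"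
      unfolding acs_power tmap_sum b_def by (rule sum.cong[OF refl]) (simp only: 1 lessThan_iff)
    also have "\<dots> = (\<Sum>k<n. if k < i then b k else if k = i then 0 else b (k - 1))"
      by (rule sum_skip[OF i, symmetric])
    also have "\<dots> = acs ?P (?ins m) (tmap ?P ?ins m v) g"
      unfolding acs_power by (rule sum.cong) (simp_all add: 2 3)
    finally show "tmap ?P ?ins m (acs ?P' m v) g = acs ?P (?ins m) (tmap ?P ?ins m v) g" .
  qed
qed

lemma pseudoholomorphic_face_map:
  assumes Y: "almost_complex Y" and M: "almost_complex M" and i: "i < n"
    and p: "p0 \<in> topspace (mtop M)" "p1 \<in> topspace (mtop M)"
  shows "pseudoholomorphic_on (prod_acs Y (power_acs M (n - 1))) (prod_acs Y (power_acs M n))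
    (topspace (mtop (prod_acs Y (power_acs M (n - 1))))) (face_map p0 p1 n i e)"
proof -
  interpret Y: almost_complex Y by fact
  interpret P': almost_complex "power_acs M (n - 1)" by (rule almost_complex_power[OF M])
  interpret P: almost_complex "power_acs M n" by (rule almost_complex_power[OF M])
  have "(if e = 0 then p0 else p1) \<in> topspace (mtop M)"
    using p by simp
  from pseudoholomorphic_map_prod[OF Y.atlas P'.atlas Y.atlas P.atlas
      Y.pseudoholomorphic_id[OF openin_topspace] pseudoholomorphic_insert_point[OF M i this]]
  show ?thesis
    by (simp add: face_map_def)
qed

subsection \<open>The sheaf of pseudoholomorphic tuples\<close>

lemma hol_tuple_subset:
  "smooth_atlas Y \<Longrightarrow> smooth_atlas X \<Longrightarrow> hol_tuple Y X U fs \<Longrightarrow> openin (mtop Y) W \<Longrightarrow> W \<subseteq> U \<Longrightarrow> hol_tuple Y X W fs"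
  unfolding hol_tuple_def pseudoholomorphic_on_def using smooth_map_subset by blast

lemma hol_sheaf: "smooth_atlas Y \<Longrightarrow> smooth_atlas X \<Longrightarrow> tuple_sheaf (mtop Y) (hol_tuple Y X)"
  by unfold_locales (rule hol_tuple_subset)

lemma JCor_restr_mono: "W' \<subseteq> W \<Longrightarrow> JCor_restr W a = JCor_restr W b \<Longrightarrow> JCor_restr W' a = JCor_restr W' b"
  using restr_mono[of W' W "snd a" "snd b"] by (auto simp: JCor_restr_def)

text \<open>The chosen multiset does not depend on the representation, by
  \<open>JCor_germ_eqD\<close>. The value \<open>{#}\<close> off the manifold lets identities of
  values hold at all points.\<close>

definition jval :: "'y acs_manifold \<Rightarrow> 'x acs_manifold \<Rightarrow> ('y, 'x) jcor \<Rightarrow> 'y \<Rightarrow> 'x multiset"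
  where "jval Y X F y = (if y \<in> topspace (mtop Y)
    then SOME a. \<exists>U fs. JCor_rep Y X F U fs \<and> y \<in> U \<and> a = mset (map (\<lambda>f. f y) fs) else {#})"

locale hol_pair =
  fixes Y :: "'y acs_manifold" and X :: "'x acs_manifold"
  assumes Y: "smooth_atlas Y" and X: "smooth_atlas X"
begin

sublocale tuple_sheaf "mtop Y" "hol_tuple Y X"
  by (rule hol_sheaf[OF Y X])

lemma tuple_in_presheaf:
  "openin (mtop Y) U \<Longrightarrow> hol_tuple Y X U fs \<Longrightarrow>
    (length fs, ncor_tuple (mtop Y) (hol_tuple Y X) U fs) \<in> JCor_presheaf Y X U"
  using ncor_tuple_in by (simp add: JCor_presheaf_def JCors_def)

lemma JCor_germ_eqI:
  assumes W: "openin (mtop Y) W" "y \<in> W" "W \<subseteq> U \<inter> V"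
    and eq: "\<And>z. z \<in> W \<Longrightarrow> mset (map (\<lambda>f. f z) fs) = mset (map (\<lambda>g. g z) gs)"
  shows "JCor_germ Y X U fs y = JCor_germ Y X V gs y"
  unfolding JCor_germ_def
proof (rule germ_eqI[OF JCor_restr_mono W])
  \<comment> \<open>The point \<open>y\<close> lies in \<open>W\<close>, so equal values there force
    equal degrees.\<close>
  have len: "length fs = length gs"
    using arg_cong[OF eq[OF W(2)], of size] by simp
  have "ncor_tuple (mtop Y) (hol_tuple Y X) W fs = ncor_tuple (mtop Y) (hol_tuple Y X) W gs"
    by (rule ncor_tuple_mset_cong[OF len eq])
  then show "JCor_restr W (length fs, ncor_tuple (mtop Y) (hol_tuple Y X) U fs) =
      JCor_restr W (length gs, ncor_tuple (mtop Y) (hol_tuple Y X) V gs)"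
    using ncor_tuple_restr[OF W(1), of U fs] ncor_tuple_restr[OF W(1), of V gs] W(3) len
    by (simp add: JCor_restr_def)
qed

text \<open>Values of elements of \<open>JCor\<close> are germs of pairs whose second component is
  itself a family of germs. The equality is unwound through both sheafifications down to the
  multisets.\<close>

lemma JCor_germ_eqD:
  assumes U: "openin (mtop Y) U" "hol_tuple Y X U fs" "y \<in> U" and V: "y \<in> V"
    and eq: "JCor_germ Y X U fs y = JCor_germ Y X V gs y"
  shows "mset (map (\<lambda>f. f y) fs) = mset (map (\<lambda>g. g y) gs)"
proof -
  obtain W where W: "openin (mtop Y) W" "y \<in> W" "W \<subseteq> U \<inter> V"
    "JCor_restr W (length fs, ncor_tuple (mtop Y) (hol_tuple Y X) U fs) =
      JCor_restr W (length gs, ncor_tuple (mtop Y) (hol_tuple Y X) V gs)"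
    by (rule germ_eqD[OF U(1,3) tuple_in_presheaf[OF U(1,2)] eq[unfolded JCor_germ_def]])
  then have len: "length fs = length gs"
    and "ncor_tuple (mtop Y) (hol_tuple Y X) W fs = ncor_tuple (mtop Y) (hol_tuple Y X) W gs"
    using ncor_tuple_restr[OF W(1), of U fs] ncor_tuple_restr[OF W(1), of V gs] W(3)
    by (simp_all add: JCor_restr_def)
  from fun_cong[OF this(2), of y] W(2)
  have g: "germ (mtop Y) (tuples (hol_tuple Y X) (length fs)) restr W (mval W fs) y =
      germ (mtop Y) (tuples (hol_tuple Y X) (length fs)) restr W (mval W gs) y"
    by (simp add: ncor_tuple_def len)
  have mv: "mval W fs \<in> tuples (hol_tuple Y X) (length fs) W"
    using tuplesI[OF adm_subset[OF U(2,1) W(1)]] W(3) by simp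
  obtain W' where "openin (mtop Y) W'" "y \<in> W'" "W' \<subseteq> W \<inter> W" "restr W' (mval W fs) = restr W' (mval W gs)"
    by (rule germ_eqD[OF W(1,2) mv g])
  then show ?thesis
    using W(2) by (auto simp: restr_eq_iff mval_apply)
qed

lemma JCor_rep_subset:
  assumes "JCor_rep Y X F U fs" "openin (mtop Y) W" "W \<subseteq> U"
  shows "JCor_rep Y X F W fs"
  unfolding JCor_rep_def
proof (intro conjI ballI assms(2))
  have U: "openin (mtop Y) U" "hol_tuple Y X U fs"
    using assms(1) by (simp_all add: JCor_rep_def)
  show "hol_tuple Y X W fs"
    by (rule adm_subset[OF U(2,1) assms(2,3)])
  fix y assume y: "y \<in> W"
  have "JCor_germ Y X U fs y = JCor_germ Y X W fs y"
    by (rule JCor_germ_eqI[OF assms(2) y]) (use assms(3) in auto)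
  then show "F y = JCor_germ Y X W fs y"
    using assms(1,3) y by (auto simp: JCor_rep_def)
qed

lemma jval_rep:
  assumes F: "JCor_rep Y X F U fs" and y: "y \<in> U"
  shows "jval Y X F y = mset (map (\<lambda>f. f y) fs)"
proof -
  have U: "openin (mtop Y) U" "hol_tuple Y X U fs" "F y = JCor_germ Y X U fs y"
    using F y by (auto simp: JCor_rep_def)
  have "a = mset (map (\<lambda>f. f y) fs)" if "\<exists>V gs. JCor_rep Y X F V gs \<and> y \<in> V \<and> a = mset (map (\<lambda>g. g y) gs)" for a
  proof -
    obtain V gs where V: "JCor_rep Y X F V gs" "y \<in> V" "a = mset (map (\<lambda>g. g y) gs)"
      using \<open>\<exists>V gs. _ V gs\<close> by blast
    then have "JCor_germ Y X U fs y = JCor_germ Y X V gs y"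
      using U(3) by (simp add: JCor_rep_def)
    from JCor_germ_eqD[OF U(1,2) y V(2) this] V(3) show ?thesis
      by simp
  qed
  moreover have "\<exists>a V gs. JCor_rep Y X F V gs \<and> y \<in> V \<and> a = mset (map (\<lambda>g. g y) gs)"
    using F y by blast
  ultimately have "(SOME a. \<exists>U fs. JCor_rep Y X F U fs \<and> y \<in> U \<and> a = mset (map (\<lambda>f. f y) fs)) = mset (map (\<lambda>f. f y) fs)"
    by (rule someI2_ex[rotated])
  moreover have "y \<in> topspace (mtop Y)"
    using openin_subset[OF U(1)] y by blast
  ultimately show ?thesis
    by (simp add: jval_def)
qed

text \<open>Two sheafifications are unwound in turn: first to a degree \<open>n\<close> with an
  \<open>n\<close>-correspondence, then to a tuple.\<close>

lemma JCor_local: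
  assumes F: "F \<in> JCor Y X" and y: "y \<in> topspace (mtop Y)"
  obtains U fs where "JCor_rep Y X F U fs" "y \<in> U"
proof -
  have "\<exists>W a. openin (mtop Y) W \<and> y \<in> W \<and> W \<subseteq> topspace (mtop Y) \<and> a \<in> JCor_presheaf Y X W \<and>
      (\<forall>z\<in>W. F z = germ (mtop Y) (JCor_presheaf Y X) JCor_restr W a z)"
    using F y by (simp add: JCor_def sheafify_def)
  then obtain W n s where W: "openin (mtop Y) W" "y \<in> W" "(n, s) \<in> JCor_presheaf Y X W"
    "\<forall>z\<in>W. F z = germ (mtop Y) (JCor_presheaf Y X) JCor_restr W (n, s) z"
    by (metis surj_pair)
  then have "s \<in> ncors (mtop Y) (hol_tuple Y X) n W"
    by (simp add: JCor_presheaf_def JCors_def)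
  from ncors_local[OF this W(2)] obtain V fs where V: "openin (mtop Y) V" "y \<in> V" "V \<subseteq> W" "length fs = n"
    "hol_tuple Y X V fs" "restr V s = ncor_tuple (mtop Y) (hol_tuple Y X) V fs"
    by blast
  have "germ (mtop Y) (JCor_presheaf Y X) JCor_restr W (n, s) z = JCor_germ Y X V fs z" if "z \<in> V" for z
    unfolding JCor_germ_def
  proof (rule germ_eqI[OF JCor_restr_mono V(1) that])
    show "JCor_restr V (n, s) = JCor_restr V (length fs, ncor_tuple (mtop Y) (hol_tuple Y X) V fs)"
      using V(4,6) ncor_tuple_restr[OF V(1) order_refl, of fs] by (simp add: JCor_restr_def)
  qed (use V(3) in auto)
  then have "JCor_rep Y X F V fs"
    using V W(4) by (auto simp: JCor_rep_def)
  then show thesis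
    using that V(2) by blast
qed

lemma JCorI:
  assumes "F \<in> extensional (topspace (mtop Y))"
    and "\<And>y. y \<in> topspace (mtop Y) \<Longrightarrow> \<exists>U fs. JCor_rep Y X F U fs \<and> y \<in> U"
  shows "F \<in> JCor Y X"
  unfolding JCor_def sheafify_def
proof (intro CollectI conjI ballI assms(1))
  fix y assume "y \<in> topspace (mtop Y)"
  then obtain U fs where U: "JCor_rep Y X F U fs" "y \<in> U"
    using assms(2) by blast
  then have "openin (mtop Y) U" "hol_tuple Y X U fs" "\<forall>z\<in>U. F z = JCor_germ Y X U fs z"
    by (simp_all add: JCor_rep_def)
  then show "\<exists>W s. openin (mtop Y) W \<and> y \<in> W \<and> W \<subseteq> topspace (mtop Y) \<and> s \<in> JCor_presheaf Y X W \<and>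
      (\<forall>z\<in>W. F z = germ (mtop Y) (JCor_presheaf Y X) JCor_restr W s z)"
    using U(2) tuple_in_presheaf[of U fs] openin_subset[of "mtop Y" U]
    by (intro exI[of _ U] exI[of _ "(length fs, ncor_tuple (mtop Y) (hol_tuple Y X) U fs)"]) (auto simp: JCor_germ_def)
qed

text \<open>Equal values near a point give equal germs, so any pseudoholomorphic tuple with the
  right values is a representation.\<close>

lemma JCor_repI:
  assumes F: "F \<in> JCor Y X" and U: "openin (mtop Y) U" "hol_tuple Y X U fs"
    and eq: "\<And>y. y \<in> U \<Longrightarrow> jval Y X F y = mset (map (\<lambda>f. f y) fs)"
  shows "JCor_rep Y X F U fs"
  unfolding JCor_rep_def
proof (intro conjI ballI U)
  fix y assume y: "y \<in> U"
  then obtain V gs where V: "JCor_rep Y X F V gs" "y \<in> V"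
    using JCor_local[OF F] openin_subset[OF U(1)] by blast
  then have V': "openin (mtop Y) V" "F y = JCor_germ Y X V gs y"
    by (simp_all add: JCor_rep_def)
  have "JCor_germ Y X V gs y = JCor_germ Y X U fs y"
  proof (rule JCor_germ_eqI[where W = "U \<inter> V"])
    show "mset (map (\<lambda>g. g z) gs) = mset (map (\<lambda>f. f z) fs)" if "z \<in> U \<inter> V" for z
      using that eq[of z] jval_rep[OF V(1), of z] by simp
  qed (use U(1) V'(1) y V(2) in auto)
  then show "F y = JCor_germ Y X U fs y"
    using V'(2) by simp
qed

lemma JCor_eqI:
  assumes F: "F \<in> JCor Y X" and G: "G \<in> JCor Y X" and eq: "\<And>y. y \<in> topspace (mtop Y) \<Longrightarrow> jval Y X F y = jval Y X G y"
  shows "F = G"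
proof (rule extensionalityI[where A = "topspace (mtop Y)"])
  show "F \<in> extensional (topspace (mtop Y))" "G \<in> extensional (topspace (mtop Y))"
    using F G by (simp_all add: JCor_def sheafify_def)
  fix y assume y: "y \<in> topspace (mtop Y)"
  obtain U fs where U: "JCor_rep Y X F U fs" "y \<in> U"
    by (rule JCor_local[OF F y])
  then have U': "openin (mtop Y) U" "hol_tuple Y X U fs"
    by (simp_all add: JCor_rep_def)
  have "JCor_rep Y X G U fs"
  proof (rule JCor_repI[OF G U'])
    fix z assume z: "z \<in> U"
    then have "z \<in> topspace (mtop Y)"
      using openin_subset[OF U'(1)] by blast
    then show "jval Y X G z = mset (map (\<lambda>f. f z) fs)"
      using eq[of z] jval_rep[OF U(1) z] by simp
  qed
  then show "F y = G y"
    using U by (simp add: JCor_rep_def)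
qed

text \<open>Gluing: local tuples with the same values have the same germs on overlaps, so choosing
  one around every point defines a section.\<close>

lemma JCor_ex:
  assumes "\<And>y. y \<in> topspace (mtop Y) \<Longrightarrow> \<exists>U fs. openin (mtop Y) U \<and> y \<in> U \<and> hol_tuple Y X U fs \<and>
    (\<forall>z\<in>U. s z = mset (map (\<lambda>f. f z) fs))"
  obtains F where "F \<in> JCor Y X" "\<And>y. y \<in> topspace (mtop Y) \<Longrightarrow> jval Y X F y = s y"
proof -
  obtain U fs where U: "\<And>y. y \<in> topspace (mtop Y) \<Longrightarrow> openin (mtop Y) (U y) \<and> y \<in> U y \<and> hol_tuple Y X (U y) (fs y) \<and>
    (\<forall>z\<in>U y. s z = mset (map (\<lambda>f. f z) (fs y)))"
    using assms by metis
  define F where "F = (\<lambda>y\<in>topspace (mtop Y). JCor_germ Y X (U y) (fs y) y)"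
  have rep: "JCor_rep Y X F (U y) (fs y)" if y: "y \<in> topspace (mtop Y)" for y
    unfolding JCor_rep_def
  proof (intro conjI ballI)
    fix z assume z: "z \<in> U y"
    then have zt: "z \<in> topspace (mtop Y)"
      using U[OF y] openin_subset by blast
    have "JCor_germ Y X (U z) (fs z) z = JCor_germ Y X (U y) (fs y) z"
    proof (rule JCor_germ_eqI[where W = "U z \<inter> U y"])
      show "mset (map (\<lambda>f. f w) (fs z)) = mset (map (\<lambda>f. f w) (fs y))" if w: "w \<in> U z \<inter> U y" for w
      proof -
        have "s w = mset (map (\<lambda>f. f w) (fs z))" "s w = mset (map (\<lambda>f. f w) (fs y))"
          using U[OF zt] U[OF y] w by blast+
        then show ?thesis by simp
      qed
    qed (use U[OF zt] U[OF y] z in auto)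
    then show "F z = JCor_germ Y X (U y) (fs y) z"
      using zt by (simp add: F_def)
  qed (use U[OF y] in auto)
  have "F \<in> JCor Y X"
    by (rule JCorI) (use rep U in \<open>auto simp: F_def\<close>)
  moreover have "jval Y X F y = s y" if "y \<in> topspace (mtop Y)" for y
    using jval_rep[OF rep[OF that]] U[OF that] by auto
  ultimately show thesis
    using that by blast
qed

lemma jval_outside: "y \<notin> topspace (mtop Y) \<Longrightarrow> jval Y X F y = {#}"
  by (simp add: jval_def)

lemma JCor_tuple:
  assumes fs: "hol_tuple Y X (topspace (mtop Y)) fs"
  shows "JCor_tuple Y X fs \<in> JCor Y X"
    and "y \<in> topspace (mtop Y) \<Longrightarrow> jval Y X (JCor_tuple Y X fs) y = mset (map (\<lambda>f. f y) fs)"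
proof -
  have rep: "JCor_rep Y X (JCor_tuple Y X fs) (topspace (mtop Y)) fs"
    using fs by (simp add: JCor_rep_def JCor_tuple_def)
  show "JCor_tuple Y X fs \<in> JCor Y X"
    by (rule JCorI) (use rep in \<open>auto simp: JCor_tuple_def\<close>)
  show "jval Y X (JCor_tuple Y X fs) y = mset (map (\<lambda>f. f y) fs)" if "y \<in> topspace (mtop Y)"
    by (rule jval_rep[OF rep that])
qed

text \<open>As in \<open>ncor_add_tuple\<close>, the union over representatives is constant; each
  representative is first restricted to a neighbourhood on which it equals the given tuple.\<close>

lemma JCor_add_germ:
  assumes U: "openin (mtop Y) U" "hol_tuple Y X U fs" "hol_tuple Y X U gs" "y \<in> U"
    and F: "F y = JCor_germ Y X U fs y" and G: "G y = JCor_germ Y X U gs y"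
  shows "JCor_add Y X F G y = JCor_germ Y X U (fs @ gs) y"
proof -
  let ?T = "\<lambda>W fs. ncor_tuple (mtop Y) (hol_tuple Y X) W fs"
  have "germ (mtop Y) (JCor_presheaf Y X) JCor_restr (V \<inter> W)
      (n + m, ncor_add (mtop Y) (hol_tuple Y X) (n + m) (V \<inter> W) s t) y = JCor_germ Y X U (fs @ gs) y"
    if st: "(V, n, s) \<in> F y" "(W, m, t) \<in> G y" for V n s W m t
  proof -
    obtain W1 where W1: "openin (mtop Y) W1" "y \<in> W1" "W1 \<subseteq> U \<inter> V" "length fs = n" "restr W1 (?T U fs) = restr W1 s"
      using st(1) unfolding F JCor_germ_def germ_def JCor_restr_def by auto
    obtain W2 where W2: "openin (mtop Y) W2" "y \<in> W2" "W2 \<subseteq> U \<inter> W" "length gs = m" "restr W2 (?T U gs) = restr W2 t"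
      using st(2) unfolding G JCor_germ_def germ_def JCor_restr_def by auto
    let ?W = "W1 \<inter> W2"
    have O: "openin (mtop Y) ?W"
      using W1(1) W2(1) by blast
    have WU: "?W \<subseteq> U"
      using W1(3) by blast
    have "restr ?W s = ?T ?W fs" "restr ?W t = ?T ?W gs"
      using restr_mono[OF _ W1(5), of ?W] restr_mono[OF _ W2(5), of ?W]
        ncor_tuple_restr[OF O WU, of fs] ncor_tuple_restr[OF O WU, of gs] by simp_all
    moreover have "ncor_add (mtop Y) (hol_tuple Y X) (length fs + length gs) ?W (?T ?W fs) (?T ?W gs) = ?T ?W (fs @ gs)"
      by (intro ncor_add_tuple O adm_subset[OF U(2,1) O WU] adm_subset[OF U(3,1) O WU])
    ultimately have "restr ?W (ncor_add (mtop Y) (hol_tuple Y X) (n + m) (V \<inter> W) s t) = ?T ?W (fs @ gs)"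
      using ncor_add_restr[of ?W "V \<inter> W" "mtop Y" "hol_tuple Y X" "n + m" s t] W1(3) W2(3)
      by (auto simp: W1(4) W2(4))
    then show ?thesis
      unfolding JCor_germ_def
      using W1 W2 O WU ncor_tuple_restr[OF O WU, of "fs @ gs"]
      by (intro germ_eqI[OF JCor_restr_mono, where W = ?W]) (auto simp: JCor_restr_def)
  qed
  moreover have "(U, length fs, ?T U fs) \<in> F y" "(U, length gs, ?T U gs) \<in> G y"
    unfolding F G JCor_germ_def using U tuple_in_presheaf by (auto intro!: germ_self)
  ultimately have "(\<Union>(V, n, s)\<in>F y. \<Union>(W, m, t)\<in>G y. germ (mtop Y) (JCor_presheaf Y X) JCor_restr (V \<inter> W)
      (n + m, ncor_add (mtop Y) (hol_tuple Y X) (n + m) (V \<inter> W) s t) y) = JCor_germ Y X U (fs @ gs) y"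
    by fast
  moreover have "y \<in> topspace (mtop Y)"
    using openin_subset[OF U(1)] U(4) by blast
  ultimately show ?thesis
    by (simp add: JCor_add_def)
qed

lemma JCor_common_rep:
  assumes "F \<in> JCor Y X" "G \<in> JCor Y X" "y \<in> topspace (mtop Y)"
  obtains U fs gs where "y \<in> U" "JCor_rep Y X F U fs" "JCor_rep Y X G U gs"
proof -
  obtain V fs where V: "JCor_rep Y X F V fs" "y \<in> V"
    by (rule JCor_local[OF assms(1,3)])
  obtain W gs where W: "JCor_rep Y X G W gs" "y \<in> W"
    by (rule JCor_local[OF assms(2,3)])
  have "openin (mtop Y) (V \<inter> W)"
    using V(1) W(1) by (auto simp: JCor_rep_def)
  then show thesis
    using that[of "V \<inter> W" fs gs] JCor_rep_subset[OF V(1), of "V \<inter> W"] JCor_rep_subset[OF W(1), of "V \<inter> W"] V(2) W(2)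
    by simp
qed

lemma JCor_add_rep:
  assumes F: "JCor_rep Y X F U fs" and G: "JCor_rep Y X G U gs"
  shows "JCor_rep Y X (JCor_add Y X F G) U (fs @ gs)"
  unfolding JCor_rep_def
proof (intro conjI ballI)
  show "openin (mtop Y) U" "hol_tuple Y X U (fs @ gs)"
    using F G by (auto simp: JCor_rep_def hol_tuple_def)
  show "JCor_add Y X F G y = JCor_germ Y X U (fs @ gs) y" if "y \<in> U" for y
    using F G that by (intro JCor_add_germ) (auto simp: JCor_rep_def)
qed

lemma JCor_add:
  assumes F: "F \<in> JCor Y X" and G: "G \<in> JCor Y X"
  shows "JCor_add Y X F G \<in> JCor Y X"
    and "jval Y X (JCor_add Y X F G) y = jval Y X F y + jval Y X G y"
proof -
  have rep: "\<exists>U hs. JCor_rep Y X (JCor_add Y X F G) U hs \<and> y \<in> U"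
    and val: "jval Y X (JCor_add Y X F G) y = jval Y X F y + jval Y X G y"
    if y: "y \<in> topspace (mtop Y)" for y
  proof -
    obtain U fs gs where U: "y \<in> U" "JCor_rep Y X F U fs" "JCor_rep Y X G U gs"
      by (rule JCor_common_rep[OF F G y])
    note FG = JCor_add_rep[OF U(2,3)]
    show "\<exists>U hs. JCor_rep Y X (JCor_add Y X F G) U hs \<and> y \<in> U"
      using FG U(1) by blast
    show "jval Y X (JCor_add Y X F G) y = jval Y X F y + jval Y X G y"
      by (simp add: jval_rep[OF FG U(1)] jval_rep[OF U(2,1)] jval_rep[OF U(3,1)])
  qed
  show "JCor_add Y X F G \<in> JCor Y X"
    by (rule JCorI) (use rep in \<open>auto simp: JCor_add_def\<close>)
  show "jval Y X (JCor_add Y X F G) y = jval Y X F y + jval Y X G y"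
    using val[of y] by (cases "y \<in> topspace (mtop Y)") (simp_all add: jval_outside)
qed

end

subsection \<open>Composition and products\<close>

lemma hol_tuple_comp:
  assumes Z: "smooth_atlas Z" and Y: "smooth_atlas Y" and X: "smooth_atlas X"
    and fs: "hol_tuple Z Y U fs" and len: "length gss = length fs"
    and gss: "\<And>i. i < length fs \<Longrightarrow> hol_tuple Y X (Vs ! i) (gss ! i) \<and> (fs ! i) ` U \<subseteq> Vs ! i"
  shows "hol_tuple Z X U (comp_tuple fs gss)"
  unfolding hol_tuple_def
proof
  fix h assume "h \<in> set (comp_tuple fs gss)"
  then obtain i g where h: "i < length fs" "g \<in> set (gss ! i)" "h = g \<circ> fs ! i"
    using comp_tuple_mem len by metis
  have "pseudoholomorphic_on Z Y U (fs ! i)" "pseudoholomorphic_on Y X (Vs ! i) g"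
    using fs gss[OF h(1)] h by (auto simp: hol_tuple_def)
  from pseudoholomorphic_compose[OF Z Y X this] gss[OF h(1)] show "pseudoholomorphic_on Z X U h"
    by (simp add: h(3) comp_def)
qed

lemma mset_comp_tuple:
  "length gss = length fs \<Longrightarrow> mset (map (\<lambda>h. h z) (comp_tuple fs gss)) =
    (\<Sum>i<length fs. mset (map (\<lambda>g. g ((fs ! i) z)) (gss ! i)))"
proof (induction gss fs rule: list_induct2)
  case (Cons gs gss f fs)
  then show ?case
    by (simp add: comp_tuple_def lessThan_Suc_eq_insert_0 sum.reindex comp_def)
qed (simp add: comp_tuple_def)

lemma sum_mset_map_nth: "(\<Sum>y\<in>#mset (map (\<lambda>f. f z) fs). h y) = (\<Sum>i<length fs. h ((fs ! i) z))"
proof (induction fs)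
  case (Cons f fs)
  then show ?case
    by (simp add: lessThan_Suc_eq_insert_0 sum.reindex comp_def)
qed simp

text \<open>The prescribed values are given locally by composite tuples, so \<open>JCor_ex\<close>
  yields a candidate. It has the defining property of \<open>cor_comp\<close> by
  \<open>JCor_repI\<close>, and it is the only one because composable representations exist near
  every point.\<close>

lemma JCor_comp:
  assumes "smooth_atlas Z" "smooth_atlas Y" "smooth_atlas X" and F: "F \<in> JCor Z Y" and G: "G \<in> JCor Y X"
  shows "JCor_comp Z Y X G F \<in> JCor Z X"
    and "jval Z X (JCor_comp Z Y X G F) z = (\<Sum>y\<in>#jval Z Y F z. jval Y X G y)"
proof -
  interpret ZX: hol_pair Z X using assms by unfold_locales
  interpret ZY: hol_pair Z Y using assms by unfold_locales
  interpret YX: hol_pair Y X using assms by unfold_locales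
  let ?s = "\<lambda>z. \<Sum>y\<in>#jval Z Y F z. jval Y X G y"
  have val: "mset (map (\<lambda>h. h z) (comp_tuple fs gss)) = ?s z"
    if "JCor_rep Z Y F U fs" "length gss = length fs"
      "\<And>i. i < length fs \<Longrightarrow> JCor_rep Y X G (Vs ! i) (gss ! i) \<and> (fs ! i) ` U \<subseteq> Vs ! i" "z \<in> U" for U fs Vs gss z
  proof -
    have "jval Y X G ((fs ! i) z) = mset (map (\<lambda>g. g ((fs ! i) z)) (gss ! i))" if "i < length fs" for i
      by (rule YX.jval_rep[of G "Vs ! i"]) (use that \<open>z \<in> U\<close> \<open>\<And>i. i < length fs \<Longrightarrow> _ i\<close> in auto)
    then show ?thesis
      using ZY.jval_rep[OF that(1,4)] by (simp add: mset_comp_tuple[OF that(2)] sum_mset_map_nth del: mset_map)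
  qed
  have reps: "\<exists>U fs Vs gss. z \<in> U \<and> JCor_rep Z Y F U fs \<and> length Vs = length fs \<and> length gss = length fs \<and>
      (\<forall>i<length fs. JCor_rep Y X G (Vs ! i) (gss ! i) \<and> (fs ! i) ` U \<subseteq> Vs ! i)"
    if z: "z \<in> topspace (mtop Z)" for z
  proof -
    obtain W fs where W: "JCor_rep Z Y F W fs" "z \<in> W"
      by (rule ZY.JCor_local[OF F z])
    then have W': "openin (mtop Z) W" "hol_tuple Z Y W fs"
      by (simp_all add: JCor_rep_def)
    have sm: "smooth_map_on Z Y W f" if "f \<in> set fs" for f
      using that W'(2) by (simp add: hol_tuple_def pseudoholomorphic_on_def)
    have "\<exists>V gs. openin (mtop Y) V \<and> y \<in> V \<and> JCor_rep Y X G V gs" if "y \<in> topspace (mtop Y)" for y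
      using YX.JCor_local[OF G that] by (metis JCor_rep_def)
    from composable_reps[OF W'(1) W(2) sm this] obtain U Vs gss where U: "openin (mtop Z) U" "z \<in> U" "U \<subseteq> W"
      "length Vs = length fs" "length gss = length fs"
      "\<And>i. i < length fs \<Longrightarrow> JCor_rep Y X G (Vs ! i) (gss ! i) \<and> openin (mtop Y) (Vs ! i) \<and> (fs ! i) ` U \<subseteq> Vs ! i"
      by blast
    then show ?thesis
      using ZY.JCor_rep_subset[OF W(1) U(1,3)]
      by (intro exI[of _ U] exI[of _ fs] exI[of _ Vs] exI[of _ gss]) simp
  qed
  have hol: "openin (mtop Z) U \<and> hol_tuple Z X U (comp_tuple fs gss)"
    if "JCor_rep Z Y F U fs" "length gss = length fs"
      "\<And>i. i < length fs \<Longrightarrow> JCor_rep Y X G (Vs ! i) (gss ! i) \<and> (fs ! i) ` U \<subseteq> Vs ! i" for U fs Vs gss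
    using that(1) hol_tuple_comp[OF assms(1-3) _ that(2), of U Vs] that(3) by (simp add: JCor_rep_def)
  obtain H where H: "H \<in> JCor Z X" "\<And>z. z \<in> topspace (mtop Z) \<Longrightarrow> jval Z X H z = ?s z"
  proof (rule ZX.JCor_ex)
    fix z assume "z \<in> topspace (mtop Z)"
    from reps[OF this] obtain U fs Vs gss where U: "z \<in> U" "JCor_rep Z Y F U fs" "length gss = length fs"
      "\<And>i. i < length fs \<Longrightarrow> JCor_rep Y X G (Vs ! i) (gss ! i) \<and> (fs ! i) ` U \<subseteq> Vs ! i"
      by blast
    show "\<exists>U hs. openin (mtop Z) U \<and> z \<in> U \<and> hol_tuple Z X U hs \<and> (\<forall>w\<in>U. ?s w = mset (map (\<lambda>h. h w) hs))"
      by (intro exI[of _ U] exI[of _ "comp_tuple fs gss"] conjI ballI)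
        (use hol[OF U(2-4)] U(1) val[OF U(2-4)] in auto)
  qed blast
  have "JCor_comp Z Y X G F = H"
    unfolding JCor_comp_def cor_comp_def
  proof (rule the_equality)
    show "H \<in> JCor Z X \<and> (\<forall>U fs Vs gss. JCor_rep Z Y F U fs \<and> length Vs = length fs \<and> length gss = length fs \<and>
      (\<forall>i<length fs. JCor_rep Y X G (Vs ! i) (gss ! i) \<and> (fs ! i) ` U \<subseteq> Vs ! i) \<longrightarrow>
      JCor_rep Z X H U (comp_tuple fs gss))"
    proof (intro conjI allI impI H(1))
      fix U fs Vs gss assume *: "JCor_rep Z Y F U fs \<and> length Vs = length fs \<and> length gss = length fs \<and>
        (\<forall>i<length fs. JCor_rep Y X G (Vs ! i) (gss ! i) \<and> (fs ! i) ` U \<subseteq> Vs ! i)"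
      then have h: "openin (mtop Z) U" "hol_tuple Z X U (comp_tuple fs gss)"
        using hol[of U fs gss Vs] by auto
      show "JCor_rep Z X H U (comp_tuple fs gss)"
      proof (rule ZX.JCor_repI[OF H(1) h])
        fix z assume z: "z \<in> U"
        then have "z \<in> topspace (mtop Z)"
          using openin_subset[OF h(1)] by blast
        then show "jval Z X H z = mset (map (\<lambda>h. h z) (comp_tuple fs gss))"
          using H(2) val[of U fs gss Vs z] * z by simp
      qed
    qed
  next
    fix K assume K: "K \<in> JCor Z X \<and> (\<forall>U fs Vs gss. JCor_rep Z Y F U fs \<and> length Vs = length fs \<and>
      length gss = length fs \<and> (\<forall>i<length fs. JCor_rep Y X G (Vs ! i) (gss ! i) \<and> (fs ! i) ` U \<subseteq> Vs ! i) \<longrightarrow>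
      JCor_rep Z X K U (comp_tuple fs gss))"
    show "K = H"
    proof (rule ZX.JCor_eqI)
      fix z assume z: "z \<in> topspace (mtop Z)"
      from reps[OF z] obtain U fs Vs gss where U: "z \<in> U" "JCor_rep Z Y F U fs" "length Vs = length fs"
        "length gss = length fs" "\<forall>i<length fs. JCor_rep Y X G (Vs ! i) (gss ! i) \<and> (fs ! i) ` U \<subseteq> Vs ! i"
        by blast
      then have "JCor_rep Z X K U (comp_tuple fs gss)"
        using K by blast
      from ZX.jval_rep[OF this U(1)] show "jval Z X K z = jval Z X H z"
        using H(2)[OF z] val[of U fs gss Vs z] U by simp
    qed (use K H in auto)
  qed
  moreover have "jval Z X H z = ?s z"
    using H(2)[of z] ZX.jval_outside[of z H] ZY.jval_outside[of z F] by (cases "z \<in> topspace (mtop Z)") simp_all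
  ultimately show "JCor_comp Z Y X G F \<in> JCor Z X" "jval Z X (JCor_comp Z Y X G F) z = ?s z"
    using H(1) by simp_all
qed

text \<open>Unlike in the symplectic setting, \<open>{f_i \<times> id}\<close> is always admissible,
  so local representations of \<open>F\<close> determine the values and these determine the
  element.\<close>

lemma JCor_times:
  assumes Z: "smooth_atlas Z" and Y: "smooth_atlas Y" and N: "almost_complex N" and F: "F \<in> JCor Z Y"
  shows "JCor_times Z Y N F \<in> JCor (prod_acs Z N) (prod_acs Y N)"
    and "p \<in> topspace (mtop (prod_acs Z N)) \<Longrightarrow> jval (prod_acs Z N) (prod_acs Y N) (JCor_times Z Y N F) p =
      image_mset (\<lambda>y. (y, snd p)) (jval Z Y F (fst p))"
proof -
  interpret N: almost_complex N by fact
  let ?ZN = "prod_acs Z N" and ?YN = "prod_acs Y N"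
  interpret ZN: prod_mfd ?ZN Z N by (rule prod_acs_mfd[OF Z N.atlas])
  interpret YN: prod_mfd ?YN Y N by (rule prod_acs_mfd[OF Y N.atlas])
  interpret ZY: hol_pair Z Y using Z Y by unfold_locales
  interpret P: hol_pair ?ZN ?YN using ZN.smooth_atlas_P YN.smooth_atlas_P by unfold_locales
  let ?s = "\<lambda>p. image_mset (\<lambda>y. (y, snd p)) (jval Z Y F (fst p))"
  let ?t = "map (\<lambda>f. map_prod f id)"
  have rep: "openin (mtop ?ZN) (U \<times> topspace (mtop N))" "hol_tuple ?ZN ?YN (U \<times> topspace (mtop N)) (?t fs)"
    "\<And>p. p \<in> U \<times> topspace (mtop N) \<Longrightarrow> ?s p = mset (map (\<lambda>h. h p) (?t fs))"
    if U: "JCor_rep Z Y F U fs" for U fs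
  proof -
    show "openin (mtop ?ZN) (U \<times> topspace (mtop N))"
      using U by (simp add: JCor_rep_def openin_prod_Times_iff)
    show "hol_tuple ?ZN ?YN (U \<times> topspace (mtop N)) (?t fs)"
      using U pseudoholomorphic_map_prod[OF Z N.atlas Y N.atlas _ N.pseudoholomorphic_id[OF openin_topspace]]
      by (auto simp: hol_tuple_def JCor_rep_def)
    show "?s p = mset (map (\<lambda>h. h p) (?t fs))" if "p \<in> U \<times> topspace (mtop N)" for p
      using ZY.jval_rep[OF U, of "fst p"] that by (cases p) (simp add: image_mset.compositionality comp_def)
  qed
  have ex: "\<exists>U fs. JCor_rep Z Y F U fs \<and> p \<in> U \<times> topspace (mtop N)" if p: "p \<in> topspace (mtop ?ZN)" for p
  proof -
    have "fst p \<in> topspace (mtop Z)"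
      using p by auto
    then obtain U fs where "JCor_rep Z Y F U fs" "fst p \<in> U"
      by (rule ZY.JCor_local[OF F])
    then show ?thesis
      using p by (cases p) auto
  qed
  obtain H where H: "H \<in> JCor ?ZN ?YN" "\<And>p. p \<in> topspace (mtop ?ZN) \<Longrightarrow> jval ?ZN ?YN H p = ?s p"
  proof (rule P.JCor_ex)
    fix p assume "p \<in> topspace (mtop ?ZN)"
    then obtain U fs where U: "JCor_rep Z Y F U fs" "p \<in> U \<times> topspace (mtop N)"
      using ex by blast
    show "\<exists>U fs. openin (mtop ?ZN) U \<and> p \<in> U \<and> hol_tuple ?ZN ?YN U fs \<and> (\<forall>q\<in>U. ?s q = mset (map (\<lambda>f. f q) fs))"
      by (intro exI[of _ "U \<times> topspace (mtop N)"] exI[of _ "?t fs"] conjI ballI rep[OF U(1)] U(2))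
  qed blast
  have "JCor_times Z Y N F = H"
    unfolding JCor_times_def Let_def
  proof (rule the_equality)
    show "H \<in> JCor ?ZN ?YN \<and> (\<forall>U fs. JCor_rep Z Y F U fs \<longrightarrow>
        JCor_rep ?ZN ?YN H (U \<times> topspace (mtop N)) (?t fs))"
    proof (intro conjI allI impI H(1))
      fix U fs assume U: "JCor_rep Z Y F U fs"
      show "JCor_rep ?ZN ?YN H (U \<times> topspace (mtop N)) (?t fs)"
      proof (rule P.JCor_repI[OF H(1) rep(1,2)[OF U]])
        fix p assume p: "p \<in> U \<times> topspace (mtop N)"
        then have "p \<in> topspace (mtop ?ZN)"
          using openin_subset[OF rep(1)[OF U]] by blast
        then show "jval ?ZN ?YN H p = mset (map (\<lambda>h. h p) (?t fs))"
          using H(2) rep(3)[OF U p] by simp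
      qed
    qed
  next
    fix K assume K: "K \<in> JCor ?ZN ?YN \<and> (\<forall>U fs. JCor_rep Z Y F U fs \<longrightarrow>
        JCor_rep ?ZN ?YN K (U \<times> topspace (mtop N)) (?t fs))"
    show "K = H"
    proof (rule P.JCor_eqI)
      fix p assume p: "p \<in> topspace (mtop ?ZN)"
      then obtain U fs where U: "JCor_rep Z Y F U fs" "p \<in> U \<times> topspace (mtop N)"
        using ex by blast
      then have "JCor_rep ?ZN ?YN K (U \<times> topspace (mtop N)) (?t fs)"
        using K by blast
      from P.jval_rep[OF this U(2)] show "jval ?ZN ?YN K p = jval ?ZN ?YN H p"
        using H(2)[OF p] rep(3)[OF U] by simp
    qed (use K H in auto)
  qed
  then show "JCor_times Z Y N F \<in> JCor ?ZN ?YN"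
    "p \<in> topspace (mtop ?ZN) \<Longrightarrow> jval ?ZN ?YN (JCor_times Z Y N F) p = ?s p"
    using H by simp_all
qed

section \<open>Grothendieck groups\<close>

text \<open>The correspondences in \<open>JCor Y X\<close> are determined by their values, which are multisets.  So these
  monoids are cancellative, and identities can be checked on values.\<close>

locale valued_monoid =
  fixes A :: "('a, 'r) monoid_scheme" and val :: "'a \<Rightarrow> 'q \<Rightarrow> 'x multiset"
  assumes val_eqI: "a \<in> carrier A \<Longrightarrow> b \<in> carrier A \<Longrightarrow> (\<And>q. val a q = val b q) \<Longrightarrow> a = b"
    and mult_closed: "a \<in> carrier A \<Longrightarrow> b \<in> carrier A \<Longrightarrow> a \<otimes>\<^bsub>A\<^esub> b \<in> carrier A"
    and val_mult: "a \<in> carrier A \<Longrightarrow> b \<in> carrier A \<Longrightarrow> val (a \<otimes>\<^bsub>A\<^esub> b) q = val a q + val b q"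
    and one_in: "\<one>\<^bsub>A\<^esub> \<in> carrier A" and val_one: "val \<one>\<^bsub>A\<^esub> q = {#}"
begin

text \<open>Values are multisets, so the auxiliary \<open>k\<close> cancels; conversely the unit
  serves as \<open>k\<close>.\<close>

lemma groth_rel_iff:
  "((a, b), (c, d)) \<in> groth_rel A \<longleftrightarrow> a \<in> carrier A \<and> b \<in> carrier A \<and> c \<in> carrier A \<and> d \<in> carrier A \<and>
    (\<forall>q. val a q + val d q = val c q + val b q)" (is "?l \<longleftrightarrow> ?r")
proof
  assume ?l
  then obtain k where abcd: "a \<in> carrier A" "b \<in> carrier A" "c \<in> carrier A" "d \<in> carrier A" "k \<in> carrier A"
    and eq: "a \<otimes>\<^bsub>A\<^esub> d \<otimes>\<^bsub>A\<^esub> k = c \<otimes>\<^bsub>A\<^esub> b \<otimes>\<^bsub>A\<^esub> k"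
    by (auto simp: groth_rel_def)
  have "val a q + val d q = val c q + val b q" for q
    using arg_cong[OF eq, of "\<lambda>x. val x q"] abcd by (simp add: val_mult mult_closed)
  then show ?r
    using abcd by simp
next
  assume r: ?r
  then have "a \<otimes>\<^bsub>A\<^esub> d \<otimes>\<^bsub>A\<^esub> \<one>\<^bsub>A\<^esub> = c \<otimes>\<^bsub>A\<^esub> b \<otimes>\<^bsub>A\<^esub> \<one>\<^bsub>A\<^esub>"
    by (intro val_eqI) (simp_all add: val_mult mult_closed one_in val_one)
  then show ?l
    using r one_in by (auto simp: groth_rel_def)
qed

lemma groth_rel_trans:
  assumes "((a, b), (c, d)) \<in> groth_rel A" "((c, d), (e, f)) \<in> groth_rel A"
  shows "((a, b), (e, f)) \<in> groth_rel A"
proof -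
  have 1: "val a q + val d q = val c q + val b q" and 2: "val c q + val f q = val e q + val d q" for q
    using assms by (simp_all add: groth_rel_iff)
  have "val a q + val f q = val e q + val b q" for q
  proof (rule multiset_eqI)
    show "count (val a q + val f q) x = count (val e q + val b q) x" for x
      using arg_cong[OF 1[of q], of "\<lambda>S. count S x"] arg_cong[OF 2[of q], of "\<lambda>S. count S x"] by simp
  qed
  then show ?thesis
    using assms by (simp add: groth_rel_iff)
qed

lemma equiv_groth: "equiv (carrier A \<times> carrier A) (groth_rel A)"
proof (rule equivI)
  show "groth_rel A \<subseteq> (carrier A \<times> carrier A) \<times> (carrier A \<times> carrier A)"
    by (auto simp: groth_rel_def)
  show "refl_on (carrier A \<times> carrier A) (groth_rel A)"
    by (auto simp: refl_on_def groth_rel_iff)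
  show "sym (groth_rel A)"
  proof (rule symI, clarify)
    fix a b c d assume "((a, b), (c, d)) \<in> groth_rel A"
    then show "((c, d), (a, b)) \<in> groth_rel A"
      unfolding groth_rel_iff by metis
  qed
  show "trans (groth_rel A)"
    by (rule transI) (use groth_rel_trans in fast)
qed

lemma groth_class_eq_iff:
  "a \<in> carrier A \<Longrightarrow> b \<in> carrier A \<Longrightarrow> c \<in> carrier A \<Longrightarrow> d \<in> carrier A \<Longrightarrow>
    groth_class A a b = groth_class A c d \<longleftrightarrow> (\<forall>q. val a q + val d q = val c q + val b q)"
  unfolding groth_class_def using eq_equiv_class_iff[OF equiv_groth, of "(a, b)" "(c, d)"] by (simp add: groth_rel_iff)

lemma in_groth_class:
  "(c, d) \<in> groth_class A a b \<longleftrightarrow> a \<in> carrier A \<and> b \<in> carrier A \<and> c \<in> carrier A \<and> d \<in> carrier A \<and>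
    (\<forall>q. val a q + val d q = val c q + val b q)"
  by (simp add: groth_class_def groth_rel_iff)

lemma groth_class_in: "a \<in> carrier A \<Longrightarrow> b \<in> carrier A \<Longrightarrow> groth_class A a b \<in> carrier (groth_group A)"
  by (simp add: groth_group_def groth_class_def quotientI)

lemma groth_classE:
  assumes "S \<in> carrier (groth_group A)"
  obtains a b where "a \<in> carrier A" "b \<in> carrier A" "S = groth_class A a b"
  using assms by (auto simp: groth_group_def groth_class_def elim!: quotientE)

end

lemma UN_pairs_const:
  assumes "\<And>a b c d. (a, b) \<in> P \<Longrightarrow> (c, d) \<in> Q \<Longrightarrow> f a b c d = K" "(x, y) \<in> P" "(z, t) \<in> Q"
  shows "(\<Union>(a, b)\<in>P. \<Union>(c, d)\<in>Q. f a b c d) = K"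
  using assms by fast

context valued_monoid
begin

lemma groth_mult:
  assumes "a \<in> carrier A" "b \<in> carrier A" "c \<in> carrier A" "d \<in> carrier A"
  shows "groth_class A a b \<otimes>\<^bsub>groth_group A\<^esub> groth_class A c d = groth_class A (a \<otimes>\<^bsub>A\<^esub> c) (b \<otimes>\<^bsub>A\<^esub> d)"
  unfolding groth_group_def monoid.simps
proof (rule UN_pairs_const[where x = a and y = b and z = c and t = d])
  fix a' b' c' d' assume *: "(a', b') \<in> groth_class A a b" "(c', d') \<in> groth_class A c d"
  then have carr: "a' \<in> carrier A" "b' \<in> carrier A" "c' \<in> carrier A" "d' \<in> carrier A"
    and 1: "\<And>q. val a q + val b' q = val a' q + val b q" and 2: "\<And>q. val c q + val d' q = val c' q + val d q"
    by (simp_all add: in_groth_class)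
  have "val (a' \<otimes>\<^bsub>A\<^esub> c') q + val (b \<otimes>\<^bsub>A\<^esub> d) q = val (a \<otimes>\<^bsub>A\<^esub> c) q + val (b' \<otimes>\<^bsub>A\<^esub> d') q" for q
  proof -
    have "(val a' q + val b q) + (val c' q + val d q) = (val a q + val b' q) + (val c q + val d' q)"
      by (simp only: 1 2)
    then show ?thesis
      by (simp add: val_mult carr assms ac_simps)
  qed
  then show "groth_class A (a' \<otimes>\<^bsub>A\<^esub> c') (b' \<otimes>\<^bsub>A\<^esub> d') = groth_class A (a \<otimes>\<^bsub>A\<^esub> c) (b \<otimes>\<^bsub>A\<^esub> d)"
    by (simp add: groth_class_eq_iff mult_closed carr assms)
qed (use assms in \<open>auto simp: in_groth_class\<close>)

lemma groth_comm_group: "comm_group (groth_group A)"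
proof (rule comm_groupI)
  have one: "\<one>\<^bsub>groth_group A\<^esub> = groth_class A \<one>\<^bsub>A\<^esub> \<one>\<^bsub>A\<^esub>"
    by (simp add: groth_group_def)
  note simps = one groth_mult mult_closed one_in groth_class_in groth_class_eq_iff val_mult val_one
  show "\<one>\<^bsub>groth_group A\<^esub> \<in> carrier (groth_group A)"
    by (simp add: simps)
  fix S assume "S \<in> carrier (groth_group A)"
  then obtain a b where S: "a \<in> carrier A" "b \<in> carrier A" "S = groth_class A a b"
    by (rule groth_classE)
  show "\<one>\<^bsub>groth_group A\<^esub> \<otimes>\<^bsub>groth_group A\<^esub> S = S"
    using S by (simp add: simps)
  have "groth_class A b a \<otimes>\<^bsub>groth_group A\<^esub> S = \<one>\<^bsub>groth_group A\<^esub>"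
    using S by (simp add: simps add.commute)
  then show "\<exists>R\<in>carrier (groth_group A). R \<otimes>\<^bsub>groth_group A\<^esub> S = \<one>\<^bsub>groth_group A\<^esub>"
    using S by (intro bexI[of _ "groth_class A b a"]) (simp_all add: groth_class_in)
  fix R assume "R \<in> carrier (groth_group A)"
  then obtain c d where R: "c \<in> carrier A" "d \<in> carrier A" "R = groth_class A c d"
    by (rule groth_classE)
  show "S \<otimes>\<^bsub>groth_group A\<^esub> R \<in> carrier (groth_group A)"
    using S R by (simp add: simps)
  show "S \<otimes>\<^bsub>groth_group A\<^esub> R = R \<otimes>\<^bsub>groth_group A\<^esub> S"
    using S R by (simp add: simps ac_simps)
  fix Q assume "Q \<in> carrier (groth_group A)"
  then obtain e f where Q: "e \<in> carrier A" "f \<in> carrier A" "Q = groth_class A e f"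
    by (rule groth_classE)
  show "S \<otimes>\<^bsub>groth_group A\<^esub> R \<otimes>\<^bsub>groth_group A\<^esub> Q = S \<otimes>\<^bsub>groth_group A\<^esub> (R \<otimes>\<^bsub>groth_group A\<^esub> Q)"
    using S R Q by (simp add: simps ac_simps)
qed

end

text \<open>Identifiers such as \<open>a'c'\<close> stand for the values of a pairing. The pair
  \<open>(a, b)\<close> is replaced by \<open>(a', b')\<close> against \<open>c'\<close> and
  \<open>d'\<close>, then \<open>(c, d)\<close> by \<open>(c', d')\<close> against \<open>a\<close>
  and \<open>b\<close>; adding up and cancelling gives the claim.\<close>

lemma bilinear_difference_eq:
  fixes ac :: "'x multiset"
  assumes "a'c' + bc' = ac' + b'c'" "a'd' + bd' = ad' + b'd'" "ac' + ad = ac + ad'" "bc' + bd = bc + bd'"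
  shows "(a'c' + b'd') + (ad + bc) = (ac + bd) + (a'd' + b'c')"
proof (rule multiset_eqI)
  show "count ((a'c' + b'd') + (ad + bc)) x = count ((ac + bd) + (a'd' + b'c')) x" for x
    using arg_cong[OF assms(1), of "\<lambda>S. count S x"] arg_cong[OF assms(2), of "\<lambda>S. count S x"]
      arg_cong[OF assms(3), of "\<lambda>S. count S x"] arg_cong[OF assms(4), of "\<lambda>S. count S x"] by simp
qed

text \<open>Biadditivity is stated on values because that is the form in which
  \<open>JCor_comp\<close> delivers it.\<close>

locale valued_pairing = A: valued_monoid A u + B: valued_monoid B v + D: valued_monoid D w
  for A :: "('a, 'r) monoid_scheme" and u :: "'a \<Rightarrow> 'p \<Rightarrow> 'x multiset"
    and B :: "('b, 's) monoid_scheme" and v :: "'b \<Rightarrow> 'q \<Rightarrow> 'y multiset"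
    and D :: "('d, 't) monoid_scheme" and w :: "'d \<Rightarrow> 'o \<Rightarrow> 'z multiset" +
  fixes \<beta> :: "'a \<Rightarrow> 'b \<Rightarrow> 'd"
  assumes closed: "a \<in> carrier A \<Longrightarrow> b \<in> carrier B \<Longrightarrow> \<beta> a b \<in> carrier D"
    and add_left: "a \<in> carrier A \<Longrightarrow> a' \<in> carrier A \<Longrightarrow> b \<in> carrier B \<Longrightarrow>
      w (\<beta> (a \<otimes>\<^bsub>A\<^esub> a') b) q = w (\<beta> a b) q + w (\<beta> a' b) q"
    and add_right: "a \<in> carrier A \<Longrightarrow> b \<in> carrier B \<Longrightarrow> b' \<in> carrier B \<Longrightarrow>
      w (\<beta> a (b \<otimes>\<^bsub>B\<^esub> b')) q = w (\<beta> a b) q + w (\<beta> a b') q"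
begin

definition ext :: "('a \<times> 'a) set \<Rightarrow> ('b \<times> 'b) set \<Rightarrow> ('d \<times> 'd) set"
  where "ext P Q = (\<Union>(a, b)\<in>P. \<Union>(c, d)\<in>Q.
    groth_class D (\<beta> a c \<otimes>\<^bsub>D\<^esub> \<beta> b d) (\<beta> a d \<otimes>\<^bsub>D\<^esub> \<beta> b c))"

lemma ext_class:
  assumes "a \<in> carrier A" "b \<in> carrier A" "c \<in> carrier B" "d \<in> carrier B"
  shows "ext (groth_class A a b) (groth_class B c d) =
    groth_class D (\<beta> a c \<otimes>\<^bsub>D\<^esub> \<beta> b d) (\<beta> a d \<otimes>\<^bsub>D\<^esub> \<beta> b c)"
  unfolding ext_def
proof (rule UN_pairs_const[where x = a and y = b and z = c and t = d])
  fix a' b' c' d' assume *: "(a', b') \<in> groth_class A a b" "(c', d') \<in> groth_class B c d"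
  then have carr: "a' \<in> carrier A" "b' \<in> carrier A" "c' \<in> carrier B" "d' \<in> carrier B"
    by (simp_all add: A.in_groth_class B.in_groth_class)
  \<comment> \<open>Equivalence of pairs becomes an equality of elements, to which the pairing can
    be applied directly.\<close>
  have ab: "a' \<otimes>\<^bsub>A\<^esub> b = a \<otimes>\<^bsub>A\<^esub> b'"
    using * assms carr by (intro A.val_eqI) (simp_all add: A.in_groth_class A.mult_closed A.val_mult)
  have cd: "c' \<otimes>\<^bsub>B\<^esub> d = c \<otimes>\<^bsub>B\<^esub> d'"
    using * assms carr by (intro B.val_eqI) (simp_all add: B.in_groth_class B.mult_closed B.val_mult)
  have l: "w (\<beta> a' x) q + w (\<beta> b x) q = w (\<beta> a x) q + w (\<beta> b' x) q" if "x \<in> carrier B" for x q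
    using arg_cong[OF ab, of "\<lambda>y. w (\<beta> y x) q"] that assms carr by (simp add: add_left)
  have r: "w (\<beta> x c') q + w (\<beta> x d) q = w (\<beta> x c) q + w (\<beta> x d') q" if "x \<in> carrier A" for x q
    using arg_cong[OF cd, of "\<lambda>y. w (\<beta> x y) q"] that assms carr by (simp add: add_right)
  have "(w (\<beta> a' c') q + w (\<beta> b' d') q) + (w (\<beta> a d) q + w (\<beta> b c) q) =
      (w (\<beta> a c) q + w (\<beta> b d) q) + (w (\<beta> a' d') q + w (\<beta> b' c') q)" for q
    by (rule bilinear_difference_eq[OF l[OF carr(3)] l[OF carr(4)] r[OF assms(1)] r[OF assms(2)]])
  then show "groth_class D (\<beta> a' c' \<otimes>\<^bsub>D\<^esub> \<beta> b' d') (\<beta> a' d' \<otimes>\<^bsub>D\<^esub> \<beta> b' c') =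
      groth_class D (\<beta> a c \<otimes>\<^bsub>D\<^esub> \<beta> b d) (\<beta> a d \<otimes>\<^bsub>D\<^esub> \<beta> b c)"
    using assms carr by (simp add: D.groth_class_eq_iff D.mult_closed D.val_mult closed)
qed (use assms in \<open>auto simp: A.in_groth_class B.in_groth_class\<close>)

lemma ext_hom_left:
  assumes "Q \<in> carrier (groth_group B)"
  shows "(\<lambda>P. ext P Q) \<in> hom (groth_group A) (groth_group D)"
proof (rule homI)
  obtain c d where Q: "c \<in> carrier B" "d \<in> carrier B" "Q = groth_class B c d"
    by (rule B.groth_classE[OF assms])
  fix P assume "P \<in> carrier (groth_group A)"
  then obtain a b where P: "a \<in> carrier A" "b \<in> carrier A" "P = groth_class A a b"
    by (rule A.groth_classE)
  show "ext P Q \<in> carrier (groth_group D)"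
    using P Q by (simp add: ext_class D.groth_class_in D.mult_closed closed)
  fix P' assume "P' \<in> carrier (groth_group A)"
  then obtain a' b' where P': "a' \<in> carrier A" "b' \<in> carrier A" "P' = groth_class A a' b'"
    by (rule A.groth_classE)
  show "ext (P \<otimes>\<^bsub>groth_group A\<^esub> P') Q = ext P Q \<otimes>\<^bsub>groth_group D\<^esub> ext P' Q"
    using P P' Q by (simp add: ext_class A.groth_mult D.groth_mult A.mult_closed D.mult_closed closed
        D.groth_class_eq_iff D.val_mult add_left ac_simps)
qed

lemma ext_hom_right:
  assumes "P \<in> carrier (groth_group A)"
  shows "ext P \<in> hom (groth_group B) (groth_group D)"
proof (rule homI)
  obtain a b where P: "a \<in> carrier A" "b \<in> carrier A" "P = groth_class A a b"
    by (rule A.groth_classE[OF assms])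
  fix Q assume "Q \<in> carrier (groth_group B)"
  then obtain c d where Q: "c \<in> carrier B" "d \<in> carrier B" "Q = groth_class B c d"
    by (rule B.groth_classE)
  show "ext P Q \<in> carrier (groth_group D)"
    using P Q by (simp add: ext_class D.groth_class_in D.mult_closed closed)
  fix Q' assume "Q' \<in> carrier (groth_group B)"
  then obtain c' d' where Q': "c' \<in> carrier B" "d' \<in> carrier B" "Q' = groth_class B c' d'"
    by (rule B.groth_classE)
  show "ext P (Q \<otimes>\<^bsub>groth_group B\<^esub> Q') = ext P Q \<otimes>\<^bsub>groth_group D\<^esub> ext P Q'"
    using P Q Q' by (simp add: ext_class B.groth_mult D.groth_mult B.mult_closed D.mult_closed closed
        D.groth_class_eq_iff D.val_mult add_right ac_simps)
qed

end

section \<open>The pseudoholomorphic complex\<close>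

lemma JCor_monoid_sel [simp]:
  "carrier (JCor_monoid Y X) = JCor Y X" "mult (JCor_monoid Y X) = JCor_add Y X"
  "one (JCor_monoid Y X) = JCor_tuple Y X []"
  by (simp_all add: JCor_monoid_def)

context hol_pair
begin

lemma JCor_tuple_Nil: "JCor_tuple Y X [] \<in> JCor Y X" "jval Y X (JCor_tuple Y X []) y = {#}"
  using JCor_tuple(1)[of "[]"] JCor_tuple(2)[of "[]" y] jval_outside[of y]
  by (simp add: hol_tuple_def, cases "y \<in> topspace (mtop Y)") (simp_all add: hol_tuple_def)

sublocale valued_monoid "JCor_monoid Y X" "jval Y X"
  by unfold_locales (simp_all add: JCor_add JCor_tuple_Nil, rule JCor_eqI)

lemma JC_comm_group: "comm_group (JC Y X)"
  unfolding JC_def by (rule groth_comm_group)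

lemma JC_of_in:
  assumes "pseudoholomorphic_on Y X (topspace (mtop Y)) f"
  shows "JC_of Y X f \<in> carrier (JC Y X)"
  unfolding JC_of_def JC_def
  by (rule groth_class_in) (use assms in \<open>simp_all add: JCor_tuple_Nil JCor_tuple hol_tuple_def\<close>)

lemma JCE:
  assumes "F \<in> carrier (JC Y X)"
  obtains a b where "a \<in> JCor Y X" "b \<in> JCor Y X" "F = groth_class (JCor_monoid Y X) a b"
  using groth_classE[OF assms[unfolded JC_def]] by auto

text \<open>Makes \<open>(y, snd p)\<close> a point of the product over \<open>Y\<close> in
  \<open>face_times\<close>.\<close>

lemma jval_support:
  assumes "F \<in> JCor Y X" "x \<in># jval Y X F y"
  shows "x \<in> topspace (mtop X)"
proof -
  have y: "y \<in> topspace (mtop Y)"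
    using assms(2) jval_outside[of y F] by fastforce
  obtain U fs where U: "JCor_rep Y X F U fs" "y \<in> U"
    by (rule JCor_local[OF assms(1) y])
  then obtain f where "f \<in> set fs" "x = f y"
    using assms(2) jval_rep[OF U] by auto
  moreover have "smooth_map_on Y X U f" if "f \<in> set fs" for f
    using U(1) that by (simp add: JCor_rep_def hol_tuple_def pseudoholomorphic_on_def)
  ultimately show ?thesis
    using smooth_map_in_topspace[of Y X U f y] U(2) by simp
qed

end

subsection \<open>Composition of classes\<close>

locale hol_triple =
  fixes Z :: "'z acs_manifold" and Y :: "'y acs_manifold" and X :: "'x acs_manifold"
  assumes Z: "smooth_atlas Z" and Y: "smooth_atlas Y" and X: "smooth_atlas X"
begin

sublocale YX: hol_pair Y X using Y X by unfold_locales
sublocale ZY: hol_pair Z Y using Z Y by unfold_locales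
sublocale ZX: hol_pair Z X using Z X by unfold_locales

sublocale pairing: valued_pairing "JCor_monoid Y X" "jval Y X" "JCor_monoid Z Y" "jval Z Y"
    "JCor_monoid Z X" "jval Z X" "JCor_comp Z Y X"
  by (intro valued_pairing.intro YX.valued_monoid_axioms ZY.valued_monoid_axioms ZX.valued_monoid_axioms
      valued_pairing_axioms.intro)
    (simp_all add: JCor_comp[OF Z Y X] YX.JCor_add ZY.JCor_add sum_mset.distrib)

lemma JC_comp_ext: "JC_comp Z Y X = pairing.ext"
  by (simp add: fun_eq_iff JC_comp_def pairing.ext_def Let_def)

lemma JC_comp_class:
  "a \<in> JCor Y X \<Longrightarrow> b \<in> JCor Y X \<Longrightarrow> c \<in> JCor Z Y \<Longrightarrow> d \<in> JCor Z Y \<Longrightarrow>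
    JC_comp Z Y X (groth_class (JCor_monoid Y X) a b) (groth_class (JCor_monoid Z Y) c d) =
    groth_class (JCor_monoid Z X) (JCor_add Z X (JCor_comp Z Y X a c) (JCor_comp Z Y X b d))
      (JCor_add Z X (JCor_comp Z Y X a d) (JCor_comp Z Y X b c))"
  using pairing.ext_class[of a b c d] by (simp add: JC_comp_ext)

lemma JC_comp_hom_left: "F \<in> carrier (JC Z Y) \<Longrightarrow> (\<lambda>G. JC_comp Z Y X G F) \<in> hom (JC Y X) (JC Z X)"
  using pairing.ext_hom_left[of F] by (simp add: JC_comp_ext JC_def)

lemma JC_comp_hom_right: "G \<in> carrier (JC Y X) \<Longrightarrow> JC_comp Z Y X G \<in> hom (JC Z Y) (JC Z X)"
  using pairing.ext_hom_right[of G] by (simp add: JC_comp_ext JC_def)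

end

lemma sum_mset_bind: "(\<Sum>y\<in>#(\<Sum>x\<in>#S. N x). g y) = (\<Sum>x\<in>#S. \<Sum>y\<in>#N x. g y)"
  by (induction S) auto

text \<open>With each argument written as a difference, both sides consist of eight triple
  composites, four of each sign. Their values are iterated sums over multisets, which
  \<open>sum_mset_bind\<close> regroups.\<close>

lemma JC_comp_assoc:
  assumes W: "smooth_atlas W" and Z: "smooth_atlas Z" and Y: "smooth_atlas Y" and X: "smooth_atlas X"
    and G: "G \<in> carrier (JC Y X)" and S: "S \<in> carrier (JC Z Y)" and P: "P \<in> carrier (JC W Z)"
  shows "JC_comp W Y X G (JC_comp W Z Y S P) = JC_comp W Z X (JC_comp Z Y X G S) P"
proof -
  interpret YX: hol_pair Y X using Y X by unfold_locales
  interpret ZY: hol_pair Z Y using Z Y by unfold_locales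
  interpret WZ: hol_pair W Z using W Z by unfold_locales
  interpret WY: hol_pair W Y using W Y by unfold_locales
  interpret WX: hol_pair W X using W X by unfold_locales
  interpret ZX: hol_pair Z X using Z X by unfold_locales
  interpret WYX: hol_triple W Y X using W Y X by unfold_locales
  interpret WZY: hol_triple W Z Y using W Z Y by unfold_locales
  interpret WZX: hol_triple W Z X using W Z X by unfold_locales
  interpret ZYX: hol_triple Z Y X using Z Y X by unfold_locales
  obtain a b where G': "a \<in> JCor Y X" "b \<in> JCor Y X" "G = groth_class (JCor_monoid Y X) a b"
    by (rule YX.JCE[OF G])
  obtain c d where S': "c \<in> JCor Z Y" "d \<in> JCor Z Y" "S = groth_class (JCor_monoid Z Y) c d"
    by (rule ZY.JCE[OF S])
  obtain e f where P': "e \<in> JCor W Z" "f \<in> JCor W Z" "P = groth_class (JCor_monoid W Z) e f"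
    by (rule WZ.JCE[OF P])
  note in_JCor = G'(1,2) S'(1,2) P'(1,2) JCor_comp(1)[OF W Y X] JCor_comp(1)[OF W Z Y] JCor_comp(1)[OF W Z X]
    JCor_comp(1)[OF Z Y X] WY.JCor_add(1) WX.JCor_add(1) ZX.JCor_add(1)
  note vals = JCor_comp(2)[OF W Y X] JCor_comp(2)[OF W Z Y] JCor_comp(2)[OF W Z X]
    JCor_comp(2)[OF Z Y X] WY.JCor_add(2) WX.JCor_add(2) ZX.JCor_add(2)
  show ?thesis
    unfolding G'(3) S'(3) P'(3)
    by (simp add: WYX.JC_comp_class WZY.JC_comp_class WZX.JC_comp_class ZYX.JC_comp_class WX.groth_class_eq_iff
        in_JCor vals sum_mset.distrib sum_mset_bind ac_simps)
qed

text \<open>The product with an identity is additive on values, so equivalent pairs have equivalent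
  products.\<close>

lemma JC_times_class:
  assumes Z: "smooth_atlas Z" and Y: "smooth_atlas Y" and N: "almost_complex N"
    and a: "a \<in> JCor Z Y" and b: "b \<in> JCor Z Y"
  shows "JC_times Z Y N (groth_class (JCor_monoid Z Y) a b) =
    groth_class (JCor_monoid (prod_acs Z N) (prod_acs Y N)) (JCor_times Z Y N a) (JCor_times Z Y N b)"
proof -
  interpret N: almost_complex N by fact
  let ?ZN = "prod_acs Z N" and ?YN = "prod_acs Y N"
  interpret ZN: prod_mfd ?ZN Z N by (rule prod_acs_mfd[OF Z N.atlas])
  interpret YN: prod_mfd ?YN Y N by (rule prod_acs_mfd[OF Y N.atlas])
  interpret ZY: hol_pair Z Y using Z Y by unfold_locales
  interpret P: hol_pair ?ZN ?YN using ZN.smooth_atlas_P YN.smooth_atlas_P by unfold_locales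
  have "groth_class (JCor_monoid ?ZN ?YN) (JCor_times Z Y N a') (JCor_times Z Y N b') =
      groth_class (JCor_monoid ?ZN ?YN) (JCor_times Z Y N a) (JCor_times Z Y N b)"
    if "(a', b') \<in> groth_class (JCor_monoid Z Y) a b" for a' b'
  proof -
    have a': "a' \<in> JCor Z Y" "b' \<in> JCor Z Y"
      and eq: "\<And>q. jval Z Y a q + jval Z Y b' q = jval Z Y a' q + jval Z Y b q"
      using that by (simp_all add: ZY.in_groth_class)
    have "jval ?ZN ?YN (JCor_times Z Y N a') p + jval ?ZN ?YN (JCor_times Z Y N b) p =
        jval ?ZN ?YN (JCor_times Z Y N a) p + jval ?ZN ?YN (JCor_times Z Y N b') p" for p
    proof (cases "p \<in> topspace (mtop ?ZN)")
      case True
      show ?thesis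
        by (simp only: JCor_times(2)[OF Z Y N _ True] a a' b image_mset_union[symmetric] eq)
    next
      case False
      show ?thesis
        by (simp only: P.jval_outside[OF False])
    qed
    then show ?thesis
      by (simp add: P.groth_class_eq_iff JCor_times(1)[OF Z Y N] a a' b)
  qed
  moreover have "(a, b) \<in> groth_class (JCor_monoid Z Y) a b"
    using a b by (simp add: ZY.in_groth_class)
  ultimately show ?thesis
    unfolding JC_times_def by fast
qed

subsection \<open>Face operators and induced maps\<close>

definition JC_face ::
    "'m acs_manifold \<Rightarrow> 'm \<Rightarrow> 'm \<Rightarrow> 'y acs_manifold \<Rightarrow> 'x acs_manifold \<Rightarrow> nat \<Rightarrow> nat \<Rightarrow> nat
      \<Rightarrow> (('y \<times> (nat \<Rightarrow> 'm), 'x) jcor \<times> ('y \<times> (nat \<Rightarrow> 'm), 'x) jcor) set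
      \<Rightarrow> (('y \<times> (nat \<Rightarrow> 'm), 'x) jcor \<times> ('y \<times> (nat \<Rightarrow> 'm), 'x) jcor) set"
  where "JC_face M p0 p1 Y X n i e \<sigma> =
    (let A = prod_acs Y (power_acs M (n - 1)); B = prod_acs Y (power_acs M n) in
      JC_comp A B X \<sigma> (JC_of A B (face_map p0 p1 n i e)))"

lemma JC_diff_eq: "JC_diff M p0 p1 Y X = cubical_diff (JC_chain M Y X) (JC_face M p0 p1 Y X)"
  unfolding JC_diff_def JC_face_def by (rule refl)

locale hol_cube =
  fixes M :: "'m acs_manifold" and p0 p1 :: 'm
  assumes M: "almost_complex M" and p0: "p0 \<in> topspace (mtop M)" and p1: "p1 \<in> topspace (mtop M)"
begin

abbreviation cube_over :: "'y acs_manifold \<Rightarrow> nat \<Rightarrow> ('y \<times> (nat \<Rightarrow> 'm)) acs_manifold"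
  where "cube_over Y n \<equiv> prod_acs Y (power_acs M n)"

lemma atlas_cube:
  assumes "smooth_atlas Y"
  shows "smooth_atlas (cube_over Y n)"
proof -
  interpret N: almost_complex "power_acs M n" by (rule almost_complex_power[OF M])
  interpret prod_mfd "cube_over Y n" Y "power_acs M n" by (rule prod_acs_mfd[OF assms N.atlas])
  show ?thesis by (rule smooth_atlas_P)
qed

lemma face_in:
  assumes Y: "almost_complex Y" and i: "i < n"
  shows "JC_of (cube_over Y (n - 1)) (cube_over Y n) (face_map p0 p1 n i e) \<in>
    carrier (JC (cube_over Y (n - 1)) (cube_over Y n))"
proof -
  interpret Y: almost_complex Y by fact
  interpret P: hol_pair "cube_over Y (n - 1)" "cube_over Y n"
    using atlas_cube[OF Y.atlas] by unfold_locales
  show ?thesis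
    by (rule P.JC_of_in[OF pseudoholomorphic_face_map[OF Y M i p0 p1]])
qed

lemma JC_cubical:
  assumes Y: "almost_complex Y" and X: "smooth_atlas X"
  shows "cubical (JC_chain M Y X) (JC_face M p0 p1 Y X)"
proof (rule cubical.intro)
  interpret Y: almost_complex Y by fact
  show "comm_group (JC_chain M Y X n)" for n
    unfolding JC_chain_def by (rule hol_pair.JC_comm_group[OF hol_pair.intro[OF atlas_cube[OF Y.atlas] X]])
  show "JC_face M p0 p1 Y X n i e \<in> hom (JC_chain M Y X n) (JC_chain M Y X (n - 1))" if "i < n" for n i e
    unfolding JC_chain_def JC_face_def Let_def
    by (rule hol_triple.JC_comp_hom_left[OF hol_triple.intro[OF atlas_cube[OF Y.atlas] atlas_cube[OF Y.atlas] X]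
          face_in[OF Y that]])
qed

text \<open>Commuting with a face is an instance of associativity:
  \<open>G \<circ> (\<sigma> \<circ> face)\<close> is
  \<open>(G \<circ> \<sigma>) \<circ> face\<close>.\<close>

lemma JC_push_induces:
  assumes Z: "almost_complex Z" and Y: "smooth_atlas Y" and X: "smooth_atlas X" and G: "G \<in> carrier (JC Y X)"
  shows "induces_on_homology (JC_chain M Z Y) (JC_diff M p0 p1 Z Y)
    (JC_chain M Z X) (JC_diff M p0 p1 Z X) (JC_push M Z Y X G)"
  unfolding JC_diff_eq
proof (rule cubical_map_induces[OF JC_cubical[OF Z Y] JC_cubical[OF Z X]])
  interpret Z: almost_complex Z by fact
  note Zn = atlas_cube[OF Z.atlas]
  show "JC_push M Z Y X G n \<in> hom (JC_chain M Z Y n) (JC_chain M Z X n)" for n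
    using hol_triple.JC_comp_hom_right[OF hol_triple.intro[OF Zn Y X] G, of n]
    by (simp add: JC_push_def[abs_def] JC_chain_def)
  fix n i e :: nat and \<sigma> assume i: "i < n" and \<sigma>: "\<sigma> \<in> carrier (JC_chain M Z Y n)"
  show "JC_push M Z Y X G (n - 1) (JC_face M p0 p1 Z Y n i e \<sigma>) = JC_face M p0 p1 Z X n i e (JC_push M Z Y X G n \<sigma>)"
    unfolding JC_push_def JC_face_def Let_def
    by (rule JC_comp_assoc[OF Zn Zn Y X G \<sigma>[unfolded JC_chain_def] face_in[OF Z i]])
qed

text \<open>For a single correspondence in place of \<open>F\<close>, both composites send
  \<open>(z, m)\<close> to the points \<open>(y, m')\<close>, where \<open>y\<close> runs through
  its values at \<open>z\<close> and \<open>m'\<close> is \<open>m\<close> with the marked point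
  inserted.\<close>

lemma face_times:
  assumes Z: "almost_complex Z" and Y: "almost_complex Y" and i: "i < n" and F: "F \<in> carrier (JC Z Y)"
  shows "JC_comp (cube_over Z (n - 1)) (cube_over Y (n - 1)) (cube_over Y n)
      (JC_of (cube_over Y (n - 1)) (cube_over Y n) (face_map p0 p1 n i e)) (JC_times Z Y (power_acs M (n - 1)) F) =
    JC_comp (cube_over Z (n - 1)) (cube_over Z n) (cube_over Y n)
      (JC_times Z Y (power_acs M n) F) (JC_of (cube_over Z (n - 1)) (cube_over Z n) (face_map p0 p1 n i e))"
proof -
  interpret Z: almost_complex Z by fact
  interpret Y: almost_complex Y by fact
  let ?Z' = "cube_over Z (n - 1)" and ?Z = "cube_over Z n" and ?Y' = "cube_over Y (n - 1)" and ?Y = "cube_over Y n"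
  let ?N' = "power_acs M (n - 1)" and ?N = "power_acs M n" and ?f = "face_map p0 p1 n i e"
  note N' = almost_complex_power[OF M, of "n - 1"] and N = almost_complex_power[OF M, of n]
  note Z' = atlas_cube[OF Z.atlas, of "n - 1"] and Zn = atlas_cube[OF Z.atlas, of n]
    and Y' = atlas_cube[OF Y.atlas, of "n - 1"] and Yn = atlas_cube[OF Y.atlas, of n]
  interpret ZY: hol_pair Z Y using Z.atlas Y.atlas by unfold_locales
  interpret Z'Z: hol_pair ?Z' ?Z using Z' Zn by unfold_locales
  interpret Y'Y: hol_pair ?Y' ?Y using Y' Yn by unfold_locales
  interpret Z'Y: hol_pair ?Z' ?Y using Z' Yn by unfold_locales
  interpret T1: hol_triple ?Z' ?Y' ?Y using Z' Y' Yn by unfold_locales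
  interpret T2: hol_triple ?Z' ?Z ?Y using Z' Zn Yn by unfold_locales
  have fZ: "hol_tuple ?Z' ?Z (topspace (mtop ?Z')) [?f]" and fY: "hol_tuple ?Y' ?Y (topspace (mtop ?Y')) [?f]"
    using pseudoholomorphic_face_map[OF Z M i p0 p1] pseudoholomorphic_face_map[OF Y M i p0 p1]
    by (simp_all add: hol_tuple_def)
  let ?tZ = "JCor_tuple ?Z' ?Z [?f]" and ?tY = "JCor_tuple ?Y' ?Y [?f]"
  let ?oZ = "JCor_tuple ?Z' ?Z []" and ?oY = "JCor_tuple ?Y' ?Y []"
  have key: "jval ?Z' ?Y (JCor_comp ?Z' ?Y' ?Y ?tY (JCor_times Z Y ?N' a)) p =
      jval ?Z' ?Y (JCor_comp ?Z' ?Z ?Y (JCor_times Z Y ?N a) ?tZ) p" if a: "a \<in> JCor Z Y" for a p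
  proof (cases "p \<in> topspace (mtop ?Z')")
    case True
    let ?p = "if e = 0 then p0 else p1"
    have single: "jval ?Y' ?Y ?tY (y, snd p) = {#(y, insert_point n i ?p (snd p))#}" if y: "y \<in># jval Z Y a (fst p)" for y
    proof -
      have "(y, snd p) \<in> topspace (mtop ?Y')"
        using ZY.jval_support[OF a y] True by (simp only: prod_acs_sel topspace_prod_topology mem_Times_iff fst_conv snd_conv)
      from Y'Y.JCor_tuple(2)[OF fY this] show ?thesis
        by (simp add: face_map_def)
    qed
    have "jval ?Z' ?Y (JCor_comp ?Z' ?Y' ?Y ?tY (JCor_times Z Y ?N' a)) p =
        (\<Sum>w\<in>#image_mset (\<lambda>y. (y, snd p)) (jval Z Y a (fst p)). jval ?Y' ?Y ?tY w)"
      unfolding JCor_comp(2)[OF Z' Y' Yn JCor_times(1)[OF Z.atlas Y.atlas N' a] Y'Y.JCor_tuple(1)[OF fY]]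
        JCor_times(2)[OF Z.atlas Y.atlas N' a True] by (rule refl)
    also have "\<dots> = (\<Sum>y\<in>#jval Z Y a (fst p). jval ?Y' ?Y ?tY (y, snd p))"
      by (simp only: image_mset.compositionality comp_def)
    also have "\<dots> = (\<Sum>y\<in>#jval Z Y a (fst p). {#(y, insert_point n i ?p (snd p))#})"
      by (intro arg_cong[where f = sum_mset] image_mset_cong single)
    also have "\<dots> = image_mset (\<lambda>y. (y, insert_point n i ?p (snd p))) (jval Z Y a (fst p))"
      by (rule sum_mset_singleton_mset)
    also have "\<dots> = image_mset (\<lambda>y. (y, snd (?f p))) (jval Z Y a (fst (?f p)))"
      by (simp add: face_map_eq)
    also have "\<dots> = jval ?Z' ?Y (JCor_comp ?Z' ?Z ?Y (JCor_times Z Y ?N a) ?tZ) p"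
    proof -
      have "?f p \<in> topspace (mtop ?Z)"
        using fZ True smooth_map_in_topspace[of ?Z' ?Z "topspace (mtop ?Z')" ?f p]
        by (simp add: hol_tuple_def pseudoholomorphic_on_def del: prod_acs_sel)
      then show ?thesis
        unfolding JCor_comp(2)[OF Z' Zn Yn Z'Z.JCor_tuple(1)[OF fZ] JCor_times(1)[OF Z.atlas Y.atlas N a]]
          Z'Z.JCor_tuple(2)[OF fZ True] by (simp add: JCor_times(2)[OF Z.atlas Y.atlas N a] del: prod_acs_sel)
    qed
    finally show ?thesis .
  next
    case False
    show ?thesis
      by (simp only: Z'Y.jval_outside[OF False])
  qed
  obtain a b where ab: "a \<in> JCor Z Y" "b \<in> JCor Z Y" "F = groth_class (JCor_monoid Z Y) a b"
    by (rule ZY.JCE[OF F])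
  note in_JCor = ab(1,2) JCor_times(1)[OF Z.atlas Y.atlas N'] JCor_times(1)[OF Z.atlas Y.atlas N]
    Z'Z.JCor_tuple(1)[OF fZ] Y'Y.JCor_tuple(1)[OF fY] Z'Z.JCor_tuple_Nil(1) Y'Y.JCor_tuple_Nil(1)
    JCor_comp(1)[OF Z' Y' Yn] JCor_comp(1)[OF Z' Zn Yn]
  \<comment> \<open>\<open>JC_of\<close> is the class of a pair whose second entry is the empty
    correspondence, so half of the terms in the bilinear extension have empty values.\<close>
  have 0: "jval ?Z' ?Y (JCor_comp ?Z' ?Y' ?Y ?oY (JCor_times Z Y ?N' x)) p = {#}"
    "jval ?Z' ?Y (JCor_comp ?Z' ?Z ?Y (JCor_times Z Y ?N x) ?oZ) p = {#}" if "x \<in> JCor Z Y" for x p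
    using that by (simp_all only: JCor_comp(2)[OF Z' Y' Yn] JCor_comp(2)[OF Z' Zn Yn] in_JCor
        Y'Y.JCor_tuple_Nil(2) Z'Z.JCor_tuple_Nil(2)) simp_all
  show ?thesis
    unfolding ab(3) JC_of_def JC_times_class[OF Z.atlas Y.atlas N' ab(1,2)] JC_times_class[OF Z.atlas Y.atlas N ab(1,2)]
      T1.JC_comp_class[OF Y'Y.JCor_tuple(1)[OF fY] Y'Y.JCor_tuple_Nil(1) JCor_times(1)[OF Z.atlas Y.atlas N' ab(1)]
        JCor_times(1)[OF Z.atlas Y.atlas N' ab(2)]]
      T2.JC_comp_class[OF JCor_times(1)[OF Z.atlas Y.atlas N ab(1)] JCor_times(1)[OF Z.atlas Y.atlas N ab(2)]
        Z'Z.JCor_tuple(1)[OF fZ] Z'Z.JCor_tuple_Nil(1)]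
    by (subst Z'Y.groth_class_eq_iff)
      (simp_all only: JCor_monoid_sel Z'Y.JCor_add in_JCor 0 key, simp_all add: ac_simps)
qed

lemma JC_pull_induces:
  assumes Z: "almost_complex Z" and Y: "almost_complex Y" and X: "smooth_atlas X" and F: "F \<in> carrier (JC Z Y)"
  shows "induces_on_homology (JC_chain M Y X) (JC_diff M p0 p1 Y X)
    (JC_chain M Z X) (JC_diff M p0 p1 Z X) (JC_pull M Z Y X F)"
  unfolding JC_diff_eq
proof (rule cubical_map_induces[OF JC_cubical[OF Y X] JC_cubical[OF Z X]])
  interpret Z: almost_complex Z by fact
  interpret Y: almost_complex Y by fact
  interpret ZY: hol_pair Z Y using Z.atlas Y.atlas by unfold_locales
  note Zn = atlas_cube[OF Z.atlas] and Yn = atlas_cube[OF Y.atlas]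
  have times: "JC_times Z Y (power_acs M n) F \<in> carrier (JC (cube_over Z n) (cube_over Y n))" for n
  proof -
    note N = almost_complex_power[OF M, of n]
    obtain a b where ab: "a \<in> JCor Z Y" "b \<in> JCor Z Y" "F = groth_class (JCor_monoid Z Y) a b"
      by (rule ZY.JCE[OF F])
    interpret P: hol_pair "cube_over Z n" "cube_over Y n" using Zn Yn by unfold_locales
    show ?thesis
      unfolding ab(3) JC_times_class[OF Z.atlas Y.atlas N ab(1,2)] JC_def
      by (rule P.groth_class_in) (simp_all add: JCor_times(1)[OF Z.atlas Y.atlas N] ab(1,2))
  qed
  show "JC_pull M Z Y X F n \<in> hom (JC_chain M Y X n) (JC_chain M Z X n)" for n
    using hol_triple.JC_comp_hom_left[OF hol_triple.intro[OF Zn Yn X] times]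
    by (simp add: JC_pull_def[abs_def] Let_def JC_chain_def)
  fix n i e :: nat and \<sigma> assume i: "i < n" and \<sigma>: "\<sigma> \<in> carrier (JC_chain M Y X n)"
  note \<sigma>' = \<sigma>[unfolded JC_chain_def]
  \<comment> \<open>Associativity isolates \<open>\<sigma>\<close> on both sides; what remains are
    the two composites compared in \<open>face_times\<close>.\<close>
  show "JC_pull M Z Y X F (n - 1) (JC_face M p0 p1 Y X n i e \<sigma>) = JC_face M p0 p1 Z X n i e (JC_pull M Z Y X F n \<sigma>)"
    unfolding JC_pull_def JC_face_def Let_def
      JC_comp_assoc[OF Zn Yn Yn X \<sigma>' face_in[OF Y i] times, symmetric]
      JC_comp_assoc[OF Zn Zn Yn X \<sigma>' times face_in[OF Z i], symmetric] face_times[OF Z Y i F] by (rule refl)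
qed

end

theorem lemma10p3:
  shows
    "(\<forall>(X :: 'x symp_manifold) (Y :: 'y symp_manifold) (Z :: 'z symp_manifold)
       (M :: 'm symp_manifold) p0 p1.
       symplectic_manifold X \<and> symplectic_manifold Y \<and> symplectic_manifold Z \<and>
       symplectic_manifold M \<and> connected_space (mtop M) \<and>
       p0 \<in> topspace (mtop M) \<and> p1 \<in> topspace (mtop M) \<longrightarrow>
       (\<forall>F \<in> carrier (SC Z Y).
          induces_on_homology (SC_chain M Y X) (SC_diff M p0 p1 Y X)
            (SC_chain M Z X) (SC_diff M p0 p1 Z X) (SC_pull M Z Y X F)) \<and>
       (\<forall>G \<in> carrier (SC Y X).
          induces_on_homology (SC_chain M Z Y) (SC_diff M p0 p1 Z Y)
            (SC_chain M Z X) (SC_diff M p0 p1 Z X) (SC_push M Z Y X G)) \<and>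
       (\<forall>f. symplectic_embedding Z Y f \<longrightarrow>
          SC_of Z Y f \<in> carrier (SC Z Y) \<and>
          induces_on_homology (SC_chain M Y X) (SC_diff M p0 p1 Y X)
            (SC_chain M Z X) (SC_diff M p0 p1 Z X) (SC_pull M Z Y X (SC_of Z Y f))) \<and>
       (\<forall>g. symplectic_embedding Y X g \<longrightarrow>
          SC_of Y X g \<in> carrier (SC Y X) \<and>
          induces_on_homology (SC_chain M Z Y) (SC_diff M p0 p1 Z Y)
            (SC_chain M Z X) (SC_diff M p0 p1 Z X) (SC_push M Z Y X (SC_of Y X g)))) \<and>
     (\<forall>(X :: 'x acs_manifold) (Y :: 'y acs_manifold) (Z :: 'z acs_manifold)
       (M :: 'm acs_manifold) p0 p1.
       pseudoholomorphic_manifold X \<and> pseudoholomorphic_manifold Y \<and>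
       pseudoholomorphic_manifold Z \<and> pseudoholomorphic_manifold M \<and>
       connected_space (mtop M) \<and> p0 \<in> topspace (mtop M) \<and> p1 \<in> topspace (mtop M) \<longrightarrow>
       (\<forall>F \<in> carrier (JC Z Y).
          induces_on_homology (JC_chain M Y X) (JC_diff M p0 p1 Y X)
            (JC_chain M Z X) (JC_diff M p0 p1 Z X) (JC_pull M Z Y X F)) \<and>
       (\<forall>G \<in> carrier (JC Y X).
          induces_on_homology (JC_chain M Z Y) (JC_diff M p0 p1 Z Y)
            (JC_chain M Z X) (JC_diff M p0 p1 Z X) (JC_push M Z Y X G)) \<and>
       (\<forall>f. pseudoholomorphic_on Z Y (topspace (mtop Z)) f \<longrightarrow>
          JC_of Z Y f \<in> carrier (JC Z Y) \<and>
          induces_on_homology (JC_chain M Y X) (JC_diff M p0 p1 Y X)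
            (JC_chain M Z X) (JC_diff M p0 p1 Z X) (JC_pull M Z Y X (JC_of Z Y f))) \<and>
       (\<forall>g. pseudoholomorphic_on Y X (topspace (mtop Y)) g \<longrightarrow>
          JC_of Y X g \<in> carrier (JC Y X) \<and>
          induces_on_homology (JC_chain M Z Y) (JC_diff M p0 p1 Z Y)
            (JC_chain M Z X) (JC_diff M p0 p1 Z X) (JC_push M Z Y X (JC_of Y X g))))"
proof (intro conjI allI impI)
  fix X :: "'x symp_manifold" and Y :: "'y symp_manifold" and Z :: "'z symp_manifold"
    and M :: "'m symp_manifold" and p0 p1
  assume *: "symplectic_manifold X \<and> symplectic_manifold Y \<and> symplectic_manifold Z \<and>
    symplectic_manifold M \<and> connected_space (mtop M) \<and> p0 \<in> topspace (mtop M) \<and> p1 \<in> topspace (mtop M)"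
  then interpret symp_setting X Y Z M p0 p1
    by (intro symp_setting.intro symplectic_tame) auto
  show pull: "\<forall>F\<in>carrier (SC Z Y). induces_on_homology (SC_chain M Y X) (SC_diff M p0 p1 Y X)
      (SC_chain M Z X) (SC_diff M p0 p1 Z X) (SC_pull M Z Y X F)"
    using SC_pull_induces by blast
  show push: "\<forall>G\<in>carrier (SC Y X). induces_on_homology (SC_chain M Z Y) (SC_diff M p0 p1 Z Y)
      (SC_chain M Z X) (SC_diff M p0 p1 Z X) (SC_push M Z Y X G)"
    using SC_push_induces by blast
  show "SC_of Z Y f \<in> carrier (SC Z Y)" "induces_on_homology (SC_chain M Y X) (SC_diff M p0 p1 Y X)
      (SC_chain M Z X) (SC_diff M p0 p1 Z X) (SC_pull M Z Y X (SC_of Z Y f))" if "symplectic_embedding Z Y f" for f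
    using SC_of_in[OF Z Y that] pull by blast+
  show "SC_of Y X g \<in> carrier (SC Y X)" "induces_on_homology (SC_chain M Z Y) (SC_diff M p0 p1 Z Y)
      (SC_chain M Z X) (SC_diff M p0 p1 Z X) (SC_push M Z Y X (SC_of Y X g))" if "symplectic_embedding Y X g" for g
    using SC_of_in[OF Y X that] push by blast+
next
  fix X :: "'x acs_manifold" and Y :: "'y acs_manifold" and Z :: "'z acs_manifold"
    and M :: "'m acs_manifold" and p0 p1
  assume *: "pseudoholomorphic_manifold X \<and> pseudoholomorphic_manifold Y \<and>
    pseudoholomorphic_manifold Z \<and> pseudoholomorphic_manifold M \<and>
    connected_space (mtop M) \<and> p0 \<in> topspace (mtop M) \<and> p1 \<in> topspace (mtop M)"
  interpret X: almost_complex X using * by (intro pseudoholomorphic_almost_complex) simp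
  interpret Y: almost_complex Y using * by (intro pseudoholomorphic_almost_complex) simp
  interpret Z: almost_complex Z using * by (intro pseudoholomorphic_almost_complex) simp
  interpret hol_cube M p0 p1 using * by (intro hol_cube.intro pseudoholomorphic_almost_complex) simp_all
  interpret ZY: hol_pair Z Y using Z.atlas Y.atlas by unfold_locales
  interpret YX: hol_pair Y X using Y.atlas X.atlas by unfold_locales
  show pull: "\<forall>F\<in>carrier (JC Z Y). induces_on_homology (JC_chain M Y X) (JC_diff M p0 p1 Y X)
      (JC_chain M Z X) (JC_diff M p0 p1 Z X) (JC_pull M Z Y X F)"
    using JC_pull_induces[OF Z.almost_complex_axioms Y.almost_complex_axioms X.atlas] by blast
  show push: "\<forall>G\<in>carrier (JC Y X). induces_on_homology (JC_chain M Z Y) (JC_diff M p0 p1 Z Y)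
      (JC_chain M Z X) (JC_diff M p0 p1 Z X) (JC_push M Z Y X G)"
    using JC_push_induces[OF Z.almost_complex_axioms Y.atlas X.atlas] by blast
  show "JC_of Z Y f \<in> carrier (JC Z Y)" "induces_on_homology (JC_chain M Y X) (JC_diff M p0 p1 Y X)
      (JC_chain M Z X) (JC_diff M p0 p1 Z X) (JC_pull M Z Y X (JC_of Z Y f))"
    if "pseudoholomorphic_on Z Y (topspace (mtop Z)) f" for f
    using ZY.JC_of_in[OF that] pull by blast+
  show "JC_of Y X g \<in> carrier (JC Y X)" "induces_on_homology (JC_chain M Z Y) (JC_diff M p0 p1 Z Y)
      (JC_chain M Z X) (JC_diff M p0 p1 Z X) (JC_push M Z Y X (JC_of Y X g))"
    if "pseudoholomorphic_on Y X (topspace (mtop Y)) g" for g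
    using YX.JC_of_in[OF that] push by blast+
qed

end
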